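(* The Riesz transform $\mathcal{R}=\nabla\mathcal{L}^{-1/2}$ on $\mathbb{T}_{q+1}$ is of weak type $(1,1)$ with respect to $\mu$, bounded from $H^1(\mu)$ to $L^1(\mu)$, and bounded on $L^p(\mu)$ for all $p\in(1,2]$.
   Context: Let $q\geq 2$ be an integer and let $\mathbb{T}_{q+1}$ be the homogeneous tree of degree $q+1$ (the connected graph without cycles in which each vertex has exactly $q+1$ neighbours), identified with its vertex set, with graph distance $d$; $x\sim y$ means that $x,y$ are neighbours. Fix a reference vertex $o$ and a ray $\omega_*$ (half-infinite geodesic emanating from $o$). The level of a vertex $x$ is the integer $\ell(x)=d(o,x\wedge\omega_* )-d(x,x\wedge\omega_* )$, where $x\wedge\omega_*$ is the closest point to $x$ on $\omega_*$. Every vertex $x$ has exactly one neighbour of level $\ell(x)+1$, its predecessor $\mathfrak{p}(x)$; its other $q$ neighbours have level $\ell(x)-1$. Write $x\geq y$ if $d(x,y)=\ell(x)-\ell(y)$. The canonical flow measure is $\mu(x)=q^{\ell(x)}$. The flow gradient of $f:\mathbb{T}_{q+1}\to\mathbb{C}$ is $\nabla f(x)=f(x)-f(\mathfrak{p}(x))$. The flow Laplacian is $$\mathcal{L} f(x)=\tfrac12\nabla^*\nabla f(x) = f(x)-\frac{1}{2\sqrt q}\sum_{y\sim x}\frac{\mu^{1/2}(y)}{\mu^{1/2}(x)}f(y),$$ where $\nabla^*$ is the adjoint of $\nabla$ on $L^2(\mu)$; it is bounded, self-adjoint, nonnegative and injective on $L^2(\mu)$. The power $\mathcal{L}^{-1/2}$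 is defined by the Spectral Theorem (with dense domain in $L^2(\mu)$). The Riesz transform $\mathcal{R}=\nabla\mathcal{L}^{-1/2}$ is understood as extended by continuity: to $L^2(\mu)$, then from $L^2(\mu)\cap L^p(\mu)$ to $L^p(\mu)$, and from $L^1(\mu)\cap L^2(\mu)$ to $L^1(\mu)$ with values in weak-$L^1(\mu)$. Weak type $(1,1)$ means $\mu(\{x:|\mathcal{R}f(x)|>\lambda\})\le C\|f\|_{L^1(\mu)}/\lambda$ for all $\lambda>0$ and $f\in L^1(\mu)$, for some constant $C$. Atomic Hardy space $H^1(\mu)$: an admissible trapezoid is a set $E\subset\mathbb{T}_{q+1}$ which is either a single vertex or of the form $E=\{x\in\mathbb{T}_{q+1}: x\leq x_E,\ h\leq \ell(x_E)-\ell(x)<2h\}$ for some vertex $x_E$ and some positive integer $h$. An atom is a function $a$ supported in an admissible trapezoid $E$ with $\|a\|_{L^\infty}\leq \mu(E)^{-1}$ and $\sum_x a(x)\mu(x)=0$. $H^1(\mu)$ is the space of all $f\in L^1(\mu)$ of the form $f=\sum_j\lambda_ja_j$ with $a_j$ atoms and $\sum_j|\lambda_j|<\infty$, with norm the infimum of $\sum_j|\lambda_j|$ over all such representations. *)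

theory Defs
  imports "HOL-Analysis.Analysis"
begin

section \<open>Lebesgue spaces of complex functions\<close>

text \<open>
  In the application the measure charges every point, so that functions agreeing almost
  everywhere are equal, and no quotient is needed.
\<close>

definition Lp :: "'a measure \<Rightarrow> real \<Rightarrow> ('a \<Rightarrow> complex) set" where
  "Lp M p = {f \<in> borel_measurable M. integrable M (\<lambda>x. norm (f x) powr p)}"

definition Lp_norm :: "'a measure \<Rightarrow> real \<Rightarrow> ('a \<Rightarrow> complex) \<Rightarrow> real" where
  "Lp_norm M p f = (\<integral>x. norm (f x) powr p \<partial>M) powr (1 / p)"

definition L2_inner :: "'a measure \<Rightarrow> ('a \<Rightarrow> complex) \<Rightarrow> ('a \<Rightarrow> complex) \<Rightarrow> complex" where
  "L2_inner M f g = (\<integral>x. f x * cnj (g x) \<partial>M)"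

definition weak_L1_norm :: "'a measure \<Rightarrow> ('a \<Rightarrow> complex) \<Rightarrow> ennreal" where
  "weak_L1_norm M f = (SUP t\<in>{0::real<..}. ennreal t * emeasure M {x \<in> space M. norm (f x) > t})"

definition converges_Lp ::
    "'a measure \<Rightarrow> real \<Rightarrow> (nat \<Rightarrow> 'a \<Rightarrow> complex) \<Rightarrow> ('a \<Rightarrow> complex) \<Rightarrow> bool" where
  "converges_Lp M p u f \<longleftrightarrow>
     (\<forall>n. (\<lambda>x. u n x - f x) \<in> Lp M p) \<and> (\<lambda>n. Lp_norm M p (\<lambda>x. u n x - f x)) \<longlonglongrightarrow> 0"

definition converges_weak_L1 ::
    "'a measure \<Rightarrow> (nat \<Rightarrow> 'a \<Rightarrow> complex) \<Rightarrow> ('a \<Rightarrow> complex) \<Rightarrow> bool" where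
  "converges_weak_L1 M u f \<longleftrightarrow> (\<lambda>n. weak_L1_norm M (\<lambda>x. u n x - f x)) \<longlonglongrightarrow> 0"

text \<open>
  Let \<open>T f g\<close> be the graph of an operator. Its extension by continuity, with respect to the
  convergence \<open>cvs\<close> in the source and \<open>cvt\<close> in the target, sends \<open>f\<close> to \<open>g\<close> if \<open>f\<close> is a limit of
  points of the domain of \<open>T\<close>, and along every such approximation the values of \<open>T\<close> tend to \<open>g\<close>.
\<close>

definition continuous_extension ::
    "('f \<Rightarrow> 'g \<Rightarrow> bool) \<Rightarrow> ((nat \<Rightarrow> 'f) \<Rightarrow> 'f \<Rightarrow> bool) \<Rightarrow> ((nat \<Rightarrow> 'g) \<Rightarrow> 'g \<Rightarrow> bool)
      \<Rightarrow> 'f \<Rightarrow> 'g \<Rightarrow> bool" where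
  "continuous_extension T cvs cvt f g \<longleftrightarrow>
     (\<exists>u v. (\<forall>n. T (u n) (v n)) \<and> cvs u f) \<and>
     (\<forall>u v. (\<forall>n. T (u n) (v n)) \<and> cvs u f \<longrightarrow> cvt v g)"


section \<open>Spectral calculus of a bounded self-adjoint operator on \<open>L\<^sup>2\<close>\<close>

text \<open>Resolutions of the identity of \<open>L\<^sup>2(M)\<close> on the Borel sets of the real line.\<close>

definition resolution_of_identity ::
    "'a measure \<Rightarrow> (real set \<Rightarrow> ('a \<Rightarrow> complex) \<Rightarrow> ('a \<Rightarrow> complex)) \<Rightarrow> bool" where
  "resolution_of_identity M E \<longleftrightarrow>
     (\<forall>B\<in>sets borel. \<forall>f\<in>Lp M 2. E B f \<in> Lp M 2) \<and>
     (\<forall>B\<in>sets borel. \<forall>f\<in>Lp M 2. \<forall>g\<in>Lp M 2. \<forall>c.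
        E B (\<lambda>x. f x + c * g x) = (\<lambda>x. E B f x + c * E B g x)) \<and>
     (\<forall>B\<in>sets borel. \<forall>f\<in>Lp M 2. \<forall>g\<in>Lp M 2. L2_inner M (E B f) g = L2_inner M f (E B g)) \<and>
     (\<forall>f\<in>Lp M 2. E {} f = (\<lambda>x. 0) \<and> E UNIV f = f) \<and>
     (\<forall>A\<in>sets borel. \<forall>B\<in>sets borel. \<forall>f\<in>Lp M 2. E (A \<inter> B) f = E A (E B f)) \<and>
     (\<forall>A. range A \<subseteq> sets borel \<and> disjoint_family A \<longrightarrow>
        (\<forall>f\<in>Lp M 2. \<forall>g\<in>Lp M 2.
           (\<lambda>n::nat. L2_inner M (E (A n) f) g) sums L2_inner M (E (\<Union>n. A n) f) g))"

text \<open>The finite positive Borel measure \<open>B \<mapsto> \<langle>E(B) f, f\<rangle>\<close>.\<close>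

definition spectral_dist ::
    "'a measure \<Rightarrow> (real set \<Rightarrow> ('a \<Rightarrow> complex) \<Rightarrow> ('a \<Rightarrow> complex)) \<Rightarrow> ('a \<Rightarrow> complex) \<Rightarrow> real measure"
  where
  "spectral_dist M E f =
     measure_of UNIV (sets borel) (\<lambda>B. ennreal (Re (L2_inner M (E B f) f)))"

text \<open>
  The integral of \<open>\<phi>\<close> against the complex measure \<open>B \<mapsto> \<langle>E(B) f, h\<rangle>\<close>, which is written by
  polarization as a combination of four positive measures.
\<close>

definition spectral_pairing ::
    "'a measure \<Rightarrow> (real set \<Rightarrow> ('a \<Rightarrow> complex) \<Rightarrow> ('a \<Rightarrow> complex)) \<Rightarrow> (real \<Rightarrow> real)
      \<Rightarrow> ('a \<Rightarrow> complex) \<Rightarrow> ('a \<Rightarrow> complex) \<Rightarrow> complex" where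
  "spectral_pairing M E \<phi> f h =
     (1 / 4) * (\<Sum>k<(4::nat). \<i> ^ k *
        complex_of_real (\<integral>t. \<phi> t \<partial>spectral_dist M E (\<lambda>x. f x + \<i> ^ k * h x)))"

definition spectral_domain ::
    "'a measure \<Rightarrow> (real set \<Rightarrow> ('a \<Rightarrow> complex) \<Rightarrow> ('a \<Rightarrow> complex)) \<Rightarrow> (real \<Rightarrow> real)
      \<Rightarrow> ('a \<Rightarrow> complex) set" where
  "spectral_domain M E \<phi> = {f \<in> Lp M 2. integrable (spectral_dist M E f) (\<lambda>t. (\<phi> t)\<^sup>2)}"

text \<open>
  The vector \<open>\<integral> \<phi> dE f\<close>, for \<open>f\<close> in the spectral domain of \<open>\<phi>\<close>. The test vectors \<open>h\<close> are taken in
  the spectral domain, which is dense, so that the four integrals in the pairing converge.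
\<close>

definition spectral_integral ::
    "'a measure \<Rightarrow> (real set \<Rightarrow> ('a \<Rightarrow> complex) \<Rightarrow> ('a \<Rightarrow> complex)) \<Rightarrow> (real \<Rightarrow> real)
      \<Rightarrow> ('a \<Rightarrow> complex) \<Rightarrow> ('a \<Rightarrow> complex)" where
  "spectral_integral M E \<phi> f =
     (THE g. g \<in> Lp M 2 \<and>
        (\<forall>h\<in>spectral_domain M E \<phi>. L2_inner M g h = spectral_pairing M E \<phi> f h))"

text \<open>
  The spectral resolution of a bounded self-adjoint operator \<open>A\<close>, i.e. \<open>A = \<integral> t dE(t)\<close>. By the
  Spectral Theorem it exists, and it is unique on Borel sets and \<open>L\<^sup>2\<close> functions.
\<close>

definition is_spectral_resolution ::
    "'a measure \<Rightarrow> (('a \<Rightarrow> complex) \<Rightarrow> ('a \<Rightarrow> complex))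
      \<Rightarrow> (real set \<Rightarrow> ('a \<Rightarrow> complex) \<Rightarrow> ('a \<Rightarrow> complex)) \<Rightarrow> bool" where
  "is_spectral_resolution M A E \<longleftrightarrow>
     resolution_of_identity M E \<and>
     spectral_domain M E (\<lambda>t. t) = Lp M 2 \<and>
     (\<forall>f\<in>Lp M 2. \<forall>h\<in>Lp M 2. L2_inner M (A f) h = spectral_pairing M E (\<lambda>t. t) f h)"

definition spectral_resolution ::
    "'a measure \<Rightarrow> (('a \<Rightarrow> complex) \<Rightarrow> ('a \<Rightarrow> complex))
      \<Rightarrow> (real set \<Rightarrow> ('a \<Rightarrow> complex) \<Rightarrow> ('a \<Rightarrow> complex))" where
  "spectral_resolution M A = (SOME E. is_spectral_resolution M A E)"

text \<open>
  Real powers of a nonnegative injective \<open>A\<close>. The values of \<open>t powr s\<close> at \<open>t \<le> 0\<close> are irrelevant,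
  because then \<open>E {..0}\<close> vanishes.
\<close>

definition power_domain ::
    "'a measure \<Rightarrow> (('a \<Rightarrow> complex) \<Rightarrow> ('a \<Rightarrow> complex)) \<Rightarrow> real \<Rightarrow> ('a \<Rightarrow> complex) set" where
  "power_domain M A s = spectral_domain M (spectral_resolution M A) (\<lambda>t. t powr s)"

definition op_power ::
    "'a measure \<Rightarrow> (('a \<Rightarrow> complex) \<Rightarrow> ('a \<Rightarrow> complex)) \<Rightarrow> real
      \<Rightarrow> ('a \<Rightarrow> complex) \<Rightarrow> ('a \<Rightarrow> complex)" where
  "op_power M A s f = spectral_integral M (spectral_resolution M A) (\<lambda>t. t powr s) f"


section \<open>The homogeneous tree with its canonical flow\<close>

definition homogeneous_tree :: "nat \<Rightarrow> ('v \<Rightarrow> 'v \<Rightarrow> bool) \<Rightarrow> bool" where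
  "homogeneous_tree d adj \<longleftrightarrow>
     (\<forall>x. \<not> adj x x) \<and> (\<forall>x y. adj x y \<longrightarrow> adj y x) \<and>
     (\<forall>x y. adj\<^sup>*\<^sup>* x y) \<and>
     (\<nexists>xs. length xs \<ge> 3 \<and> distinct xs \<and> successively adj xs \<and> adj (last xs) (hd xs)) \<and>
     (\<forall>x. finite {y. adj x y} \<and> card {y. adj x y} = d)"

definition gdist :: "('v \<Rightarrow> 'v \<Rightarrow> bool) \<Rightarrow> 'v \<Rightarrow> 'v \<Rightarrow> nat" where
  "gdist adj x y = (LEAST n. (adj ^^ n) x y)"

definition ray_from :: "('v \<Rightarrow> 'v \<Rightarrow> bool) \<Rightarrow> 'v \<Rightarrow> (nat \<Rightarrow> 'v) \<Rightarrow> bool" where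
  "ray_from adj r \<omega> \<longleftrightarrow> \<omega> 0 = r \<and> (\<forall>m n. m \<le> n \<longrightarrow> gdist adj (\<omega> m) (\<omega> n) = n - m)"

text \<open>In a tree the closest point of the ray is unique.\<close>

definition confluent :: "('v \<Rightarrow> 'v \<Rightarrow> bool) \<Rightarrow> (nat \<Rightarrow> 'v) \<Rightarrow> 'v \<Rightarrow> 'v" where
  "confluent adj \<omega> x = arg_min_on (gdist adj x) (range \<omega>)"

definition level :: "('v \<Rightarrow> 'v \<Rightarrow> bool) \<Rightarrow> 'v \<Rightarrow> (nat \<Rightarrow> 'v) \<Rightarrow> 'v \<Rightarrow> int" where
  "level adj r \<omega> x =
     int (gdist adj r (confluent adj \<omega> x)) - int (gdist adj x (confluent adj \<omega> x))"

definition predecessor :: "('v \<Rightarrow> 'v \<Rightarrow> bool) \<Rightarrow> 'v \<Rightarrow> (nat \<Rightarrow> 'v) \<Rightarrow> 'v \<Rightarrow> 'v" where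
  "predecessor adj r \<omega> x = (THE y. adj x y \<and> level adj r \<omega> y = level adj r \<omega> x + 1)"

text \<open>\<open>below adj r \<omega> y x\<close> is the order relation \<open>y \<le> x\<close>.\<close>

definition below :: "('v \<Rightarrow> 'v \<Rightarrow> bool) \<Rightarrow> 'v \<Rightarrow> (nat \<Rightarrow> 'v) \<Rightarrow> 'v \<Rightarrow> 'v \<Rightarrow> bool" where
  "below adj r \<omega> y x \<longleftrightarrow> int (gdist adj x y) = level adj r \<omega> x - level adj r \<omega> y"

definition flow_weight :: "nat \<Rightarrow> ('v \<Rightarrow> 'v \<Rightarrow> bool) \<Rightarrow> 'v \<Rightarrow> (nat \<Rightarrow> 'v) \<Rightarrow> 'v \<Rightarrow> real" where
  "flow_weight q adj r \<omega> x = real q powi level adj r \<omega> x"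

definition flow_measure :: "nat \<Rightarrow> ('v \<Rightarrow> 'v \<Rightarrow> bool) \<Rightarrow> 'v \<Rightarrow> (nat \<Rightarrow> 'v) \<Rightarrow> 'v measure" where
  "flow_measure q adj r \<omega> = density (count_space UNIV) (\<lambda>x. ennreal (flow_weight q adj r \<omega> x))"

definition flow_gradient ::
    "('v \<Rightarrow> 'v \<Rightarrow> bool) \<Rightarrow> 'v \<Rightarrow> (nat \<Rightarrow> 'v) \<Rightarrow> ('v \<Rightarrow> complex) \<Rightarrow> 'v \<Rightarrow> complex" where
  "flow_gradient adj r \<omega> f x = f x - f (predecessor adj r \<omega> x)"

text \<open>
  This is \<open>\<nabla>\<^sup>*\<nabla> / 2\<close>, with the adjoint taken in \<open>L\<^sup>2\<close> of the flow measure: since the weight is multiplied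
  by \<open>q\<close> at each step up, the formula is \<open>f x - f (p x) / 2\<close> minus \<open>1 / (2 * q)\<close> times the sum of \<open>f\<close>
  over the \<open>q\<close> lower neighbours of \<open>x\<close>.
\<close>

definition flow_laplacian ::
    "nat \<Rightarrow> ('v \<Rightarrow> 'v \<Rightarrow> bool) \<Rightarrow> 'v \<Rightarrow> (nat \<Rightarrow> 'v) \<Rightarrow> ('v \<Rightarrow> complex) \<Rightarrow> 'v \<Rightarrow> complex" where
  "flow_laplacian q adj r \<omega> f x =
     f x - complex_of_real (1 / (2 * sqrt (real q))) *
       (\<Sum>y | adj x y.
          complex_of_real (sqrt (flow_weight q adj r \<omega> y) / sqrt (flow_weight q adj r \<omega> x)) * f y)"


section \<open>The Riesz transform\<close>

text \<open>
  The Riesz transform is given by its graph: \<open>riesz_L2 \<dots> f g\<close>, \<open>riesz_Lp \<dots> f g\<close> and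
  \<open>riesz_L1 \<dots> f g\<close> say that the respective extension is defined at \<open>f\<close> and has the value \<open>g\<close>.
\<close>

definition riesz_initial ::
    "nat \<Rightarrow> ('v \<Rightarrow> 'v \<Rightarrow> bool) \<Rightarrow> 'v \<Rightarrow> (nat \<Rightarrow> 'v) \<Rightarrow> ('v \<Rightarrow> complex) \<Rightarrow> ('v \<Rightarrow> complex) \<Rightarrow> bool" where
  "riesz_initial q adj r \<omega> f g \<longleftrightarrow>
     f \<in> power_domain (flow_measure q adj r \<omega>) (flow_laplacian q adj r \<omega>) (- 1 / 2) \<and>
     g = flow_gradient adj r \<omega>
           (op_power (flow_measure q adj r \<omega>) (flow_laplacian q adj r \<omega>) (- 1 / 2) f)"

definition riesz_L2 ::
    "nat \<Rightarrow> ('v \<Rightarrow> 'v \<Rightarrow> bool) \<Rightarrow> 'v \<Rightarrow> (nat \<Rightarrow> 'v) \<Rightarrow> ('v \<Rightarrow> complex) \<Rightarrow> ('v \<Rightarrow> complex) \<Rightarrow> bool" where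
  "riesz_L2 q adj r \<omega> =
     continuous_extension (riesz_initial q adj r \<omega>)
       (converges_Lp (flow_measure q adj r \<omega>) 2) (converges_Lp (flow_measure q adj r \<omega>) 2)"

definition riesz_Lp ::
    "real \<Rightarrow> nat \<Rightarrow> ('v \<Rightarrow> 'v \<Rightarrow> bool) \<Rightarrow> 'v \<Rightarrow> (nat \<Rightarrow> 'v) \<Rightarrow> ('v \<Rightarrow> complex) \<Rightarrow> ('v \<Rightarrow> complex) \<Rightarrow> bool"
  where
  "riesz_Lp p q adj r \<omega> =
     continuous_extension (\<lambda>f g. f \<in> Lp (flow_measure q adj r \<omega>) p \<and> riesz_L2 q adj r \<omega> f g)
       (converges_Lp (flow_measure q adj r \<omega>) p) (converges_Lp (flow_measure q adj r \<omega>) p)"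

definition riesz_L1 ::
    "nat \<Rightarrow> ('v \<Rightarrow> 'v \<Rightarrow> bool) \<Rightarrow> 'v \<Rightarrow> (nat \<Rightarrow> 'v) \<Rightarrow> ('v \<Rightarrow> complex) \<Rightarrow> ('v \<Rightarrow> complex) \<Rightarrow> bool" where
  "riesz_L1 q adj r \<omega> =
     continuous_extension (\<lambda>f g. f \<in> Lp (flow_measure q adj r \<omega>) 1 \<and> riesz_L2 q adj r \<omega> f g)
       (converges_Lp (flow_measure q adj r \<omega>) 1) (converges_weak_L1 (flow_measure q adj r \<omega>))"


section \<open>The atomic Hardy space\<close>

definition admissible_trapezoid ::
    "('v \<Rightarrow> 'v \<Rightarrow> bool) \<Rightarrow> 'v \<Rightarrow> (nat \<Rightarrow> 'v) \<Rightarrow> 'v set \<Rightarrow> bool" where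
  "admissible_trapezoid adj r \<omega> S \<longleftrightarrow>
     (\<exists>x. S = {x}) \<or>
     (\<exists>xS. \<exists>h::int. h > 0 \<and> S = {x. below adj r \<omega> x xS \<and>
        h \<le> level adj r \<omega> xS - level adj r \<omega> x \<and> level adj r \<omega> xS - level adj r \<omega> x < 2 * h})"

definition atom ::
    "nat \<Rightarrow> ('v \<Rightarrow> 'v \<Rightarrow> bool) \<Rightarrow> 'v \<Rightarrow> (nat \<Rightarrow> 'v) \<Rightarrow> ('v \<Rightarrow> complex) \<Rightarrow> bool" where
  "atom q adj r \<omega> a \<longleftrightarrow>
     (\<exists>S. admissible_trapezoid adj r \<omega> S \<and> (\<forall>x. x \<notin> S \<longrightarrow> a x = 0) \<and>
        (\<forall>x. norm (a x) \<le> 1 / measure (flow_measure q adj r \<omega>) S) \<and>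
        (\<Sum>x\<in>S. a x * complex_of_real (flow_weight q adj r \<omega> x)) = 0)"

definition atomic_decomposition ::
    "nat \<Rightarrow> ('v \<Rightarrow> 'v \<Rightarrow> bool) \<Rightarrow> 'v \<Rightarrow> (nat \<Rightarrow> 'v) \<Rightarrow> ('v \<Rightarrow> complex)
      \<Rightarrow> (nat \<Rightarrow> complex) \<Rightarrow> (nat \<Rightarrow> 'v \<Rightarrow> complex) \<Rightarrow> bool" where
  "atomic_decomposition q adj r \<omega> f c a \<longleftrightarrow>
     (\<forall>j. atom q adj r \<omega> (a j)) \<and> summable (\<lambda>j. norm (c j)) \<and>
     converges_Lp (flow_measure q adj r \<omega>) 1 (\<lambda>n x. \<Sum>j<n. c j * a j x) f"

definition H1 ::
    "nat \<Rightarrow> ('v \<Rightarrow> 'v \<Rightarrow> bool) \<Rightarrow> 'v \<Rightarrow> (nat \<Rightarrow> 'v) \<Rightarrow> ('v \<Rightarrow> complex) set" where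
  "H1 q adj r \<omega> =
     {f \<in> Lp (flow_measure q adj r \<omega>) 1. \<exists>c a. atomic_decomposition q adj r \<omega> f c a}"

definition H1_norm ::
    "nat \<Rightarrow> ('v \<Rightarrow> 'v \<Rightarrow> bool) \<Rightarrow> 'v \<Rightarrow> (nat \<Rightarrow> 'v) \<Rightarrow> ('v \<Rightarrow> complex) \<Rightarrow> real" where
  "H1_norm q adj r \<omega> f =
     Inf {(\<Sum>j. norm (c j)) | c. \<exists>a. atomic_decomposition q adj r \<omega> f c a}"

end

theory Submission
  imports Defs
begin

text \<open>
  On the tree \<open>\<L> = 1 - (U + U\<^sup>*) / 2\<close> with the isometry \<open>U f = f \<circ> \<pp>\<close> of \<open>L\<^sup>2(\<mu>)\<close>, and \<open>U + U\<^sup>*\<close> acts on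
  kernels of the form \<open>F(d(x, y)) / \<mu>(x \<or> y)\<close>, where \<open>x \<or> y\<close> is the lowest common ancestor, as a
  Jacobi matrix on \<open>F\<close>. Its generalized eigenfunctions
  \<open>F(d) = (2 / \<pi>) sin \<theta> \<Sum>\<^sub>j q\<^sup>-\<^sup>j sin ((d + 2j + 1) \<theta>)\<close> give the spectral density of \<open>\<L>\<close> in the
  variable \<open>1 - cos \<theta>\<close>, and hence an explicit kernel for \<open>\<L>\<^sup>-\<^sup>1\<^sup>/\<^sup>2\<close>. An arbitrary spectral resolution of \<open>\<L>\<close> has
  the same moments, so it yields the same operator.

  The kernel of \<open>\<nabla>\<L>\<^sup>-\<^sup>1\<^sup>/\<^sup>2\<close> is of order \<open>d\<^sup>-\<^sup>2 / \<mu>(x \<or> y)\<close>, its variation in \<open>y\<close> over a trapezoid is of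
  order \<open>d\<^sup>-\<^sup>3\<close>, and below the apex of the trapezoid the measure of the admissible \<open>x\<close> is already small
  enough for the size bound. This gives the Hoermander condition for trapezoids whose depths run from \<open>a\<close>
  to between \<open>2a\<close> and \<open>8a\<close>. Such trapezoids split into smaller ones of comparable measure, so there is a
  Calderon-Zygmund decomposition although \<open>\<mu>\<close> is not doubling. The \<open>L\<^sup>2\<close> bound then yields the weak type
  \<open>(1,1)\<close> estimate and the \<open>H\<^sup>1\<close> estimate, and \<open>1 < p < 2\<close> follows by interpolation.
\<close>

section \<open>The flow structure of the tree\<close>

text \<open>The statement reaches the operator through a chosen spectral resolution, an unbounded
  power and three extensions by continuity. All of this is collapsed into one absolutely convergent
  kernel integral, \<open>Rz\<close>, which makes sense on \<open>Lp M s\<close> for all exponents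
  from 1 to 2. The choice is harmless only if some resolution exists, so one is built from the
  explicit density. This requires the density to be nonnegative, which the oscillating series for
  the eigenfunctions does not show; positivity is extracted from self-adjointness instead, since
  squares of polynomials in the Laplacian have nonnegative forms. The singularity of
  \<open>t powr (- 1 / 2)\<close> at the bottom of the spectrum is harmless because the density is
  bounded by a multiple of \<open>(sin \<theta>)\<^sup>2\<close>, hence of the spectral variable.
  Even \<open>1 / t\<close> is integrable, so finitely supported functions lie in the domain, and
  all operators can be computed on them by finite sums. The measure enters the estimates through one
  identity: every generation of descendants of a vertex has the weight of that vertex.\<close>

locale acyclic_graph =
  fixes adj :: "'v \<Rightarrow> 'v \<Rightarrow> bool"
  assumes adj_irrefl: "\<not> adj x x"
    and adj_sym: "adj x y \<Longrightarrow> adj y x"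
    and connected: "adj\<^sup>*\<^sup>* x y"
    and acyclic: "\<lbrakk>length xs \<ge> 3; distinct xs; successively adj xs; adj (last xs) (hd xs)\<rbrakk> \<Longrightarrow> False"
begin

lemma relpow_gdist: "(adj ^^ gdist adj x y) x y"
  unfolding gdist_def by (rule LeastI_ex) (use connected[of x y] rtranclp_imp_relpowp in metis)

lemma gdist_le: "(adj ^^ n) x y \<Longrightarrow> gdist adj x y \<le> n"
  unfolding gdist_def by (rule Least_le)

lemma gdist_eq_0 [simp]: "gdist adj x y = 0 \<longleftrightarrow> x = y"
proof
  assume "gdist adj x y = 0"
  then show "x = y" using relpow_gdist[of x y] by simp
next
  assume "x = y"
  then show "gdist adj x y = 0" using gdist_le[of 0 x y] by simp
qed

lemma gdist_self [simp]: "gdist adj x x = 0"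
  by simp

lemma relpow_sym: "(adj ^^ n) x y \<Longrightarrow> (adj ^^ n) y x"
proof (induction n arbitrary: y)
  case (Suc n)
  then obtain z where "(adj ^^ n) x z" "adj z y" by auto
  then show ?case using Suc.IH adj_sym by (intro relpowp_Suc_I2) blast+
qed simp

lemma gdist_sym: "gdist adj x y = gdist adj y x"
  by (rule antisym; rule gdist_le; rule relpow_sym; rule relpow_gdist)

lemma gdist_triangle: "gdist adj x z \<le> gdist adj x y + gdist adj y z"
  by (intro gdist_le relpowp_trans[OF relpow_gdist relpow_gdist])

lemma gdist_adj: "adj x y \<Longrightarrow> gdist adj x y = 1"
  using gdist_le[of 1 x y] adj_irrefl gdist_eq_0[of x y] by (cases "x = y") (auto simp: le_Suc_eq)

lemma closer_neighbour:
  assumes "x \<noteq> z"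
  obtains y where "adj x y" "gdist adj x z = Suc (gdist adj y z)"
proof -
  obtain n where n: "gdist adj x z = Suc n"
    using assms by (cases "gdist adj x z") auto
  then obtain y where y: "adj x y" "(adj ^^ n) y z"
    using relpow_gdist[of x z] relpowp_Suc_D2 by metis
  have "gdist adj y z \<le> n" "gdist adj x z \<le> 1 + gdist adj y z"
    using gdist_le[OF y(2)] gdist_triangle[of x z y] gdist_adj[OF y(1)] by auto
  then show ?thesis using that[OF y(1)] n by simp
qed

text \<open>Walks in the graph with the vertex \<open>x\<close> deleted. Without cycles, distinct
  neighbours of \<open>x\<close> fall into different components of it, and the uniqueness statements
  about geodesics below are reduced to that.\<close>

definition avoiding :: "'v \<Rightarrow> 'v \<Rightarrow> 'v \<Rightarrow> bool" where
  "avoiding x u v \<longleftrightarrow> adj u v \<and> u \<noteq> x \<and> v \<noteq> x"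

lemma avoiding_sym: "(avoiding x)\<^sup>*\<^sup>* u v \<Longrightarrow> (avoiding x)\<^sup>*\<^sup>* v u"
proof (induction rule: rtranclp_induct)
  case (step y z)
  then show ?case using adj_sym by (auto simp: avoiding_def intro: converse_rtranclp_into_rtranclp)
qed simp

text \<open>A shortest walk from \<open>a\<close> to \<open>b\<close> that misses \<open>x\<close>
  has no repeated vertex, since the loop between two visits could be cut out. Prepending
  \<open>x\<close> then closes it to a forbidden cycle.\<close>

lemma avoiding_closed_walk:
  assumes "adj x a" "adj x b" "a \<noteq> b" "(avoiding x)\<^sup>*\<^sup>* a b"
  shows False
proof -
  let ?P = "\<lambda>xs. xs \<noteq> [] \<and> hd xs = a \<and> last xs = b \<and> successively adj xs \<and> x \<notin> set xs"
  have "\<exists>xs. ?P xs" using assms(4)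
  proof (induction rule: rtranclp_induct)
    case base
    then show ?case using assms(1) adj_irrefl by (intro exI[of _ "[a]"]) auto
  next
    case (step y z)
    then obtain xs where "xs \<noteq> []" "hd xs = a" "last xs = y" "successively adj xs" "x \<notin> set xs"
      by auto
    then show ?case using step(2)
      by (intro exI[of _ "xs @ [z]"]) (auto simp: successively_append_iff avoiding_def)
  qed
  then obtain xs where P: "?P xs" and least: "\<And>ys. ?P ys \<Longrightarrow> length xs \<le> length ys"
    using ex_has_least_nat[of ?P _ length] by (metis (no_types, lifting))
  have "distinct xs"
  proof (rule ccontr)
    assume "\<not> distinct xs"
    then obtain us vs ws v where xs: "xs = us @ [v] @ vs @ [v] @ ws"
      using not_distinct_decomp by blast
    have "?P (us @ [v] @ ws)"
      using P unfolding xs by (cases us) (auto simp: successively_append_iff successively_Cons hd_append split: if_splits)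
    then have "length xs \<le> length (us @ [v] @ ws)" by (rule least)
    then show False unfolding xs by simp
  qed
  moreover have "length xs \<ge> 2"
  proof (rule ccontr)
    assume "\<not> length xs \<ge> 2"
    then obtain v where "xs = [v]" using P by (cases xs; cases "tl xs") (simp_all del: length_tl)
    then show False using P assms(3) by auto
  qed
  moreover have "successively adj (x # xs)"
    using P assms(1) by (simp add: successively_Cons)
  ultimately show False
    using acyclic[of "x # xs"] P assms(2) adj_sym by auto
qed

text \<open>Every vertex of a geodesic from \<open>y\<close> to \<open>z\<close> is at least as
  close to \<open>z\<close> as \<open>y\<close> is, hence closer than \<open>x\<close>, so it cannot
  be \<open>x\<close>.\<close>

lemma geodesic_avoiding:
  assumes "gdist adj y z < gdist adj x z"
  shows "(avoiding x)\<^sup>*\<^sup>* y z"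
  using assms
proof (induction "gdist adj y z" arbitrary: y)
  case (Suc n)
  have "y \<noteq> z" using Suc.hyps(2) by (metis gdist_eq_0 nat.distinct(1))
  then obtain y' where y': "adj y y'" "gdist adj y z = Suc (gdist adj y' z)"
    by (rule closer_neighbour)
  have "avoiding x y y'"
    using y' Suc.prems by (auto simp: avoiding_def)
  moreover have "(avoiding x)\<^sup>*\<^sup>* y' z"
    using Suc y' by simp
  ultimately show ?case by (rule converse_rtranclp_into_rtranclp)
qed simp

text \<open>Two geodesics to \<open>z\<close>, one from each neighbour, would connect the neighbours
  without passing \<open>x\<close>.\<close>

lemma closer_neighbour_unique:
  assumes "adj x a" "adj x b" "gdist adj a z < gdist adj x z" "gdist adj b z < gdist adj x z"
  shows "a = b"
  using avoiding_closed_walk[OF assms(1,2)]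
    rtranclp_trans[OF geodesic_avoiding[OF assms(3)] avoiding_sym[OF geodesic_avoiding[OF assms(4)]]]
  by blast

text \<open>The graph is bipartite. With equal distances, the edge from \<open>y\<close> to
  \<open>y'\<close>, a geodesic from \<open>y'\<close> to \<open>z\<close> and one from
  \<open>z\<close> back to \<open>x'\<close> would join the neighbours \<open>y\<close> and
  \<open>x'\<close> of \<open>x\<close> without passing \<open>x\<close>.\<close>

lemma gdist_neighbour_neq:
  assumes "adj x y"
  shows "gdist adj x z \<noteq> gdist adj y z"
proof
  assume eq: "gdist adj x z = gdist adj y z"
  have "x \<noteq> z" "y \<noteq> z" using eq assms adj_irrefl gdist_eq_0 by metis+
  obtain x' where x': "adj x x'" "gdist adj x z = Suc (gdist adj x' z)"
    using closer_neighbour[OF \<open>x \<noteq> z\<close>] .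
  obtain y' where y': "adj y y'" "gdist adj y z = Suc (gdist adj y' z)"
    using closer_neighbour[OF \<open>y \<noteq> z\<close>] .
  have "avoiding x y y'"
    using assms adj_irrefl y' eq by (auto simp: avoiding_def)
  then have "(avoiding x)\<^sup>*\<^sup>* y z"
    using geodesic_avoiding[of y' z x] y' eq by (auto intro: converse_rtranclp_into_rtranclp)
  moreover have "(avoiding x)\<^sup>*\<^sup>* z x'"
    using avoiding_sym[OF geodesic_avoiding[of x' z x]] x' by simp
  ultimately have "(avoiding x)\<^sup>*\<^sup>* y x'" by (rule rtranclp_trans)
  moreover have "y \<noteq> x'" using x' eq by auto
  ultimately show False using avoiding_closed_walk[OF assms x'(1)] by simp
qed

lemma gdist_neighbour:
  assumes "adj x y"
  shows "gdist adj y z = Suc (gdist adj x z) \<or> gdist adj x z = Suc (gdist adj y z)"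
  using gdist_neighbour_neq[OF assms, of z] gdist_triangle[of x z y] gdist_triangle[of y z x]
    gdist_adj[OF assms] gdist_adj[OF adj_sym[OF assms]] by linarith

end

section \<open>Levels and predecessors determined by a ray\<close>

locale acyclic_graph_ray = acyclic_graph adj for adj :: "'v \<Rightarrow> 'v \<Rightarrow> bool" +
  fixes r :: 'v and \<omega> :: "nat \<Rightarrow> 'v"
  assumes ray: "ray_from adj r \<omega>"
begin

lemma gdist_ray: "m \<le> n \<Longrightarrow> gdist adj (\<omega> m) (\<omega> n) = n - m"
  and ray_0: "\<omega> 0 = r"
  using ray by (auto simp: ray_from_def)

lemma adj_ray: "adj (\<omega> n) (\<omega> (Suc n))"
  using relpow_gdist[of "\<omega> n" "\<omega> (Suc n)"] gdist_ray[of n "Suc n"] by auto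

lemma gdist_ray_step:
  "gdist adj x (\<omega> (Suc n)) = Suc (gdist adj x (\<omega> n)) \<or>
   gdist adj x (\<omega> n) = Suc (gdist adj x (\<omega> (Suc n)))"
  using gdist_neighbour[OF adj_ray, where z = x] unfolding gdist_sym[of _ x] by blast

text \<open>Otherwise the two neighbours of \<open>\<omega> (Suc n)\<close> on the ray would both be
  closer to \<open>x\<close>, hence equal. So the distance from \<open>x\<close> along the ray can
  only decrease first and then increase.\<close>

lemma gdist_ray_increasing:
  assumes "gdist adj x (\<omega> (Suc n)) = Suc (gdist adj x (\<omega> n))"
  shows "gdist adj x (\<omega> (Suc (Suc n))) = Suc (gdist adj x (\<omega> (Suc n)))"
proof (rule ccontr)
  assume "\<not> ?thesis"
  then have *: "gdist adj x (\<omega> (Suc n)) = Suc (gdist adj x (\<omega> (Suc (Suc n))))"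
    using gdist_ray_step by blast
  have "\<omega> n = \<omega> (Suc (Suc n))"
    by (rule closer_neighbour_unique[OF adj_sym[OF adj_ray] adj_ray, where z = x])
      (use assms * gdist_sym[of _ x] in simp_all)
  then have "gdist adj (\<omega> n) (\<omega> n) = 2"
    using gdist_ray[of n "Suc (Suc n)"] by simp
  then show False by (simp del: gdist_eq_0 add: gdist_ray)
qed

text \<open>The level is a Busemann function. After the closest point the distance grows by one at
  each step, so any far ray point can replace the confluent, and one common ray point serves several
  vertices at once.\<close>

lemma level_busemann:
  obtains k where "\<And>n. n \<ge> k \<Longrightarrow> level adj r \<omega> x = int n - int (gdist adj x (\<omega> n))"
proof -
  let ?c = "confluent adj \<omega> x"
  have c: "?c \<in> range \<omega> \<and> (\<forall>y. y \<in> range \<omega> \<longrightarrow> gdist adj x ?c \<le> gdist adj x y)"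
    unfolding confluent_def arg_min_on_def by (rule arg_min_nat_lemma[where k = "\<omega> 0"]) (rule rangeI)
  then obtain k where k: "?c = \<omega> k" by blast
  have min: "gdist adj x (\<omega> k) \<le> gdist adj x (\<omega> j)" for j
    using c unfolding k by blast
  have step: "gdist adj x (\<omega> (Suc (k + j))) = Suc (gdist adj x (\<omega> (k + j)))" for j
  proof (induction j)
    case 0
    then show ?case using gdist_ray_step[of x k] min[of "Suc k"] by auto
  next
    case (Suc j)
    then show ?case using gdist_ray_increasing by simp
  qed
  have dist: "gdist adj x (\<omega> (k + j)) = gdist adj x (\<omega> k) + j" for j
    by (induction j) (use step in auto)
  have "level adj r \<omega> x = int k - int (gdist adj x (\<omega> k))"
    using gdist_ray[of 0 k] ray_0 unfolding level_def k by simp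
  then have "level adj r \<omega> x = int n - int (gdist adj x (\<omega> n))" if "n \<ge> k" for n
    using dist[of "n - k"] that by simp
  then show ?thesis by (rule that)
qed

lemma level_neighbour:
  assumes "adj x y"
  shows "level adj r \<omega> y = level adj r \<omega> x + 1 \<or> level adj r \<omega> y = level adj r \<omega> x - 1"
proof -
  obtain k where k: "\<And>n. n \<ge> k \<Longrightarrow> level adj r \<omega> x = int n - int (gdist adj x (\<omega> n))"
    using level_busemann by blast
  obtain l where l: "\<And>n. n \<ge> l \<Longrightarrow> level adj r \<omega> y = int n - int (gdist adj y (\<omega> n))"
    using level_busemann by blast
  show ?thesis
    using k[of "k + l"] l[of "k + l"] gdist_neighbour[OF assms, of "\<omega> (k + l)"] by auto
qed

text \<open>The predecessor is the first step of the geodesic to a far ray point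
  \<open>\<omega> n\<close>, which is why the distance to \<open>\<omega> n\<close> drops. Any
  neighbour of higher level is closer to some still farther ray point, and
  \<open>closer_neighbour_unique\<close> applies there.\<close>

lemma predecessor_step:
  assumes "x \<noteq> \<omega> n" "level adj r \<omega> x = int n - int (gdist adj x (\<omega> n))"
  shows "adj x (predecessor adj r \<omega> x)"
    "level adj r \<omega> (predecessor adj r \<omega> x) = level adj r \<omega> x + 1"
    "gdist adj x (\<omega> n) = Suc (gdist adj (predecessor adj r \<omega> x) (\<omega> n))"
    "adj x z \<Longrightarrow> level adj r \<omega> z = level adj r \<omega> x + 1 \<Longrightarrow> z = predecessor adj r \<omega> x"
proof -
  obtain y where y: "adj x y" "gdist adj x (\<omega> n) = Suc (gdist adj y (\<omega> n))"
    using closer_neighbour[OF assms(1)] .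
  \<comment> \<open>The distance to the ray point grows by at most one per step along the ray, so
    passing from \<open>\<omega> n\<close> to a farther point cannot lower the Busemann value of
    \<open>y\<close>: its level is at least that of \<open>x\<close> plus one.\<close>
  have far: "gdist adj v (\<omega> (n + j)) \<le> gdist adj v (\<omega> n) + j" for v j
    using gdist_triangle[of v "\<omega> (n + j)" "\<omega> n"] gdist_ray[of n "n + j"] by simp
  obtain k where k: "\<And>n. n \<ge> k \<Longrightarrow> level adj r \<omega> x = int n - int (gdist adj x (\<omega> n))"
    using level_busemann by blast
  have y_level: "level adj r \<omega> y = level adj r \<omega> x + 1"
  proof -
    obtain l where l: "\<And>n. n \<ge> l \<Longrightarrow> level adj r \<omega> y = int n - int (gdist adj y (\<omega> n))"
      using level_busemann by blast
    show ?thesis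
      using l[of "n + l"] far[of y l] y assms(2) level_neighbour[OF y(1)] by auto
  qed
  have unique: "z = y" if z: "adj x z" "level adj r \<omega> z = level adj r \<omega> x + 1" for z
  proof -
    obtain l where l: "\<And>n. n \<ge> l \<Longrightarrow> level adj r \<omega> z = int n - int (gdist adj z (\<omega> n))"
      using level_busemann by blast
    obtain m where m: "\<And>n. n \<ge> m \<Longrightarrow> level adj r \<omega> y = int n - int (gdist adj y (\<omega> n))"
      using level_busemann by blast
    let ?N = "k + l + m"
    show ?thesis
      by (rule closer_neighbour_unique[OF z(1) y(1), of "\<omega> ?N"])
        (use k[of ?N] l[of ?N] m[of ?N] z y_level in simp_all)
  qed
  have pred: "predecessor adj r \<omega> x = y"
    unfolding predecessor_def
  proof (rule the_equality)
    show "adj x y \<and> level adj r \<omega> y = level adj r \<omega> x + 1" using y(1) y_level by (rule conjI)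
  qed (use unique in blast)
  show "adj x (predecessor adj r \<omega> x)"
    "level adj r \<omega> (predecessor adj r \<omega> x) = level adj r \<omega> x + 1"
    "gdist adj x (\<omega> n) = Suc (gdist adj (predecessor adj r \<omega> x) (\<omega> n))"
    unfolding pred by (rule y y_level)+
  show "adj x z \<Longrightarrow> level adj r \<omega> z = level adj r \<omega> x + 1 \<Longrightarrow> z = predecessor adj r \<omega> x"
    unfolding pred by (rule unique)
qed

lemma far_ray_point:
  obtains k where "\<And>n. n \<ge> k \<Longrightarrow> x \<noteq> \<omega> n"
    "\<And>n. n \<ge> k \<Longrightarrow> level adj r \<omega> x = int n - int (gdist adj x (\<omega> n))"
proof -
  obtain k where k: "\<And>n. n \<ge> k \<Longrightarrow> level adj r \<omega> x = int n - int (gdist adj x (\<omega> n))"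
    using level_busemann by blast
  show ?thesis
  proof (rule that)
    fix n assume n: "n \<ge> k + nat \<bar>level adj r \<omega> x\<bar> + 1"
    then show "level adj r \<omega> x = int n - int (gdist adj x (\<omega> n))"
      using k by simp
    then show "x \<noteq> \<omega> n"
      using n gdist_eq_0[of x "\<omega> n"] by linarith
  qed
qed

lemma adj_predecessor: "adj x (predecessor adj r \<omega> x)"
  and level_predecessor: "level adj r \<omega> (predecessor adj r \<omega> x) = level adj r \<omega> x + 1"
  and predecessor_unique:
    "adj x z \<Longrightarrow> level adj r \<omega> z = level adj r \<omega> x + 1 \<Longrightarrow> z = predecessor adj r \<omega> x"
proof -
  obtain k where "x \<noteq> \<omega> k" "level adj r \<omega> x = int k - int (gdist adj x (\<omega> k))"
    using far_ray_point[of x] by (metis order_refl)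
  note s = predecessor_step[OF this]
  show "adj x (predecessor adj r \<omega> x)" by (rule s)
  show "level adj r \<omega> (predecessor adj r \<omega> x) = level adj r \<omega> x + 1" by (rule s)
  show "adj x z \<Longrightarrow> level adj r \<omega> z = level adj r \<omega> x + 1 \<Longrightarrow> z = predecessor adj r \<omega> x" by (rule s)
qed

lemma adj_iff_predecessor:
  "adj x y \<longleftrightarrow> y = predecessor adj r \<omega> x \<or> x = predecessor adj r \<omega> y"
proof
  assume "adj x y"
  then show "y = predecessor adj r \<omega> x \<or> x = predecessor adj r \<omega> y"
    using level_neighbour[OF \<open>adj x y\<close>] predecessor_unique[of x y] predecessor_unique[of y x] adj_sym
    by auto
qed (use adj_predecessor adj_sym in auto)

lemma predecessor_ray:
  "level adj r \<omega> x = int n - int d \<Longrightarrow> gdist adj x (\<omega> n) = d \<Longrightarrow>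
    (predecessor adj r \<omega> ^^ d) x = \<omega> n"
proof (induction d arbitrary: x)
  case 0
  then show ?case using gdist_eq_0[of x "\<omega> n"] by (simp only: funpow_0)
next
  case (Suc d)
  have "x \<noteq> \<omega> n" using Suc.prems(2) by auto
  moreover have "level adj r \<omega> x = int n - int (gdist adj x (\<omega> n))"
    unfolding Suc.prems(2) by (rule Suc.prems(1))
  ultimately have "gdist adj (predecessor adj r \<omega> x) (\<omega> n) = d"
    using predecessor_step(3)[of x n] Suc.prems(2) by simp
  then have "(predecessor adj r \<omega> ^^ d) (predecessor adj r \<omega> x) = \<omega> n"
    using Suc.IH[of "predecessor adj r \<omega> x"] Suc.prems(1) level_predecessor[of x] by simp
  then show ?case by (simp only: funpow_Suc_right o_apply)
qed

text \<open>Both ancestor chains run into the ray, and they meet at any point of it that is far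
  enough for both vertices.\<close>

lemma common_ancestor:
  "\<exists>m n. (predecessor adj r \<omega> ^^ m) x = (predecessor adj r \<omega> ^^ n) y"
proof -
  obtain k where k: "\<And>n. n \<ge> k \<Longrightarrow> level adj r \<omega> x = int n - int (gdist adj x (\<omega> n))"
    using level_busemann by blast
  obtain l where l: "\<And>n. n \<ge> l \<Longrightarrow> level adj r \<omega> y = int n - int (gdist adj y (\<omega> n))"
    using level_busemann by blast
  show ?thesis
    using predecessor_ray[OF k[of "k + l"] refl] predecessor_ray[OF l[of "k + l"] refl]
    by (metis le_add1 le_add2)
qed

lemma level_funpow:
  "level adj r \<omega> ((predecessor adj r \<omega> ^^ n) x) = level adj r \<omega> x + int n"
  by (induction n) (auto simp: level_predecessor)

text \<open>A walk that gains as much level as it has steps goes up at every step. This identifies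
  the metric order \<open>below\<close> with the ancestor relation in
  \<open>below_iff\<close>.\<close>

lemma level_relpow:
  "(adj ^^ n) x y \<Longrightarrow> level adj r \<omega> y \<le> level adj r \<omega> x + int n \<and>
    (level adj r \<omega> y = level adj r \<omega> x + int n \<longrightarrow> y = (predecessor adj r \<omega> ^^ n) x)"
proof (induction n arbitrary: y)
  case (Suc n)
  then obtain z where z: "(adj ^^ n) x z" "adj z y" by auto
  have "level adj r \<omega> y \<le> level adj r \<omega> x + int (Suc n)"
    using Suc.IH[OF z(1)] level_neighbour[OF z(2)] by linarith
  moreover have "y = (predecessor adj r \<omega> ^^ Suc n) x"
    if "level adj r \<omega> y = level adj r \<omega> x + int (Suc n)"
  proof -
    have "level adj r \<omega> y = level adj r \<omega> z + 1" "level adj r \<omega> z = level adj r \<omega> x + int n"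
      using that Suc.IH[OF z(1)] level_neighbour[OF z(2)] by linarith+
    then have "y = predecessor adj r \<omega> z" "z = (predecessor adj r \<omega> ^^ n) x"
      using Suc.IH[OF z(1)] predecessor_unique[OF z(2)] by blast+
    then show ?thesis by simp
  qed
  ultimately show ?case by blast
qed simp

lemma below_iff: "below adj r \<omega> y x \<longleftrightarrow> (\<exists>n. (predecessor adj r \<omega> ^^ n) y = x)"
proof
  assume "below adj r \<omega> y x"
  then have "level adj r \<omega> x = level adj r \<omega> y + int (gdist adj y x)"
    unfolding below_def gdist_sym[of x y] by linarith
  then have "x = (predecessor adj r \<omega> ^^ gdist adj y x) y"
    using level_relpow[OF relpow_gdist[of y x]] by blast
  then show "\<exists>n. (predecessor adj r \<omega> ^^ n) y = x" by (intro exI[of _ "gdist adj y x"]) (rule sym)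
next
  assume "\<exists>n. (predecessor adj r \<omega> ^^ n) y = x"
  then obtain n where n: "(predecessor adj r \<omega> ^^ n) y = x" ..
  have "(adj ^^ n) y ((predecessor adj r \<omega> ^^ n) y)" for n
    by (induction n) (auto intro: adj_predecessor)
  then have "gdist adj y x \<le> n" using gdist_le unfolding n[symmetric] by blast
  moreover have "level adj r \<omega> x = level adj r \<omega> y + int n"
    unfolding n[symmetric] by (rule level_funpow)
  moreover have "level adj r \<omega> x \<le> level adj r \<omega> y + int (gdist adj y x)"
    using level_relpow[OF relpow_gdist[of y x]] by blast
  ultimately show "below adj r \<omega> y x"
    unfolding below_def gdist_sym[of x y] by linarith
qed

end

section \<open>The tree as an abstract predecessor map with levels\<close>

lemma le_suminf_ennreal: "(f :: nat \<Rightarrow> ennreal) i \<le> (\<Sum>n. f n)"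
  using sum_le_suminf[of f "{i}"] by simp

text \<open>From here on the graph is forgotten. The level excludes cycles, \<open>common\<close> is
  connectedness, and distances enter only through the depths of two vertices below their
  join.\<close>

locale flow_tree =
  fixes q :: nat and p :: "'v \<Rightarrow> 'v" and lev :: "'v \<Rightarrow> int"
  assumes q_ge_2: "q \<ge> 2"
    and card_children: "card {y. p y = x} = q"
    and lev_p: "lev (p x) = lev x + 1"
    and common: "\<exists>m n. (p ^^ m) x = (p ^^ n) y"
begin

abbreviation anc :: "nat \<Rightarrow> 'v \<Rightarrow> 'v" where "anc n x \<equiv> (p ^^ n) x"

definition w :: "'v \<Rightarrow> real" where "w x = real q powi lev x"

definition M :: "'v measure" where "M = density (count_space UNIV) (\<lambda>x. ennreal (w x))"

lemma q_gt_0: "real q > 0" and q_gt_1: "real q > 1" and q_neq_0 [simp]: "q \<noteq> 0"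
  using q_ge_2 by auto

lemma w_pos [simp]: "w x > 0"
  using q_ge_2 by (simp add: w_def)

lemma w_nonneg [simp]: "w x \<ge> 0" and w_neq_0 [simp]: "w x \<noteq> 0"
  using w_pos[of x] by linarith+

lemma w_p: "w (p x) = real q * w x"
  using q_ge_2 by (simp add: w_def lev_p power_int_add)

lemma lev_anc: "lev (anc n x) = lev x + int n"
  by (induction n) (auto simp: lev_p)

lemma w_anc: "w (anc n x) = real q ^ n * w x"
  by (induction n) (auto simp: w_p)

lemma w_le_anc: "w x \<le> w (anc n x)"
  using q_gt_1 w_pos[of x] by (simp add: w_anc)

lemma anc_Suc: "anc (Suc n) x = anc n (p x)"
  by (simp add: funpow_swap1)

lemma anc_add: "anc (m + n) x = anc m (anc n x)"
  by (simp add: funpow_add)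

lemma finite_children: "finite {y. p y = x}"
  using card_children[of x] q_ge_2 card.infinite[of "{y. p y = x}"] by fastforce

lemma desc_Suc: "{y. anc (Suc n) y = z} = (\<Union>u\<in>{u. anc n u = z}. {y. p y = u})"
  by (auto simp: anc_Suc simp del: funpow.simps)

lemma finite_desc: "finite {y. anc n y = z}"
proof (induction n)
  case (Suc n)
  then show ?case unfolding desc_Suc using finite_children by blast
qed simp

lemma sum_w_children: "(\<Sum>y | p y = x. w y) = w x"
proof -
  have "(\<Sum>y | p y = x. w y) = (\<Sum>y | p y = x. w x / q)"
    by (rule sum.cong) (auto simp: w_p)
  then show ?thesis by (simp add: card_children)
qed

text \<open>The flow property: each child carries the fraction \<open>1 / q\<close> of the weight,
  so no generation gains or loses mass. It takes the place of doubling in all later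
  integrals.\<close>

lemma sum_w_desc: "(\<Sum>y | anc n y = z. w y) = w z"
proof (induction n)
  case (Suc n)
  have "(\<Sum>y | anc (Suc n) y = z. w y) = (\<Sum>u | anc n u = z. \<Sum>y | p y = u. w y)"
    unfolding desc_Suc by (rule sum.UNION_disjoint) (auto simp: finite_desc finite_children)
  then show ?case by (simp add: sum_w_children Suc)
qed simp

lemma countable_UNIV: "countable (UNIV :: 'v set)"
proof (rule countable_subset)
  let ?A = "\<Union>m. \<Union>n. {y. anc n y = anc m undefined}"
  show "UNIV \<subseteq> ?A"
  proof
    fix x :: 'v
    obtain m n where "anc m undefined = anc n x" using common by blast
    then have "x \<in> {y. anc n y = anc m undefined}" by simp
    then show "x \<in> ?A" by blast
  qed
  show "countable ?A"
    by (intro countable_UN countable_finite finite_desc countableI_type)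
qed


subsection \<open>Joins\<close>

text \<open>The join of \<open>x\<close> and \<open>y\<close> lies \<open>jn x y\<close> levels above \<open>x\<close> and \<open>jn y x\<close> levels above \<open>y\<close>.\<close>

definition jn :: "'v \<Rightarrow> 'v \<Rightarrow> nat" where
  "jn x y = (LEAST n. \<exists>m. anc n x = anc m y)"

definition dd :: "'v \<Rightarrow> 'v \<Rightarrow> nat" where
  "dd x y = jn x y + jn y x"

definition apx :: "'v \<Rightarrow> 'v \<Rightarrow> 'v" where
  "apx x y = anc (jn x y) x"

lemma anc_eq_lev: "anc n x = anc m y \<Longrightarrow> int n - int m = lev y - lev x"
  using lev_anc[of n x] lev_anc[of m y] by simp

lemma jn_le: "anc n x = anc m y \<Longrightarrow> jn x y \<le> n"
  unfolding jn_def by (rule Least_le) blast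

lemma anc_jn: "anc (jn x y) x = anc (jn y x) y"
proof -
  have "\<exists>m. anc (jn x y) x = anc m y"
    unfolding jn_def by (rule LeastI_ex) (rule common)
  then obtain m where m: "anc (jn x y) x = anc m y" ..
  have "\<exists>m. anc (jn y x) y = anc m x"
    unfolding jn_def by (rule LeastI_ex) (rule common)
  then obtain n where n: "anc (jn y x) y = anc n x" ..
  have "jn y x \<le> m" "jn x y \<le> n" using jn_le m n by metis+
  moreover have "int (jn x y) - int m = int n - int (jn y x)"
    using anc_eq_lev[OF m] anc_eq_lev[OF n] by linarith
  ultimately have "m = jn y x" by linarith
  then show ?thesis using m by simp
qed

text \<open>The levels fix the difference of the two exponents, so the meeting pairs form a single
  half-line that starts at the join.\<close>

lemma anc_eq_iff: "anc n x = anc m y \<longleftrightarrow> (\<exists>j. n = j + jn x y \<and> m = j + jn y x)"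
proof
  assume eq: "anc n x = anc m y"
  have "jn x y \<le> n" "jn y x \<le> m" using jn_le eq by metis+
  moreover have "int n - int m = int (jn x y) - int (jn y x)"
    using anc_eq_lev[OF eq] anc_eq_lev[OF anc_jn[of x y]] by linarith
  ultimately show "\<exists>j. n = j + jn x y \<and> m = j + jn y x"
    by (intro exI[of _ "n - jn x y"]) linarith
next
  assume "\<exists>j. n = j + jn x y \<and> m = j + jn y x"
  then show "anc n x = anc m y" using anc_jn[of x y] by (auto simp: anc_add)
qed

lemma jnI:
  assumes "anc n x = anc m y" "n = 0 \<or> m = 0 \<or> anc (n - 1) x \<noteq> anc (m - 1) y"
  shows "jn x y = n" "jn y x = m"
proof -
  obtain j where j: "n = j + jn x y" "m = j + jn y x"
    using assms(1) anc_eq_iff by blast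
  have "j = 0"
  proof (rule ccontr)
    assume "j \<noteq> 0"
    then have "n - 1 = (j - 1) + jn x y" "m - 1 = (j - 1) + jn y x" "n \<noteq> 0" "m \<noteq> 0"
      using j by auto
    then show False using assms(2) anc_eq_iff by blast
  qed
  then show "jn x y = n" "jn y x = m" using j by auto
qed

lemma apx_sym: "apx x y = apx y x"
  using anc_jn[of x y] by (simp add: apx_def)

lemma dd_sym: "dd x y = dd y x"
  by (simp add: dd_def)

lemma dd_eq_0: "dd x y = 0 \<longleftrightarrow> x = y"
proof
  assume "dd x y = 0"
  then show "x = y" using anc_jn[of x y] by (simp add: dd_def)
next
  assume "x = y"
  then show "dd x y = 0" using jnI[of 0 x 0 y] by (simp add: dd_def)
qed

lemma jn_predecessor:
  "jn (p x) y = jn x y - 1" "jn y (p x) = (if jn x y = 0 then Suc (jn y x) else jn y x)"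
proof -
  have "jn (p x) y = jn x y - 1 \<and> jn y (p x) = (if jn x y = 0 then Suc (jn y x) else jn y x)"
  proof (cases "jn x y")
    case 0
    then have "anc 0 (p x) = anc (Suc (jn y x)) y"
      using anc_jn[of x y] by simp
    then show ?thesis using jnI[of 0 "p x" "Suc (jn y x)" y] 0 by simp
  next
    case (Suc n)
    have eq: "anc n (p x) = anc (jn y x) y"
      using anc_jn[of x y] unfolding Suc by (simp add: anc_Suc del: funpow.simps)
    have "n = 0 \<or> jn y x = 0 \<or> anc (n - 1) (p x) \<noteq> anc (jn y x - 1) y"
    proof (cases "n = 0")
      case False
      then have "anc (n - 1) (p x) = anc n x" by (simp flip: anc_Suc del: funpow.simps)
      then show ?thesis using anc_eq_iff[of n x "jn y x - 1" y] Suc by auto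
    qed simp
    then show ?thesis using jnI[OF eq] Suc by simp
  qed
  then show "jn (p x) y = jn x y - 1" "jn y (p x) = (if jn x y = 0 then Suc (jn y x) else jn y x)"
    by auto
qed

lemma jn_child:
  assumes "p c = x" "jn x y \<noteq> 0"
  shows "jn c y = Suc (jn x y)" "jn y c = jn y x"
  using jn_predecessor[where x = c and y = y] assms by (auto split: if_splits)

lemma jn_child_below:
  assumes "p c = x" "jn x y = 0"
  shows "jn y x \<noteq> 0 \<Longrightarrow> c = anc (jn y x - 1) y \<Longrightarrow> jn c y = 0 \<and> jn y c = jn y x - 1"
    "jn y x = 0 \<or> c \<noteq> anc (jn y x - 1) y \<Longrightarrow> jn c y = 1 \<and> jn y c = jn y x"
proof -
  show "jn c y = 0 \<and> jn y c = jn y x - 1" if "jn y x \<noteq> 0" "c = anc (jn y x - 1) y"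
    using jnI[of 0 c "jn y x - 1" y] that by simp
  assume *: "jn y x = 0 \<or> c \<noteq> anc (jn y x - 1) y"
  have "anc 1 c = anc (jn y x) y" using anc_jn[of x y] assms by simp
  then show "jn c y = 1 \<and> jn y c = jn y x" using jnI[of 1 c "jn y x" y] * by auto
qed

lemma apx_predecessor: "apx (p x) y = (if jn x y = 0 then p x else apx x y)"
  by (cases "jn x y") (simp_all add: apx_def jn_predecessor anc_Suc del: funpow.simps(2))

lemma w_le_apx: "w x \<le> w (apx x y)" "w y \<le> w (apx x y)"
  using w_le_anc[of x "jn x y"] w_le_anc[of y "jn y x"] anc_jn[of x y] by (auto simp: apx_def)


subsection \<open>Radial kernels\<close>

definition ker :: "(nat \<Rightarrow> real) \<Rightarrow> 'v \<Rightarrow> 'v \<Rightarrow> real" where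
  "ker F x y = F (dd x y) / w (apx x y)"

lemma ker_sym: "ker F x y = ker F y x"
  by (simp add: ker_def dd_sym[of x y] apx_sym[of x y])

text \<open>Half the sum of composition with \<open>p\<close> and its adjoint on L2. It is
  polymorphic because it is applied to real kernels as well as to complex functions.\<close>

definition J :: "('v \<Rightarrow> 'b::real_vector) \<Rightarrow> 'v \<Rightarrow> 'b" where
  "J u x = (1 / 2) *\<^sub>R u (p x) + (1 / (2 * real q)) *\<^sub>R (\<Sum>c | p c = x. u c)"

text \<open>The row \<open>d = 0\<close> belongs to \<open>x = y\<close>: all neighbours are at
  distance one, but for the step up the join is the parent, of weight \<open>q\<close> times as
  large, which accounts for the summand \<open>1 / q\<close>.\<close>

definition jac :: "(nat \<Rightarrow> real) \<Rightarrow> nat \<Rightarrow> real" where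
  "jac F d = (if d = 0 then (1 + 1 / q) / 2 * F 1 else (F (d + 1) + F (d - 1)) / 2)"

text \<open>If \<open>y\<close> is not below \<open>x\<close>, the parent is nearer and all children
  are farther, with the same join. If \<open>y\<close> lies strictly below \<open>x\<close>, the
  parent has a heavier join (factor \<open>1 / q\<close>), the child towards \<open>y\<close> a
  lighter one (factor \<open>q\<close>), and the other \<open>q - 1\<close> children keep
  \<open>x\<close>; the coefficients of \<open>F (d + 1)\<close> agree in both cases because
  \<open>1 / q + (q - 1) / q = 1\<close>.\<close>

lemma J_ker: "J (\<lambda>x. ker F x y) x = ker (jac F) x y"
proof (cases "jn x y = 0")
  case False
  have "ker F (p x) y = F (dd x y - 1) / w (apx x y)"
    using False by (simp add: ker_def dd_def jn_predecessor apx_predecessor)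
  moreover have "ker F c y = F (dd x y + 1) / w (apx x y)" if "p c = x" for c
    using that False jn_child[OF that False] apx_predecessor[of c y] by (auto simp: ker_def dd_def)
  then have "(\<Sum>c | p c = x. ker F c y) = (\<Sum>c | p c = x. F (dd x y + 1) / w (apx x y))"
    by (intro sum.cong) auto
  then have "(\<Sum>c | p c = x. ker F c y) = q * (F (dd x y + 1) / w (apx x y))"
    by (simp add: card_children)
  moreover have "dd x y \<noteq> 0" using False by (simp add: dd_def)
  ultimately show ?thesis
    by (simp add: J_def ker_def[of "jac F"] jac_def field_simps)
next
  case True
  let ?m = "jn y x"
  have apx: "apx x y = x" using True by (simp add: apx_def)
  have dd: "dd x y = ?m" using True by (simp add: dd_def)
  have parent: "ker F (p x) y = F (?m + 1) / (q * w x)"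
    using True by (simp add: ker_def dd_def jn_predecessor apx_predecessor w_p)
  have far: "ker F c y = F (?m + 1) / w x" if "p c = x" "?m = 0 \<or> c \<noteq> anc (?m - 1) y" for c
  proof -
    have c: "jn c y = 1" "jn y c = ?m" using jn_child_below(2)[OF that(1) True that(2)] by auto
    have "apx c y = x" using c that(1) by (simp add: apx_def)
    then show ?thesis using c by (simp add: ker_def dd_def)
  qed
  show ?thesis
  proof (cases "?m = 0")
    case m: True
    have "(\<Sum>c | p c = x. ker F c y) = (\<Sum>c | p c = x. F (?m + 1) / w x)"
      using far m by (intro sum.cong) auto
    then show ?thesis using parent apx dd m
      by (simp add: J_def ker_def[of "jac F"] jac_def card_children field_simps)
  next
    case m: False
    let ?c = "anc (?m - 1) y"
    obtain k where k: "?m = Suc k" using m by (cases ?m) auto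
    have "anc (jn y x) y = x" using anc_jn[of x y] unfolding True by simp
    then have "p (anc k y) = x" unfolding k by simp
    then have pc: "p ?c = x" unfolding k by simp
    have "jn ?c y = 0" "jn y ?c = ?m - 1"
      using jn_child_below(1)[OF pc True m refl] by auto
    then have near: "ker F ?c y = F (?m - 1) * q / w x"
      using w_p[of ?c] pc by (simp add: ker_def dd_def apx_def field_simps)
    have "(\<Sum>c | p c = x. ker F c y) = ker F ?c y + (\<Sum>c\<in>{c. p c = x} - {?c}. ker F c y)"
      using pc by (intro sum.remove) (simp_all add: finite_children)
    also have "(\<Sum>c\<in>{c. p c = x} - {?c}. ker F c y) = (\<Sum>c\<in>{c. p c = x} - {?c}. F (?m + 1) / w x)"
      using far by (intro sum.cong) auto
    also have "\<dots> = (real q - 1) * (F (?m + 1) / w x)"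
      using pc q_ge_2 by (simp add: card_Diff_singleton card_children finite_children of_nat_diff)
    finally show ?thesis using parent near m apx dd
      by (simp add: J_def ker_def[of "jac F"] jac_def field_simps)
  qed
qed


subsection \<open>Integration with respect to the flow measure\<close>

lemma sets_M [simp]: "sets M = UNIV" and space_M [simp]: "space M = UNIV"
  by (auto simp: M_def)

lemma measurable_M [simp, measurable]: "f \<in> borel_measurable M"
  by (simp add: measurable_def)

lemma AE_M [simp]: "(AE x in M. P x) \<longleftrightarrow> (\<forall>x. P x)"
  unfolding M_def by (subst AE_density) (simp_all add: AE_count_space)

lemma emeasure_M_singleton: "emeasure M {x} = ennreal (w x)"
  by (simp add: M_def emeasure_density nn_integral_count_space'[where A = "{x}"])

lemma emeasure_M_finite: "finite S \<Longrightarrow> emeasure M S = ennreal (\<Sum>x\<in>S. w x)"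
  by (subst emeasure_eq_sum_singleton) (auto simp: emeasure_M_singleton sum_ennreal)

lemma measure_M_finite: "finite S \<Longrightarrow> measure M S = (\<Sum>x\<in>S. w x)"
  by (simp add: measure_def emeasure_M_finite sum_nonneg)

lemma emeasure_desc: "emeasure M {y. anc n y = z} = ennreal (w z)"
  by (simp add: emeasure_M_finite finite_desc sum_w_desc)

lemma has_bochner_integral_finite_support:
  fixes f :: "'v \<Rightarrow> 'b::{banach, second_countable_topology}"
  assumes "finite S" "\<And>x. x \<notin> S \<Longrightarrow> f x = 0"
  shows "has_bochner_integral M f (\<Sum>x\<in>S. w x *\<^sub>R f x)"
proof -
  have "has_bochner_integral M (\<lambda>x. \<Sum>a\<in>S. indicator {a} x *\<^sub>R f a) (\<Sum>x\<in>S. w x *\<^sub>R f x)"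
  proof (rule has_bochner_integral_sum)
    fix a
    have "has_bochner_integral M (indicator {a} :: 'v \<Rightarrow> real) (measure M {a})"
      by (rule has_bochner_integral_real_indicator) (auto simp: emeasure_M_singleton)
    then show "has_bochner_integral M (\<lambda>x. indicator {a} x *\<^sub>R f a) (w a *\<^sub>R f a)"
      by (intro has_bochner_integral_scaleR_left) (simp add: measure_M_finite)
  qed
  moreover have "(\<Sum>a\<in>S. indicator {a} x *\<^sub>R f a) = f x" for x
  proof (cases "x \<in> S")
    case True
    have "(\<Sum>a\<in>S. indicator {a} x *\<^sub>R f a) = (\<Sum>a\<in>S. if a = x then f x else 0)"
      by (intro sum.cong) (auto simp: indicator_def)
    then show ?thesis using True assms(1) by simp
  next
    case False
    then have "(\<Sum>a\<in>S. indicator {a} x *\<^sub>R f a) = (\<Sum>a\<in>S. 0)"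
      by (intro sum.cong) (auto simp: indicator_def)
    then show ?thesis using assms(2)[OF False] by simp
  qed
  ultimately show ?thesis by simp
qed

lemmas integral_finite_support = has_bochner_integral_finite_support[THEN has_bochner_integral_integral_eq]

lemma integrable_finite_support:
  fixes f :: "'v \<Rightarrow> 'b::{banach, second_countable_topology}"
  shows "finite S \<Longrightarrow> (\<And>x. x \<notin> S \<Longrightarrow> f x = 0) \<Longrightarrow> integrable M f"
  using has_bochner_integral_finite_support[of S f] by (auto simp: has_bochner_integral_iff)

text \<open>The \<open>y\<close> with \<open>jn x y = n\<close> and \<open>jn y x = m\<close> lie in
  generation \<open>m\<close> below \<open>anc n x\<close>, whose total weight cancels the
  denominator. Integrals of kernels thereby become double series over the two depths.\<close>

lemma nn_integral_join_le:
  assumes "\<And>n m. B n m \<ge> 0" "\<And>y. g y \<le> ennreal (B (jn x y) (jn y x) / w (apx x y))"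
  shows "(\<integral>\<^sup>+y. g y \<partial>M) \<le> (\<Sum>n. \<Sum>m. ennreal (B n m))"
proof -
  let ?h = "\<lambda>n m y. ennreal (B n m / w (anc n x)) * indicator {y. anc m y = anc n x} y"
  have "(\<integral>\<^sup>+y. g y \<partial>M) \<le> (\<integral>\<^sup>+y. (\<Sum>n. \<Sum>m. ?h n m y) \<partial>M)"
  proof (rule nn_integral_mono)
    fix y
    have "g y \<le> ?h (jn x y) (jn y x) y"
      using assms(2)[of y] anc_jn[of x y] by (simp add: apx_def)
    also have "\<dots> \<le> (\<Sum>m. ?h (jn x y) m y)"
      by (rule le_suminf_ennreal[of "\<lambda>m. ?h (jn x y) m y"])
    also have "\<dots> \<le> (\<Sum>n. \<Sum>m. ?h n m y)"
      by (rule le_suminf_ennreal[of "\<lambda>n. \<Sum>m. ?h n m y"])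
    finally show "g y \<le> (\<Sum>n. \<Sum>m. ?h n m y)" .
  qed
  also have "\<dots> = (\<Sum>n. \<Sum>m. \<integral>\<^sup>+y. ?h n m y \<partial>M)"
    by (simp add: nn_integral_suminf)
  also have "\<dots> = (\<Sum>n. \<Sum>m. ennreal (B n m))"
    by (simp add: nn_integral_cmult_indicator emeasure_desc assms(1) flip: ennreal_mult')
  finally show ?thesis .
qed

end

section \<open>Square integrable functions\<close>

text \<open>Cauchy-Schwarz in the form in which it is obtained below: a bound with a free parameter
  \<open>t\<close>, optimized afterwards. It avoids dividing by norms that may vanish.\<close>

lemma le_sqrt_mult_sqrt:
  fixes a b c :: real
  assumes "a \<ge> 0" "b \<ge> 0" "\<And>t. t > 0 \<Longrightarrow> c \<le> (t * a + b / t) / 2"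
  shows "c \<le> sqrt a * sqrt b"
proof -
  consider "c \<le> 0" | "c > 0" "a = 0" | "c > 0" "b = 0" | "a > 0" "b > 0"
    using assms(1,2) by linarith
  then show ?thesis
  proof cases
    case 1
    then show ?thesis using assms(1,2) by (simp add: order_trans[OF 1])
  next
    case 2
    \<comment> \<open>With \<open>a = 0\<close> the parameter is taken so large that
      \<open>b / t \<le> c\<close>; the hypothesis then gives \<open>c \<le> c / 2\<close>. The next
      case is symmetric, with a small parameter.\<close>
    define X where "X = b / ((b + 1) / c)"
    have "c \<le> X / 2" using assms(3)[of "(b + 1) / c"] 2 assms(2) by (simp add: X_def)
    moreover have "X \<le> c" using 2 assms(2) by (simp add: X_def field_simps)
    ultimately have False using 2(1) by linarith
    then show ?thesis ..
  next
    case 3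
    define X where "X = c / (a + 1) * a"
    have "c \<le> X / 2" using assms(3)[of "c / (a + 1)"] 3 assms(1) by (simp add: X_def)
    moreover have "X \<le> c" using 3 assms(1) by (simp add: X_def field_simps)
    ultimately have False using 3(1) by linarith
    then show ?thesis ..
  next
    case 4
    have *: "sqrt a * sqrt a = a" "sqrt b * sqrt b = b" using 4 by simp_all
    have "sqrt b / sqrt a * a = sqrt a * sqrt b" "b / (sqrt b / sqrt a) = sqrt a * sqrt b"
      using 4 * by (simp_all add: field_simps)
    then show ?thesis using assms(3)[of "sqrt b / sqrt a"] 4 by simp
  qed
qed

context flow_tree
begin

definition nrm2 :: "('v \<Rightarrow> complex) \<Rightarrow> real" where
  "nrm2 f = (\<integral>x. (cmod (f x))\<^sup>2 \<partial>M)"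

definition nrm :: "('v \<Rightarrow> complex) \<Rightarrow> real" where
  "nrm f = sqrt (nrm2 f)"

abbreviation ip :: "('v \<Rightarrow> complex) \<Rightarrow> ('v \<Rightarrow> complex) \<Rightarrow> complex" where
  "ip \<equiv> L2_inner M"

lemma in_L2_iff: "f \<in> Lp M 2 \<longleftrightarrow> integrable M (\<lambda>x. (cmod (f x))\<^sup>2)"
  by (simp add: Lp_def)

lemma nrm2_nonneg [simp]: "nrm2 f \<ge> 0"
  by (simp add: nrm2_def)

lemma nrm_nonneg [simp]: "nrm f \<ge> 0"
  by (simp add: nrm_def)

lemma nrm_sq: "(nrm f)\<^sup>2 = nrm2 f"
  by (simp add: nrm_def)

lemma cmod_add_sq_le: "(cmod (a + b))\<^sup>2 \<le> 2 * (cmod a)\<^sup>2 + 2 * (cmod b)\<^sup>2"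
proof -
  have "(cmod (a + b))\<^sup>2 \<le> (cmod a + cmod b)\<^sup>2"
    by (intro power_mono norm_triangle_ineq) simp
  moreover have "0 \<le> (cmod a - cmod b)\<^sup>2" by simp
  ultimately show ?thesis by (simp add: power2_eq_square algebra_simps)
qed

lemma L2_add: "f \<in> Lp M 2 \<Longrightarrow> g \<in> Lp M 2 \<Longrightarrow> (\<lambda>x. f x + g x) \<in> Lp M 2"
  unfolding in_L2_iff
  by (rule Bochner_Integration.integrable_bound[where f = "\<lambda>x. 2 * (cmod (f x))\<^sup>2 + 2 * (cmod (g x))\<^sup>2"])
    (use cmod_add_sq_le in auto)

lemma L2_scale: "f \<in> Lp M 2 \<Longrightarrow> (\<lambda>x. c * f x) \<in> Lp M 2"
  unfolding in_L2_iff by (simp add: norm_mult power_mult_distrib)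

lemma L2_zero [simp]: "(\<lambda>x. 0) \<in> Lp M 2"
  by (simp add: in_L2_iff)

lemma L2_diff: "f \<in> Lp M 2 \<Longrightarrow> g \<in> Lp M 2 \<Longrightarrow> (\<lambda>x. f x - g x) \<in> Lp M 2"
  using L2_add[OF _ L2_scale[of g "-1"], of f] by simp

lemma L2_sum: "(\<And>i. i \<in> I \<Longrightarrow> f i \<in> Lp M 2) \<Longrightarrow> (\<lambda>x. \<Sum>i\<in>I. f i x) \<in> Lp M 2"
  by (induction I rule: infinite_finite_induct) (auto intro: L2_add)

lemma L2_integrable_norm_mult:
  "f \<in> Lp M 2 \<Longrightarrow> g \<in> Lp M 2 \<Longrightarrow> integrable M (\<lambda>x. cmod (f x) * cmod (g x))"
  unfolding in_L2_iff
proof (rule Bochner_Integration.integrable_bound[where f = "\<lambda>x. (cmod (f x))\<^sup>2 + (cmod (g x))\<^sup>2"])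
  have "a * b \<le> a\<^sup>2 + b\<^sup>2" for a b :: real
    using sum_squares_bound[of a b] zero_le_power2[of a] zero_le_power2[of b] by linarith
  then show "AE x in M. norm (cmod (f x) * cmod (g x)) \<le> norm ((cmod (f x))\<^sup>2 + (cmod (g x))\<^sup>2)"
    by (auto simp: abs_mult)
qed auto

lemma L2_integrable_mult: "f \<in> Lp M 2 \<Longrightarrow> g \<in> Lp M 2 \<Longrightarrow> integrable M (\<lambda>x. f x * cnj (g x))"
  using L2_integrable_norm_mult[of f g]
  by (rule Bochner_Integration.integrable_bound) (auto simp: norm_mult)

lemma ip_add_left: "f \<in> Lp M 2 \<Longrightarrow> g \<in> Lp M 2 \<Longrightarrow> h \<in> Lp M 2 \<Longrightarrow>
    ip (\<lambda>x. f x + g x) h = ip f h + ip g h"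
  using L2_integrable_mult[of f h] L2_integrable_mult[of g h] by (simp add: L2_inner_def distrib_right)

lemma ip_scale_left: "ip (\<lambda>x. c * f x) h = c * ip f h"
  by (simp add: L2_inner_def mult.assoc)

lemma ip_cnj: "ip g f = cnj (ip f g)"
proof -
  have "cnj (ip f g) = (\<integral>x. cnj (f x * cnj (g x)) \<partial>M)" unfolding L2_inner_def
    by (rule Bochner_Integration.integral_cnj[symmetric])
  then show ?thesis unfolding L2_inner_def by (simp add: mult.commute)
qed

lemma ip_swap: "ip a b = ip c d \<Longrightarrow> ip b a = ip d c"
  by (simp only: ip_cnj[of b a] ip_cnj[of d c])

lemma ip_add_right: "f \<in> Lp M 2 \<Longrightarrow> g \<in> Lp M 2 \<Longrightarrow> h \<in> Lp M 2 \<Longrightarrow>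
    ip h (\<lambda>x. f x + g x) = ip h f + ip h g"
  by (subst (1 2 3) ip_cnj) (simp add: ip_add_left)

lemma ip_scale_right: "ip h (\<lambda>x. c * f x) = cnj c * ip h f"
  by (subst (1 2) ip_cnj) (simp add: ip_scale_left)

lemma ip_diff_left: "f \<in> Lp M 2 \<Longrightarrow> g \<in> Lp M 2 \<Longrightarrow> h \<in> Lp M 2 \<Longrightarrow>
    ip (\<lambda>x. f x - g x) h = ip f h - ip g h"
  using ip_add_left[of f "\<lambda>x. (-1) * g x" h] L2_scale[of g "-1"] ip_scale_left[of "-1" g h] by simp

lemma ip_diff_right: "f \<in> Lp M 2 \<Longrightarrow> g \<in> Lp M 2 \<Longrightarrow> h \<in> Lp M 2 \<Longrightarrow>
    ip h (\<lambda>x. f x - g x) = ip h f - ip h g"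
  by (subst (1 2 3) ip_cnj) (simp add: ip_diff_left)

lemma ip_self: "ip f f = complex_of_real (nrm2 f)"
  by (simp add: L2_inner_def nrm2_def complex_norm_square flip: of_real_power integral_complex_of_real)

lemma ip_cauchy_schwarz:
  assumes "f \<in> Lp M 2" "g \<in> Lp M 2"
  shows "cmod (ip f g) \<le> nrm f * nrm g"
  unfolding nrm_def
proof (rule le_sqrt_mult_sqrt)
  fix t :: real assume t: "t > 0"
  have pt: "a * b \<le> (t * a\<^sup>2 + b\<^sup>2 / t) / 2" for a b :: real
  proof -
    have "0 \<le> (t * a - b)\<^sup>2 / t" using t by simp
    then show ?thesis using t by (simp add: power2_eq_square field_simps)
  qed
  have "cmod (ip f g) \<le> (\<integral>x. cmod (f x) * cmod (g x) \<partial>M)"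
    unfolding L2_inner_def by (rule order_trans[OF integral_norm_bound]) (simp add: norm_mult)
  also have "\<dots> \<le> (\<integral>x. (t * (cmod (f x))\<^sup>2 + (cmod (g x))\<^sup>2 / t) / 2 \<partial>M)"
    by (rule integral_mono[OF L2_integrable_norm_mult[OF assms]])
      (use assms pt in \<open>auto simp: in_L2_iff\<close>)
  also have "\<dots> = (t * nrm2 f + nrm2 g / t) / 2"
    using assms by (simp add: in_L2_iff nrm2_def)
  finally show "cmod (ip f g) \<le> (t * nrm2 f + nrm2 g / t) / 2" .
qed simp_all

lemma nrm_scale: "nrm (\<lambda>x. c * f x) = cmod c * nrm f"
  by (simp add: nrm_def nrm2_def norm_mult power_mult_distrib real_sqrt_mult)

lemma nrm_minus_commute: "nrm (\<lambda>x. f x - g x) = nrm (\<lambda>x. g x - f x)"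
  by (simp add: nrm_def nrm2_def norm_minus_commute)

lemma nrm_triangle:
  assumes "f \<in> Lp M 2" "g \<in> Lp M 2"
  shows "nrm (\<lambda>x. f x + g x) \<le> nrm f + nrm g"
proof (rule power2_le_imp_le)
  let ?h = "\<lambda>x. f x + g x"
  have "complex_of_real ((nrm ?h)\<^sup>2) = ip f f + ip f g + (ip g f + ip g g)"
    using assms L2_add[OF assms]
    by (simp add: nrm_sq ip_self[symmetric] ip_add_left ip_add_right)
  then have "(nrm ?h)\<^sup>2 = Re (ip f f + ip f g + (ip g f + ip g g))"
    by (metis Re_complex_of_real)
  also have "\<dots> \<le> (nrm f)\<^sup>2 + 2 * (nrm f * nrm g) + (nrm g)\<^sup>2"
    using ip_cauchy_schwarz[OF assms] ip_cauchy_schwarz[OF assms(2,1)]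
      complex_Re_le_cmod[of "ip f g"] complex_Re_le_cmod[of "ip g f"]
    by (simp add: ip_self nrm_sq mult.commute)
  finally show "(nrm ?h)\<^sup>2 \<le> (nrm f + nrm g)\<^sup>2" by (simp add: power2_sum)
qed simp

subsection \<open>Finitely supported functions\<close>

definition fs :: "('v \<Rightarrow> complex) \<Rightarrow> bool" where
  "fs f \<longleftrightarrow> finite {x. f x \<noteq> 0}"

lemma fsI: "finite S \<Longrightarrow> (\<And>x. x \<notin> S \<Longrightarrow> f x = 0) \<Longrightarrow> fs f"
  unfolding fs_def by (rule finite_subset[of _ S]) auto

lemma fs_add: "fs f \<Longrightarrow> fs g \<Longrightarrow> fs (\<lambda>x. f x + g x)"
  by (rule fsI[of "{x. f x \<noteq> 0} \<union> {x. g x \<noteq> 0}"]) (auto simp: fs_def)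

lemma fs_scale: "fs f \<Longrightarrow> fs (\<lambda>x. c * f x)"
  by (rule fsI[of "{x. f x \<noteq> 0}"]) (auto simp: fs_def)

lemma fs_zero [simp]: "fs (\<lambda>x. 0)"
  by (simp add: fs_def)

lemma fs_diff: "fs f \<Longrightarrow> fs g \<Longrightarrow> fs (\<lambda>x. f x - g x)"
  using fs_add[OF _ fs_scale[of g "-1"], of f] by simp

lemma fs_sum: "(\<And>i. i \<in> I \<Longrightarrow> fs (f i)) \<Longrightarrow> fs (\<lambda>x. \<Sum>i\<in>I. f i x)"
  by (induction I rule: infinite_finite_induct) (auto intro: fs_add)

lemma fs_integrable: "fs f \<Longrightarrow> integrable M (\<lambda>x. f x * g x)"
  by (rule integrable_finite_support[of "{x. f x \<noteq> 0}"]) (auto simp: fs_def)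

lemma fs_L2: "fs f \<Longrightarrow> f \<in> Lp M 2"
  unfolding in_L2_iff by (rule integrable_finite_support[of "{x. f x \<noteq> 0}"]) (auto simp: fs_def)

definition \<delta> :: "'v \<Rightarrow> 'v \<Rightarrow> complex" where
  "\<delta> y x = (if x = y then 1 else 0)"

lemma fs_\<delta> [simp]: "fs (\<delta> y)"
  by (rule fsI[of "{y}"]) (auto simp: \<delta>_def)

lemma ip_\<delta>: "ip (\<delta> y) f = complex_of_real (w y) * cnj (f y)" "ip f (\<delta> y) = complex_of_real (w y) * f y"
  unfolding L2_inner_def
  by (subst integral_finite_support[of "{y}"]; simp add: \<delta>_def scaleR_conv_of_real)+

text \<open>An increasing sequence of finite sets that exhausts the countable tree; restricting to
  it (\<open>trunc\<close>) supplies the finitely supported approximants in the density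
  arguments.\<close>

definition exh :: "nat \<Rightarrow> 'v set" where
  "exh n = from_nat_into UNIV ` {..n}"

lemma finite_exh [simp]: "finite (exh n)"
  by (simp add: exh_def)

lemma mono_exh: "m \<le> n \<Longrightarrow> exh m \<subseteq> exh n"
  by (auto simp: exh_def)

lemma exh_eventually: "\<forall>\<^sub>F n in sequentially. x \<in> exh n"
proof -
  obtain n where "x = from_nat_into UNIV n"
    using from_nat_into_surj[OF countable_UNIV, of x] by auto
  then have "x \<in> exh m" if "m \<ge> n" for m using that by (auto simp: exh_def)
  then show ?thesis by (auto simp: eventually_sequentially)
qed

definition trunc :: "nat \<Rightarrow> ('v \<Rightarrow> 'b::zero) \<Rightarrow> 'v \<Rightarrow> 'b" where
  "trunc n f x = (if x \<in> exh n then f x else 0)"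

lemma trunc_eventually: "\<forall>\<^sub>F n in sequentially. trunc n f x = f x"
  by (rule eventually_mono[OF exh_eventually[of x]]) (simp add: trunc_def)

lemma fs_trunc [simp]: "fs (trunc n f)"
  by (rule fsI[of "exh n"]) (auto simp: trunc_def)

lemma nrm_trunc_tendsto:
  assumes "f \<in> Lp M 2"
  shows "(\<lambda>n. nrm (\<lambda>x. f x - trunc n f x)) \<longlonglongrightarrow> 0"
proof -
  have "(\<lambda>n. nrm2 (\<lambda>x. f x - trunc n f x)) \<longlonglongrightarrow> (\<integral>x. 0 \<partial>M)"
    unfolding nrm2_def
  proof (rule integral_dominated_convergence[where w = "\<lambda>x. (cmod (f x))\<^sup>2"])
    show "AE x in M. (\<lambda>n. (cmod (f x - trunc n f x))\<^sup>2) \<longlonglongrightarrow> 0"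
    proof (unfold AE_M, intro allI tendsto_eventually)
      fix x
      show "\<forall>\<^sub>F n in sequentially. (cmod (f x - trunc n f x))\<^sup>2 = 0"
        using trunc_eventually[of f x] by (rule eventually_mono) simp
    qed
  qed (use assms in \<open>auto simp: in_L2_iff trunc_def\<close>)
  then show ?thesis unfolding nrm_def using tendsto_real_sqrt by fastforce
qed

lemma L2_approx:
  assumes "f \<in> Lp M 2" "e > 0"
  obtains h where "fs h" "nrm (\<lambda>x. f x - h x) < e"
proof -
  have "\<forall>\<^sub>F n in sequentially. nrm (\<lambda>x. f x - trunc n f x) < e"
    using nrm_trunc_tendsto[OF assms(1)] assms(2) by (simp add: order_tendsto_iff)
  then obtain N where "nrm (\<lambda>x. f x - trunc N f x) < e"
    by (auto simp: eventually_sequentially)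
  then show ?thesis by (rule that[OF fs_trunc])
qed

text \<open>Testing with the restriction of \<open>u\<close> to a finite set bounds the sum of
  \<open>w x * (cmod (u x))\<^sup>2\<close> over this set by \<open>C\<^sup>2\<close>, and monotone
  convergence does the rest. No integrability of \<open>u\<close> is assumed, so this is how
  functions given by a formula are shown to be in L2.\<close>

lemma L2_dual:
  assumes "C \<ge> 0" "\<And>h. fs h \<Longrightarrow> cmod (ip u h) \<le> C * nrm h"
  shows "u \<in> Lp M 2" "nrm u \<le> C"
proof -
  have fin: "(\<Sum>x\<in>S. w x * (cmod (u x))\<^sup>2) \<le> C\<^sup>2" if S: "finite S" for S
  proof -
    let ?h = "\<lambda>x. if x \<in> S then u x else 0"
    let ?s = "\<Sum>x\<in>S. w x * (cmod (u x))\<^sup>2"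
    have s0: "?s \<ge> 0" by (intro sum_nonneg) simp
    have h: "fs ?h" by (rule fsI[OF S]) auto
    have "nrm2 ?h = ?s"
      unfolding nrm2_def by (subst integral_finite_support[OF S]) auto
    moreover have "ip u ?h = complex_of_real ?s"
      unfolding L2_inner_def
      by (subst integral_finite_support[OF S])
        (auto simp: scaleR_conv_of_real complex_norm_square simp flip: of_real_power)
    ultimately have "?s \<le> C * sqrt ?s"
      using assms(2)[OF h] s0 by (simp add: nrm_def del: of_real_sum)
    then have "sqrt ?s * sqrt ?s \<le> C * sqrt ?s" using s0 by simp
    have "sqrt ?s \<le> C"
    proof (cases "?s = 0")
      case False
      then have "sqrt ?s > 0" using s0 by simp
      then show ?thesis using \<open>sqrt ?s * sqrt ?s \<le> C * sqrt ?s\<close> by (rule mult_right_le_imp_le[rotated])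
    qed (use assms(1) in simp)
    then have "(sqrt ?s)\<^sup>2 \<le> C\<^sup>2" using s0 by (intro power_mono) auto
    then show ?thesis using s0 by simp
  qed
  have "(\<integral>\<^sup>+x. ennreal ((cmod (u x))\<^sup>2) \<partial>M) = (\<integral>\<^sup>+x. (SUP n. ennreal ((cmod (trunc n u x))\<^sup>2)) \<partial>M)"
  proof (rule nn_integral_cong)
    fix x
    have "(\<lambda>n. ennreal ((cmod (trunc n u x))\<^sup>2)) \<longlonglongrightarrow> ennreal ((cmod (u x))\<^sup>2)"
      by (rule tendsto_eventually) (rule eventually_mono[OF trunc_eventually[of u x]], simp)
    moreover have "incseq (\<lambda>n. ennreal ((cmod (trunc n u x))\<^sup>2))"
      using mono_exh by (auto simp: incseq_def trunc_def)
    ultimately show "ennreal ((cmod (u x))\<^sup>2) = (SUP n. ennreal ((cmod (trunc n u x))\<^sup>2))"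
      using LIMSEQ_SUP LIMSEQ_unique by blast
  qed
  also have "\<dots> = (SUP n. \<integral>\<^sup>+x. ennreal ((cmod (trunc n u x))\<^sup>2) \<partial>M)"
    using mono_exh by (intro nn_integral_monotone_convergence_SUP)
      (auto simp: incseq_def le_fun_def trunc_def)
  also have "\<dots> \<le> ennreal (C\<^sup>2)"
  proof (rule SUP_least)
    fix n
    have "(\<integral>\<^sup>+x. ennreal ((cmod (trunc n u x))\<^sup>2) \<partial>M) = ennreal (\<integral>x. (cmod (trunc n u x))\<^sup>2 \<partial>M)"
      using fs_L2[OF fs_trunc] by (intro nn_integral_eq_integral) (auto simp: in_L2_iff)
    also have "(\<integral>x. (cmod (trunc n u x))\<^sup>2 \<partial>M) = (\<Sum>x\<in>exh n. w x * (cmod (u x))\<^sup>2)"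
      by (subst integral_finite_support[of "exh n"]) (auto simp: trunc_def)
    finally show "(\<integral>\<^sup>+x. ennreal ((cmod (trunc n u x))\<^sup>2) \<partial>M) \<le> ennreal (C\<^sup>2)"
      using fin[of "exh n"] by (simp add: ennreal_leI)
  qed
  finally have *: "(\<integral>\<^sup>+x. ennreal ((cmod (u x))\<^sup>2) \<partial>M) \<le> ennreal (C\<^sup>2)" .
  then have int: "integrable M (\<lambda>x. (cmod (u x))\<^sup>2)"
    by (intro integrableI_nonneg) (auto intro: le_less_trans)
  then show "u \<in> Lp M 2" by (simp add: in_L2_iff)
  have "ennreal (nrm2 u) \<le> ennreal (C\<^sup>2)"
    using * int by (simp add: nrm2_def nn_integral_eq_integral)
  then have "(nrm u)\<^sup>2 \<le> C\<^sup>2" by (simp add: nrm_sq)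
  then show "nrm u \<le> C" using assms(1) by (rule power2_le_imp_le)
qed

lemma ip_fs_tendsto:
  assumes "fs h" "\<And>x. (\<lambda>n. u n x) \<longlonglongrightarrow> v x"
  shows "(\<lambda>n. ip (u n) h) \<longlonglongrightarrow> ip v h"
proof -
  have eq: "ip v h = (\<Sum>x | h x \<noteq> 0. w x *\<^sub>R (v x * cnj (h x)))" for v
    unfolding L2_inner_def using assms(1) by (intro integral_finite_support) (auto simp: fs_def)
  show ?thesis unfolding eq by (intro tendsto_intros assms(2))
qed

text \<open>Fatou's lemma through duality: against a finitely supported function, pointwise
  convergence is enough to pass to the limit.\<close>

lemma L2_pointwise_limit:
  assumes "\<And>n. u n \<in> Lp M 2" "\<And>n. nrm (u n) \<le> C" "\<And>x. (\<lambda>n. u n x) \<longlonglongrightarrow> v x"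
  shows "v \<in> Lp M 2" "nrm v \<le> C"
proof -
  have C: "C \<ge> 0" using assms(2)[of 0] nrm_nonneg[of "u 0"] by linarith
  have "cmod (ip v h) \<le> C * nrm h" if h: "fs h" for h
  proof (rule LIMSEQ_le_const2)
    show "(\<lambda>n. cmod (ip (u n) h)) \<longlonglongrightarrow> cmod (ip v h)"
      by (intro tendsto_norm ip_fs_tendsto[OF h] assms(3))
    have "cmod (ip (u n) h) \<le> C * nrm h" for n
      using ip_cauchy_schwarz[OF assms(1)[of n] fs_L2[OF h]] mult_right_mono[OF assms(2)[of n] nrm_nonneg[of h]]
      by linarith
    then show "\<exists>N. \<forall>n\<ge>N. cmod (ip (u n) h) \<le> C * nrm h" by blast
  qed
  then show "v \<in> Lp M 2" "nrm v \<le> C" using L2_dual[OF C] by blast+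
qed

text \<open>For bounded sequences pointwise convergence is weak convergence, because finitely
  supported functions are dense.\<close>

lemma ip_weak_tendsto:
  assumes u: "\<And>n. u n \<in> Lp M 2" "\<And>n. nrm (u n) \<le> C" "\<And>x. (\<lambda>n. u n x) \<longlonglongrightarrow> v x"
    and g: "g \<in> Lp M 2"
  shows "(\<lambda>n. ip (u n) g) \<longlonglongrightarrow> ip v g"
proof (rule LIMSEQ_I)
  fix e :: real assume e: "e > 0"
  have C: "C \<ge> 0" using u(2)[of 0] nrm_nonneg[of "u 0"] by linarith
  note v = L2_pointwise_limit[OF u]
  have e3: "e / (3 * (C + 1)) > 0" using e C by simp
  obtain h where h: "fs h" "nrm (\<lambda>x. g x - h x) < e / (3 * (C + 1))"
    using L2_approx[OF g e3] .
  have d: "(\<lambda>x. g x - h x) \<in> Lp M 2" by (rule L2_diff[OF g fs_L2[OF h(1)]])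
  have small: "cmod (ip u g - ip u h) < e / 3" if "u \<in> Lp M 2" "nrm u \<le> C" for u
  proof -
    have "ip u g - ip u h = ip u (\<lambda>x. g x - h x)"
      using that(1) g fs_L2[OF h(1)] by (simp add: ip_diff_right)
    also have "cmod \<dots> \<le> nrm u * nrm (\<lambda>x. g x - h x)"
      by (rule ip_cauchy_schwarz[OF that(1) d])
    also have "\<dots> \<le> C * (e / (3 * (C + 1)))"
      using that(2) h(2) C by (intro mult_mono) auto
    also have "\<dots> < e / 3" using C e by (simp add: field_simps)
    finally show ?thesis .
  qed
  have "(\<lambda>n. ip (u n) h) \<longlonglongrightarrow> ip v h" by (rule ip_fs_tendsto[OF h(1) u(3)])
  then obtain N where N: "\<And>n. n \<ge> N \<Longrightarrow> cmod (ip (u n) h - ip v h) < e / 3"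
    using LIMSEQ_D[of _ "ip v h" "e / 3"] e by (metis divide_pos_pos zero_less_numeral)
  have "cmod (ip (u n) g - ip v g) < e" if "n \<ge> N" for n
  proof -
    have "ip (u n) g - ip v g = (ip (u n) g - ip (u n) h) + (ip (u n) h - ip v h) - (ip v g - ip v h)"
      by simp
    then have "cmod (ip (u n) g - ip v g)
        \<le> cmod (ip (u n) g - ip (u n) h) + cmod (ip (u n) h - ip v h) + cmod (ip v g - ip v h)"
      using norm_triangle_ineq4[of "(ip (u n) g - ip (u n) h) + (ip (u n) h - ip v h)" "ip v g - ip v h"]
        norm_triangle_ineq[of "ip (u n) g - ip (u n) h" "ip (u n) h - ip v h"] by simp
    then show ?thesis using small[OF u(1,2)[of n]] small[OF v] N[OF that] by linarith
  qed
  then show "\<exists>N. \<forall>n\<ge>N. cmod (ip (u n) g - ip v g) < e" by blast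
qed

lemma ip_tendsto_left:
  assumes "\<And>n. u n \<in> Lp M 2" "v \<in> Lp M 2" "(\<lambda>n. nrm (\<lambda>x. u n x - v x)) \<longlonglongrightarrow> 0" "g \<in> Lp M 2"
  shows "(\<lambda>n. ip (u n) g) \<longlonglongrightarrow> ip v g"
proof (rule LIM_zero_cancel, rule Lim_null_comparison)
  show "\<forall>\<^sub>F n in sequentially. cmod (ip (u n) g - ip v g) \<le> nrm (\<lambda>x. u n x - v x) * nrm g"
    using ip_cauchy_schwarz[OF L2_diff[OF assms(1,2)] assms(4)] assms
    by (simp add: ip_diff_left)
  show "(\<lambda>n. nrm (\<lambda>x. u n x - v x) * nrm g) \<longlonglongrightarrow> 0"
    using tendsto_mult_left_zero[OF assms(3)] by simp
qed


subsection \<open>The flow isometry and its adjoint\<close>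

lemma measurable_p [measurable, simp]: "p \<in> M \<rightarrow>\<^sub>M M"
  by (simp add: measurable_def)

text \<open>The preimage of a point consists of its children, which have the same total weight;
  hence composition with \<open>p\<close> preserves integrals and is an isometry of L2.\<close>

lemma distr_p: "distr M M p = M"
proof (rule measure_eqI_countable[where A = UNIV])
  fix z
  have "emeasure (distr M M p) {z} = emeasure M {y. anc 1 y = z}"
    by (subst emeasure_distr) (auto simp: vimage_def)
  then show "emeasure (distr M M p) {z} = emeasure M {z}"
    by (simp add: emeasure_desc emeasure_M_singleton del: One_nat_def funpow.simps)
qed (auto simp: countable_UNIV)

lemma integrable_p: 
  fixes f :: "'v \<Rightarrow> 'b::{banach, second_countable_topology}"
  shows "integrable M (\<lambda>x. f (p x)) \<longleftrightarrow> integrable M f"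
  using integrable_distr_eq[of p M M f] by (simp add: distr_p)

lemma integral_p: 
  fixes f :: "'v \<Rightarrow> 'b::{banach, second_countable_topology}"
  shows "(\<integral>x. f (p x) \<partial>M) = (\<integral>x. f x \<partial>M)"
  using integral_distr[of p M M f] by (simp add: distr_p)

lemma L2_p: "f \<in> Lp M 2 \<Longrightarrow> (\<lambda>x. f (p x)) \<in> Lp M 2"
  unfolding in_L2_iff using integrable_p[of "\<lambda>x. (cmod (f x))\<^sup>2"] by simp

lemma nrm2_p: "nrm2 (\<lambda>x. f (p x)) = nrm2 f"
  unfolding nrm2_def by (rule integral_p)

lemma nrm_p: "nrm (\<lambda>x. f (p x)) = nrm f"
  by (simp add: nrm_def nrm2_p)

lemma fs_p: "fs f \<Longrightarrow> fs (\<lambda>x. f (p x))"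
  by (rule fsI[of "\<Union>z\<in>{x. f x \<noteq> 0}. {y. p y = z}"]) (auto simp: fs_def finite_children)

text \<open>The adjoint of composition with \<open>p\<close>: a plain average over the children,
  since they all have the same weight.\<close>

definition Ua :: "('v \<Rightarrow> complex) \<Rightarrow> 'v \<Rightarrow> complex" where
  "Ua f x = (\<Sum>c | p c = x. f c) / q"

lemma fs_Ua: "fs f \<Longrightarrow> fs (Ua f)"
proof (rule fsI[of "p ` {x. f x \<noteq> 0}"])
  fix x assume "x \<notin> p ` {x. f x \<noteq> 0}"
  then have "(\<Sum>c | p c = x. f c) = 0" by (intro sum.neutral) auto
  then show "Ua f x = 0" by (simp add: Ua_def)
qed (simp add: fs_def)

lemma J_eq: "J f x = (f (p x) + Ua f x) / 2"
  by (simp add: J_def Ua_def scaleR_conv_of_real field_simps)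

lemma ip_p_fs:
  assumes "fs h"
  shows "ip (\<lambda>x. f (p x)) h = ip f (Ua h)" "ip (Ua f) h = ip f (\<lambda>x. h (p x))"
proof -
  let ?H = "{x. h x \<noteq> 0}"
  have H: "finite ?H" using assms by (simp add: fs_def)
  have "ip (\<lambda>x. f (p x)) h = (\<Sum>x\<in>?H. w x *\<^sub>R (f (p x) * cnj (h x)))"
    unfolding L2_inner_def by (rule integral_finite_support[OF H]) auto
  also have "\<dots> = (\<Sum>z\<in>p ` ?H. \<Sum>x\<in>{x\<in>?H. p x = z}. w x *\<^sub>R (f (p x) * cnj (h x)))"
    by (rule sum.image_gen[OF H])
  also have "\<dots> = (\<Sum>z\<in>p ` ?H. w z *\<^sub>R (f z * cnj (Ua h z)))"
  proof (rule sum.cong[OF refl])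
    fix z
    have "(\<Sum>x\<in>{x\<in>?H. p x = z}. w x *\<^sub>R (f (p x) * cnj (h x)))
        = (\<Sum>x | p x = z. (w z / q) *\<^sub>R (f z * cnj (h x)))"
      by (rule sum.mono_neutral_cong_left) (auto simp: finite_children w_p)
    then show "(\<Sum>x\<in>{x\<in>?H. p x = z}. w x *\<^sub>R (f (p x) * cnj (h x))) = w z *\<^sub>R (f z * cnj (Ua h z))"
      by (simp add: Ua_def scaleR_conv_of_real sum_distrib_left sum_divide_distrib)
  qed
  also have "\<dots> = ip f (Ua h)"
  proof -
    have "Ua h z = 0" if "z \<notin> p ` ?H" for z
    proof -
      have "(\<Sum>c | p c = z. h c) = 0" using that by (intro sum.neutral) auto
      then show ?thesis by (simp add: Ua_def)
    qed
    then show ?thesis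
      unfolding L2_inner_def using H by (intro integral_finite_support[symmetric]) auto
  qed
  finally show "ip (\<lambda>x. f (p x)) h = ip f (Ua h)" .
  let ?S = "\<Union>z\<in>?H. {y. p y = z}"
  have S: "finite ?S" using H by (auto simp: finite_children)
  have "ip f (\<lambda>x. h (p x)) = (\<Sum>x\<in>?S. w x *\<^sub>R (f x * cnj (h (p x))))"
    unfolding L2_inner_def by (rule integral_finite_support[OF S]) auto
  also have "\<dots> = (\<Sum>z\<in>?H. \<Sum>x | p x = z. w x *\<^sub>R (f x * cnj (h (p x))))"
    by (rule sum.UNION_disjoint) (use H finite_children in auto)
  also have "\<dots> = (\<Sum>z\<in>?H. w z *\<^sub>R (Ua f z * cnj (h z)))"
  proof (rule sum.cong[OF refl])
    fix z
    have "(\<Sum>x | p x = z. w x *\<^sub>R (f x * cnj (h (p x)))) = (\<Sum>x | p x = z. (w z / q) *\<^sub>R (f x * cnj (h z)))"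
      by (rule sum.cong) (auto simp: w_p)
    then show "(\<Sum>x | p x = z. w x *\<^sub>R (f x * cnj (h (p x)))) = w z *\<^sub>R (Ua f z * cnj (h z))"
      by (simp add: Ua_def scaleR_conv_of_real sum_distrib_left sum_distrib_right sum_divide_distrib mult.assoc)
  qed
  also have "\<dots> = ip (Ua f) h"
    unfolding L2_inner_def by (rule integral_finite_support[OF H, symmetric]) auto
  finally show "ip (Ua f) h = ip f (\<lambda>x. h (p x))" ..
qed

lemma Ua_L2:
  assumes "f \<in> Lp M 2"
  shows "Ua f \<in> Lp M 2" "nrm (Ua f) \<le> nrm f"
proof -
  have "cmod (ip (Ua f) h) \<le> nrm f * nrm h" if "fs h" for h
    using ip_cauchy_schwarz[OF assms L2_p[OF fs_L2[OF that]]] ip_p_fs(2)[OF that] by (simp add: nrm_p)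
  then show "Ua f \<in> Lp M 2" "nrm (Ua f) \<le> nrm f" using L2_dual[of "nrm f" "Ua f"] by auto
qed

lemma J_L2:
  assumes "f \<in> Lp M 2"
  shows "J f \<in> Lp M 2" "nrm (J f) \<le> nrm f"
proof -
  have eq: "J f = (\<lambda>x. (1 / 2) * (f (p x) + Ua f x))" by (auto simp: J_eq)
  show "J f \<in> Lp M 2" unfolding eq by (intro L2_scale L2_add L2_p assms Ua_L2)
  have "nrm (J f) = (1 / 2) * nrm (\<lambda>x. f (p x) + Ua f x)" unfolding eq nrm_scale by simp
  also have "\<dots> \<le> (1 / 2) * (nrm (\<lambda>x. f (p x)) + nrm (Ua f))"
    by (intro mult_left_mono nrm_triangle L2_p assms Ua_L2) simp
  finally show "nrm (J f) \<le> nrm f" using Ua_L2(2)[OF assms] by (simp add: nrm_p)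
qed

lemma fs_J: "fs f \<Longrightarrow> fs (J f)"
  using fs_scale[OF fs_add[OF fs_p fs_Ua], of f f "1/2"] by (simp add: J_eq[abs_def])

lemma J_self_adjoint_fs:
  assumes "f \<in> Lp M 2" "fs h"
  shows "ip (J f) h = ip f (J h)"
proof -
  have eq: "J f = (\<lambda>x. (1 / 2) * (f (p x) + Ua f x))" for f by (auto simp: J_eq)
  show ?thesis
    unfolding eq ip_scale_left ip_scale_right
    using assms fs_L2[OF assms(2)]
    by (simp add: ip_add_left ip_add_right L2_p Ua_L2 ip_p_fs add.commute)
qed

lemma J_self_adjoint:
  assumes "f \<in> Lp M 2" "g \<in> Lp M 2"
  shows "ip (J f) g = ip f (J g)"
proof -
  have lin: "J (\<lambda>x. f x - g x) = (\<lambda>x. J f x - J g x)" for f g :: "'v \<Rightarrow> complex"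
    by (auto simp: J_def sum_subtractf scaleR_diff_right)
  let ?g = "\<lambda>n. trunc n g"
  have g: "?g n \<in> Lp M 2" for n by (simp add: fs_L2)
  have t: "(\<lambda>n. nrm (\<lambda>x. ?g n x - g x)) \<longlonglongrightarrow> 0"
    using nrm_trunc_tendsto[OF assms(2)] by (subst nrm_minus_commute)
  have "(\<lambda>n. ip (?g n) (J f)) \<longlonglongrightarrow> ip g (J f)"
    by (rule ip_tendsto_left[OF g assms(2) t J_L2(1)[OF assms(1)]])
  moreover have "(\<lambda>n. ip (J (?g n)) f) \<longlonglongrightarrow> ip (J g) f"
  proof (rule ip_tendsto_left[OF J_L2(1)[OF g] J_L2(1)[OF assms(2)] _ assms(1)])
    show "(\<lambda>n. nrm (\<lambda>x. J (?g n) x - J g x)) \<longlonglongrightarrow> 0"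
      by (rule tendsto_sandwich[OF _ _ tendsto_const t])
        (use J_L2(2)[OF L2_diff[OF g assms(2)]] in \<open>auto simp: lin\<close>)
  qed
  moreover have "ip (?g n) (J f) = ip (J (?g n)) f" for n
    using J_self_adjoint_fs[OF assms(1) fs_trunc[of n g]] by (rule ip_swap)
  ultimately have "ip g (J f) = ip (J g) f" using LIMSEQ_unique by auto
  then show ?thesis by (rule ip_swap)
qed

text \<open>Composition with \<open>p\<close> is an isometry, so both diagonal terms of the square
  equal \<open>nrm2 f\<close>, and the cross terms give the form of \<open>J\<close>. The second
  identity, with the form of the Laplacian, later yields both its positivity and the L2 bound for
  the Riesz transform.\<close>

lemma nrm2_gradient:
  assumes "f \<in> Lp M 2"
  shows "nrm2 (\<lambda>x. f x - f (p x)) = 2 * (nrm2 f - Re (ip (J f) f))"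
    "Re (ip (\<lambda>x. f x - J f x) f) * 2 = nrm2 (\<lambda>x. f x - f (p x))"
proof -
  note [simp] = assms L2_p[OF assms] Ua_L2(1)[OF assms] L2_add L2_diff
  have adj: "ip (Ua f) f = ip f (\<lambda>x. f (p x))"
  proof -
    let ?g = "\<lambda>n. trunc n f"
    have g: "?g n \<in> Lp M 2" for n by (simp add: fs_L2)
    have t: "(\<lambda>n. nrm (\<lambda>x. ?g n x - f x)) \<longlonglongrightarrow> 0"
      using nrm_trunc_tendsto[OF assms] by (subst nrm_minus_commute)
    have "(\<lambda>n. ip (?g n) (Ua f)) \<longlonglongrightarrow> ip f (Ua f)"
      by (rule ip_tendsto_left[OF g _ t]) simp_all
    moreover have "(\<lambda>n. ip (\<lambda>x. ?g n (p x)) f) \<longlonglongrightarrow> ip (\<lambda>x. f (p x)) f"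
      by (rule ip_tendsto_left[OF L2_p[OF g]]) (use t nrm_p[of "\<lambda>x. ?g _ x - f x"] in simp_all)
    moreover have "ip (?g n) (Ua f) = ip (\<lambda>x. ?g n (p x)) f" for n
      using ip_p_fs(2)[OF fs_trunc[of n f], of f] by (rule ip_swap)
    ultimately have "ip f (Ua f) = ip (\<lambda>x. f (p x)) f" using LIMSEQ_unique by auto
    then show ?thesis by (rule ip_swap)
  qed
  have eq: "J f = (\<lambda>x. (1 / 2) * (f (p x) + Ua f x))" by (auto simp: J_eq)
  have eqJ: "ip (J f) f = (1 / 2) * (ip (\<lambda>x. f (p x)) f + ip f (\<lambda>x. f (p x)))"
    unfolding eq ip_scale_left by (simp add: ip_add_left adj)
  have J: "Re (ip (J f) f) = Re (ip f (\<lambda>x. f (p x)))"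
    unfolding eqJ by (simp add: ip_cnj[of "\<lambda>x. f (p x)" f])
  have "complex_of_real (nrm2 (\<lambda>x. f x - f (p x)))
      = ip f f - ip f (\<lambda>x. f (p x)) - (ip (\<lambda>x. f (p x)) f - ip (\<lambda>x. f (p x)) (\<lambda>x. f (p x)))"
    by (simp add: ip_self[symmetric] ip_diff_left ip_diff_right)
  then have "nrm2 (\<lambda>x. f x - f (p x))
      = Re (ip f f - ip f (\<lambda>x. f (p x)) - (ip (\<lambda>x. f (p x)) f - ip (\<lambda>x. f (p x)) (\<lambda>x. f (p x))))"
    by (metis Re_complex_of_real)
  also have "\<dots> = 2 * nrm2 f - 2 * Re (ip f (\<lambda>x. f (p x)))"
    by (simp add: ip_self nrm2_p ip_cnj[of "\<lambda>x. f (p x)" f])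
  finally show *: "nrm2 (\<lambda>x. f x - f (p x)) = 2 * (nrm2 f - Re (ip (J f) f))" using J by simp
  have "ip (\<lambda>x. f x - J f x) f = ip f f - ip (J f) f"
    using J_L2(1)[OF assms] by (simp add: ip_diff_left)
  then show "Re (ip (\<lambda>x. f x - J f x) f) * 2 = nrm2 (\<lambda>x. f x - f (p x))"
    using * by (simp add: ip_self)
qed

end

section \<open>The spectral density of the flow Laplacian\<close>

lemma abs_sin_mult_le: "\<bar>sin (real n * t)\<bar> \<le> real n * \<bar>sin t\<bar>"
proof (induction n)
  case (Suc n)
  have "sin (real (Suc n) * t) = sin (real n * t) * cos t + cos (real n * t) * sin t"
    by (simp add: distrib_right sin_add add.commute)
  then have "\<bar>sin (real (Suc n) * t)\<bar> \<le> \<bar>sin (real n * t)\<bar> * \<bar>cos t\<bar> + \<bar>cos (real n * t)\<bar> * \<bar>sin t\<bar>"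
    using abs_triangle_ineq[of "sin (real n * t) * cos t" "cos (real n * t) * sin t"]
    by (simp add: abs_mult)
  also have "\<dots> \<le> \<bar>sin (real n * t)\<bar> * 1 + 1 * \<bar>sin t\<bar>"
    by (intro add_mono mult_left_mono mult_right_mono abs_cos_le_one) auto
  finally show ?case using Suc by (simp add: distrib_right)
qed simp

definition T :: "real measure" where
  "T = restrict_space lborel {0..pi}"

lemma space_T [simp]: "space T = {0..pi}"
  by (simp add: T_def space_restrict_space)

lemma measurable_T: "f \<in> borel_measurable borel \<Longrightarrow> f \<in> borel_measurable T"
  unfolding T_def by (rule measurable_restrict_space1) simp

interpretation T: finite_measure T
  by (rule finite_measureI) (simp add: T_def emeasure_restrict_space space_restrict_space)

lemma integrable_T:
  fixes f :: "real \<Rightarrow> 'a::{banach, second_countable_topology}"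
  assumes "f \<in> borel_measurable borel" "\<And>t. 0 \<le> t \<Longrightarrow> t \<le> pi \<Longrightarrow> norm (f t) \<le> B"
  shows "integrable T f"
  by (rule T.integrable_const_bound[where B = B]) (use assms measurable_T in \<open>auto intro!: AE_I2\<close>)

lemma integral_T_FTC:
  fixes F f :: "real \<Rightarrow> real"
  assumes "\<And>x. (F has_real_derivative f x) (at x)" "\<And>x. isCont f x"
  shows "(\<integral>x. f x \<partial>T) = F pi - F 0"
proof -
  have "(\<integral>x. f x \<partial>T) = (\<integral>x. f x * indicator {0..pi} x \<partial>lborel)"
    unfolding T_def by (subst integral_restrict_space) (simp_all add: mult.commute)
  also have "\<dots> = F pi - F 0"
    by (rule integral_FTC_Icc_real) (use assms in auto)
  finally show ?thesis .
qed

lemma integral_T_cos: "(\<integral>x. cos (a * x) \<partial>T) = (if a = 0 then pi else sin (a * pi) / a)"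
proof (cases "a = 0")
  case True
  have "(\<integral>x. 1 \<partial>T) = pi - 0"
    by (rule integral_T_FTC[where F = "\<lambda>x. x"]) (auto intro!: derivative_eq_intros)
  then show ?thesis using True by simp
next
  case False
  have "(\<integral>x. cos (a * x) \<partial>T) = sin (a * pi) / a - sin (a * 0) / a"
    using False by (intro integral_T_FTC[where F = "\<lambda>x. sin (a * x) / a"])
      (auto intro!: derivative_eq_intros)
  then show ?thesis using False by simp
qed

lemma integral_T_sin: "a \<noteq> 0 \<Longrightarrow> (\<integral>x. sin (a * x) \<partial>T) = (1 - cos (a * pi)) / a"
  by (subst integral_T_FTC[where F = "\<lambda>x. - cos (a * x) / a"])
    (auto intro!: derivative_eq_intros simp: field_simps)

lemma integral_T_sin_sin: "(\<integral>x. sin x * sin (real (k + 1) * x) \<partial>T) = (if k = 0 then pi / 2 else 0)"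
proof -
  have eq: "sin x * sin (real (k + 1) * x) = cos (real k * x) / 2 - cos (real (k + 2) * x) / 2" for x
    using sin_times_sin[of "real (k + 1) * x" x] by (simp add: algebra_simps)
  have int: "integrable T (\<lambda>x. cos (a * x) / 2)" for a
    by (rule integrable_T[where B = "1/2"]) (simp_all add: abs_cos_le_one)
  have "(\<integral>x. sin x * sin (real (k + 1) * x) \<partial>T)
      = (\<integral>x. cos (real k * x) \<partial>T) / 2 - (\<integral>x. cos (real (k + 2) * x) \<partial>T) / 2"
    unfolding eq by (subst Bochner_Integration.integral_diff[OF int int]) simp
  then show ?thesis
    unfolding integral_T_cos using sin_npi[of k] sin_npi[of "k + 2"] by (auto simp del: of_nat_add of_nat_Suc)
qed

lemma one_minus_cos_bounds: "1 - cos t \<in> {0..2::real}"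
  using cos_le_one[of t] cos_ge_minus_one[of t] by auto

lemma sin_sq_eq: "(sin t)\<^sup>2 = (1 - cos t) * (1 + cos (t::real))"
  using sin_cos_squared_add[of t] by (simp add: power2_eq_square algebra_simps)

text \<open>The spectral variable is \<open>1 - cos \<theta>\<close>; the integrals below are against a density of order
  \<open>sin\<^sup>2 \<theta>\<close>, so that singularities of order \<open>1 / t\<close> at \<open>0\<close> are allowed.\<close>

definition good :: "(real \<Rightarrow> real) \<Rightarrow> bool" where
  "good \<phi> \<longleftrightarrow> \<phi> \<in> borel_measurable borel \<and> (\<exists>B. \<forall>t\<in>{0..2}. \<bar>t * \<phi> t\<bar> \<le> B)"

lemma good_measurable: "good \<phi> \<Longrightarrow> \<phi> \<in> borel_measurable borel"
  by (simp add: good_def)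

lemma good_boundedI:
  assumes "\<phi> \<in> borel_measurable borel" "\<And>t. t \<in> {0..2} \<Longrightarrow> \<bar>\<phi> t\<bar> \<le> s"
  shows "good \<phi>"
  unfolding good_def
proof (intro conjI assms(1) exI ballI)
  fix t :: real assume t: "t \<in> {0..2}"
  then show "\<bar>t * \<phi> t\<bar> \<le> 2 * s" using assms(2)[OF t] by (auto simp: abs_mult intro: mult_mono)
qed

lemma good_mult_id:
  assumes "good \<phi>" shows "good (\<lambda>t. t * \<phi> t)"
proof -
  obtain B where "\<forall>t\<in>{0..2}. \<bar>t * \<phi> t\<bar> \<le> B" using assms by (auto simp: good_def)
  then show ?thesis using assms by (intro good_boundedI[of _ B]) (auto simp: good_def)
qed

lemma good_add:
  assumes "good \<phi>" "good \<psi>" shows "good (\<lambda>t. \<phi> t + \<psi> t)"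
proof -
  obtain B C where B: "\<forall>t\<in>{0..2}. \<bar>t * \<phi> t\<bar> \<le> B" and C: "\<forall>t\<in>{0..2}. \<bar>t * \<psi> t\<bar> \<le> C"
    using assms by (auto simp: good_def)
  have "\<bar>t * (\<phi> t + \<psi> t)\<bar> \<le> B + C" if "t \<in> {0..2}" for t
    using bspec[OF B that] bspec[OF C that] abs_triangle_ineq[of "t * \<phi> t" "t * \<psi> t"]
    unfolding distrib_left by linarith
  then show ?thesis using assms unfolding good_def by (intro conjI exI[of _ "B + C"]) auto
qed

lemma good_scale:
  assumes "good \<phi>" shows "good (\<lambda>t. c * \<phi> t)"
proof -
  obtain B where B: "\<forall>t\<in>{0..2}. \<bar>t * \<phi> t\<bar> \<le> B" using assms by (auto simp: good_def)
  have "\<bar>t * (c * \<phi> t)\<bar> \<le> \<bar>c\<bar> * B" if "t \<in> {0..2}" for t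
    using mult_left_mono[OF bspec[OF B that], of "\<bar>c\<bar>"] by (simp add: abs_mult mult_ac)
  then show ?thesis using assms unfolding good_def by (intro conjI exI[of _ "\<bar>c\<bar> * B"]) auto
qed

lemma good_power: "good (\<lambda>t. t ^ n)"
  by (rule good_boundedI[where s = "2 ^ n"]) (auto simp: power_mono)

lemma good_sum: "(\<And>i. i \<in> I \<Longrightarrow> good (\<phi> i)) \<Longrightarrow> good (\<lambda>t. \<Sum>i\<in>I. \<phi> i t)"
proof (induction I rule: infinite_finite_induct)
  case (insert x F)
  then show ?case using good_add[of "\<phi> x" "\<lambda>t. \<Sum>i\<in>F. \<phi> i t"] by simp
qed (use good_power[of 0] good_scale[of "\<lambda>t. 1" 0] in auto)

lemma poly_approx:
  assumes "continuous_on {0..2} \<phi>" "e > 0"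
  obtains a n where "\<And>t. t \<in> {0..2} \<Longrightarrow> \<bar>\<phi> t - (\<Sum>i\<le>n. a i * t ^ i)\<bar> < (e::real)"
proof -
  obtain g where g: "real_polynomial_function g" "\<And>x. x \<in> {0..2} \<Longrightarrow> \<bar>\<phi> x - g x\<bar> < e"
    using Stone_Weierstrass_real_polynomial_function[of "{0..2::real}" \<phi> e] assms by auto
  obtain a n where "g = (\<lambda>x. \<Sum>i\<le>n. a i * x ^ i)"
    using real_polynomial_function_imp_sum[OF g(1)] by auto
  then show ?thesis using that[of a n] g(2) by simp
qed

section \<open>Eigenfunctions of the Jacobi matrix and kernels of functions of the Laplacian\<close>

context flow_tree
begin

definition Cd :: "nat \<Rightarrow> real" where
  "Cd d = (2 / pi) * (\<Sum>j. real (d + 2 * j + 1) / real q ^ j)"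

text \<open>For every angle \<open>t\<close> the function \<open>Fd t\<close> is the eigenfunction of \<open>jac\<close> with eigenvalue \<open>cos t\<close>;
  the factor \<open>sin t\<close> normalizes the integral over \<open>t\<close> to the kernel of the identity.\<close>

definition Fd :: "real \<Rightarrow> nat \<Rightarrow> real" where
  "Fd t d = (2 / pi) * sin t * (\<Sum>j. sin (real (d + 2 * j + 1) * t) / real q ^ j)"

lemma summable_linear_geometric: "summable (\<lambda>j. real (d + 2 * j + 1) / real q ^ j)"
proof (rule summable_ratio_test[of "3/4" 2])
  fix j :: nat assume j: "2 \<le> j"
  have "real (d + 2 * Suc j + 1) * 4 \<le> 6 * real (d + 2 * j + 1)" using j by simp
  also have "\<dots> \<le> 3 * q * real (d + 2 * j + 1)" using q_ge_2 by (intro mult_right_mono) auto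
  finally have "real (d + 2 * Suc j + 1) \<le> (3/4) * real (d + 2 * j + 1) * q"
    by (simp add: algebra_simps)
  then have "real (d + 2 * Suc j + 1) / real q ^ Suc j \<le> (3/4) * real (d + 2 * j + 1) * q / real q ^ Suc j"
    by (rule divide_right_mono) simp
  then show "norm (real (d + 2 * Suc j + 1) / real q ^ Suc j) \<le> 3/4 * norm (real (d + 2 * j + 1) / real q ^ j)"
    by simp
qed simp

lemma Cd_nonneg: "Cd d \<ge> 0"
  unfolding Cd_def by (intro mult_nonneg_nonneg suminf_nonneg summable_linear_geometric) auto

lemma summable_geometric_bounded:
  assumes "\<And>j. \<bar>s j\<bar> \<le> (B::real)"
  shows "summable (\<lambda>j. \<bar>s j / real q ^ j\<bar>)"
proof (rule summable_comparison_test')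
  show "summable (\<lambda>j. B * (1 / real q) ^ j)"
    using q_gt_1 by (intro summable_mult summable_geometric) auto
  show "norm \<bar>s j / real q ^ j\<bar> \<le> B * (1 / real q) ^ j" if "j \<ge> 0" for j
    using assms[of j] by (simp add: power_one_over divide_right_mono)
qed

lemma summable_sin: "summable (\<lambda>j. \<bar>sin (real (d + 2 * j + 1) * t) / real q ^ j\<bar>)"
  by (rule summable_geometric_bounded[of _ 1]) simp

lemma summable_sin': "summable (\<lambda>j. sin (real (d + 2 * j + 1) * t) / real q ^ j)"
  using summable_sin by (rule summable_rabs_cancel)

text \<open>Each term of the series contributes a second factor \<open>sin t\<close> by
  \<open>abs_sin_mult_le\<close>. The resulting double zero is what allows \<open>good\<close>
  symbols, singular like \<open>1 / t\<close>, to be integrated.\<close>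

lemma Fd_bound: "\<bar>Fd t d\<bar> \<le> Cd d * (sin t)\<^sup>2"
proof -
  have term_le: "\<bar>sin (real (d + 2 * j + 1) * t) / real q ^ j\<bar> \<le> real (d + 2 * j + 1) / real q ^ j * \<bar>sin t\<bar>" for j
    using divide_right_mono[OF abs_sin_mult_le[of "d + 2 * j + 1" t], of "real q ^ j"] by simp
  have "\<bar>\<Sum>j. sin (real (d + 2 * j + 1) * t) / real q ^ j\<bar> \<le> (\<Sum>j. \<bar>sin (real (d + 2 * j + 1) * t) / real q ^ j\<bar>)"
    by (rule summable_rabs[OF summable_sin])
  also have "\<dots> \<le> (\<Sum>j. real (d + 2 * j + 1) / real q ^ j * \<bar>sin t\<bar>)"
    by (rule suminf_le[OF term_le summable_sin summable_mult2[OF summable_linear_geometric]])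
  also have "\<dots> = (\<Sum>j. real (d + 2 * j + 1) / real q ^ j) * \<bar>sin t\<bar>"
    by (rule suminf_mult2[OF summable_linear_geometric, symmetric])
  finally have "\<bar>Fd t d\<bar> \<le> (2 / pi) * \<bar>sin t\<bar> * ((\<Sum>j. real (d + 2 * j + 1) / real q ^ j) * \<bar>sin t\<bar>)"
    unfolding Fd_def abs_mult by (intro mult_mono) auto
  then show ?thesis by (simp add: Cd_def power2_eq_square mult_ac flip: abs_mult)
qed

lemma continuous_Fd: "continuous_on UNIV (\<lambda>t. Fd t d)"
proof -
  have "uniform_limit UNIV (\<lambda>n t. \<Sum>j<n. sin (real (d + 2 * j + 1) * t) / real q ^ j)
      (\<lambda>t. \<Sum>j. sin (real (d + 2 * j + 1) * t) / real q ^ j) sequentially"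
  proof (rule Weierstrass_m_test)
    show "summable (\<lambda>j. (1 / real q) ^ j)"
      using q_gt_1 by (intro summable_geometric) auto
  qed (auto simp: power_one_over divide_right_mono)
  then have "continuous_on UNIV (\<lambda>t. \<Sum>j. sin (real (d + 2 * j + 1) * t) / real q ^ j)"
    by (rule uniform_limit_theorem[rotated]) (auto intro!: always_eventually continuous_intros)
  then show ?thesis unfolding Fd_def by (intro continuous_intros)
qed

lemma measurable_Fd [measurable]: "(\<lambda>t. Fd t d) \<in> borel_measurable borel"
  using continuous_Fd by (rule borel_measurable_continuous_onI)

text \<open>For \<open>d > 0\<close> this is the addition formula, term by term. The weights
  \<open>1 / q ^ j\<close> and the step 2 in \<open>j\<close> are dictated by the row
  \<open>d = 0\<close>.\<close>

lemma jac_Fd: "jac (Fd t) d = cos t * Fd t d"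
proof -
  let ?S = "\<lambda>m. \<Sum>j. sin (real (m + 2 * j + 1) * t) / real q ^ j"
  have trig: "sin (real (m + 2) * t) + sin (real m * t) = 2 * (cos t * sin (real (m + 1) * t))" for m
  proof -
    have "(real (m + 2) * t + real m * t) / 2 = real (m + 1) * t" "(real (m + 2) * t - real m * t) / 2 = t"
      by (simp_all add: field_simps)
    then show ?thesis using sin_plus_sin[of "real (m + 2) * t" "real m * t"] by (simp only: mult_ac)
  qed
  show ?thesis
  proof (cases d)
    case (Suc k)
    have "?S (d + 1) + ?S k = (\<Sum>j. sin (real (d + 1 + 2 * j + 1) * t) / real q ^ j + sin (real (k + 2 * j + 1) * t) / real q ^ j)"
      by (rule suminf_add[OF summable_sin' summable_sin'])
    also have "\<dots> = (\<Sum>j. 2 * cos t * (sin (real (d + 2 * j + 1) * t) / real q ^ j))"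
    proof (rule suminf_cong)
      fix j
      show "sin (real (d + 1 + 2 * j + 1) * t) / real q ^ j + sin (real (k + 2 * j + 1) * t) / real q ^ j
          = 2 * cos t * (sin (real (d + 2 * j + 1) * t) / real q ^ j)"
        using trig[of "d + 2 * j"] Suc by (simp add: field_simps)
    qed
    also have "\<dots> = 2 * cos t * ?S d" by (rule suminf_mult[OF summable_sin'])
    finally have "?S (d + 1) + ?S k = 2 * cos t * ?S d" .
    then have "(2 / pi * sin t) * (?S (d + 1) + ?S k) / 2 = (2 / pi * sin t) * (2 * cos t * ?S d) / 2"
      by simp
    then show ?thesis using Suc by (simp add: jac_def Fd_def algebra_simps add_divide_distrib)
  next
    case 0
    \<comment> \<open>This plays the part of the value at distance \<open>-1\<close>: the term
      \<open>j = 0\<close> vanishes, and a shift of \<open>j\<close> turns the others into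
      \<open>?S 1 / q\<close>. It accounts for the summand \<open>1 / q\<close> in
      \<open>jac\<close>.\<close>
    have sh: "(\<Sum>j. sin (real (2 * j) * t) / real q ^ j) = ?S 1 / q"
    proof -
      have s: "summable (\<lambda>j. sin (real (2 * j) * t) / real q ^ j)"
        by (rule summable_rabs_cancel, rule summable_geometric_bounded[of _ 1]) simp
      have "(\<Sum>j. sin (real (2 * j) * t) / real q ^ j) = (\<Sum>j. sin (real (2 * Suc j) * t) / real q ^ Suc j)"
        using suminf_split_head[OF s] by simp
      also have "\<dots> = (\<Sum>j. (sin (real (1 + 2 * j + 1) * t) / real q ^ j) / q)"
        by (rule suminf_cong) (simp add: field_simps)
      also have "\<dots> = ?S 1 / q" by (rule suminf_divide[OF summable_sin'])
      finally show ?thesis .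
    qed
    have "?S 1 + ?S 1 / q = (\<Sum>j. sin (real (1 + 2 * j + 1) * t) / real q ^ j + sin (real (2 * j) * t) / real q ^ j)"
      unfolding sh[symmetric]
      by (rule suminf_add[OF summable_sin']) (rule summable_rabs_cancel, rule summable_geometric_bounded[of _ 1], simp)
    also have "\<dots> = (\<Sum>j. 2 * cos t * (sin (real (0 + 2 * j + 1) * t) / real q ^ j))"
    proof (rule suminf_cong)
      fix j
      show "sin (real (1 + 2 * j + 1) * t) / real q ^ j + sin (real (2 * j) * t) / real q ^ j
          = 2 * cos t * (sin (real (0 + 2 * j + 1) * t) / real q ^ j)"
        using trig[of "2 * j"] by (simp add: field_simps)
    qed
    also have "\<dots> = 2 * cos t * ?S 0" by (rule suminf_mult[OF summable_sin'])
    finally have "(1 + 1 / q) * ?S 1 = 2 * cos t * ?S 0" by (simp add: distrib_right)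
    then have "(2 / pi * sin t) * ((1 + 1 / q) * ?S 1) / 2 = (2 / pi * sin t) * (2 * cos t * ?S 0) / 2"
      by simp
    then show ?thesis using 0 by (simp add: jac_def Fd_def mult_ac)
  qed
qed

text \<open>Radial profile of the kernel of \<open>\<phi>\<close> applied to the Laplacian; the
  spectral variable is \<open>1 - cos t\<close>.\<close>

definition Kf :: "(real \<Rightarrow> real) \<Rightarrow> nat \<Rightarrow> real" where
  "Kf \<phi> d = (\<integral>t. \<phi> (1 - cos t) * Fd t d \<partial>T)"

lemma good_Fd_bound:
  assumes "\<forall>t\<in>{0..2}. \<bar>t * \<phi> t\<bar> \<le> B"
  shows "\<bar>\<phi> (1 - cos t) * Fd t d\<bar> \<le> 2 * B * Cd d"
proof -
  let ?c = "1 - cos t"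
  have c: "?c \<in> {0..2}" by (rule one_minus_cos_bounds)
  have "\<bar>\<phi> ?c * Fd t d\<bar> \<le> \<bar>\<phi> ?c\<bar> * (Cd d * (?c * (1 + cos t)))"
    using Fd_bound[of t d] by (simp add: abs_mult mult_left_mono sin_sq_eq)
  also have "\<dots> = \<bar>?c * \<phi> ?c\<bar> * (1 + cos t) * Cd d"
    using c by (simp add: abs_mult mult_ac)
  also have "\<dots> \<le> B * 2 * Cd d"
  proof (intro mult_right_mono mult_mono Cd_nonneg)
    show "\<bar>?c * \<phi> ?c\<bar> \<le> B" by (rule bspec[OF assms c])
    then show "0 \<le> B" by linarith
  qed (use cos_le_one[of t] cos_ge_minus_one[of t] in linarith)+
  finally show ?thesis by (simp add: mult_ac)
qed

lemma Kf_integrable: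
  assumes "good \<phi>"
  shows "integrable T (\<lambda>t. \<phi> (1 - cos t) * Fd t d)"
proof -
  note [measurable] = good_measurable[OF assms]
  obtain B where "\<forall>t\<in>{0..2}. \<bar>t * \<phi> t\<bar> \<le> B" using assms by (auto simp: good_def)
  from good_Fd_bound[OF this] show ?thesis
    by (intro integrable_T[where B = "2 * B * Cd d"]) auto
qed

lemma Kf_add: "good \<phi> \<Longrightarrow> good \<psi> \<Longrightarrow> Kf (\<lambda>t. \<phi> t + \<psi> t) d = Kf \<phi> d + Kf \<psi> d"
  unfolding Kf_def by (simp add: distrib_right Kf_integrable)

lemma Kf_scale: "Kf (\<lambda>t. c * \<phi> t) d = c * Kf \<phi> d"
  unfolding Kf_def by (simp add: mult.assoc)

lemma Kf_sum: "(\<And>i. i \<in> I \<Longrightarrow> good (\<phi> i)) \<Longrightarrow> Kf (\<lambda>t. \<Sum>i\<in>I. \<phi> i t) d = (\<Sum>i\<in>I. Kf (\<phi> i) d)"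
  unfolding Kf_def by (simp add: sum_distrib_right Kf_integrable)

text \<open>Convergence at the spectral value 0 is not asked for: there \<open>Fd\<close> vanishes
  by \<open>Fd_bound\<close>, so the limit may be taken along regularizations that diverge at
  0.\<close>

lemma Kf_tendsto:
  assumes "\<And>n. \<phi> n \<in> borel_measurable borel" "\<psi> \<in> borel_measurable borel"
    and "\<And>n t. t \<in> {0..2} \<Longrightarrow> \<bar>t * \<phi> n t\<bar> \<le> B"
    and "\<And>t. t \<in> {0<..2} \<Longrightarrow> (\<lambda>n. \<phi> n t) \<longlonglongrightarrow> \<psi> t"
  shows "(\<lambda>n. Kf (\<phi> n) d) \<longlonglongrightarrow> Kf \<psi> d"
  unfolding Kf_def
proof (rule integral_dominated_convergence[where w = "\<lambda>t. 2 * B * Cd d"])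
  show "AE t in T. (\<lambda>n. \<phi> n (1 - cos t) * Fd t d) \<longlonglongrightarrow> \<psi> (1 - cos t) * Fd t d"
  proof (rule AE_I2)
    fix t
    show "(\<lambda>n. \<phi> n (1 - cos t) * Fd t d) \<longlonglongrightarrow> \<psi> (1 - cos t) * Fd t d"
    proof (cases "cos t = 1")
      case True
      then have "Fd t d = 0" using Fd_bound[of t d] by (simp add: sin_sq_eq)
      then show ?thesis by simp
    next
      case False
      then have "1 - cos t \<in> {0<..2}" using one_minus_cos_bounds[of t] by (auto simp: less_le)
      then show ?thesis by (intro tendsto_mult tendsto_const assms(4))
    qed
  qed
  show "AE t in T. norm (\<phi> n (1 - cos t) * Fd t d) \<le> 2 * B * Cd d" for n
    using good_Fd_bound[of "\<phi> n" B _ d] assms(3) by (intro AE_I2) auto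
  note [measurable] = assms(1,2)
  show "(\<lambda>t. \<psi> (1 - cos t) * Fd t d) \<in> borel_measurable T"
    by (rule measurable_T) measurable
  show "(\<lambda>t. \<phi> n (1 - cos t) * Fd t d) \<in> borel_measurable T" for n
    by (rule measurable_T) measurable
qed simp

lemma jac_Kf:
  assumes "good \<phi>"
  shows "jac (Kf \<phi>) d = Kf (\<lambda>t. \<phi> t) d - Kf (\<lambda>t. t * \<phi> t) d"
proof -
  have "jac (Kf \<phi>) d = (\<integral>t. jac (\<lambda>d. \<phi> (1 - cos t) * Fd t d) d \<partial>T)"
    unfolding jac_def Kf_def using assms by (simp add: Kf_integrable)
  also have "\<dots> = (\<integral>t. \<phi> (1 - cos t) * Fd t d - (1 - cos t) * \<phi> (1 - cos t) * Fd t d \<partial>T)"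
  proof (rule Bochner_Integration.integral_cong[OF refl])
    fix t
    have "jac (\<lambda>d. \<phi> (1 - cos t) * Fd t d) d = \<phi> (1 - cos t) * jac (Fd t) d"
      by (simp add: jac_def distrib_left)
    then show "jac (\<lambda>d. \<phi> (1 - cos t) * Fd t d) d = \<phi> (1 - cos t) * Fd t d - (1 - cos t) * \<phi> (1 - cos t) * Fd t d"
      by (simp add: jac_Fd algebra_simps)
  qed
  also have "\<dots> = Kf (\<lambda>t. \<phi> t) d - Kf (\<lambda>t. t * \<phi> t) d"
    unfolding Kf_def
    by (rule Bochner_Integration.integral_diff[OF Kf_integrable[OF assms] Kf_integrable[OF good_mult_id[OF assms]]])
  finally show ?thesis .
qed

text \<open>Termwise integration of the eigenfunction series; the bound on
  \<open>\<phi> (1 - cos t) * sin t\<close> makes the geometric weights a summable majorant and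
  reduces \<open>Kf\<close> to sine coefficients.\<close>

lemma Kf_eq_suminf:
  assumes [measurable]: "\<phi> \<in> borel_measurable borel"
    and B: "\<And>t. 0 \<le> t \<Longrightarrow> t \<le> pi \<Longrightarrow> \<bar>\<phi> (1 - cos t) * sin t\<bar> \<le> B"
  shows "Kf \<phi> d = (\<Sum>j. (2 / pi) * (\<integral>t. \<phi> (1 - cos t) * sin t * sin (real (d + 2 * j + 1) * t) \<partial>T) / real q ^ j)"
proof -
  let ?f = "\<lambda>j t. (2 / pi) * (\<phi> (1 - cos t) * sin t * sin (real (d + 2 * j + 1) * t)) / real q ^ j"
  have B0: "B \<ge> 0" using B[of 0] by simp
  have bound: "\<bar>?f j t\<bar> \<le> (2 / pi) * B * (1 / real q) ^ j" if "t \<in> {0..pi}" for j t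
  proof -
    have "\<bar>\<phi> (1 - cos t) * sin t * sin (real (d + 2 * j + 1) * t)\<bar> \<le> B * 1"
      using B[of t] that B0 unfolding abs_mult[of _ "sin (real (d + 2 * j + 1) * t)"] by (intro mult_mono) auto
    then have "(2 / pi) * \<bar>\<phi> (1 - cos t) * sin t * sin (real (d + 2 * j + 1) * t)\<bar> / real q ^ j \<le> (2 / pi) * B / real q ^ j"
      by (intro divide_right_mono mult_left_mono) auto
    then show ?thesis by (simp add: abs_mult power_one_over)
  qed
  have int: "integrable T (?f j)" for j
    by (rule integrable_T[where B = "(2 / pi) * B * (1 / real q) ^ j"]) (use bound in auto)
  have geo: "summable (\<lambda>j. C * (1 / real q) ^ j)" for C
    using q_gt_1 by (intro summable_mult summable_geometric) auto
  have "(\<lambda>j. \<integral>t. ?f j t \<partial>T) sums (\<integral>t. (\<Sum>j. ?f j t) \<partial>T)"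
  proof (rule sums_integral[OF int])
    show "AE t in T. summable (\<lambda>j. norm (?f j t))"
    proof (rule AE_I2)
      fix t assume "t \<in> space T"
      then show "summable (\<lambda>j. norm (?f j t))"
        using bound[of t] by (intro summable_comparison_test'[OF geo[of "(2 / pi) * B"]]) auto
    qed
    show "summable (\<lambda>j. \<integral>t. norm (?f j t) \<partial>T)"
    proof (rule summable_comparison_test'[OF geo[of "(2 / pi) * B * measure T (space T)"]])
      fix j :: nat
      have "(\<integral>t. norm (?f j t) \<partial>T) \<le> (\<integral>t. (2 / pi) * B * (1 / real q) ^ j \<partial>T)"
        using bound[of _ j] by (intro integral_mono integrable_norm int) auto
      then show "norm (\<integral>t. norm (?f j t) \<partial>T) \<le> (2 / pi) * B * measure T (space T) * (1 / real q) ^ j"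
        by (simp add: mult_ac)
    qed
  qed
  moreover have "(\<Sum>j. ?f j t) = \<phi> (1 - cos t) * Fd t d" for t
  proof -
    have "(\<Sum>j. ?f j t) = (\<Sum>j. (\<phi> (1 - cos t) * (2 / pi * sin t)) * (sin (real (d + 2 * j + 1) * t) / real q ^ j))"
      by (rule suminf_cong) (simp add: mult_ac)
    also have "\<dots> = (\<phi> (1 - cos t) * (2 / pi * sin t)) * (\<Sum>j. sin (real (d + 2 * j + 1) * t) / real q ^ j)"
      by (rule suminf_mult[OF summable_sin'])
    finally show ?thesis by (simp add: Fd_def)
  qed
  ultimately have "Kf \<phi> d = (\<Sum>j. \<integral>t. ?f j t \<partial>T)" unfolding Kf_def by (simp add: sums_iff)
  then show ?thesis by (simp add: mult.assoc)
qed

text \<open>By orthogonality of the sines only a term with \<open>d + 2 * j = 0\<close> survives.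
  This is the completeness relation: the symbol 1 gives the identity operator.\<close>

lemma Kf_one: "Kf (\<lambda>t. 1) d = (if d = 0 then 1 else 0)"
proof -
  have "Kf (\<lambda>t. 1) d = (\<Sum>j. (2 / pi) * (\<integral>t. 1 * sin t * sin (real (d + 2 * j + 1) * t) \<partial>T) / real q ^ j)"
    by (rule Kf_eq_suminf[of _ 1]) auto
  also have "\<dots> = (\<Sum>j. if j = 0 then (if d = 0 then 1 else 0) else 0)"
    using integral_T_sin_sin[of "d + 2 * _"] by (intro suminf_cong) auto
  also have "\<dots> = (\<Sum>j\<in>{0::nat}. if j = 0 then (if d = 0 then 1 else 0) else 0)"
    by (rule suminf_finite) auto
  finally show ?thesis by simp
qed

text \<open>Sine coefficients of \<open>(1 - cos t) powr (- 1 / 2) * sin t\<close>, which equals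
  \<open>sqrt 2 * cos (t / 2)\<close> for \<open>0 < t\<close> and \<open>t \<le> pi\<close>; they
  are computed in \<open>integral_T_b\<close>.\<close>

definition b :: "nat \<Rightarrow> real" where
  "b k = (sqrt 2 / pi) * (1 / (real k + 1/2) + 1 / (real k + 3/2))"

lemma integral_T_b:
  "(2 / pi) * (\<integral>t. (1 - cos t) powr (- 1 / 2) * sin t * sin (real (k + 1) * t) \<partial>T) = b k"
proof -
  have eq: "(1 - cos t) powr (- 1 / 2) * sin t * sin (real (k + 1) * t)
      = (sqrt 2 / 2) * sin ((real k + 3/2) * t) + (sqrt 2 / 2) * sin ((real k + 1/2) * t)"
    if "t \<in> space T" for t
  proof (cases "t = 0")
    case False
    then have t: "0 < t / 2" "t / 2 < pi" using that by auto
    then have s: "sin (t / 2) > 0" by (rule sin_gt_zero)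
    have c: "1 - cos t = 2 * (sin (t / 2))\<^sup>2"
      using cos_double_sin[of "t / 2"] by simp
    have "(1 - cos t) powr (- 1 / 2) = 1 / sqrt (1 - cos t)"
      using s by (simp add: c powr_minus powr_half_sqrt inverse_eq_divide)
    also have "\<dots> = 1 / (sqrt 2 * sin (t / 2))"
      using s by (simp add: c real_sqrt_mult)
    finally have p: "(1 - cos t) powr (- 1 / 2) = 1 / (sqrt 2 * sin (t / 2))" .
    have "sin t = 2 * sin (t / 2) * cos (t / 2)" using sin_double[of "t / 2"] by simp
    then have "(1 - cos t) powr (- 1 / 2) * sin t = sqrt 2 * cos (t / 2)"
      using s unfolding p by (simp add: field_simps)
    then have "(1 - cos t) powr (- 1 / 2) * sin t * sin (real (k + 1) * t)
        = sqrt 2 * (sin (real (k + 1) * t) * cos (t / 2))" by (simp only: mult_ac)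
    also have "sin (real (k + 1) * t) * cos (t / 2)
        = (sin ((real k + 3/2) * t) + sin ((real k + 1/2) * t)) / 2"
      using sin_times_cos[of "real (k + 1) * t" "t / 2"] by (simp add: algebra_simps)
    finally show ?thesis by (simp add: distrib_left add_divide_distrib)
  qed simp
  have int: "integrable T (\<lambda>t. (sqrt 2 / 2) * sin (a * t))" for a
  proof (rule integrable_T[where B = "sqrt 2 / 2 * 1"])
    show "norm (sqrt 2 / 2 * sin (a * t)) \<le> sqrt 2 / 2 * 1" for t
      unfolding norm_mult by (intro mult_mono) auto
  qed measurable
  have cos0: "cos ((real k + 1/2) * pi) = 0" "cos ((real k + 3/2) * pi) = 0"
  proof -
    have half: "cos (real m * pi + pi / 2) = 0" for m
      by (simp add: cos_add)
    have "(real k + 1/2) * pi = real k * pi + pi / 2" "(real k + 3/2) * pi = real (k + 1) * pi + pi / 2"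
      by (simp_all add: field_simps)
    then show "cos ((real k + 1/2) * pi) = 0" "cos ((real k + 3/2) * pi) = 0"
      by (simp_all only: half)
  qed
  have "(\<integral>t. (1 - cos t) powr (- 1 / 2) * sin t * sin (real (k + 1) * t) \<partial>T)
      = (\<integral>t. (sqrt 2 / 2) * sin ((real k + 3/2) * t) + (sqrt 2 / 2) * sin ((real k + 1/2) * t) \<partial>T)"
    by (rule Bochner_Integration.integral_cong[OF refl eq])
  also have "\<dots> = (sqrt 2 / 2) * (1 / (real k + 3/2)) + (sqrt 2 / 2) * (1 / (real k + 1/2))"
    by (subst Bochner_Integration.integral_add[OF int int])
      (simp add: integral_T_sin cos0, simp add: mult.commute)
  finally show ?thesis by (simp add: b_def distrib_left field_simps)
qed

lemma powr_half_bounds: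
  assumes "t \<in> {0..2::real}"
  shows "\<bar>t * t powr (- 1 / 2)\<bar> \<le> 2" "\<bar>t * (t powr (- 1 / 2))\<^sup>2\<bar> \<le> 1"
    "t > 0 \<Longrightarrow> t * (t powr (- 1 / 2))\<^sup>2 = 1"
proof -
  have eq: "t * t powr (- 1 / 2) = sqrt t" "t > 0 \<Longrightarrow> t * (t powr (- 1 / 2))\<^sup>2 = 1"
    using assms by (cases "t = 0"; simp add: powr_minus powr_half_sqrt power_inverse
        real_div_sqrt flip: divide_inverse)+
  show "\<bar>t * t powr (- 1 / 2)\<bar> \<le> 2"
    using assms sqrt_le_D[of t 2] real_sqrt_le_mono[of t 4] unfolding eq by auto
  show "t > 0 \<Longrightarrow> t * (t powr (- 1 / 2))\<^sup>2 = 1" by (rule eq)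
  then show "\<bar>t * (t powr (- 1 / 2))\<^sup>2\<bar> \<le> 1" using assms by (cases "t = 0") auto
qed

text \<open>Even the square, \<open>1 / t\<close>, is admissible. This is what will put every
  finitely supported function into the domain of the inverse square root.\<close>

lemma good_powr_half: "good (\<lambda>t. t powr (- 1 / 2))" "good (\<lambda>t. (t powr (- 1 / 2))\<^sup>2)"
  unfolding good_def
  by (intro conjI exI[of _ 2] ballI powr_half_bounds(1), measurable)
    (intro conjI exI[of _ 1] ballI powr_half_bounds(2), measurable)

text \<open>Radial profile of the inverse square root of the Laplacian, see
  \<open>Kf_powr_half\<close>.\<close>

definition Fb :: "nat \<Rightarrow> real" where
  "Fb d = (\<Sum>j. b (d + 2 * j) / real q ^ j)"

lemma Kf_powr_half: "Kf (\<lambda>t. t powr (- 1 / 2)) = Fb"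
proof
  fix d
  have "Kf (\<lambda>t. t powr (- 1 / 2)) d
      = (\<Sum>j. (2 / pi) * (\<integral>t. (1 - cos t) powr (- 1 / 2) * sin t * sin (real (d + 2 * j + 1) * t) \<partial>T) / real q ^ j)"
  proof (rule Kf_eq_suminf)
    fix t :: real
    let ?c = "1 - cos t"
    have "(?c powr (- 1 / 2) * sin t)\<^sup>2 = \<bar>?c * (?c powr (- 1 / 2))\<^sup>2\<bar> * (1 + cos t)"
      using one_minus_cos_bounds[of t] by (simp add: power_mult_distrib sin_sq_eq abs_mult mult_ac)
    also have "\<dots> \<le> 1 * 2"
      using powr_half_bounds(2)[OF one_minus_cos_bounds[of t]] cos_le_one[of t] cos_ge_minus_one[of t]
      by (intro mult_mono) linarith+
    finally have "\<bar>?c powr (- 1 / 2) * sin t\<bar>\<^sup>2 \<le> 2\<^sup>2" by simp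
    then show "\<bar>?c powr (- 1 / 2) * sin t\<bar> \<le> 2" by (rule power2_le_imp_le) simp
  qed measurable
  then show "Kf (\<lambda>t. t powr (- 1 / 2)) d = Fb d"
    unfolding integral_T_b[of "d + 2 * _"] Fb_def .
qed


section \<open>Operators with radial kernels and positivity of the spectral density\<close>

definition Op :: "(nat \<Rightarrow> real) \<Rightarrow> ('v \<Rightarrow> complex) \<Rightarrow> 'v \<Rightarrow> complex" where
  "Op F f x = (\<integral>y. complex_of_real (ker F x y) * f y \<partial>M)"

definition A :: "('v \<Rightarrow> complex) \<Rightarrow> 'v \<Rightarrow> complex" where
  "A u x = u x - J u x"

lemma Op_fs: "fs f \<Longrightarrow> Op F f x = (\<Sum>y | f y \<noteq> 0. complex_of_real (w y) * (f y * complex_of_real (ker F x y)))"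
  unfolding Op_def
  by (subst integral_finite_support[of "{y. f y \<noteq> 0}"]) (auto simp: fs_def scaleR_conv_of_real mult_ac)

lemma Op_fs_on:
  assumes "finite S" "{x. f x \<noteq> 0} \<subseteq> S"
  shows "Op F f x = (\<Sum>y\<in>S. complex_of_real (w y) * (f y * complex_of_real (ker F x y)))"
proof -
  have "fs f" using assms finite_subset by (auto simp: fs_def)
  then show ?thesis unfolding Op_fs[OF \<open>fs f\<close>]
    by (intro sum.mono_neutral_left) (use assms in auto)
qed

lemma J_zero [simp]: "J (\<lambda>x. 0) = (\<lambda>x. 0)"
  by (auto simp: J_def)

lemma J_add: "J (\<lambda>x. u x + v x) = (\<lambda>x. J u x + J v x)"
  by (auto simp: J_def sum.distrib scaleR_add_right)

lemma J_scale: "J (\<lambda>x. c * u x) = (\<lambda>x. c * J u x)" for c :: complex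
  by (auto simp: J_def scaleR_conv_of_real distrib_left mult_ac simp flip: sum_distrib_left)

lemma J_sum: "J (\<lambda>x. \<Sum>i\<in>I. u i x) = (\<lambda>x. \<Sum>i\<in>I. J (u i) x)"
  by (induction I rule: infinite_finite_induct) (auto simp: J_add)

lemma J_of_real: "J (\<lambda>x. complex_of_real (u x)) x = complex_of_real (J u x)"
  by (simp add: J_def scaleR_conv_of_real)

lemma J_Op: "fs f \<Longrightarrow> J (Op F f) = Op (jac F) f"
proof
  fix x assume f: "fs f"
  have "J (\<lambda>x. \<Sum>y | f y \<noteq> 0. (complex_of_real (w y) * f y) * complex_of_real (ker F x y)) x = (\<Sum>y | f y \<noteq> 0. (complex_of_real (w y) * f y) * complex_of_real (ker (jac F) x y))"
    unfolding J_sum J_scale J_of_real J_ker ..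
  then show "J (Op F f) x = Op (jac F) f x"
    using f by (simp add: Op_fs[OF f, abs_def] mult.assoc)
qed

lemma Op_lin: "fs f \<Longrightarrow> Op (\<lambda>d. F d - G d) f x = Op F f x - Op G f x"
  by (simp add: Op_fs ker_def diff_divide_distrib right_diff_distrib sum_subtractf)

lemma A_Op:
  assumes "fs f" "good \<phi>"
  shows "A (Op (Kf \<phi>) f) = Op (Kf (\<lambda>t. t * \<phi> t)) f"
proof
  fix x
  have "jac (Kf \<phi>) = (\<lambda>d. Kf \<phi> d - Kf (\<lambda>t. t * \<phi> t) d)"
    using jac_Kf[OF assms(2)] by auto
  then show "A (Op (Kf \<phi>) f) x = Op (Kf (\<lambda>t. t * \<phi> t)) f x"
    unfolding A_def J_Op[OF assms(1)] by (simp add: Op_lin[OF assms(1)])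
qed

lemma ker_one: "ker (\<lambda>d. if d = 0 then 1 else 0) x y = (if x = y then 1 / w x else 0)"
  by (auto simp: ker_def dd_eq_0 apx_def) (metis add_is_0 dd_def dd_eq_0 funpow_0)

lemma Op_one: "Op (Kf (\<lambda>t. 1)) f = f"
proof
  fix x
  have "Op (Kf (\<lambda>t. 1)) f x = (\<Sum>y\<in>{x}. w y *\<^sub>R (ker (Kf (\<lambda>t. 1)) x y * f y))"
    unfolding Op_def by (rule integral_finite_support) (auto simp: Kf_one[abs_def] ker_one)
  then show "Op (Kf (\<lambda>t. 1)) f x = f x"
    by (simp add: Kf_one[abs_def] ker_one scaleR_conv_of_real)
qed

lemma ip_Op:
  assumes "finite S" "{x. f x \<noteq> 0} \<subseteq> S" "{x. g x \<noteq> 0} \<subseteq> S"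
  shows "ip (Op F f) g = (\<Sum>x\<in>S. \<Sum>y\<in>S. complex_of_real (w x * w y * ker F x y) * (f y * cnj (g x)))"
    "ip g (Op F f) = (\<Sum>x\<in>S. \<Sum>y\<in>S. complex_of_real (w x * w y * ker F x y) * (g x * cnj (f y)))"
  unfolding L2_inner_def
  by (subst integral_finite_support[OF assms(1)];
      (use assms in fastforce)?;
      simp add: Op_fs_on[OF assms(1,2)] scaleR_conv_of_real sum_distrib_left sum_distrib_right mult_ac)+

lemma Op_symmetric_fs:
  assumes "fs f" "fs g"
  shows "ip (Op F f) g = ip f (Op F g)"
proof -
  define S where "S = {x. f x \<noteq> 0} \<union> {x. g x \<noteq> 0}"
  have S: "finite S" "{x. f x \<noteq> 0} \<subseteq> S" "{x. g x \<noteq> 0} \<subseteq> S"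
    using assms by (auto simp: S_def fs_def)
  have "ip f (Op F g) = (\<Sum>y\<in>S. \<Sum>x\<in>S. complex_of_real (w x * w y * ker F x y) * (f x * cnj (g y)))"
    unfolding ip_Op(2)[OF S(1,3,2)] by (rule sum.swap)
  also have "\<dots> = ip (Op F f) g"
    unfolding ip_Op(1)[OF S] by (intro sum.cong refl) (simp add: ker_sym[of F] mult_ac)
  finally show ?thesis ..
qed

lemma Op_real: "fs f \<Longrightarrow> ip (Op F f) f = complex_of_real (Re (ip (Op F f) f))"
  using Op_symmetric_fs[of f f F] ip_cnj[of "Op F f" f] by (simp add: complex_eq_iff)

lemma ip_Op_Kf:
  assumes "fs f" "fs g" "good \<phi>"
  shows "integrable T (\<lambda>t. complex_of_real (\<phi> (1 - cos t)) * ip (Op (Fd t) f) g)"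
    "ip (Op (Kf \<phi>) f) g = (\<integral>t. complex_of_real (\<phi> (1 - cos t)) * ip (Op (Fd t) f) g \<partial>T)"
proof -
  define S where "S = {x. f x \<noteq> 0} \<union> {x. g x \<noteq> 0}"
  have S: "finite S" "{x. f x \<noteq> 0} \<subseteq> S" "{x. g x \<noteq> 0} \<subseteq> S"
    using assms(1,2) by (auto simp: S_def fs_def)
  have eq: "complex_of_real (\<phi> (1 - cos t)) * ip (Op (Fd t) f) g
      = (\<Sum>x\<in>S. \<Sum>y\<in>S. complex_of_real (\<phi> (1 - cos t) * Fd t (dd x y)) * (complex_of_real (w x * w y / w (apx x y)) * (f y * cnj (g x))))" for t
    unfolding ip_Op(1)[OF S] by (simp add: sum_distrib_left ker_def mult_ac)
  have int: "integrable T (\<lambda>t. complex_of_real (\<phi> (1 - cos t) * Fd t (dd x y)) * (complex_of_real (w x * w y / w (apx x y)) * (f y * cnj (g x))))" for x y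
    using Kf_integrable[OF assms(3), of "dd x y"] by (intro integrable_mult_left integrable_of_real)
  show "integrable T (\<lambda>t. complex_of_real (\<phi> (1 - cos t)) * ip (Op (Fd t) f) g)"
    unfolding eq by (intro Bochner_Integration.integrable_sum int)
  have "(\<integral>t. complex_of_real (\<phi> (1 - cos t)) * ip (Op (Fd t) f) g \<partial>T)
      = (\<Sum>x\<in>S. \<Sum>y\<in>S. \<integral>t. complex_of_real (\<phi> (1 - cos t) * Fd t (dd x y)) * (complex_of_real (w x * w y / w (apx x y)) * (f y * cnj (g x))) \<partial>T)"
  proof -
    let ?h = "\<lambda>x y t. complex_of_real (\<phi> (1 - cos t) * Fd t (dd x y)) * (complex_of_real (w x * w y / w (apx x y)) * (f y * cnj (g x)))"
    have "(\<integral>t. (\<Sum>x\<in>S. \<Sum>y\<in>S. ?h x y t) \<partial>T) = (\<Sum>x\<in>S. \<integral>t. (\<Sum>y\<in>S. ?h x y t) \<partial>T)"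
      by (rule Bochner_Integration.integral_sum) (intro Bochner_Integration.integrable_sum int)
    also have "\<dots> = (\<Sum>x\<in>S. \<Sum>y\<in>S. \<integral>t. ?h x y t \<partial>T)"
      by (rule sum.cong[OF refl], rule Bochner_Integration.integral_sum) (rule int)
    finally show ?thesis unfolding eq .
  qed
  also have "\<dots> = (\<Sum>x\<in>S. \<Sum>y\<in>S. complex_of_real (Kf \<phi> (dd x y)) * (complex_of_real (w x * w y / w (apx x y)) * (f y * cnj (g x))))"
    by (simp add: Kf_def del: of_real_mult)
  also have "\<dots> = ip (Op (Kf \<phi>) f) g"
    unfolding ip_Op(1)[OF S] by (simp add: ker_def mult_ac)
  finally show "ip (Op (Kf \<phi>) f) g = (\<integral>t. complex_of_real (\<phi> (1 - cos t)) * ip (Op (Fd t) f) g \<partial>T)" ..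
qed

text \<open>Density, in the angle \<open>t\<close>, of the spectral measure of a finitely supported
  \<open>f\<close>. The formula shows continuity but not the sign, which is proved in
  \<open>\<rho>_nonneg\<close>.\<close>

definition \<rho> :: "('v \<Rightarrow> complex) \<Rightarrow> real \<Rightarrow> real" where
  "\<rho> f t = Re (ip (Op (Fd t) f) f)"

lemma \<rho>_eq: "fs f \<Longrightarrow> complex_of_real (\<rho> f t) = ip (Op (Fd t) f) f"
  unfolding \<rho>_def using Op_real by metis

lemma \<rho>_integral:
  assumes "fs f" "good \<phi>"
  shows "integrable T (\<lambda>t. \<phi> (1 - cos t) * \<rho> f t)"
    "Re (ip (Op (Kf \<phi>) f) f) = (\<integral>t. \<phi> (1 - cos t) * \<rho> f t \<partial>T)"
proof -
  have *: "integrable T (\<lambda>t. complex_of_real (\<phi> (1 - cos t) * \<rho> f t))"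
    using ip_Op_Kf(1)[OF assms(1,1,2)] \<rho>_eq[OF assms(1)] by simp
  show "integrable T (\<lambda>t. \<phi> (1 - cos t) * \<rho> f t)"
    using integrable_Re[OF *] by simp
  have "ip (Op (Kf \<phi>) f) f = (\<integral>t. complex_of_real (\<phi> (1 - cos t) * \<rho> f t) \<partial>T)"
    using ip_Op_Kf(2)[OF assms(1,1,2)] \<rho>_eq[OF assms(1)] by simp
  then show "Re (ip (Op (Kf \<phi>) f) f) = (\<integral>t. \<phi> (1 - cos t) * \<rho> f t \<partial>T)"
    by (simp del: of_real_mult)
qed

lemma continuous_\<rho>: "fs f \<Longrightarrow> continuous_on UNIV (\<rho> f)"
proof -
  assume f: "fs f"
  define S where "S = {x. f x \<noteq> 0}"
  have S: "finite S" "{x. f x \<noteq> 0} \<subseteq> S"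
    using f by (auto simp: S_def fs_def)
  show ?thesis
    unfolding \<rho>_def[abs_def] ip_Op(1)[OF S(1,2,2)] ker_def
    by (intro continuous_intros continuous_Fd) auto
qed

lemma A_fs: "fs f \<Longrightarrow> fs (A f)"
  using fs_diff[OF _ fs_J] by (simp add: A_def[abs_def])

lemma A_L2: "f \<in> Lp M 2 \<Longrightarrow> A f \<in> Lp M 2"
  using L2_diff[OF _ J_L2(1)] by (simp add: A_def[abs_def])

lemma A_self_adjoint:
  assumes "f \<in> Lp M 2" "g \<in> Lp M 2"
  shows "ip (A f) g = ip f (A g)"
  unfolding A_def[abs_def]
  using assms J_L2(1) by (simp add: ip_diff_left ip_diff_right J_self_adjoint)

lemma A_pow_fs: "fs f \<Longrightarrow> fs ((A ^^ n) f)"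
  by (induction n) (auto simp: A_fs)

lemma A_pow_self_adjoint_fs:
  "fs f \<Longrightarrow> fs g \<Longrightarrow> ip ((A ^^ n) f) g = ip f ((A ^^ n) g)"
proof (induction n arbitrary: g)
  case (Suc n)
  then show ?case
    using A_self_adjoint[OF fs_L2[OF A_pow_fs[OF Suc.prems(1)]] fs_L2[OF Suc.prems(2)]]
      Suc.IH[OF Suc.prems(1) A_fs[OF Suc.prems(2)]]
    by (simp add: funpow_swap1)
qed simp

definition PA :: "(nat \<Rightarrow> real) \<Rightarrow> nat \<Rightarrow> ('v \<Rightarrow> complex) \<Rightarrow> 'v \<Rightarrow> complex" where
  "PA a n u x = (\<Sum>i\<le>n. complex_of_real (a i) * (A ^^ i) u x)"

lemma PA_fs: "fs f \<Longrightarrow> fs (PA a n f)"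
  unfolding PA_def[abs_def] by (intro fs_sum fs_scale A_pow_fs)

lemma ip_sum_left:
  "(\<And>i. i \<in> I \<Longrightarrow> f i \<in> Lp M 2) \<Longrightarrow> g \<in> Lp M 2 \<Longrightarrow> ip (\<lambda>x. \<Sum>i\<in>I. f i x) g = (\<Sum>i\<in>I. ip (f i) g)"
proof (induction I rule: infinite_finite_induct)
  case (insert x F)
  then show ?case using ip_add_left[of "f x" "\<lambda>y. \<Sum>i\<in>F. f i y" g] L2_sum[of F f] by simp
qed (simp_all add: L2_inner_def)

lemma PA_self_adjoint_fs:
  assumes "fs f" "fs g"
  shows "ip (PA a n f) g = ip f (PA a n g)"
proof -
  have *: "ip (PA a n f) g = (\<Sum>i\<le>n. complex_of_real (a i) * ip ((A ^^ i) f) g)" if "fs f" "fs g" for f g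
    unfolding PA_def[abs_def]
    using that by (subst ip_sum_left) (auto intro: L2_scale fs_L2 A_pow_fs simp: ip_scale_left)
  have "ip f (PA a n g) = cnj (ip (PA a n g) f)" by (rule ip_cnj)
  also have "\<dots> = (\<Sum>i\<le>n. complex_of_real (a i) * cnj (ip ((A ^^ i) g) f))"
    unfolding *[OF assms(2,1)] by simp
  also have "\<dots> = (\<Sum>i\<le>n. complex_of_real (a i) * ip ((A ^^ i) f) g)"
    unfolding A_pow_self_adjoint_fs[OF assms] by (simp only: ip_cnj[symmetric])
  finally show ?thesis using *[OF assms] by simp
qed

lemma A_pow_Op:
  assumes "fs f" "good \<phi>"
  shows "(A ^^ i) (Op (Kf \<phi>) f) = Op (Kf (\<lambda>t. t ^ i * \<phi> t)) f \<and> good (\<lambda>t. t ^ i * \<phi> t)"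
proof (induction i)
  case (Suc i)
  then show ?case
    using A_Op[OF assms(1), of "\<lambda>t. t ^ i * \<phi> t"] good_mult_id[of "\<lambda>t. t ^ i * \<phi> t"]
    by (simp add: mult.assoc)
qed (use assms in simp)

lemma PA_Op:
  assumes "fs f" "good \<phi>"
  shows "PA a n (Op (Kf \<phi>) f) = Op (Kf (\<lambda>t. (\<Sum>i\<le>n. a i * t ^ i) * \<phi> t)) f"
    "good (\<lambda>t. (\<Sum>i\<le>n. a i * t ^ i) * \<phi> t)"
proof -
  have g: "good (\<lambda>t. a i * (t ^ i * \<phi> t))" for i
    using A_pow_Op[OF assms] by (intro good_scale) blast
  have eq: "(\<Sum>i\<le>n. a i * t ^ i) * \<phi> t = (\<Sum>i\<le>n. a i * (t ^ i * \<phi> t))" for t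
    by (simp add: sum_distrib_right mult.assoc)
  show "good (\<lambda>t. (\<Sum>i\<le>n. a i * t ^ i) * \<phi> t)"
    unfolding eq by (intro good_sum g)
  have K: "Kf (\<lambda>t. (\<Sum>i\<le>n. a i * t ^ i) * \<phi> t) d = (\<Sum>i\<le>n. a i * Kf (\<lambda>t. t ^ i * \<phi> t) d)" for d
    unfolding eq by (subst Kf_sum) (auto simp: g Kf_scale)
  show "PA a n (Op (Kf \<phi>) f) = Op (Kf (\<lambda>t. (\<Sum>i\<le>n. a i * t ^ i) * \<phi> t)) f"
  proof
    fix x
    have "PA a n (Op (Kf \<phi>) f) x = (\<Sum>i\<le>n. complex_of_real (a i) * (\<Sum>y | f y \<noteq> 0. complex_of_real (w y) * (f y * complex_of_real (ker (Kf (\<lambda>t. t ^ i * \<phi> t)) x y))))"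
      unfolding PA_def A_pow_Op[OF assms, THEN conjunct1] Op_fs[OF assms(1)] ..
    also have "\<dots> = (\<Sum>y | f y \<noteq> 0. \<Sum>i\<le>n. complex_of_real (a i) * (complex_of_real (w y) * (f y * complex_of_real (ker (Kf (\<lambda>t. t ^ i * \<phi> t)) x y))))"
      unfolding sum_distrib_left by (rule sum.swap)
    also have "\<dots> = (\<Sum>y | f y \<noteq> 0. complex_of_real (w y) * (f y * complex_of_real (ker (Kf (\<lambda>t. (\<Sum>i\<le>n. a i * t ^ i) * \<phi> t)) x y)))"
      by (intro sum.cong refl)
        (simp only: ker_def K, simp add: sum_divide_distrib sum_distrib_left mult_ac)
    finally show "PA a n (Op (Kf \<phi>) f) x = Op (Kf (\<lambda>t. (\<Sum>i\<le>n. a i * t ^ i) * \<phi> t)) f x"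
      unfolding Op_fs[OF assms(1)] .
  qed
qed

lemma PA_eq_Op:
  assumes "fs f"
  shows "PA a n f = Op (Kf (\<lambda>t. \<Sum>i\<le>n. a i * t ^ i)) f"
    "good (\<lambda>t. \<Sum>i\<le>n. a i * t ^ i)"
  using PA_Op[OF assms good_power[of 0], of a n] by (simp_all add: Op_one)

text \<open>Polynomials in \<open>A\<close> are self-adjoint, so squares move to one side and become
  symbols. The first identity makes the density positive, the second bounds gradients.\<close>

lemma ip_PA_A_PA:
  assumes "fs f"
  shows "Re (ip (PA a n f) (PA a n f)) = (\<integral>t. (\<Sum>i\<le>n. a i * (1 - cos t) ^ i)\<^sup>2 * \<rho> f t \<partial>T)"
    "Re (ip (A (PA a n f)) (PA a n f)) = (\<integral>t. (1 - cos t) * (\<Sum>i\<le>n. a i * (1 - cos t) ^ i)\<^sup>2 * \<rho> f t \<partial>T)"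
proof -
  let ?P = "\<lambda>t. \<Sum>i\<le>n. a i * t ^ i"
  note P = PA_eq_Op[OF assms, of a n]
  note PP = PA_Op[OF assms P(2), of a n]
  have "ip (PA a n f) (PA a n f) = ip (PA a n (PA a n f)) f"
    by (rule PA_self_adjoint_fs[OF PA_fs[OF assms] assms, symmetric])
  also have "PA a n (PA a n f) = Op (Kf (\<lambda>t. ?P t * ?P t)) f"
    using PP(1) P(1) by simp
  finally show "Re (ip (PA a n f) (PA a n f)) = (\<integral>t. (?P (1 - cos t))\<^sup>2 * \<rho> f t \<partial>T)"
    using \<rho>_integral(2)[OF assms PP(2)] by (simp add: power2_eq_square)
  have AP: "A (PA a n f) = Op (Kf (\<lambda>t. t * ?P t)) f"
    using A_Op[OF assms P(2)] P(1) by simp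
  note PP2 = PA_Op[OF assms good_mult_id[OF P(2)], of a n]
  have "ip (A (PA a n f)) (PA a n f) = ip (PA a n (A (PA a n f))) f"
    by (rule PA_self_adjoint_fs[OF A_fs[OF PA_fs[OF assms]] assms, symmetric])
  also have "PA a n (A (PA a n f)) = Op (Kf (\<lambda>t. ?P t * (t * ?P t))) f"
    using PP2(1) AP by simp
  finally show "Re (ip (A (PA a n f)) (PA a n f)) = (\<integral>t. (1 - cos t) * (?P (1 - cos t))\<^sup>2 * \<rho> f t \<partial>T)"
    using \<rho>_integral(2)[OF assms PP2(2)] by (simp add: power2_eq_square mult_ac)
qed

lemma nrm2_eq_integral_\<rho>:
  assumes "fs f"
  shows "nrm2 f = (\<integral>t. \<rho> f t \<partial>T)" "integrable T (\<rho> f)"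
  using \<rho>_integral[OF assms good_power[of 0]] by (simp_all add: Op_one ip_self)

text \<open>If \<open>\<phi>\<close> is the square of a polynomial \<open>P\<close>, the integral is
  the squared norm of \<open>P\<close> of \<open>A\<close> applied to \<open>f\<close>. In general
  \<open>sqrt (\<phi> t)\<close> is approximated uniformly by polynomials.\<close>

lemma integral_\<rho>_nonneg:
  assumes f: "fs f" and cont: "continuous_on {0..2} \<phi>" and pos: "\<And>t. t \<in> {0..2} \<Longrightarrow> \<phi> t \<ge> 0"
    and good: "good \<phi>"
  shows "(\<integral>t. \<phi> (1 - cos t) * \<rho> f t \<partial>T) \<ge> 0"
proof (rule field_le_epsilon[of 0])
  fix e :: real assume e: "e > 0"
  define K where "K = (\<integral>t. \<bar>\<rho> f t\<bar> \<partial>T)"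
  have K: "K \<ge> 0" by (simp add: K_def)
  have "compact (\<phi> ` {0..2})" by (intro compact_continuous_image cont) simp
  then obtain S where S: "\<And>t. t \<in> {0..2} \<Longrightarrow> \<bar>\<phi> t\<bar> \<le> S"
    using compact_imp_bounded bounded_iff by (metis (no_types, lifting) imageI real_norm_def)
  have S0: "S \<ge> 0" using S[of 0] by simp
  \<comment> \<open>\<open>X\<close> collects the error: \<open>\<phi> - P\<^sup>2\<close> factors,
    and \<open>sqrt \<phi> + P\<close> is at most \<open>2 * sqrt S + 1\<close> once
    \<open>d \<le> 1\<close>. The added ones keep \<open>X\<close> positive.\<close>
  define X where "X = (2 * sqrt S + 1) * (K + 1)"
  define d where "d = min 1 (e / X)"
  have X: "X > 0" using S0 K by (simp add: X_def add_nonneg_pos)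
  have "d \<le> e / X" by (simp add: d_def)
  then have "d * X \<le> e" using X by (simp add: pos_le_divide_eq)
  then have d: "d > 0" "d \<le> 1" "d * ((2 * sqrt S + 1) * (K + 1)) \<le> e"
    using e X by (simp_all add: d_def flip: X_def)
  have "continuous_on {0..2} (\<lambda>t. sqrt (\<phi> t))" by (intro continuous_intros cont)
  then obtain a n where P: "\<And>t. t \<in> {0..2} \<Longrightarrow> \<bar>sqrt (\<phi> t) - (\<Sum>i\<le>n. a i * t ^ i)\<bar> < d"
    using poly_approx d(1) by blast
  let ?P = "\<lambda>t. \<Sum>i\<le>n. a i * t ^ i"
  have close: "\<bar>\<phi> t - (?P t)\<^sup>2\<bar> \<le> d * (2 * sqrt S + 1)" if t: "t \<in> {0..2}" for t
  proof -
    have sq: "(sqrt (\<phi> t))\<^sup>2 = \<phi> t" using pos[OF t] by simp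
    have "\<bar>\<phi> t - (?P t)\<^sup>2\<bar> = \<bar>sqrt (\<phi> t) - ?P t\<bar> * \<bar>sqrt (\<phi> t) + ?P t\<bar>"
      by (subst sq[symmetric]) (simp add: power2_eq_square algebra_simps flip: abs_mult)
    also have "\<dots> \<le> d * (2 * sqrt S + 1)"
    proof (rule mult_mono)
      have "sqrt (\<phi> t) \<le> sqrt S" using S[OF t] by simp
      moreover have "sqrt (\<phi> t) \<ge> 0" using pos[OF t] by simp
      ultimately show "\<bar>sqrt (\<phi> t) + ?P t\<bar> \<le> 2 * sqrt S + 1"
        using P[OF t] d(2) by linarith
    qed (use P[OF t] d in auto)
    finally show ?thesis .
  qed
  note PP = PA_Op[OF f PA_eq_Op(2)[OF f, of a n], of a n]
  have int: "integrable T (\<lambda>t. (?P (1 - cos t))\<^sup>2 * \<rho> f t)"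
    using \<rho>_integral(1)[OF f PP(2)] by (simp add: power2_eq_square)
  have "0 \<le> (\<integral>t. (?P (1 - cos t))\<^sup>2 * \<rho> f t \<partial>T)"
    unfolding ip_PA_A_PA(1)[OF f, symmetric] by (simp add: ip_self)
  also have "\<dots> \<le> (\<integral>t. \<phi> (1 - cos t) * \<rho> f t + d * (2 * sqrt S + 1) * \<bar>\<rho> f t\<bar> \<partial>T)"
  proof (rule integral_mono[OF int])
    show "integrable T (\<lambda>t. \<phi> (1 - cos t) * \<rho> f t + d * (2 * sqrt S + 1) * \<bar>\<rho> f t\<bar>)"
      using \<rho>_integral(1)[OF f good] nrm2_eq_integral_\<rho>(2)[OF f] by auto
    fix t
    have "((?P (1 - cos t))\<^sup>2 - \<phi> (1 - cos t)) * \<rho> f t \<le> \<bar>\<phi> (1 - cos t) - (?P (1 - cos t))\<^sup>2\<bar> * \<bar>\<rho> f t\<bar>"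
      using abs_ge_self[of "((?P (1 - cos t))\<^sup>2 - \<phi> (1 - cos t)) * \<rho> f t"]
      by (simp only: abs_mult abs_minus_commute[of "\<phi> (1 - cos t)"])
    also have "\<dots> \<le> d * (2 * sqrt S + 1) * \<bar>\<rho> f t\<bar>"
      by (intro mult_right_mono close one_minus_cos_bounds) simp
    finally show "(?P (1 - cos t))\<^sup>2 * \<rho> f t \<le> \<phi> (1 - cos t) * \<rho> f t + d * (2 * sqrt S + 1) * \<bar>\<rho> f t\<bar>"
      by (simp add: left_diff_distrib)
  qed
  also have "\<dots> = (\<integral>t. \<phi> (1 - cos t) * \<rho> f t \<partial>T) + d * (2 * sqrt S + 1) * K"
    using \<rho>_integral(1)[OF f good] nrm2_eq_integral_\<rho>(2)[OF f] by (simp add: K_def)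
  also have "d * (2 * sqrt S + 1) * K \<le> d * ((2 * sqrt S + 1) * (K + 1))"
    using d S0 by (simp add: mult.assoc mult_left_mono)
  finally show "0 \<le> (\<integral>t. \<phi> (1 - cos t) * \<rho> f t \<partial>T) + e" using d(3) by linarith
qed

text \<open>The negative part of the density, written as a function of \<open>1 - cos t\<close>, is
  an admissible test function. It gives minus the integral of its own square, which is nonnegative
  only if this continuous function vanishes.\<close>

lemma \<rho>_nonneg:
  assumes f: "fs f" and t: "t \<in> {0..pi}"
  shows "\<rho> f t \<ge> 0"
proof -
  define g where "g t = max 0 (- \<rho> f t)" for t
  have g: "continuous_on UNIV g" unfolding g_def by (intro continuous_intros continuous_\<rho> f)
  \<comment> \<open>Clamping the argument of \<open>arccos\<close> makes \<open>\<phi>\<close>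
    continuous, hence Borel, on the whole line.\<close>
  define \<phi> where "\<phi> s = g (arccos (max (-1) (min 1 (1 - s))))" for s
  have \<phi>: "continuous_on UNIV \<phi>" unfolding \<phi>_def
    by (rule continuous_on_compose2[OF g]) (auto intro!: continuous_intros)
  then have [measurable]: "\<phi> \<in> borel_measurable borel" by (rule borel_measurable_continuous_onI)
  have "compact (\<phi> ` {0..2})"
    by (intro compact_continuous_image continuous_on_subset[OF \<phi>]) auto
  then obtain S where S: "\<And>t. t \<in> {0..2} \<Longrightarrow> \<bar>\<phi> t\<bar> \<le> S"
    using compact_imp_bounded bounded_iff by (metis (no_types, lifting) imageI real_norm_def)
  have good: "good \<phi>" by (rule good_boundedI[where s = S]) (use S in auto)
  have eq: "\<phi> (1 - cos t) = g t" if "t \<in> {0..pi}" for t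
    using that cos_ge_minus_one[of t] cos_le_one[of t] by (simp add: \<phi>_def arccos_cos)
  have "0 \<le> (\<integral>t. \<phi> (1 - cos t) * \<rho> f t \<partial>T)"
    by (rule integral_\<rho>_nonneg[OF f continuous_on_subset[OF \<phi>] _ good]) (auto simp: \<phi>_def g_def)
  also have "\<dots> = (\<integral>t. - (g t * g t) \<partial>T)"
    by (rule Bochner_Integration.integral_cong) (auto simp: eq g_def)
  also have "\<dots> = - (LINT t:{0..pi}|lborel. g t * g t)"
    unfolding T_def set_lebesgue_integral_def by (subst integral_restrict_space) auto
  also have "(LINT t:{0..pi}|lborel. g t * g t) = integral {0..pi} (\<lambda>t. g t * g t)"
    by (rule set_borel_integral_eq_integral(2), rule borel_integrable_atLeastAtMost')
      (intro continuous_intros continuous_on_subset[OF g] subset_UNIV)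
  finally have "integral {0..pi} (\<lambda>t. g t * g t) \<le> 0" by simp
  moreover have "integral {0..pi} (\<lambda>t. g t * g t) \<ge> 0"
    by (rule Henstock_Kurzweil_Integration.integral_nonneg)
      (auto intro!: integrable_continuous_interval continuous_intros continuous_on_subset[OF g])
  ultimately have "integral {0..pi} (\<lambda>t. g t * g t) = 0" by simp
  then have "\<forall>t\<in>{0..pi}. g t * g t = 0"
    by (subst (asm) integral_eq_0_iff)
      (auto intro!: continuous_intros continuous_on_subset[OF g])
  then have "g t = 0" using t by auto
  then show ?thesis by (simp add: g_def max_def split: if_splits)
qed


lemma fs_Op_integrable: "fs f \<Longrightarrow> integrable M (\<lambda>y. complex_of_real (ker F x y) * f y)"
  using fs_integrable[of f "\<lambda>y. complex_of_real (ker F x y)"] by (simp add: mult.commute)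

lemma Op_scale: "Op F (\<lambda>x. c * f x) = (\<lambda>x. c * Op F f x)"
  unfolding Op_def[abs_def] by (simp add: mult.left_commute)

lemma Op_diff_fs: "fs f \<Longrightarrow> fs g \<Longrightarrow> Op F (\<lambda>x. f x - g x) = (\<lambda>x. Op F f x - Op F g x)"
  unfolding Op_def[abs_def] by (simp add: right_diff_distrib fs_Op_integrable)

lemma ip_Op_diff:
  assumes "fs f" "fs g" "fs h"
  shows "ip (Op F (\<lambda>x. f x - g x)) h = ip (Op F f) h - ip (Op F g) h"
proof -
  have "ip (\<lambda>x. f x - g x) (Op F h) = ip f (Op F h) - ip g (Op F h)"
    unfolding L2_inner_def
    using fs_integrable[OF assms(1)] fs_integrable[OF assms(2)] by (simp add: left_diff_distrib)
  then show ?thesis using assms fs_diff[OF assms(1,2)] by (simp add: Op_symmetric_fs)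
qed

lemma \<rho>_scale: "\<rho> (\<lambda>x. c * f x) t = (cmod c)\<^sup>2 * \<rho> f t"
proof -
  have "ip (Op (Fd t) (\<lambda>x. c * f x)) (\<lambda>x. c * f x) = complex_of_real ((cmod c)\<^sup>2) * ip (Op (Fd t) f) f"
    unfolding Op_scale ip_scale_left ip_scale_right complex_norm_square by (simp add: mult_ac)
  then show ?thesis by (simp add: \<rho>_def del: of_real_power)
qed

text \<open>Expansion of the nonnegative density of \<open>\<lambda>x. f x - g x\<close>.\<close>

lemma density_bound_aux:
  assumes "fs f" "fs g" "t \<in> {0..pi}"
  shows "2 * Re (ip (Op (Fd t) f) g) \<le> \<rho> f t + \<rho> g t"
proof -
  let ?K = "Op (Fd t)" and ?h = "\<lambda>x. f x - g x"
  have h: "fs ?h" using assms by (intro fs_diff)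
  have r: "ip (?K u) ?h = ip (?K u) f - ip (?K u) g" if "fs u" for u
  proof -
    have "ip (?K u) ?h = ip u (?K ?h)" by (rule Op_symmetric_fs[OF that h])
    also have "\<dots> = cnj (ip (?K ?h) u)" by (rule ip_cnj)
    also have "\<dots> = cnj (ip (?K f) u) - cnj (ip (?K g) u)"
      unfolding ip_Op_diff[OF assms(1,2) that] by simp
    also have "\<dots> = ip u (?K f) - ip u (?K g)" by (simp only: ip_cnj[symmetric])
    finally show ?thesis using Op_symmetric_fs[OF that assms(1)] Op_symmetric_fs[OF that assms(2)] by simp
  qed
  have sym: "ip (?K g) f = cnj (ip (?K f) g)"
    unfolding Op_symmetric_fs[OF assms(2,1)] by (rule ip_cnj)
  have "\<rho> ?h t = Re (ip (?K f) f - ip (?K f) g - (ip (?K g) f - ip (?K g) g))"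
    unfolding \<rho>_def ip_Op_diff[OF assms(1,2) h] r[OF assms(1)] r[OF assms(2)] ..
  also have "\<dots> = \<rho> f t + \<rho> g t - 2 * Re (ip (?K f) g)"
    by (simp add: sym \<rho>_def)
  finally show ?thesis using \<rho>_nonneg[OF h assms(3)] by linarith
qed

lemma density_bound:
  assumes "fs f" "fs g" "t \<in> {0..pi}" "s > 0"
  shows "cmod (ip (Op (Fd t) f) g) \<le> (s * \<rho> f t + \<rho> g t / s) / 2"
proof -
  let ?z = "ip (Op (Fd t) f) g"
  \<comment> \<open>The phase \<open>u\<close> turns the form into its modulus; the factors
    \<open>sqrt s\<close> and \<open>1 / sqrt s\<close> then distribute the parameter.\<close>
  define u where "u = (if ?z = 0 then 1 else cnj ?z / complex_of_real (cmod ?z))"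
  have u: "cmod u = 1" "u * ?z = complex_of_real (cmod ?z)"
  proof -
    show "cmod u = 1" by (simp add: u_def norm_divide)
    have "cnj ?z * ?z = complex_of_real (cmod ?z) * complex_of_real (cmod ?z)"
      using complex_norm_square[of ?z] by (simp add: power2_eq_square mult.commute)
    then show "u * ?z = complex_of_real (cmod ?z)" by (simp add: u_def)
  qed
  define c where "c = complex_of_real (sqrt s) * u"
  define d where "d = complex_of_real (1 / sqrt s)"
  have "2 * Re (ip (Op (Fd t) (\<lambda>x. c * f x)) (\<lambda>x. d * g x)) \<le> \<rho> (\<lambda>x. c * f x) t + \<rho> (\<lambda>x. d * g x) t"
    by (rule density_bound_aux) (use assms in \<open>auto intro: fs_scale\<close>)
  moreover have "ip (Op (Fd t) (\<lambda>x. c * f x)) (\<lambda>x. d * g x) = complex_of_real (cmod ?z)"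
  proof -
    have "ip (Op (Fd t) (\<lambda>x. c * f x)) (\<lambda>x. d * g x) = (c * cnj d) * ?z"
      unfolding Op_scale ip_scale_left ip_scale_right by simp
    also have "c * cnj d = u" using assms(4) by (simp add: c_def d_def)
    finally show ?thesis using u(2) by simp
  qed
  moreover have "(cmod c)\<^sup>2 = s" "(cmod d)\<^sup>2 = 1 / s"
    using assms(4) u(1) by (simp_all add: c_def d_def norm_mult norm_divide power_divide)
  ultimately show ?thesis by (simp add: \<rho>_scale)
qed

section \<open>Functional calculus for bounded Borel symbols\<close>

definition bdd :: "real \<Rightarrow> (real \<Rightarrow> real) \<Rightarrow> bool" where
  "bdd s \<phi> \<longleftrightarrow> \<phi> \<in> borel_measurable borel \<and> (\<forall>t\<in>{0..2}. \<bar>\<phi> t\<bar> \<le> s)"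

lemma bdd_good: "bdd s \<phi> \<Longrightarrow> good \<phi>"
  by (rule good_boundedI[of _ s]) (auto simp: bdd_def)

lemma bdd_nonneg: "bdd s \<phi> \<Longrightarrow> s \<ge> 0"
  unfolding bdd_def using abs_ge_zero[of "\<phi> 0"] by (meson atLeastAtMost_iff order_refl order_trans zero_le_numeral)

text \<open>The pointwise inequality \<open>density_bound\<close> is integrated over the angle with
  a constant parameter and only then optimized. Positivity of the density enters here, and yields
  the norm bound by the supremum of the symbol on \<open>{0..2}\<close>.\<close>

lemma Op_Kf_form_bound:
  assumes "fs f" "fs g" "bdd s \<phi>"
  shows "cmod (ip (Op (Kf \<phi>) f) g) \<le> s * nrm f * nrm g"
proof -
  have s: "s \<ge> 0" using bdd_nonneg[OF assms(3)] .
  note good = bdd_good[OF assms(3)]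
  have "cmod (ip (Op (Kf \<phi>) f) g) \<le> sqrt (s * nrm2 f) * sqrt (s * nrm2 g)"
  proof (rule le_sqrt_mult_sqrt)
    fix c :: real assume c: "c > 0"
    have "cmod (ip (Op (Kf \<phi>) f) g) \<le> (\<integral>t. cmod (complex_of_real (\<phi> (1 - cos t)) * ip (Op (Fd t) f) g) \<partial>T)"
      unfolding ip_Op_Kf(2)[OF assms(1,2) good] by (rule integral_norm_bound)
    also have "\<dots> \<le> (\<integral>t. s * ((c * \<rho> f t + \<rho> g t / c) / 2) \<partial>T)"
    proof (rule integral_mono)
      show "integrable T (\<lambda>t. cmod (complex_of_real (\<phi> (1 - cos t)) * ip (Op (Fd t) f) g))"
        by (rule integrable_norm[OF ip_Op_Kf(1)[OF assms(1,2) good]])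
      show "integrable T (\<lambda>t. s * ((c * \<rho> f t + \<rho> g t / c) / 2))"
        using nrm2_eq_integral_\<rho>(2)[OF assms(1)] nrm2_eq_integral_\<rho>(2)[OF assms(2)] by auto
      fix t assume "t \<in> space T"
      then have "cmod (ip (Op (Fd t) f) g) \<le> (c * \<rho> f t + \<rho> g t / c) / 2"
        using density_bound[OF assms(1,2) _ c] by simp
      moreover have "\<bar>\<phi> (1 - cos t)\<bar> \<le> s" using assms(3) one_minus_cos_bounds by (auto simp: bdd_def)
      ultimately show "cmod (complex_of_real (\<phi> (1 - cos t)) * ip (Op (Fd t) f) g) \<le> s * ((c * \<rho> f t + \<rho> g t / c) / 2)"
        unfolding norm_mult norm_of_real using s by (intro mult_mono) auto
    qed
    also have "\<dots> = (c * (s * nrm2 f) + s * nrm2 g / c) / 2"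
      using nrm2_eq_integral_\<rho>[OF assms(1)] nrm2_eq_integral_\<rho>[OF assms(2)]
      by (simp add: algebra_simps)
    finally show "cmod (ip (Op (Kf \<phi>) f) g) \<le> (c * (s * nrm2 f) + s * nrm2 g / c) / 2" .
  qed (use s in auto)
  also have "\<dots> = s * nrm f * nrm g"
    using s by (simp add: nrm_def real_sqrt_mult)
  finally show ?thesis .
qed

definition kx :: "(nat \<Rightarrow> real) \<Rightarrow> 'v \<Rightarrow> 'v \<Rightarrow> complex" where
  "kx F x y = complex_of_real (ker F x y)"

lemma Op_eq_ip: "Op F f x = ip f (kx F x)"
  unfolding Op_def L2_inner_def kx_def by (simp add: mult.commute)

lemma kx_eq: "kx F x = (\<lambda>y. complex_of_real (1 / w x) * Op F (\<delta> x) y)"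
proof
  fix y
  have "Op F (\<delta> x) y = w x * (\<delta> x x * ker F y x)"
    by (subst Op_fs_on[of "{x}"]) (auto simp: \<delta>_def)
  then show "kx F x y = complex_of_real (1 / w x) * Op F (\<delta> x) y"
    by (simp add: kx_def \<delta>_def ker_sym[of F x])
qed

text \<open>A row of the kernel is, up to the factor \<open>1 / w x\<close>, the operator applied to
  the point mass \<open>\<delta> x\<close>, hence in L2. So \<open>Op\<close> is given on all of L2
  by inner products with the rows.\<close>

lemma kx_L2:
  assumes "bdd s \<phi>"
  shows "kx (Kf \<phi>) x \<in> Lp M 2" "nrm (kx (Kf \<phi>) x) \<le> s * nrm (\<delta> x) / w x"
proof -
  have "cmod (ip (kx (Kf \<phi>) x) h) \<le> s * nrm (\<delta> x) / w x * nrm h" if "fs h" for h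
  proof -
    have "cmod (ip (kx (Kf \<phi>) x) h) = cmod (ip (Op (Kf \<phi>) (\<delta> x)) h) / w x"
      unfolding kx_eq ip_scale_left by (simp add: norm_divide)
    also have "\<dots> \<le> s * nrm (\<delta> x) * nrm h / w x"
      by (intro divide_right_mono Op_Kf_form_bound[OF _ that assms]) auto
    finally show ?thesis by simp
  qed
  then show "kx (Kf \<phi>) x \<in> Lp M 2" "nrm (kx (Kf \<phi>) x) \<le> s * nrm (\<delta> x) / w x"
    using L2_dual[of "s * nrm (\<delta> x) / w x" "kx (Kf \<phi>) x"] bdd_nonneg[OF assms] by auto
qed

lemma nrm_trunc_le: "f \<in> Lp M 2 \<Longrightarrow> nrm (trunc n f) \<le> nrm f"
  unfolding nrm_def nrm2_def
  by (intro real_sqrt_le_mono integral_mono) (use fs_L2[OF fs_trunc] in \<open>auto simp: in_L2_iff trunc_def\<close>)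

lemma trunc_tendsto: "f \<in> Lp M 2 \<Longrightarrow> (\<lambda>n. nrm (\<lambda>x. trunc n f x - f x)) \<longlonglongrightarrow> 0"
  using nrm_trunc_tendsto[of f] by (subst nrm_minus_commute)

lemma Op_trunc_tendsto:
  assumes "f \<in> Lp M 2" "kx F x \<in> Lp M 2"
  shows "(\<lambda>n. Op F (trunc n f) x) \<longlonglongrightarrow> Op F f x"
  unfolding Op_eq_ip by (rule ip_tendsto_left[OF fs_L2[OF fs_trunc] assms(1) trunc_tendsto[OF assms(1)] assms(2)])

lemma Op_Kf_fs_L2:
  assumes "bdd s \<phi>" "fs f"
  shows "Op (Kf \<phi>) f \<in> Lp M 2" "nrm (Op (Kf \<phi>) f) \<le> s * nrm f"
  using L2_dual[of "s * nrm f" "Op (Kf \<phi>) f"] Op_Kf_form_bound[OF assms(2) _ assms(1)] bdd_nonneg[OF assms(1)]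
  by auto

lemma Op_Kf_L2:
  assumes "bdd s \<phi>" "f \<in> Lp M 2"
  shows "Op (Kf \<phi>) f \<in> Lp M 2" "nrm (Op (Kf \<phi>) f) \<le> s * nrm f"
proof -
  have "nrm (Op (Kf \<phi>) (trunc n f)) \<le> s * nrm f" for n
    using Op_Kf_fs_L2(2)[OF assms(1) fs_trunc[of n f]]
      mult_left_mono[OF nrm_trunc_le[OF assms(2), of n] bdd_nonneg[OF assms(1)]] by linarith
  note * = L2_pointwise_limit[OF Op_Kf_fs_L2(1)[OF assms(1) fs_trunc] this
      Op_trunc_tendsto[OF assms(2) kx_L2(1)[OF assms(1)]]]
  show "Op (Kf \<phi>) f \<in> Lp M 2" "nrm (Op (Kf \<phi>) f) \<le> s * nrm f" by (rule *)+
qed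

lemma Op_diff_L2:
  assumes "bdd s \<phi>" "f \<in> Lp M 2" "g \<in> Lp M 2"
  shows "Op (Kf \<phi>) (\<lambda>x. f x - g x) = (\<lambda>x. Op (Kf \<phi>) f x - Op (Kf \<phi>) g x)"
  using assms kx_L2(1)[OF assms(1)] by (auto simp: Op_eq_ip ip_diff_left)

lemma Op_add_L2:
  assumes "bdd s \<phi>" "f \<in> Lp M 2" "g \<in> Lp M 2"
  shows "Op (Kf \<phi>) (\<lambda>x. f x + g x) = (\<lambda>x. Op (Kf \<phi>) f x + Op (Kf \<phi>) g x)"
  using assms kx_L2(1)[OF assms(1)] by (auto simp: Op_eq_ip ip_add_left)

lemma Op_trunc_nrm_tendsto:
  assumes "bdd s \<phi>" "f \<in> Lp M 2"
  shows "(\<lambda>n. nrm (\<lambda>x. Op (Kf \<phi>) (trunc n f) x - Op (Kf \<phi>) f x)) \<longlonglongrightarrow> 0"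
proof (rule Lim_null_comparison)
  show "(\<lambda>n. s * nrm (\<lambda>x. trunc n f x - f x)) \<longlonglongrightarrow> 0"
    using tendsto_mult_right_zero[OF trunc_tendsto[OF assms(2)]] by simp
  have "nrm (\<lambda>x. Op (Kf \<phi>) (trunc n f) x - Op (Kf \<phi>) f x) \<le> s * nrm (\<lambda>x. trunc n f x - f x)" for n
    using Op_Kf_L2(2)[OF assms(1) L2_diff[OF fs_L2[OF fs_trunc] assms(2)]]
    unfolding Op_diff_L2[OF assms(1) fs_L2[OF fs_trunc] assms(2)] .
  then show "\<forall>\<^sub>F n in sequentially. norm (nrm (\<lambda>x. Op (Kf \<phi>) (trunc n f) x - Op (Kf \<phi>) f x)) \<le> s * nrm (\<lambda>x. trunc n f x - f x)"
    by simp
qed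

lemma Op_symmetric_L2:
  assumes "bdd s \<phi>" "f \<in> Lp M 2" "g \<in> Lp M 2"
  shows "ip (Op (Kf \<phi>) f) g = ip f (Op (Kf \<phi>) g)"
proof -
  have half: "ip (Op (Kf \<phi>) f) h = ip f (Op (Kf \<phi>) h)" if "fs h" "f \<in> Lp M 2" for f h
  proof (rule LIMSEQ_unique)
    show "(\<lambda>n. ip (Op (Kf \<phi>) (trunc n f)) h) \<longlonglongrightarrow> ip (Op (Kf \<phi>) f) h"
      by (rule ip_tendsto_left[OF Op_Kf_fs_L2(1)[OF assms(1) fs_trunc] Op_Kf_L2(1)[OF assms(1) that(2)]
            Op_trunc_nrm_tendsto[OF assms(1) that(2)] fs_L2[OF that(1)]])
    show "(\<lambda>n. ip (Op (Kf \<phi>) (trunc n f)) h) \<longlonglongrightarrow> ip f (Op (Kf \<phi>) h)"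
      unfolding Op_symmetric_fs[OF fs_trunc that(1)]
      by (rule ip_tendsto_left[OF fs_L2[OF fs_trunc] that(2) trunc_tendsto[OF that(2)]
            Op_Kf_fs_L2(1)[OF assms(1) that(1)]])
  qed
  have "ip g (Op (Kf \<phi>) f) = ip (Op (Kf \<phi>) g) f"
  proof (rule LIMSEQ_unique)
    show "(\<lambda>n. ip (trunc n g) (Op (Kf \<phi>) f)) \<longlonglongrightarrow> ip g (Op (Kf \<phi>) f)"
      by (rule ip_tendsto_left[OF fs_L2[OF fs_trunc] assms(3) trunc_tendsto[OF assms(3)]
            Op_Kf_L2(1)[OF assms(1,2)]])
    have "ip (trunc n g) (Op (Kf \<phi>) f) = ip (Op (Kf \<phi>) (trunc n g)) f" for n
      by (rule ip_swap[OF half[OF fs_trunc assms(2)]])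
    then show "(\<lambda>n. ip (trunc n g) (Op (Kf \<phi>) f)) \<longlonglongrightarrow> ip (Op (Kf \<phi>) g) f"
      using ip_tendsto_left[OF Op_Kf_fs_L2(1)[OF assms(1) fs_trunc] Op_Kf_L2(1)[OF assms(1,3)]
            Op_trunc_nrm_tendsto[OF assms(1,3)] assms(2)] by simp
  qed
  then show ?thesis by (rule ip_swap)
qed

lemma ker_tendsto: "(\<And>d. (\<lambda>n. F n d) \<longlonglongrightarrow> G d) \<Longrightarrow> (\<lambda>n. ker (F n) x y) \<longlonglongrightarrow> ker G x y"
  unfolding ker_def by (intro tendsto_divide tendsto_const) auto

text \<open>Bounded pointwise convergence of symbols gives weak convergence of the operators: the
  rows converge weakly, hence the images pointwise, hence weakly by boundedness.\<close>

lemma Op_Kf_tendsto: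
  assumes "\<And>n. bdd s (\<phi> n)" "bdd s \<psi>" "\<And>t. t \<in> {0<..2} \<Longrightarrow> (\<lambda>n. \<phi> n t) \<longlonglongrightarrow> \<psi> t"
    and f: "f \<in> Lp M 2"
  shows "(\<lambda>n. Op (Kf (\<phi> n)) f x) \<longlonglongrightarrow> Op (Kf \<psi>) f x"
    "g \<in> Lp M 2 \<Longrightarrow> (\<lambda>n. ip (Op (Kf (\<phi> n)) f) g) \<longlonglongrightarrow> ip (Op (Kf \<psi>) f) g"
proof -
  have s: "s \<ge> 0" using bdd_nonneg[OF assms(2)] .
  have K: "(\<lambda>n. Kf (\<phi> n) d) \<longlonglongrightarrow> Kf \<psi> d" for d
  proof (rule Kf_tendsto[where B = "2 * s"])
    show "\<bar>t * \<phi> n t\<bar> \<le> 2 * s" if "t \<in> {0..2}" for n t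
      using assms(1)[of n] that s unfolding abs_mult bdd_def by (intro mult_mono) auto
  qed (use assms(1-3) in \<open>auto simp: bdd_def\<close>)
  have pt: "(\<lambda>n. Op (Kf (\<phi> n)) f x) \<longlonglongrightarrow> Op (Kf \<psi>) f x" for x
  proof -
    have "(\<lambda>n. ip (kx (Kf (\<phi> n)) x) f) \<longlonglongrightarrow> ip (kx (Kf \<psi>) x) f"
      by (rule ip_weak_tendsto[OF kx_L2(1)[OF assms(1)] kx_L2(2)[OF assms(1)] _ f])
        (auto simp: kx_def intro!: tendsto_of_real ker_tendsto K)
    then have "(\<lambda>n. cnj (ip (kx (Kf (\<phi> n)) x) f)) \<longlonglongrightarrow> cnj (ip (kx (Kf \<psi>) x) f)"
      by (rule tendsto_cnj)
    then show ?thesis unfolding Op_eq_ip by (simp only: ip_cnj[symmetric])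
  qed
  then show "(\<lambda>n. Op (Kf (\<phi> n)) f x) \<longlonglongrightarrow> Op (Kf \<psi>) f x" .
  show "(\<lambda>n. ip (Op (Kf (\<phi> n)) f) g) \<longlonglongrightarrow> ip (Op (Kf \<psi>) f) g" if "g \<in> Lp M 2"
    by (rule ip_weak_tendsto[OF Op_Kf_L2(1)[OF assms(1) f] Op_Kf_L2(2)[OF assms(1) f] pt that])
qed

lemma A_pow_L2: "f \<in> Lp M 2 \<Longrightarrow> (A ^^ i) f \<in> Lp M 2"
  by (induction i) (auto intro: A_L2)

lemma A_pow_self_adjoint:
  "f \<in> Lp M 2 \<Longrightarrow> g \<in> Lp M 2 \<Longrightarrow> ip ((A ^^ i) f) g = ip f ((A ^^ i) g)"
proof (induction i arbitrary: g)
  case (Suc i)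
  then show ?case
    using A_self_adjoint[OF A_pow_L2[OF Suc.prems(1)] Suc.prems(2)] Suc.IH[OF Suc.prems(1) A_L2[OF Suc.prems(2)]]
    by (simp add: funpow_swap1)
qed simp

lemma PA_self_adjoint:
  assumes "f \<in> Lp M 2" "g \<in> Lp M 2"
  shows "ip (PA a n f) g = ip f (PA a n g)"
proof -
  have *: "ip (PA a n f) g = (\<Sum>i\<le>n. complex_of_real (a i) * ip ((A ^^ i) f) g)" if "f \<in> Lp M 2" "g \<in> Lp M 2" for f g
    unfolding PA_def[abs_def]
    using that by (subst ip_sum_left) (auto intro: L2_scale A_pow_L2 simp: ip_scale_left)
  have "ip f (PA a n g) = cnj (ip (PA a n g) f)" by (rule ip_cnj)
  also have "\<dots> = (\<Sum>i\<le>n. complex_of_real (a i) * cnj (ip ((A ^^ i) g) f))"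
    unfolding *[OF assms(2,1)] by simp
  also have "\<dots> = (\<Sum>i\<le>n. complex_of_real (a i) * ip ((A ^^ i) f) g)"
    unfolding A_pow_self_adjoint[OF assms] by (simp only: ip_cnj[symmetric])
  finally show ?thesis using *[OF assms] by simp
qed

lemma poly_bdd: "\<exists>s. bdd s (\<lambda>t. \<Sum>i\<le>n. a i * t ^ i)"
proof -
  have "\<bar>\<Sum>i\<le>n. a i * t ^ i\<bar> \<le> (\<Sum>i\<le>n. \<bar>a i\<bar> * 2 ^ i)" if "t \<in> {0..2}" for t :: real
    by (rule order_trans[OF sum_abs]) (use that in \<open>auto intro!: sum_mono mult_left_mono power_mono simp: abs_mult\<close>)
  then have "bdd (\<Sum>i\<le>n. \<bar>a i\<bar> * 2 ^ i) (\<lambda>t. \<Sum>i\<le>n. a i * t ^ i)" unfolding bdd_def by auto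
  then show ?thesis by blast
qed

text \<open>Both sides are self-adjoint, so it is enough to know the identity on the point masses
  \<open>\<delta> x\<close>.\<close>

lemma PA_eq_Op_L2:
  assumes "u \<in> Lp M 2"
  shows "PA a n u = Op (Kf (\<lambda>t. \<Sum>i\<le>n. a i * t ^ i)) u"
proof
  fix x
  obtain s where s: "bdd s (\<lambda>t. \<Sum>i\<le>n. a i * t ^ i)" using poly_bdd by blast
  have "w x * PA a n u x = ip (PA a n u) (\<delta> x)" by (simp add: ip_\<delta>)
  also have "\<dots> = ip u (PA a n (\<delta> x))" by (rule PA_self_adjoint[OF assms fs_L2]) simp
  also have "\<dots> = ip (Op (Kf (\<lambda>t. \<Sum>i\<le>n. a i * t ^ i)) u) (\<delta> x)"
    using Op_symmetric_L2[OF s assms fs_L2[OF fs_\<delta>[of x]]] PA_eq_Op(1)[OF fs_\<delta>[of x], of a n] by simp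
  also have "\<dots> = w x * Op (Kf (\<lambda>t. \<Sum>i\<le>n. a i * t ^ i)) u x" by (simp add: ip_\<delta>)
  finally show "PA a n u x = Op (Kf (\<lambda>t. \<Sum>i\<le>n. a i * t ^ i)) u x"
    by (simp del: of_real_sum)
qed

lemma Op_id: "u \<in> Lp M 2 \<Longrightarrow> Op (Kf (\<lambda>t. t)) u = A u"
  using PA_eq_Op_L2[of u "\<lambda>i. if i = 1 then 1 else 0" 1] by (auto simp: PA_def[abs_def])

lemma bdd_mult: "bdd s \<phi> \<Longrightarrow> bdd r \<psi> \<Longrightarrow> bdd (s * r) (\<lambda>t. \<phi> t * \<psi> t)"
proof -
  assume a: "bdd s \<phi>" "bdd r \<psi>"
  have "\<bar>\<phi> t\<bar> * \<bar>\<psi> t\<bar> \<le> s * r" if "t \<in> {0..2}" for t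
    using a that bdd_nonneg[OF a(1)] by (intro mult_mono) (auto simp: bdd_def)
  then show ?thesis using a by (auto simp: bdd_def abs_mult)
qed

text \<open>Multiplicativity survives bounded pointwise limits in the left symbol. It thus climbs
  from polynomials to continuous functions, to indicators of half-lines and, by induction over the
  Borel sets, to all indicators.\<close>

lemma Op_mult_limit:
  assumes "\<And>n. bdd s (\<phi> n)" "bdd s \<eta>" "\<And>t. t \<in> {0<..2} \<Longrightarrow> (\<lambda>n. \<phi> n t) \<longlonglongrightarrow> \<eta> t"
    and "bdd r \<psi>" "f \<in> Lp M 2"
    and "\<And>n. Op (Kf (\<phi> n)) (Op (Kf \<psi>) f) = Op (Kf (\<lambda>t. \<phi> n t * \<psi> t)) f"
  shows "Op (Kf \<eta>) (Op (Kf \<psi>) f) = Op (Kf (\<lambda>t. \<eta> t * \<psi> t)) f"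
proof
  fix x
  have "(\<lambda>n. Op (Kf (\<phi> n)) (Op (Kf \<psi>) f) x) \<longlonglongrightarrow> Op (Kf \<eta>) (Op (Kf \<psi>) f) x"
    by (rule Op_Kf_tendsto(1)[OF assms(1,2,3) Op_Kf_L2(1)[OF assms(4,5)]])
  moreover have "(\<lambda>n. Op (Kf (\<lambda>t. \<phi> n t * \<psi> t)) f x) \<longlonglongrightarrow> Op (Kf (\<lambda>t. \<eta> t * \<psi> t)) f x"
    by (rule Op_Kf_tendsto(1)[OF bdd_mult[OF assms(1,4)] bdd_mult[OF assms(2,4)] _ assms(5)])
      (intro tendsto_mult tendsto_const assms(3))
  ultimately show "Op (Kf \<eta>) (Op (Kf \<psi>) f) x = Op (Kf (\<lambda>t. \<eta> t * \<psi> t)) f x"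
    unfolding assms(6) by (rule LIMSEQ_unique)
qed

lemma Op_mult_continuous:
  assumes "continuous_on {0..2} \<eta>" "bdd s \<eta>" "bdd r \<psi>" "fs f"
  shows "Op (Kf \<eta>) (Op (Kf \<psi>) f) = Op (Kf (\<lambda>t. \<eta> t * \<psi> t)) f"
proof -
  have "\<exists>a m. \<forall>t\<in>{0..2}. \<bar>\<eta> t - (\<Sum>i\<le>m. a i * t ^ i)\<bar> < 1 / Suc n" for n
    using poly_approx[OF assms(1), of "1 / Suc n"] by (metis of_nat_0_less_iff zero_less_Suc zero_less_divide_1_iff)
  then obtain a m where am: "\<And>n t. t \<in> {0..2} \<Longrightarrow> \<bar>\<eta> t - (\<Sum>i\<le>m n. a n i * t ^ i)\<bar> < 1 / Suc n"
    by metis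
  let ?P = "\<lambda>n t. \<Sum>i\<le>m n. a n i * t ^ i"
  show ?thesis
  proof (rule Op_mult_limit[where s = "s + 1" and r = r and \<phi> = ?P])
    show "bdd (s + 1) (?P n)" for n
      unfolding bdd_def
    proof (intro conjI ballI)
      fix t :: real assume t: "t \<in> {0..2}"
      have "\<bar>\<eta> t\<bar> \<le> s" using assms(2) t by (simp add: bdd_def)
      moreover have "1 / real (Suc n) \<le> 1" by simp
      ultimately show "\<bar>?P n t\<bar> \<le> s + 1" using am[OF t, of n] by linarith
    qed measurable
    show "bdd (s + 1) \<eta>" using assms(2) by (force simp: bdd_def)
    show "(\<lambda>n. ?P n t) \<longlonglongrightarrow> \<eta> t" if "t \<in> {0<..2}" for t
    proof (rule LIM_zero_cancel, rule Lim_null_comparison)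
      show "\<forall>\<^sub>F n in sequentially. norm (?P n t - \<eta> t) \<le> 1 / Suc n"
        using am[of t] that by (intro always_eventually) (auto simp: abs_minus_commute less_imp_le)
      show "(\<lambda>n. 1 / real (Suc n)) \<longlonglongrightarrow> 0" by (rule LIMSEQ_Suc[OF lim_1_over_n])
    qed
    show "Op (Kf (?P n)) (Op (Kf \<psi>) f) = Op (Kf (\<lambda>t. ?P n t * \<psi> t)) f" for n
      using PA_eq_Op_L2[OF Op_Kf_fs_L2(1)[OF assms(3,4)], of "a n" "m n"]
        PA_Op(1)[OF assms(4) bdd_good[OF assms(3)], of "a n" "m n"] by simp
  qed (use assms fs_L2 in auto)
qed

lemma bdd_indicator [simp]: "B \<in> sets borel \<Longrightarrow> bdd 1 (indicator B)"
  by (auto simp: bdd_def indicator_def)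

lemma Op_mult_indicator_fs:
  assumes "B \<in> sets borel" "bdd r \<psi>" "fs f"
  shows "Op (Kf (indicator B)) (Op (Kf \<psi>) f) = Op (Kf (\<lambda>t. indicator B t * \<psi> t)) f"
proof -
  have f: "f \<in> Lp M 2" by (rule fs_L2[OF assms(3)])
  let ?u = "Op (Kf \<psi>) f"
  have u: "?u \<in> Lp M 2" by (rule Op_Kf_L2[OF assms(2) f])
  have borel: "sets borel = sigma_sets UNIV (range (\<lambda>a::real. {..a}))"
    unfolding borel_eq_atMost by (rule sets_measure_of) simp
  have "B \<in> sigma_sets UNIV (range (\<lambda>a::real. {..a}))" using assms(1) borel by simp
  moreover have stable: "Int_stable (range (\<lambda>a::real. {..a}))"
    by (auto simp: Int_stable_def)
  have "range (\<lambda>a::real. {..a}) \<subseteq> Pow UNIV" by simp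
  note induct = sigma_sets_induct_disjoint[OF stable this]
  from calculation show ?thesis
  proof (rule induct)
    fix X assume "X \<in> range (\<lambda>a::real. {..a})"
    then obtain a :: real where X: "X = {..a}" by auto
    \<comment> \<open>Continuous ramps that equal 1 up to \<open>a\<close> and, for
      \<open>n > 0\<close>, equal 0 from \<open>a + 1 / n\<close> on.\<close>
    let ?\<phi> = "\<lambda>n t. max 0 (min 1 (1 - real n * (t - a)))"
    show "Op (Kf (indicator X)) ?u = Op (Kf (\<lambda>t. indicator X t * \<psi> t)) f"
    proof (rule Op_mult_limit[where s = 1 and r = r and \<phi> = ?\<phi>])
      show b: "bdd 1 (?\<phi> n)" for n by (auto simp: bdd_def)
      show "Op (Kf (?\<phi> n)) ?u = Op (Kf (\<lambda>t. ?\<phi> n t * \<psi> t)) f" for n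
        by (rule Op_mult_continuous[OF _ b assms(2,3)]) (intro continuous_intros)
      show "(\<lambda>n. ?\<phi> n t) \<longlonglongrightarrow> indicator X t" for t
      proof (cases "t \<le> a")
        case True
        have "?\<phi> n t = 1" for n
          using True mult_nonneg_nonpos[of "real n" "t - a"] by (simp add: min_def max_def)
        then show ?thesis using True X by simp
      next
        case False
        obtain N where N: "real N > 1 / (t - a)" using reals_Archimedean2 by blast
        have "?\<phi> n t = 0" if "n \<ge> N" for n
        proof -
          have "1 / (t - a) < real n" using N that by (meson of_nat_mono less_le_trans)
          then have "1 < real n * (t - a)" using False by (simp add: field_simps)
          then show ?thesis by simp
        qed
        then have "\<forall>\<^sub>F n in sequentially. ?\<phi> n t = indicator X t"
          using False X by (auto simp: eventually_sequentially)
        then show ?thesis by (rule tendsto_eventually)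
      qed
      show "bdd 1 (indicator X)" using X by simp
    qed (use assms f in auto)
  next
    show "Op (Kf (indicator {})) ?u = Op (Kf (\<lambda>t. indicator {} t * \<psi> t)) f"
      by (simp add: Kf_def[abs_def] Op_def[abs_def] ker_def)
  next
    fix A assume A: "A \<in> sigma_sets UNIV (range (\<lambda>a::real. {..a}))"
      and IH: "Op (Kf (indicator A)) ?u = Op (Kf (\<lambda>t. indicator A t * \<psi> t)) f"
    have Ab: "A \<in> sets borel" using A borel by simp
    have K1: "Kf (indicator (UNIV - A)) d = Kf (\<lambda>t. 1) d - Kf (indicator A) d" for d
    proof -
      have "indicator (UNIV - A) = (\<lambda>t. 1 + (-1) * (indicator A t :: real))" by (auto simp: indicator_def)
      then show ?thesis
        using Kf_add[OF good_power[of 0] good_scale[of "indicator A" "-1"], of d] Kf_scale[of "-1" "indicator A" d]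
          bdd_good[OF bdd_indicator[OF Ab]] by simp
    qed
    have K2: "Kf (\<lambda>t. indicator (UNIV - A) t * \<psi> t) d = Kf \<psi> d - Kf (\<lambda>t. indicator A t * \<psi> t) d" for d
    proof -
      have "(\<lambda>t. indicator (UNIV - A) t * \<psi> t) = (\<lambda>t. \<psi> t + (-1) * (indicator A t * \<psi> t))"
        by (auto simp: indicator_def)
      then show ?thesis
        using Kf_add[OF bdd_good[OF assms(2)] good_scale[of "\<lambda>t. indicator A t * \<psi> t" "-1"], of d]
          Kf_scale[of "-1" "\<lambda>t. indicator A t * \<psi> t" d]
          bdd_good[OF bdd_mult[OF bdd_indicator[OF Ab] assms(2)]] by simp
    qed
    have kx_diff: "kx (\<lambda>d. F d - G d) x = (\<lambda>y. kx F x y - kx G x y)" for F G x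
      by (auto simp: kx_def ker_def diff_divide_distrib)
    have lin: "Op (\<lambda>d. F d - G d) v x = Op F v x - Op G v x"
      if "kx F x \<in> Lp M 2" "kx G x \<in> Lp M 2" "v \<in> Lp M 2" for F G v x
      unfolding Op_eq_ip kx_diff using that by (rule ip_diff_right)
    show "Op (Kf (indicator (UNIV - A))) ?u = Op (Kf (\<lambda>t. indicator (UNIV - A) t * \<psi> t)) f"
    proof
      fix x
      have k1: "kx (Kf (\<lambda>t. 1)) x \<in> Lp M 2" by (rule kx_L2(1)[of 1]) (simp add: bdd_def)
      have "Op (Kf (indicator (UNIV - A))) ?u x = ?u x - Op (Kf (indicator A)) ?u x"
        unfolding K1[abs_def] lin[OF k1 kx_L2(1)[OF bdd_indicator[OF Ab]] u] Op_one ..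
      also have "\<dots> = Op (Kf (\<lambda>t. indicator (UNIV - A) t * \<psi> t)) f x"
        unfolding K2[abs_def] lin[OF kx_L2(1)[OF assms(2)] kx_L2(1)[OF bdd_mult[OF bdd_indicator[OF Ab] assms(2)]] f]
          IH ..
      finally show "Op (Kf (indicator (UNIV - A))) ?u x = Op (Kf (\<lambda>t. indicator (UNIV - A) t * \<psi> t)) f x" .
    qed
  next
    fix D :: "nat \<Rightarrow> real set"
    assume disj: "disjoint_family D" and D: "range D \<subseteq> sigma_sets UNIV (range (\<lambda>a::real. {..a}))"
      and IH: "\<And>i. Op (Kf (indicator (D i))) ?u = Op (Kf (\<lambda>t. indicator (D i) t * \<psi> t)) f"
    have Db: "D i \<in> sets borel" for i using D borel by auto
    let ?\<phi> = "\<lambda>n t. \<Sum>i<n. indicator (D i) t :: real"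
    have ind: "?\<phi> n t = indicator (\<Union>i<n. D i) t" for n t
      using disj by (intro indicator_UN_disjoint[symmetric]) (auto simp: disjoint_family_on_def)
    have kx_sum: "kx (\<lambda>d. \<Sum>i\<in>I. F i d) x = (\<lambda>y. \<Sum>i\<in>I. kx (F i) x y)" for F and I :: "nat set" and x
      by (auto simp: kx_def ker_def sum_divide_distrib)
    have ip_sum_right: "ip v (\<lambda>y. \<Sum>i\<in>I. h i y) = (\<Sum>i\<in>I. ip v (h i))"
      if "\<And>i. h i \<in> Lp M 2" "v \<in> Lp M 2" for v h and I :: "nat set"
    proof -
      have "ip v (\<lambda>y. \<Sum>i\<in>I. h i y) = cnj (\<Sum>i\<in>I. ip (h i) v)"
        unfolding ip_sum_left[OF that, symmetric] by (rule ip_cnj)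
      then show ?thesis by (simp only: cnj_sum ip_cnj[symmetric])
    qed
    have lin: "Op (\<lambda>d. \<Sum>i<n. F i d) v x = (\<Sum>i<n. Op (F i) v x)"
      if "\<And>i. kx (F i) x \<in> Lp M 2" "v \<in> Lp M 2" for F v x and n :: nat
      unfolding Op_eq_ip kx_sum using that by (rule ip_sum_right)
    show "Op (Kf (indicator (\<Union>i. D i))) ?u = Op (Kf (\<lambda>t. indicator (\<Union>i. D i) t * \<psi> t)) f"
    proof (rule Op_mult_limit[where s = 1 and r = r and \<phi> = ?\<phi>])
      show "bdd 1 (?\<phi> n)" for n
        unfolding ind using Db by (intro bdd_indicator) auto
      show "bdd 1 (indicator (\<Union>i. D i))" using Db by (intro bdd_indicator) auto
      show "(\<lambda>n. ?\<phi> n t) \<longlonglongrightarrow> indicator (\<Union>i. D i) t" for t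
        unfolding ind by (rule LIMSEQ_indicator_UN)
      show "Op (Kf (?\<phi> n)) ?u = Op (Kf (\<lambda>t. ?\<phi> n t * \<psi> t)) f" for n
      proof
        fix x
        have "Kf (?\<phi> n) = (\<lambda>d. \<Sum>i<n. Kf (indicator (D i)) d)"
          by (rule ext, rule Kf_sum) (rule bdd_good[OF bdd_indicator[OF Db]])
        then have "Op (Kf (?\<phi> n)) ?u x = (\<Sum>i<n. Op (Kf (indicator (D i))) ?u x)"
          using lin[OF kx_L2(1)[OF bdd_indicator[OF Db]] u] by simp
        moreover have "Kf (\<lambda>t. ?\<phi> n t * \<psi> t) = (\<lambda>d. \<Sum>i<n. Kf (\<lambda>t. indicator (D i) t * \<psi> t) d)"
          unfolding sum_distrib_right
          by (rule ext, rule Kf_sum) (rule bdd_good[OF bdd_mult[OF bdd_indicator[OF Db] assms(2)]])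
        then have "Op (Kf (\<lambda>t. ?\<phi> n t * \<psi> t)) f x = (\<Sum>i<n. Op (Kf (\<lambda>t. indicator (D i) t * \<psi> t)) f x)"
          using lin[OF kx_L2(1)[OF bdd_mult[OF bdd_indicator[OF Db] assms(2)]] f] by simp
        ultimately show "Op (Kf (?\<phi> n)) ?u x = Op (Kf (\<lambda>t. ?\<phi> n t * \<psi> t)) f x"
          using IH by simp
      qed
    qed (use assms f in auto)
  qed
qed

end

section \<open>Resolutions of the identity\<close>

lemma simple_function_vimage: "simple_function borel F \<Longrightarrow> F -` {y} \<in> sets borel"
  using simple_functionD(2)[of borel F "{y}"] by simp

lemma simple_function_integral:
  fixes F :: "real \<Rightarrow> real" and \<psi> :: "real \<Rightarrow> real"
  assumes "finite_measure N" "sets N = sets borel" "simple_function borel F"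
  shows "integrable N (\<lambda>x. \<psi> (F x))"
    "(\<integral>x. \<psi> (F x) \<partial>N) = (\<Sum>y\<in>range F. \<psi> y * measure N (F -` {y}))"
proof -
  interpret finite_measure N by fact
  have fin: "finite (range F)" and meas: "F -` {y} \<in> sets N" for y
    using assms(2) simple_functionD(1)[OF assms(3)] simple_function_vimage[OF assms(3)] by auto
  have eq: "\<psi> (F x) = (\<Sum>y\<in>range F. \<psi> y * indicator (F -` {y}) x)" for x
  proof -
    have "(\<Sum>y\<in>range F. \<psi> y * indicator (F -` {y}) x) = (\<Sum>y\<in>range F. if F x = y then \<psi> y else 0)"
      by (intro sum.cong) (auto simp: indicator_def)
    then show ?thesis using fin by simp
  qed
  have int: "integrable N (\<lambda>x. \<psi> y * indicator (F -` {y}) x)" for y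
    using meas[of y] by (intro integrable_mult_right integrable_real_indicator) (auto simp: less_top[symmetric])
  show "integrable N (\<lambda>x. \<psi> (F x))"
    unfolding eq by (intro Bochner_Integration.integrable_sum int)
  have space: "space N = UNIV" using sets_eq_imp_space_eq[OF assms(2)] by simp
  have "(\<integral>x. \<psi> (F x) \<partial>N) = (\<Sum>y\<in>range F. \<integral>x. \<psi> y * indicator (F -` {y}) x \<partial>N)"
    unfolding eq by (rule Bochner_Integration.integral_sum) (rule int)
  then show "(\<integral>x. \<psi> (F x) \<partial>N) = (\<Sum>y\<in>range F. \<psi> y * measure N (F -` {y}))"
    using meas by (simp add: space)
qed

lemma simple_approx:
  fixes \<phi> :: "real \<Rightarrow> real"
  assumes "\<phi> \<in> borel_measurable borel"
  obtains F where "\<And>j. simple_function borel (F j)" "\<And>x. (\<lambda>j. F j x) \<longlonglongrightarrow> \<phi> x"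
    "\<And>j x. \<bar>F j x\<bar> \<le> 2 * \<bar>\<phi> x\<bar>"
  using borel_measurable_implies_sequence_metric[OF assms, of 0] by (auto simp: dist_real_def)

lemma simple_approx_integral:
  fixes \<phi> :: "real \<Rightarrow> real"
  assumes "\<phi> \<in> borel_measurable borel" "sets N = sets borel" "integrable N \<phi>"
    "\<And>j. simple_function borel (F j)" "\<And>x. (\<lambda>j. F j x) \<longlonglongrightarrow> \<phi> x" "\<And>j x. \<bar>F j x\<bar> \<le> 2 * \<bar>\<phi> x\<bar>"
  shows "(\<lambda>j. \<integral>x. F j x \<partial>N) \<longlonglongrightarrow> (\<integral>x. \<phi> x \<partial>N)"
proof (rule integral_dominated_convergence[where w = "\<lambda>x. 2 * \<bar>\<phi> x\<bar>"])
  show "F j \<in> borel_measurable N" for j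
    using borel_measurable_simple_function[OF assms(4)] assms(2) by (simp cong: measurable_cong_sets)
  show "\<phi> \<in> borel_measurable N"
    using assms(1,2) by (simp cong: measurable_cong_sets)
qed (use assms in auto)

text \<open>A linear relation between finite measures passes to integrals by approximation with
  simple functions. It replaces an integration theory for the complex measures that polarization
  produces.\<close>

lemma integral_signed_combination:
  fixes N :: "'i \<Rightarrow> real measure" and c :: "'i \<Rightarrow> complex" and \<phi> :: "real \<Rightarrow> real"
  assumes "finite I" "\<And>i. i \<in> I \<Longrightarrow> finite_measure (N i)" "\<And>i. i \<in> I \<Longrightarrow> sets (N i) = sets borel"
    and zero: "\<And>B. B \<in> sets borel \<Longrightarrow> (\<Sum>i\<in>I. c i * complex_of_real (measure (N i) B)) = 0"
    and \<phi>: "\<phi> \<in> borel_measurable borel" "\<And>i. i \<in> I \<Longrightarrow> integrable (N i) \<phi>"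
  shows "(\<Sum>i\<in>I. c i * complex_of_real (\<integral>t. \<phi> t \<partial>N i)) = 0"
proof -
  obtain F where F: "\<And>j. simple_function borel (F j)" "\<And>x. (\<lambda>j. F j x) \<longlonglongrightarrow> \<phi> x"
    "\<And>j x. \<bar>F j x\<bar> \<le> 2 * \<bar>\<phi> x\<bar>"
    using simple_approx[OF \<phi>(1)] by blast
  have "(\<lambda>j. \<Sum>i\<in>I. c i * complex_of_real (\<integral>t. F j t \<partial>N i))
      \<longlonglongrightarrow> (\<Sum>i\<in>I. c i * complex_of_real (\<integral>t. \<phi> t \<partial>N i))"
    by (intro tendsto_sum tendsto_mult tendsto_const tendsto_of_real
        simple_approx_integral[OF \<phi>(1) assms(3) \<phi>(2) F])
  moreover have "(\<Sum>i\<in>I. c i * complex_of_real (\<integral>t. F j t \<partial>N i)) = 0" for j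
  proof -
    have meas: "F j -` {y} \<in> sets borel" for y
      by (rule simple_function_vimage[OF F(1)])
    have "(\<Sum>i\<in>I. c i * complex_of_real (\<integral>t. F j t \<partial>N i))
        = (\<Sum>i\<in>I. \<Sum>y\<in>range (F j). complex_of_real y * (c i * complex_of_real (measure (N i) (F j -` {y}))))"
      using simple_function_integral(2)[OF assms(2,3) F(1)[of j], where \<psi> = "\<lambda>y. y"]
      by (simp add: sum_distrib_left mult_ac)
    also have "\<dots> = (\<Sum>y\<in>range (F j). complex_of_real y * (\<Sum>i\<in>I. c i * complex_of_real (measure (N i) (F j -` {y}))))"
      unfolding sum_distrib_left by (rule sum.swap)
    also have "\<dots> = 0" using zero[OF meas] by simp
    finally show ?thesis .
  qed
  ultimately show ?thesis by (simp add: LIMSEQ_const_iff)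
qed

lemma nn_integral_le_combination:
  fixes N N1 N2 :: "real measure"
  assumes "sets N = sets borel" "sets N1 = sets borel" "sets N2 = sets borel"
    and le: "\<And>B. B \<in> sets borel \<Longrightarrow> emeasure N B \<le> a * emeasure N1 B + b * emeasure N2 B"
    and g: "g \<in> borel_measurable borel"
  shows "(\<integral>\<^sup>+t. g t \<partial>N) \<le> a * (\<integral>\<^sup>+t. g t \<partial>N1) + b * (\<integral>\<^sup>+t. g t \<partial>N2)"
proof -
  have cong: "borel_measurable N = borel_measurable borel" "borel_measurable N1 = borel_measurable borel"
    "borel_measurable N2 = borel_measurable borel" for N' :: "real measure"
    using assms(1-3) by (simp_all cong: measurable_cong_sets)
  show ?thesis using g
  proof (induction rule: borel_measurable_induct)
    case (cong f g)
    then have "f = g" by auto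
    then show ?case using cong by simp
  next
    case (set A)
    then show ?case using le[OF set] assms by simp
  next
    case (mult u c)
    have "(\<integral>\<^sup>+t. c * u t \<partial>N) = c * (\<integral>\<^sup>+t. u t \<partial>N)" "(\<integral>\<^sup>+t. c * u t \<partial>N1) = c * (\<integral>\<^sup>+t. u t \<partial>N1)"
      "(\<integral>\<^sup>+t. c * u t \<partial>N2) = c * (\<integral>\<^sup>+t. u t \<partial>N2)"
      using mult(2) by (simp_all add: nn_integral_cmult cong)
    then show ?case using mult_left_mono[OF mult.IH, of c] by (simp add: distrib_left mult_ac)
  next
    case (add u v)
    then show ?case using add_mono[OF add.IH]
      by (simp add: nn_integral_add cong distrib_left add_ac)
  next
    case (seq U)
    have sup: "(\<integral>\<^sup>+t. (SUP i. U i) t \<partial>N) = (SUP i. \<integral>\<^sup>+t. U i t \<partial>N)"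
      unfolding SUP_apply
      by (rule nn_integral_monotone_convergence_SUP) (use seq in \<open>auto simp: cong\<close>)
    have "(\<integral>\<^sup>+t. U i t \<partial>N) \<le> a * (\<integral>\<^sup>+t. (SUP i. U i) t \<partial>N1) + b * (\<integral>\<^sup>+t. (SUP i. U i) t \<partial>N2)" for i
      by (rule order_trans[OF seq.IH], intro add_mono mult_left_mono nn_integral_mono)
        (auto simp: SUP_apply intro: SUP_upper)
    then show ?case unfolding sup by (intro SUP_least)
  qed
qed

text \<open>\<open>a\<close>, \<open>b\<close>, \<open>c\<close>, \<open>d\<close> are the four
  terms of an expanded sesquilinear form. Averaging over the fourth roots of unity cancels all but
  \<open>b\<close>, since only there the factor \<open>\<i> ^ k\<close> is compensated.\<close>

lemma polarization_algebra:
  "(1 / 4) * (\<Sum>k<(4::nat). \<i> ^ k * (a + cnj (\<i> ^ k) * b + \<i> ^ k * c + d)) = (b :: complex)"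
  by (simp add: eval_nat_numeral lessThan_Suc algebra_simps)

locale flow_tree_resolution = flow_tree q p lev
  for q :: nat and p :: "'v \<Rightarrow> 'v" and lev :: "'v \<Rightarrow> int" +
  fixes E :: "real set \<Rightarrow> ('v \<Rightarrow> complex) \<Rightarrow> 'v \<Rightarrow> complex"
  assumes roi: "resolution_of_identity M E"
begin

lemmas roi_conj = roi[unfolded resolution_of_identity_def]

lemma roi_L2: "B \<in> sets borel \<Longrightarrow> f \<in> Lp M 2 \<Longrightarrow> E B f \<in> Lp M 2"
  by (rule roi_conj[THEN conjunct1, rule_format])

lemma roi_lin: "B \<in> sets borel \<Longrightarrow> f \<in> Lp M 2 \<Longrightarrow> g \<in> Lp M 2 \<Longrightarrow>
    E B (\<lambda>x. f x + c * g x) = (\<lambda>x. E B f x + c * E B g x)"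
  by (rule roi_conj[THEN conjunct2, THEN conjunct1, rule_format])

lemma roi_sym: "B \<in> sets borel \<Longrightarrow> f \<in> Lp M 2 \<Longrightarrow> g \<in> Lp M 2 \<Longrightarrow> ip (E B f) g = ip f (E B g)"
  by (rule roi_conj[THEN conjunct2, THEN conjunct2, THEN conjunct1, rule_format])

lemma roi_empty: "f \<in> Lp M 2 \<Longrightarrow> E {} f = (\<lambda>x. 0)"
  and roi_UNIV: "f \<in> Lp M 2 \<Longrightarrow> E UNIV f = f"
  using roi_conj[THEN conjunct2, THEN conjunct2, THEN conjunct2, THEN conjunct1, rule_format, of f]
  by simp_all

lemma roi_Int: "B \<in> sets borel \<Longrightarrow> C \<in> sets borel \<Longrightarrow> f \<in> Lp M 2 \<Longrightarrow> E (B \<inter> C) f = E B (E C f)"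
  by (rule roi_conj[THEN conjunct2, THEN conjunct2, THEN conjunct2, THEN conjunct2, THEN conjunct1, rule_format])

lemma roi_sums: "range D \<subseteq> sets borel \<Longrightarrow> disjoint_family D \<Longrightarrow> f \<in> Lp M 2 \<Longrightarrow> g \<in> Lp M 2 \<Longrightarrow>
    (\<lambda>n::nat. ip (E (D n) f) g) sums ip (E (\<Union>n. D n) f) g"
  by (rule roi_conj[THEN conjunct2, THEN conjunct2, THEN conjunct2, THEN conjunct2, THEN conjunct2, rule_format])
    (rule conjI)

abbreviation \<nu> :: "('v \<Rightarrow> complex) \<Rightarrow> real measure" where
  "\<nu> f \<equiv> spectral_dist M E f"

abbreviation pair :: "(real \<Rightarrow> real) \<Rightarrow> ('v \<Rightarrow> complex) \<Rightarrow> ('v \<Rightarrow> complex) \<Rightarrow> complex" where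
  "pair \<equiv> spectral_pairing M E"

abbreviation dom :: "(real \<Rightarrow> real) \<Rightarrow> ('v \<Rightarrow> complex) set" where
  "dom \<equiv> spectral_domain M E"

lemma roi_ip_eq:
  assumes "B \<in> sets borel" "f \<in> Lp M 2" "g \<in> Lp M 2"
  shows "ip (E B f) g = ip (E B f) (E B g)"
  using roi_Int[OF assms(1,1,2)] roi_sym[OF assms(1) roi_L2[OF assms(1,2)] assms(3)] by simp

lemma roi_ip_self: "B \<in> sets borel \<Longrightarrow> f \<in> Lp M 2 \<Longrightarrow> ip (E B f) f = complex_of_real (nrm2 (E B f))"
  using roi_ip_eq[of B f f] by (simp add: ip_self)

lemma sets_\<nu> [simp]: "sets (\<nu> f) = sets borel" and space_\<nu> [simp]: "space (\<nu> f) = UNIV"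
  unfolding spectral_dist_def using sets.sigma_sets_eq[of "borel :: real measure"]
  by (auto simp: sets_measure_of_conv space_measure_of_conv)

lemma emeasure_\<nu>:
  assumes f: "f \<in> Lp M 2" and B: "B \<in> sets borel"
  shows "emeasure (\<nu> f) B = ennreal (nrm2 (E B f))"
proof -
  let ?\<mu> = "\<lambda>B. ennreal (Re (ip (E B f) f))"
  have "emeasure (\<nu> f) B = ?\<mu> B"
  proof (rule emeasure_measure_of[OF spectral_dist_def])
    show "positive (sets (\<nu> f)) ?\<mu>"
      using f by (auto simp: positive_def roi_empty L2_inner_def)
    show "countably_additive (sets (\<nu> f)) ?\<mu>"
    proof (rule countably_additiveI)
      fix D :: "nat \<Rightarrow> real set"
      assume D: "range D \<subseteq> sets (\<nu> f)" "disjoint_family D" "(\<Union>i. D i) \<in> sets (\<nu> f)"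
      then have Db: "D i \<in> sets borel" for i by auto
      have "(\<lambda>n. Re (ip (E (D n) f) f)) sums Re (ip (E (\<Union>n. D n) f) f)"
        using D by (intro sums_Re roi_sums f) auto
      moreover have "Re (ip (E (D n) f) f) \<ge> 0" for n
        using roi_ip_self[OF Db f] by simp
      ultimately show "(\<Sum>i. ?\<mu> (D i)) = ?\<mu> (\<Union>i. D i)"
        by (subst suminf_ennreal2) (auto simp: sums_iff)
    qed
  qed (use B in auto)
  then show ?thesis using roi_ip_self[OF B f] by simp
qed

lemma measure_\<nu>: "f \<in> Lp M 2 \<Longrightarrow> B \<in> sets borel \<Longrightarrow> measure (\<nu> f) B = nrm2 (E B f)"
  by (simp add: measure_def emeasure_\<nu>)

lemma finite_\<nu>: "f \<in> Lp M 2 \<Longrightarrow> finite_measure (\<nu> f)"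
  by (rule finite_measureI) (simp add: emeasure_\<nu>)

lemma measure_\<nu>_UNIV: "f \<in> Lp M 2 \<Longrightarrow> measure (\<nu> f) UNIV = nrm2 f"
  by (simp add: measure_\<nu> roi_UNIV)

lemma polarization:
  assumes f: "f \<in> Lp M 2" and h: "h \<in> Lp M 2" and B: "B \<in> sets borel"
  shows "(1 / 4) * (\<Sum>k<(4::nat). \<i> ^ k * complex_of_real (measure (\<nu> (\<lambda>x. f x + \<i> ^ k * h x)) B)) = ip (E B f) h"
proof -
  have "complex_of_real (measure (\<nu> (\<lambda>x. f x + \<i> ^ k * h x)) B)
      = ip (E B f) f + cnj (\<i> ^ k) * ip (E B f) h + \<i> ^ k * ip (E B h) f + ip (E B h) h" for k
  proof -
    have u: "(\<lambda>x. f x + \<i> ^ k * h x) \<in> Lp M 2" using f h by (intro L2_add L2_scale)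
    have "complex_of_real (measure (\<nu> (\<lambda>x. f x + \<i> ^ k * h x)) B)
        = ip (E B (\<lambda>x. f x + \<i> ^ k * h x)) (\<lambda>x. f x + \<i> ^ k * h x)"
      using measure_\<nu>[OF u B] roi_ip_self[OF B u] by simp
    also have "\<dots> = ip (E B f) f + cnj (\<i> ^ k) * ip (E B f) h + (\<i> ^ k * ip (E B h) f + \<i> ^ k * (cnj (\<i> ^ k) * ip (E B h) h))"
      unfolding roi_lin[OF B f h]
      using f h roi_L2[OF B f] roi_L2[OF B h]
      by (simp add: ip_add_left ip_add_right ip_scale_left ip_scale_right L2_add L2_scale distrib_left)
    also have "\<i> ^ k * (cnj (\<i> ^ k) * ip (E B h) h) = ip (E B h) h"
      by (simp flip: mult.assoc power_mult_distrib)
    finally show ?thesis by (simp add: add_ac)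
  qed
  then show ?thesis by (simp only: polarization_algebra)
qed

lemma domI: "f \<in> Lp M 2 \<Longrightarrow> integrable (\<nu> f) (\<lambda>t. (\<phi> t)\<^sup>2) \<Longrightarrow> f \<in> dom \<phi>"
  and dom_L2: "f \<in> dom \<phi> \<Longrightarrow> f \<in> Lp M 2"
  and dom_sq: "f \<in> dom \<phi> \<Longrightarrow> integrable (\<nu> f) (\<lambda>t. (\<phi> t)\<^sup>2)"
  by (auto simp: spectral_domain_def)

lemma borel_\<nu>: "\<phi> \<in> borel_measurable borel \<Longrightarrow> \<phi> \<in> borel_measurable (\<nu> f)"
  by (simp cong: measurable_cong_sets)

lemma dom_integrable:
  assumes "f \<in> dom \<phi>" "\<phi> \<in> borel_measurable borel"
  shows "integrable (\<nu> f) \<phi>"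
proof (rule Bochner_Integration.integrable_bound[where f = "\<lambda>t. 1 + (\<phi> t)\<^sup>2"])
  interpret finite_measure "\<nu> f" by (rule finite_\<nu>[OF dom_L2[OF assms(1)]])
  show "integrable (\<nu> f) (\<lambda>t. 1 + (\<phi> t)\<^sup>2)" using dom_sq[OF assms(1)] by simp
  have "\<bar>x\<bar> \<le> 1 + x\<^sup>2" for x :: real
    using sum_squares_bound[of 1 "\<bar>x\<bar>"] by (simp add: power2_eq_square)
  then show "AE t in \<nu> f. norm (\<phi> t) \<le> norm (1 + (\<phi> t)\<^sup>2)" by (auto intro!: AE_I2)
qed (rule borel_\<nu>[OF assms(2)])

text \<open>The spectral measure of the sum is dominated by twice that of \<open>f\<close> plus
  \<open>2 * (cmod c)\<^sup>2\<close> times that of \<open>g\<close>, as one sees on each projection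
  \<open>E B\<close>.\<close>

lemma dom_lin:
  assumes f: "f \<in> dom \<phi>" and g: "g \<in> dom \<phi>" and \<phi>: "\<phi> \<in> borel_measurable borel"
  shows "(\<lambda>x. f x + c * g x) \<in> dom \<phi>"
proof (rule domI)
  note f2 = dom_L2[OF f] and g2 = dom_L2[OF g]
  let ?u = "\<lambda>x. f x + c * g x"
  show u2: "?u \<in> Lp M 2" using f2 g2 by (intro L2_add L2_scale)
  have le: "emeasure (\<nu> ?u) B \<le> 2 * emeasure (\<nu> f) B + ennreal (2 * (cmod c)\<^sup>2) * emeasure (\<nu> g) B"
    if B: "B \<in> sets borel" for B
  proof -
    have "nrm2 (E B ?u) \<le> (\<integral>x. 2 * (cmod (E B f x))\<^sup>2 + 2 * (cmod (c * E B g x))\<^sup>2 \<partial>M)"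
      unfolding nrm2_def roi_lin[OF B f2 g2]
      by (intro integral_mono cmod_add_sq_le)
        (use roi_L2[OF B f2] L2_scale[OF roi_L2[OF B g2], of c] L2_add[OF roi_L2[OF B f2] L2_scale[OF roi_L2[OF B g2], of c]]
          in \<open>auto simp: in_L2_iff\<close>)
    also have "\<dots> = 2 * nrm2 (E B f) + 2 * (cmod c)\<^sup>2 * nrm2 (E B g)"
      using roi_L2[OF B f2] roi_L2[OF B g2]
      by (simp add: nrm2_def in_L2_iff norm_mult power_mult_distrib)
    finally have "ennreal (nrm2 (E B ?u)) \<le> ennreal (2 * nrm2 (E B f) + 2 * (cmod c)\<^sup>2 * nrm2 (E B g))"
      by (rule ennreal_leI)
    moreover have "ennreal (2 * a + 2 * c * b) = 2 * ennreal a + ennreal (2 * c) * ennreal b"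
      if "a \<ge> 0" "b \<ge> 0" "c \<ge> 0" for a b c :: real
      using that by (simp add: ennreal_plus ennreal_mult)
    ultimately show ?thesis
      unfolding emeasure_\<nu>[OF f2 B] emeasure_\<nu>[OF g2 B] emeasure_\<nu>[OF u2 B] by simp
  qed
  have "(\<integral>\<^sup>+t. ennreal ((\<phi> t)\<^sup>2) \<partial>\<nu> ?u) \<le> 2 * (\<integral>\<^sup>+t. ennreal ((\<phi> t)\<^sup>2) \<partial>\<nu> f) + ennreal (2 * (cmod c)\<^sup>2) * (\<integral>\<^sup>+t. ennreal ((\<phi> t)\<^sup>2) \<partial>\<nu> g)"
    by (rule nn_integral_le_combination[OF _ _ _ le]) (use \<phi> in auto)
  also have "\<dots> < \<infinity>"
    using integrableD(2)[OF dom_sq[OF f]] integrableD(2)[OF dom_sq[OF g]]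
    by (simp add: ennreal_mult_less_top less_top top.not_eq_extremum)
  finally show "integrable (\<nu> ?u) (\<lambda>t. (\<phi> t)\<^sup>2)"
    using \<phi> by (intro integrableI_nonneg) (auto cong: measurable_cong_sets)
qed

text \<open>Each pairing is a combination of four positive measures by polarization; together with
  the extra measures \<open>N\<close> this becomes one relation of the form handled by
  \<open>integral_signed_combination\<close>. Linearity of the pairing and its diagonal values are
  then relations to be checked on Borel sets only.\<close>

lemma pairing_combination:
  fixes f h :: "'j \<Rightarrow> 'v \<Rightarrow> complex" and N :: "'k \<Rightarrow> real measure"
  assumes "finite P" "finite K"
    and \<phi>: "\<phi> \<in> borel_measurable borel"
    and dom: "\<And>j. j \<in> P \<Longrightarrow> f j \<in> dom \<phi>" "\<And>j. j \<in> P \<Longrightarrow> h j \<in> dom \<phi>"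
    and N: "\<And>k. k \<in> K \<Longrightarrow> finite_measure (N k)" "\<And>k. k \<in> K \<Longrightarrow> sets (N k) = sets borel"
      "\<And>k. k \<in> K \<Longrightarrow> integrable (N k) \<phi>"
    and zero: "\<And>B. B \<in> sets borel \<Longrightarrow>
      (\<Sum>j\<in>P. c j * ip (E B (f j)) (h j)) + (\<Sum>k\<in>K. d k * complex_of_real (measure (N k) B)) = 0"
  shows "(\<Sum>j\<in>P. c j * pair \<phi> (f j) (h j)) + (\<Sum>k\<in>K. d k * complex_of_real (\<integral>t. \<phi> t \<partial>N k)) = 0"
proof -
  let ?u = "\<lambda>(j, m) x. f j x + \<i> ^ m * h j x"
  define N' where "N' = case_sum (\<lambda>p. \<nu> (?u p)) N"
  define c' where "c' = case_sum (\<lambda>(j, m). c j * (1 / 4) * \<i> ^ m) d"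
  let ?I = "(P \<times> {..<4::nat}) <+> K"
  have split: "(\<Sum>i\<in>?I. c' i * complex_of_real (G (N' i)))
      = (\<Sum>j\<in>P. c j * ((1 / 4) * (\<Sum>m<4. \<i> ^ m * complex_of_real (G (\<nu> (\<lambda>x. f j x + \<i> ^ m * h j x))))))
        + (\<Sum>k\<in>K. d k * complex_of_real (G (N k)))" for G
    using assms(1,2)
    by (simp add: sum.Plus c'_def N'_def sum_distrib_left mult.assoc)
      (subst sum.cartesian_product, auto intro!: sum.cong)
  have u: "?u p \<in> dom \<phi>" if "fst p \<in> P" for p
    using dom[OF that] dom_lin \<phi> by (cases p) auto
  have "(\<Sum>i\<in>?I. c' i * complex_of_real (\<integral>t. \<phi> t \<partial>N' i)) = 0"
  proof (rule integral_signed_combination[OF _ _ _ _ \<phi>])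
    show "finite ?I" using assms(1,2) by simp
    show "finite_measure (N' i)" if "i \<in> ?I" for i
      using that N(1) finite_\<nu>[OF dom_L2[OF u]] by (auto simp: N'_def)
    show "sets (N' i) = sets borel" if "i \<in> ?I" for i
      using that N(2) by (auto simp: N'_def)
    show "integrable (N' i) \<phi>" if "i \<in> ?I" for i
      using that N(3) dom_integrable[OF u \<phi>] by (auto simp: N'_def)
    fix B :: "real set" assume B: "B \<in> sets borel"
    have "(\<Sum>j\<in>P. c j * ((1 / 4) * (\<Sum>m<(4::nat). \<i> ^ m * complex_of_real (measure (\<nu> (\<lambda>x. f j x + \<i> ^ m * h j x)) B))))
        = (\<Sum>j\<in>P. c j * ip (E B (f j)) (h j))"
      by (intro sum.cong refl arg_cong2[where f = "(*)"] polarization dom_L2[OF dom(1)] dom_L2[OF dom(2)] B)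
    then show "(\<Sum>i\<in>?I. c' i * complex_of_real (measure (N' i) B)) = 0"
      using zero[OF B] split[of "\<lambda>N. measure N B"] by simp
  qed
  then show ?thesis
    unfolding split[of "\<lambda>N. \<integral>t. \<phi> t \<partial>N"] spectral_pairing_def .
qed

lemma pairing_diff_left:
  assumes "f \<in> dom \<phi>" "g \<in> dom \<phi>" "h \<in> dom \<phi>" "\<phi> \<in> borel_measurable borel"
  shows "pair \<phi> (\<lambda>x. f x - g x) h = pair \<phi> f h - pair \<phi> g h"
proof -
  have fg: "(\<lambda>x. f x - g x) \<in> dom \<phi>" using dom_lin[OF assms(1,2,4), of "-1"] by simp
  let ?F = "\<lambda>j::nat. if j = 0 then (\<lambda>x. f x - g x) else if j = 1 then f else g"
  have "(\<Sum>j\<in>{0,1,2::nat}. (if j = 1 then - 1 else 1) * pair \<phi> (?F j) h) + (\<Sum>k\<in>({}::nat set). 0 * complex_of_real (\<integral>t. \<phi> t \<partial>borel)) = 0"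
  proof (rule pairing_combination[OF _ _ assms(4)])
    fix B :: "real set" assume B: "B \<in> sets borel"
    note [simp] = dom_L2[OF assms(1)] dom_L2[OF assms(2)] dom_L2[OF assms(3)]
    have "E B (\<lambda>x. f x - g x) = (\<lambda>x. E B f x - E B g x)"
      using roi_lin[OF B, of f g "-1"] by simp
    then show "(\<Sum>j\<in>{0,1,2::nat}. (if j = 1 then - 1 else 1) * ip (E B (?F j)) h) + (\<Sum>k\<in>({}::nat set). 0 * complex_of_real (measure borel B)) = 0"
      using roi_L2[OF B] by (simp add: ip_diff_left)
  qed (use assms fg in auto)
  then show ?thesis by (simp add: algebra_simps)
qed

lemma pairing_diff_right:
  assumes "f \<in> dom \<phi>" "g \<in> dom \<phi>" "h \<in> dom \<phi>" "\<phi> \<in> borel_measurable borel"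
  shows "pair \<phi> h (\<lambda>x. f x - g x) = pair \<phi> h f - pair \<phi> h g"
proof -
  have fg: "(\<lambda>x. f x - g x) \<in> dom \<phi>" using dom_lin[OF assms(1,2,4), of "-1"] by simp
  let ?F = "\<lambda>j::nat. if j = 0 then (\<lambda>x. f x - g x) else if j = 1 then f else g"
  have "(\<Sum>j\<in>{0,1,2::nat}. (if j = 1 then - 1 else 1) * pair \<phi> h (?F j)) + (\<Sum>k\<in>({}::nat set). 0 * complex_of_real (\<integral>t. \<phi> t \<partial>borel)) = 0"
  proof (rule pairing_combination[OF _ _ assms(4)])
    fix B :: "real set" assume B: "B \<in> sets borel"
    note [simp] = dom_L2[OF assms(1)] dom_L2[OF assms(2)] dom_L2[OF assms(3)]
    show "(\<Sum>j\<in>{0,1,2::nat}. (if j = 1 then - 1 else 1) * ip (E B h) (?F j)) + (\<Sum>k\<in>({}::nat set). 0 * complex_of_real (measure borel B)) = 0"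
      using roi_L2[OF B] by (simp add: ip_diff_right)
  qed (use assms fg in auto)
  then show ?thesis by (simp add: algebra_simps)
qed

lemma pairing_self:
  assumes "f \<in> dom \<phi>" "\<phi> \<in> borel_measurable borel"
  shows "pair \<phi> f f = complex_of_real (\<integral>t. \<phi> t \<partial>\<nu> f)"
proof -
  have "(\<Sum>j\<in>{0::nat}. 1 * pair \<phi> f f) + (\<Sum>k\<in>{0::nat}. - 1 * complex_of_real (\<integral>t. \<phi> t \<partial>\<nu> f)) = 0"
  proof (rule pairing_combination[OF _ _ assms(2)])
    fix B :: "real set" assume B: "B \<in> sets borel"
    show "(\<Sum>j\<in>{0::nat}. 1 * ip (E B f) f) + (\<Sum>k\<in>{0::nat}. - 1 * complex_of_real (measure (\<nu> f) B)) = 0"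
      using measure_\<nu>[OF dom_L2[OF assms(1)] B] roi_ip_self[OF B dom_L2[OF assms(1)]] by simp
  qed (simp_all add: assms finite_\<nu>[OF dom_L2[OF assms(1)]] dom_integrable[OF assms])
  then show ?thesis by simp
qed

text \<open>For simple functions the projections onto the level sets are orthogonal, so the pairing
  splits into inner products of the pieces of \<open>f\<close> and \<open>h\<close>. The factor
  \<open>y\<close> can be charged to either side, which gives the two bounds; both pass to the
  limit.\<close>

lemma pairing_bound:
  assumes f: "f \<in> dom \<phi>" and h: "h \<in> dom \<phi>" and \<phi>: "\<phi> \<in> borel_measurable borel"
  shows "cmod (pair \<phi> f h) \<le> sqrt (\<integral>t. (\<phi> t)\<^sup>2 \<partial>\<nu> f) * nrm h"
    "cmod (pair \<phi> f h) \<le> nrm f * sqrt (\<integral>t. (\<phi> t)\<^sup>2 \<partial>\<nu> h)"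
proof -
  note f2 = dom_L2[OF f] and h2 = dom_L2[OF h]
  obtain F where F: "\<And>j. simple_function borel (F j)" "\<And>x. (\<lambda>j. F j x) \<longlonglongrightarrow> \<phi> x"
    "\<And>j x. \<bar>F j x\<bar> \<le> 2 * \<bar>\<phi> x\<bar>"
    using simple_approx[OF \<phi>] by blast
  have meas: "F j -` {y} \<in> sets borel" for j y
    by (rule simple_function_vimage[OF F(1)])
  have u: "(\<lambda>x. f x + \<i> ^ k * h x) \<in> dom \<phi>" for k by (rule dom_lin[OF f h \<phi>])
  have lim: "(\<lambda>j. cmod (pair (F j) f h)) \<longlonglongrightarrow> cmod (pair \<phi> f h)"
    unfolding spectral_pairing_def
    by (intro tendsto_norm tendsto_sum tendsto_mult tendsto_const tendsto_of_real
        simple_approx_integral[OF \<phi> _ dom_integrable[OF u \<phi>] F]) simp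
  have sq: "(\<lambda>j. \<integral>t. (F j t)\<^sup>2 \<partial>\<nu> g) \<longlonglongrightarrow> (\<integral>t. (\<phi> t)\<^sup>2 \<partial>\<nu> g)" if "g \<in> dom \<phi>" for g
  proof (rule integral_dominated_convergence[where w = "\<lambda>t. 4 * (\<phi> t)\<^sup>2"])
    show "AE x in \<nu> g. norm ((F j x)\<^sup>2) \<le> 4 * (\<phi> x)\<^sup>2" for j
    proof (rule AE_I2)
      fix x
      have "\<bar>F j x\<bar>\<^sup>2 \<le> (2 * \<bar>\<phi> x\<bar>)\<^sup>2" by (rule power_mono[OF F(3)]) simp
      then show "norm ((F j x)\<^sup>2) \<le> 4 * (\<phi> x)\<^sup>2" by (simp add: power_mult_distrib)
    qed
    show "(\<lambda>t. (F j t)\<^sup>2) \<in> borel_measurable (\<nu> g)" for j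
      using borel_measurable_simple_function[OF F(1)[of j]] by (intro borel_\<nu>) auto
    show "(\<lambda>t. (\<phi> t)\<^sup>2) \<in> borel_measurable (\<nu> g)" using \<phi> by (intro borel_\<nu>) auto
  qed (use dom_sq[OF that] F(2) in \<open>auto intro!: tendsto_power\<close>)
  have simple_pair: "pair (F j) f h = (\<Sum>y\<in>range (F j). complex_of_real y * ip (E (F j -` {y}) f) h)" for j
  proof -
    have "pair (F j) f h = (1 / 4) * (\<Sum>k<(4::nat). \<i> ^ k * (\<Sum>y\<in>range (F j). complex_of_real y * complex_of_real (measure (\<nu> (\<lambda>x. f x + \<i> ^ k * h x)) (F j -` {y}))))"
      unfolding spectral_pairing_def
      using simple_function_integral(2)[OF finite_\<nu>[OF dom_L2[OF u]] sets_\<nu> F(1)[of j], where \<psi> = "\<lambda>y. y"] by simp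
    also have "\<dots> = (\<Sum>y\<in>range (F j). complex_of_real y * ((1 / 4) * (\<Sum>k<(4::nat). \<i> ^ k * complex_of_real (measure (\<nu> (\<lambda>x. f x + \<i> ^ k * h x)) (F j -` {y})))))"
      unfolding sum_distrib_left by (subst sum.swap) (simp add: mult_ac)
    also have "\<dots> = (\<Sum>y\<in>range (F j). complex_of_real y * ip (E (F j -` {y}) f) h)"
      by (simp only: polarization[OF f2 h2 meas])
    finally show ?thesis .
  qed
  have sq_sum: "(\<integral>t. (F j t)\<^sup>2 \<partial>\<nu> g) = (\<Sum>y\<in>range (F j). y\<^sup>2 * nrm2 (E (F j -` {y}) g))"
    and one_sum: "nrm2 g = (\<Sum>y\<in>range (F j). nrm2 (E (F j -` {y}) g))" if "g \<in> Lp M 2" for j g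
    using simple_function_integral(2)[OF finite_\<nu>[OF that] sets_\<nu> F(1)[of j], where \<psi> = "\<lambda>y. y\<^sup>2"]
      simple_function_integral(2)[OF finite_\<nu>[OF that] sets_\<nu> F(1)[of j], where \<psi> = "\<lambda>y. 1"]
      finite_measure.finite_emeasure_space[OF finite_\<nu>[OF that]] measure_\<nu>_UNIV[OF that]
    by (simp_all add: measure_\<nu>[OF that meas])
  have trm: "cmod (complex_of_real y * ip (E (F j -` {y}) f) h)
      \<le> \<bar>y\<bar> * (nrm (E (F j -` {y}) f) * nrm (E (F j -` {y}) h))" for j y
    unfolding norm_mult norm_of_real
    by (subst roi_ip_eq[OF meas f2 h2]) (intro mult_left_mono ip_cauchy_schwarz roi_L2 meas f2 h2, simp)
  have amgm: "\<bar>y\<bar> * (a * b) \<le> (t * (y\<^sup>2 * a\<^sup>2) + b\<^sup>2 / t) / 2" if "t > 0" for y a b t :: real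
  proof -
    have "0 \<le> (t * \<bar>y\<bar> * a - b)\<^sup>2 / t" using that by simp
    then show ?thesis using that by (simp add: power2_eq_square field_simps)
  qed
  have bound1: "cmod (pair (F j) f h) \<le> sqrt (\<integral>t. (F j t)\<^sup>2 \<partial>\<nu> f) * sqrt (nrm2 h)" for j
  proof (rule le_sqrt_mult_sqrt)
    fix t :: real assume t: "t > 0"
    have "cmod (pair (F j) f h) \<le> (\<Sum>y\<in>range (F j). (t * (y\<^sup>2 * (nrm (E (F j -` {y}) f))\<^sup>2) + (nrm (E (F j -` {y}) h))\<^sup>2 / t) / 2)"
      unfolding simple_pair by (rule sum_norm_le) (rule order_trans[OF trm amgm[OF t]])
    also have "\<dots> = (t * (\<integral>t. (F j t)\<^sup>2 \<partial>\<nu> f) + nrm2 h / t) / 2"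
      unfolding sq_sum[OF f2] one_sum[OF h2, of j] nrm_sq
      by (simp add: sum.distrib sum_distrib_left flip: sum_divide_distrib)
    finally show "cmod (pair (F j) f h) \<le> (t * (\<integral>t. (F j t)\<^sup>2 \<partial>\<nu> f) + nrm2 h / t) / 2" .
  qed simp_all
  have bound2: "cmod (pair (F j) f h) \<le> sqrt (\<integral>t. (F j t)\<^sup>2 \<partial>\<nu> h) * sqrt (nrm2 f)" for j
  proof (rule le_sqrt_mult_sqrt)
    fix t :: real assume t: "t > 0"
    have "cmod (pair (F j) f h) \<le> (\<Sum>y\<in>range (F j). (t * (y\<^sup>2 * (nrm (E (F j -` {y}) h))\<^sup>2) + (nrm (E (F j -` {y}) f))\<^sup>2 / t) / 2)"
      unfolding simple_pair
      by (rule sum_norm_le, rule order_trans[OF trm], subst mult.commute[of "nrm (E _ f)"]) (rule amgm[OF t])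
    also have "\<dots> = (t * (\<integral>t. (F j t)\<^sup>2 \<partial>\<nu> h) + nrm2 f / t) / 2"
      unfolding sq_sum[OF h2] one_sum[OF f2, of j] nrm_sq
      by (simp add: sum.distrib sum_distrib_left flip: sum_divide_distrib)
    finally show "cmod (pair (F j) f h) \<le> (t * (\<integral>t. (F j t)\<^sup>2 \<partial>\<nu> h) + nrm2 f / t) / 2" .
  qed simp_all
  have "cmod (pair \<phi> f h) \<le> sqrt (\<integral>t. (\<phi> t)\<^sup>2 \<partial>\<nu> f) * sqrt (nrm2 h)"
    by (rule LIMSEQ_le[OF lim tendsto_mult[OF tendsto_real_sqrt[OF sq[OF f]] tendsto_const]]) (use bound1 in blast)
  then show "cmod (pair \<phi> f h) \<le> sqrt (\<integral>t. (\<phi> t)\<^sup>2 \<partial>\<nu> f) * nrm h" by (simp add: nrm_def)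
  have "cmod (pair \<phi> f h) \<le> sqrt (\<integral>t. (\<phi> t)\<^sup>2 \<partial>\<nu> h) * sqrt (nrm2 f)"
    by (rule LIMSEQ_le[OF lim tendsto_mult[OF tendsto_real_sqrt[OF sq[OF h]] tendsto_const]]) (use bound2 in blast)
  then show "cmod (pair \<phi> f h) \<le> nrm f * sqrt (\<integral>t. (\<phi> t)\<^sup>2 \<partial>\<nu> h)" by (simp add: nrm_def mult.commute)
qed

end

section \<open>Spectral measures of an arbitrary resolution of the Laplacian\<close>

locale flow_tree_spectral = flow_tree_resolution q p lev E
  for q :: nat and p :: "'v \<Rightarrow> 'v" and lev :: "'v \<Rightarrow> int"
    and E :: "real set \<Rightarrow> ('v \<Rightarrow> complex) \<Rightarrow> 'v \<Rightarrow> complex" +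
  assumes spec: "is_spectral_resolution M A E"
begin

lemma dom_id: "f \<in> Lp M 2 \<Longrightarrow> f \<in> dom (\<lambda>t. t)"
  and ip_A: "f \<in> Lp M 2 \<Longrightarrow> h \<in> Lp M 2 \<Longrightarrow> ip (A f) h = pair (\<lambda>t. t) f h"
  using spec unfolding is_spectral_resolution_def by simp_all

lemma integrable_\<nu>_id:
  assumes "f \<in> Lp M 2"
  shows "integrable (\<nu> f) (\<lambda>t. t)" "integrable (\<nu> f) (\<lambda>t. t\<^sup>2)"
  using dom_integrable[OF dom_id[OF assms]] dom_sq[OF dom_id[OF assms]] by simp_all

lemma ip_A_self: "f \<in> Lp M 2 \<Longrightarrow> ip (A f) f = complex_of_real (\<integral>t. t \<partial>\<nu> f)"
  using ip_A[of f f] pairing_self[OF dom_id[of f]] by simp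

lemma Re_ip_A_bounds:
  assumes "f \<in> Lp M 2"
  shows "Re (ip (A f) f) \<ge> 0" "Re (ip (A f) f) \<le> 2 * nrm2 f"
proof -
  have eq: "Re (ip (A f) f) * 2 = nrm2 (\<lambda>x. f x - f (p x))"
    using nrm2_gradient(2)[OF assms] by (simp add: A_def[abs_def])
  then show "Re (ip (A f) f) \<ge> 0" using nrm2_nonneg[of "\<lambda>x. f x - f (p x)"] by linarith
  have "\<bar>Re (ip (J f) f)\<bar> \<le> nrm (J f) * nrm f"
    using ip_cauchy_schwarz[OF J_L2(1)[OF assms] assms] abs_Re_le_cmod[of "ip (J f) f"] by linarith
  also have "\<dots> \<le> nrm f * nrm f" by (intro mult_right_mono J_L2(2) assms) simp
  finally have "\<bar>Re (ip (J f) f)\<bar> \<le> nrm2 f" by (simp add: nrm_sq flip: power2_eq_square)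
  moreover have "Re (ip (A f) f) = nrm2 f - Re (ip (J f) f)"
    using eq nrm2_gradient(1)[OF assms] by simp
  ultimately show "Re (ip (A f) f) \<le> 2 * nrm2 f" by linarith
qed

lemma restricted_\<nu>:
  assumes f: "f \<in> Lp M 2" and B: "B \<in> sets borel"
  shows "\<nu> (E B f) = density (\<nu> f) (indicator B)"
proof (rule measure_eqI)
  fix C assume "C \<in> sets (\<nu> (E B f))"
  then have C: "C \<in> sets borel" by simp
  have "emeasure (\<nu> (E B f)) C = ennreal (nrm2 (E (C \<inter> B) f))"
    using emeasure_\<nu>[OF roi_L2[OF B f] C] roi_Int[OF C B f] by simp
  also have "\<dots> = emeasure (density (\<nu> f) (indicator B)) C"
    using B C by (subst emeasure_restricted) (simp_all add: emeasure_\<nu>[OF f] Int_commute)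
  finally show "emeasure (\<nu> (E B f)) C = emeasure (density (\<nu> f) (indicator B)) C" .
qed simp

lemma integral_restricted:
  fixes \<phi> :: "real \<Rightarrow> real"
  assumes "B \<in> sets borel" "\<phi> \<in> borel_measurable borel" "sets N = sets borel"
  shows "(\<integral>t. \<phi> t \<partial>density N (indicator B)) = (\<integral>t. indicator B t * \<phi> t \<partial>N)"
    "integrable (density N (indicator B)) \<phi> \<longleftrightarrow> integrable N (\<lambda>t. indicator B t * \<phi> t)"
proof -
  have eq: "density N (indicator B) = density N (\<lambda>t. ennreal (indicator B t))"
    by (simp add: ennreal_indicator)
  have m: "\<phi> \<in> borel_measurable N" "(\<lambda>t. indicator B t :: real) \<in> borel_measurable N"
    using assms by (simp_all cong: measurable_cong_sets)
  show "(\<integral>t. \<phi> t \<partial>density N (indicator B)) = (\<integral>t. indicator B t * \<phi> t \<partial>N)"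
    unfolding eq using m by (subst integral_density) auto
  show "integrable (density N (indicator B)) \<phi> \<longleftrightarrow> integrable N (\<lambda>t. indicator B t * \<phi> t)"
    unfolding eq using m by (subst integrable_density) auto
qed

text \<open>The numerical range of \<open>A\<close> lies between 0 and 2, also on the ranges of
  \<open>E {..<0}\<close> and \<open>E {2<..}\<close>. There \<open>t\<close>, respectively
  \<open>t - 2\<close>, has a strict sign that contradicts these bounds unless the spectral measure
  of the set vanishes.\<close>

lemma AE_\<nu>_support:
  assumes f: "f \<in> Lp M 2"
  shows "AE t in \<nu> f. t \<in> {0..2}"
proof -
  have B: "{..<(0::real)} \<in> sets borel" "{(2::real)<..} \<in> sets borel" by auto
  note int = integrable_\<nu>_id(1)[OF f]
  have int': "integrable (\<nu> f) (\<lambda>t. indicator S t * t)" if "S \<in> sets borel" for S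
    by (rule Bochner_Integration.integrable_bound[OF int]) (use that in \<open>auto simp: indicator_def intro!: borel_\<nu>\<close>)
  have "(\<integral>t. indicator {..<0} t * t \<partial>\<nu> f) \<ge> 0"
    using Re_ip_A_bounds(1)[OF roi_L2[OF B(1) f]] ip_A_self[OF roi_L2[OF B(1) f]]
    by (simp add: restricted_\<nu>[OF f B(1)] integral_restricted(1)[OF B(1)])
  moreover have "(\<integral>t. - (indicator {..<0} t * t) \<partial>\<nu> f) \<ge> 0"
    by (intro integral_nonneg_AE AE_I2) (auto simp: indicator_def)
  ultimately have "(\<integral>t. - (indicator {..<0} t * t) \<partial>\<nu> f) = 0" by simp
  then have 1: "AE t in \<nu> f. - (indicator {..<0} t * t) = 0"
    by (subst (asm) integral_nonneg_eq_0_iff_AE)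
      (use int'[OF B(1)] in \<open>auto simp: indicator_def intro!: AE_I2\<close>)
  have one: "integrable (\<nu> f) (\<lambda>t. indicator {2<..} t :: real)"
    by (rule finite_measure.integrable_const_bound[OF finite_\<nu>[OF f], where B = 1])
      (auto intro!: AE_I2 simp: indicator_def borel_\<nu>)
  have "nrm2 (E {2<..} f) = (\<integral>t. indicator {2<..} t \<partial>\<nu> f)"
    using measure_\<nu>[OF f B(2)] by simp
  then have "(\<integral>t. indicator {2<..} t * t \<partial>\<nu> f) \<le> 2 * (\<integral>t. indicator {2<..} t \<partial>\<nu> f)"
    using Re_ip_A_bounds(2)[OF roi_L2[OF B(2) f]] ip_A_self[OF roi_L2[OF B(2) f]]
    by (simp add: restricted_\<nu>[OF f B(2)] integral_restricted(1)[OF B(2)])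
  then have "(\<integral>t. indicator {2<..} t * t - 2 * indicator {2<..} t \<partial>\<nu> f) \<le> 0"
    using int'[OF B(2)] one by simp
  moreover have "(\<integral>t. indicator {2<..} t * t - 2 * indicator {2<..} t \<partial>\<nu> f) \<ge> 0"
    by (intro integral_nonneg_AE AE_I2) (auto simp: indicator_def)
  ultimately have "(\<integral>t. indicator {2<..} t * t - 2 * indicator {2<..} t \<partial>\<nu> f) = 0" by simp
  then have 2: "AE t in \<nu> f. indicator {2<..} t * t - 2 * indicator {2<..} t = (0::real)"
    by (subst (asm) integral_nonneg_eq_0_iff_AE)
      (use int'[OF B(2)] one in \<open>auto simp: indicator_def intro!: AE_I2\<close>)
  from 1 2 show ?thesis
    by eventually_elim (auto simp: indicator_def split: if_splits)
qed

lemma integrable_\<nu>_bounded: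
  fixes \<phi> :: "real \<Rightarrow> real"
  assumes "f \<in> Lp M 2" "\<phi> \<in> borel_measurable borel" "\<And>t. t \<in> {0..2} \<Longrightarrow> \<bar>\<phi> t\<bar> \<le> s"
  shows "integrable (\<nu> f) \<phi>"
proof (rule finite_measure.integrable_const_bound[OF finite_\<nu>[OF assms(1)], where B = s])
  show "AE t in \<nu> f. norm (\<phi> t) \<le> s"
    using AE_\<nu>_support[OF assms(1)] by eventually_elim (use assms(3) in auto)
qed (rule borel_\<nu>[OF assms(2)])

lemma dom_bounded:
  assumes "f \<in> Lp M 2" "\<phi> \<in> borel_measurable borel" "\<And>t. t \<in> {0..2} \<Longrightarrow> \<bar>\<phi> t\<bar> \<le> s"
  shows "f \<in> dom \<phi>"
proof (rule domI[OF assms(1)], rule integrable_\<nu>_bounded[OF assms(1)])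
  show "\<bar>(\<phi> t)\<^sup>2\<bar> \<le> s\<^sup>2" if "t \<in> {0..2}" for t
    using power_mono[OF assms(3)[OF that], of 2] by simp
qed (use assms(2) in auto)

text \<open>Restricting the four polarization measures to \<open>C\<close> corresponds to projecting
  the second argument of the pairing; this is the weak form of the statement that \<open>A\<close>
  commutes with \<open>E C\<close>.\<close>

lemma ip_E_A:
  assumes f: "f \<in> Lp M 2" and h: "h \<in> Lp M 2" and C: "C \<in> sets borel"
  shows "ip (E C (A f)) h = pair (\<lambda>t. indicator C t * t) f h"
proof -
  let ?u = "\<lambda>k x. f x + \<i> ^ k * h x"
  have u: "?u k \<in> Lp M 2" for k using f h by (intro L2_add L2_scale)
  let ?N = "\<lambda>k::nat. density (\<nu> (?u k)) (indicator C)"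
  have N: "?N k = \<nu> (E C (?u k))" for k by (rule restricted_\<nu>[OF u C, symmetric])
  have EC: "E C (?u k) \<in> Lp M 2" for k by (rule roi_L2[OF C u])
  have "(\<Sum>j\<in>{0::nat}. 1 * pair (\<lambda>t. t) f (E C h)) + (\<Sum>k<(4::nat). (- (1 / 4) * \<i> ^ k) * complex_of_real (\<integral>t. t \<partial>?N k)) = 0"
  proof (rule pairing_combination)
    show "finite_measure (?N k)" for k unfolding N by (rule finite_\<nu>[OF EC])
    show "integrable (?N k) (\<lambda>t. t)" for k unfolding N by (rule integrable_\<nu>_id(1)[OF EC])
    fix B :: "real set" assume B: "B \<in> sets borel"
    have "measure (?N k) B = measure (\<nu> (?u k)) (C \<inter> B)" for k
      using B C by (subst measure_restricted) simp_all
    then have "(\<Sum>k<(4::nat). (- (1 / 4) * \<i> ^ k) * complex_of_real (measure (?N k) B))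
        = - ((1 / 4) * (\<Sum>k<(4::nat). \<i> ^ k * complex_of_real (measure (\<nu> (?u k)) (C \<inter> B))))"
      by (simp add: sum_negf sum_distrib_left mult.assoc)
    also have "\<dots> = - ip (E (C \<inter> B) f) h"
      using polarization[OF f h] B C by simp
    also have "ip (E (C \<inter> B) f) h = ip (E B f) (E C h)"
      using roi_Int[OF C B f] roi_sym[OF C roi_L2[OF B f] h] by simp
    finally show "(\<Sum>j\<in>{0::nat}. 1 * ip (E B f) (E C h)) + (\<Sum>k<(4::nat). (- (1 / 4) * \<i> ^ k) * complex_of_real (measure (?N k) B)) = 0"
      by simp
  qed (use dom_id[OF f] dom_id[OF roi_L2[OF C h]] in auto)
  moreover have "ip (E C (A f)) h = pair (\<lambda>t. t) f (E C h)"
    using roi_sym[OF C A_L2[OF f] h] ip_A[OF f roi_L2[OF C h]] by simp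
  ultimately show ?thesis
    unfolding spectral_pairing_def
    by (simp add: integral_restricted(1)[OF C] sum_negf sum_distrib_left mult.assoc)
qed

text \<open>The hypothesis on \<open>E\<close> relates \<open>A\<close> only to the first power of
  \<open>t\<close>. Pairing \<open>f\<close> with \<open>A f\<close> gives a measure of density
  \<open>t\<close>, and a second use of the hypothesis gives \<open>t\<^sup>2\<close>; iteration
  yields all moments.\<close>

lemma \<nu>_A:
  assumes f: "f \<in> Lp M 2"
  shows "\<nu> (A f) = density (\<nu> f) (\<lambda>t. ennreal (t\<^sup>2))"
proof (rule measure_eqI)
  fix C assume "C \<in> sets (\<nu> (A f))"
  then have C [measurable]: "C \<in> sets borel" by simp
  note Af = A_L2[OF f]
  let ?\<psi> = "\<lambda>t. indicator C t * t :: real"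
  let ?N = "density (\<nu> f) (\<lambda>t. ennreal t)"
  have pos: "AE t in \<nu> f. 0 \<le> t" using AE_\<nu>_support[OF f] by auto
  have int_ind: "integrable (\<nu> f) (\<lambda>t. indicator B t * t)" if "B \<in> sets borel" for B
    by (rule integrable_\<nu>_bounded[OF f, where s = 2]) (use that in \<open>auto simp: indicator_def\<close>)
  have dom\<psi>: "g \<in> dom (\<lambda>t. indicator B t * t)" if "g \<in> Lp M 2" "B \<in> sets borel" for g B
    by (rule dom_bounded[OF that(1), where s = 2]) (use that in \<open>auto simp: indicator_def\<close>)
  have emN: "emeasure ?N B = ennreal (\<integral>t. indicator B t * t \<partial>\<nu> f)" if B: "B \<in> sets borel" for B
  proof -
    have "emeasure ?N B = (\<integral>\<^sup>+t. ennreal (indicator B t * t) \<partial>\<nu> f)"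
      using B by (subst emeasure_density) (auto intro!: nn_integral_cong borel_\<nu> simp: indicator_def cong: measurable_cong_sets)
    also have "\<dots> = ennreal (\<integral>t. indicator B t * t \<partial>\<nu> f)"
      using pos by (intro nn_integral_eq_integral int_ind B) (auto simp: indicator_def)
    finally show ?thesis .
  qed
  have nonneg: "(\<integral>t. indicator B t * t \<partial>\<nu> f) \<ge> 0" for B :: "real set"
    using pos by (intro integral_nonneg_AE) (auto simp: indicator_def)
  have finN: "finite_measure ?N"
    by (rule finite_measureI) (use emN[of UNIV] in simp)
  have intN: "integrable ?N ?\<psi> \<longleftrightarrow> integrable (\<nu> f) (\<lambda>t. t * ?\<psi> t)"
    "(\<integral>t. ?\<psi> t \<partial>?N) = (\<integral>t. t * ?\<psi> t \<partial>\<nu> f)"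
    using pos by (subst integrable_density integral_density; auto intro!: borel_\<nu>)+
  have int2: "integrable (\<nu> f) (\<lambda>t. t * ?\<psi> t)"
    by (rule integrable_\<nu>_bounded[OF f, where s = 4])
      (auto simp: indicator_def intro: order_trans[OF mult_mono[where b = 2 and d = 2]])
  \<comment> \<open>The set function \<open>B \<mapsto> ip (E B f) (A f)\<close> is the positive
    measure \<open>?N\<close>, so the pairing can be computed as an integral against
    \<open>?N\<close>.\<close>
  have "(\<Sum>j\<in>{0::nat}. 1 * pair ?\<psi> f (A f)) + (\<Sum>k\<in>{0::nat}. - 1 * complex_of_real (\<integral>t. ?\<psi> t \<partial>?N)) = 0"
  proof (rule pairing_combination)
    fix B :: "real set" assume B: "B \<in> sets borel"
    have "ip (E B f) (A f) = cnj (ip (E B (A f)) f)"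
      unfolding roi_sym[OF B Af f] by (rule ip_cnj)
    also have "\<dots> = complex_of_real (\<integral>t. indicator B t * t \<partial>\<nu> f)"
      unfolding ip_E_A[OF f f B] using B by (subst pairing_self[OF dom\<psi>[OF f B]]) auto
    also have "\<dots> = complex_of_real (measure ?N B)"
      using emN[OF B] nonneg[of B] by (simp add: measure_def)
    finally show "(\<Sum>j\<in>{0::nat}. 1 * ip (E B f) (A f)) + (\<Sum>k\<in>{0::nat}. - 1 * complex_of_real (measure ?N B)) = 0"
      by simp
  qed (use dom\<psi>[OF f C] dom\<psi>[OF Af C] finN intN(1) int2 in auto)
  then have "complex_of_real (nrm2 (E C (A f))) = complex_of_real (\<integral>t. t * ?\<psi> t \<partial>\<nu> f)"
    unfolding roi_ip_self[OF C Af, symmetric] ip_E_A[OF f Af C] intN(2) by simp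
  then have "emeasure (\<nu> (A f)) C = ennreal (\<integral>t. t * ?\<psi> t \<partial>\<nu> f)"
    using emeasure_\<nu>[OF Af C] by (simp only: of_real_eq_iff)
  also have "\<dots> = (\<integral>\<^sup>+t. ennreal (t * ?\<psi> t) \<partial>\<nu> f)"
    by (rule nn_integral_eq_integral[OF int2, symmetric]) (auto simp: indicator_def)
  also have "\<dots> = emeasure (density (\<nu> f) (\<lambda>t. ennreal (t\<^sup>2))) C"
    by (subst emeasure_density)
      (auto intro!: nn_integral_cong borel_\<nu> simp: indicator_def power2_eq_square cong: measurable_cong_sets)
  finally show "emeasure (\<nu> (A f)) C = emeasure (density (\<nu> f) (\<lambda>t. ennreal (t\<^sup>2))) C" .
qed simp

lemma integral_\<nu>_A_pow:
  assumes f: "f \<in> Lp M 2" and \<phi> [measurable]: "\<phi> \<in> borel_measurable borel"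
  shows "(\<integral>t. \<phi> t \<partial>\<nu> ((A ^^ k) f)) = (\<integral>t. t ^ (2 * k) * \<phi> t \<partial>\<nu> f)"
  using \<phi>
proof (induction k arbitrary: \<phi>)
  case (Suc k)
  have "(\<integral>t. \<phi> t \<partial>\<nu> ((A ^^ Suc k) f)) = (\<integral>t. t\<^sup>2 * \<phi> t \<partial>\<nu> ((A ^^ k) f))"
    using Suc.prems by (simp add: \<nu>_A[OF A_pow_L2[OF f]]) (subst integral_density, auto intro!: borel_\<nu>)
  also have "\<dots> = (\<integral>t. t ^ (2 * k) * (t\<^sup>2 * \<phi> t) \<partial>\<nu> f)"
    using Suc.prems by (intro Suc.IH) auto
  finally show ?case by (simp add: power2_eq_square mult_ac)
qed simp

text \<open>Even moments are squared norms of iterates \<open>(A ^^ k) f\<close> and odd moments are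
  forms of \<open>A\<close> at them, so both are accessible through \<open>\<nu>_A\<close>.\<close>

lemma moments:
  assumes f: "f \<in> Lp M 2"
  shows "complex_of_real (\<integral>t. t ^ m \<partial>\<nu> f) = ip ((A ^^ m) f) f"
proof (cases "even m")
  case True
  then obtain k where m: "m = 2 * k" by auto
  have "(\<integral>t. t ^ m \<partial>\<nu> f) = (\<integral>t. 1 \<partial>\<nu> ((A ^^ k) f))"
    using integral_\<nu>_A_pow[OF f, of "\<lambda>t. 1" k] m by simp
  also have "\<dots> = nrm2 ((A ^^ k) f)"
    using measure_\<nu>_UNIV[OF A_pow_L2[OF f]] by simp
  finally have "complex_of_real (\<integral>t. t ^ m \<partial>\<nu> f) = ip ((A ^^ k) f) ((A ^^ k) f)" by (simp add: ip_self)
  also have "\<dots> = ip ((A ^^ k) ((A ^^ k) f)) f"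
    by (rule A_pow_self_adjoint[OF A_pow_L2[OF f] f, symmetric])
  finally show ?thesis unfolding m by (simp add: mult_2 funpow_add)
next
  case False
  then obtain k where m: "m = 2 * k + 1" by (elim oddE)
  have "(\<integral>t. t ^ m \<partial>\<nu> f) = (\<integral>t. t \<partial>\<nu> ((A ^^ k) f))"
    using integral_\<nu>_A_pow[OF f, of "\<lambda>t. t" k] m by (simp add: mult.commute)
  then have "complex_of_real (\<integral>t. t ^ m \<partial>\<nu> f) = ip (A ((A ^^ k) f)) ((A ^^ k) f)"
    using ip_A_self[OF A_pow_L2[OF f]] by simp
  also have "\<dots> = ip ((A ^^ k) (A ((A ^^ k) f))) f"
    by (rule A_pow_self_adjoint[OF A_L2[OF A_pow_L2[OF f]] f, symmetric])
  also have "(A ^^ k) (A ((A ^^ k) f)) = (A ^^ m) f"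
    unfolding m by (simp add: mult_2 funpow_add funpow_swap1)
  finally show ?thesis .
qed

lemma moments_fs:
  assumes "fs f"
  shows "(\<integral>t. t ^ m \<partial>\<nu> f) = (\<integral>t. (1 - cos t) ^ m * \<rho> f t \<partial>T)"
proof -
  have "(A ^^ m) f = Op (Kf (\<lambda>t. t ^ m)) f"
    using A_pow_Op[OF assms good_power[of 0], of m] by (simp add: Op_one)
  then have "Re (ip ((A ^^ m) f) f) = (\<integral>t. (1 - cos t) ^ m * \<rho> f t \<partial>T)"
    using \<rho>_integral(2)[OF assms good_power[of m]] by simp
  then show ?thesis using moments[OF fs_L2[OF assms], of m] by (metis Re_complex_of_real)
qed

text \<open>Two measures on a compact interval with equal moments agree on continuous functions, by
  Weierstrass. This is where the arbitrary resolution and the explicit density are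
  identified.\<close>

lemma integral_\<nu>_continuous:
  assumes f: "fs f" and cont: "continuous_on {0..2} \<phi>" and meas: "\<phi> \<in> borel_measurable borel"
  shows "(\<integral>t. \<phi> t \<partial>\<nu> f) = (\<integral>t. \<phi> (1 - cos t) * \<rho> f t \<partial>T)" "integrable (\<nu> f) \<phi>"
proof -
  note f2 = fs_L2[OF f]
  have "compact (\<phi> ` {0..2})" by (intro compact_continuous_image cont) simp
  then obtain S where S: "\<And>t. t \<in> {0..2} \<Longrightarrow> \<bar>\<phi> t\<bar> \<le> S"
    using compact_imp_bounded bounded_iff by (metis (no_types, lifting) imageI real_norm_def)
  have good: "good \<phi>" by (rule good_boundedI[OF meas S])
  show int: "integrable (\<nu> f) \<phi>" by (rule integrable_\<nu>_bounded[OF f2 meas S])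
  have "\<bar>(\<integral>t. \<phi> t \<partial>\<nu> f) - (\<integral>t. \<phi> (1 - cos t) * \<rho> f t \<partial>T)\<bar> \<le> 0"
  proof (rule field_le_epsilon)
    fix e :: real assume e: "e > 0"
    \<comment> \<open>Two errors of at most \<open>d * nrm2 f\<close> occur, one for either measure,
      since both have total mass \<open>nrm2 f\<close>; the added 1 keeps the denominator
      positive.\<close>
    define Y where "Y = nrm2 f + 1"
    define d where "d = e / (2 * Y)"
    have pos: "Y > 0" using nrm2_nonneg[of f] by (simp add: Y_def add_nonneg_pos)
    have d: "d > 0" using e pos by (simp add: d_def)
    have "2 * d * nrm2 f \<le> 2 * d * Y" using d by (simp add: Y_def)
    also have "\<dots> = e" using pos by (simp add: d_def)
    finally have d2: "2 * d * nrm2 f \<le> e" .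
    obtain a n where P: "\<And>t. t \<in> {0..2} \<Longrightarrow> \<bar>\<phi> t - (\<Sum>i\<le>n. a i * t ^ i)\<bar> < d"
      using poly_approx[OF cont d] by blast
    let ?P = "\<lambda>t. \<Sum>i\<le>n. a i * t ^ i"
    have pw: "integrable (\<nu> f) (\<lambda>t. t ^ i)" for i
      by (rule integrable_\<nu>_bounded[OF f2, where s = "2 ^ i"]) (auto simp: power_mono)
    have Pint: "integrable (\<nu> f) ?P" using pw by auto
    have good_P: "good ?P" by (rule PA_eq_Op(2)[OF f])
    have eq: "(\<integral>t. ?P t \<partial>\<nu> f) = (\<integral>t. ?P (1 - cos t) * \<rho> f t \<partial>T)"
      using \<rho>_integral(1)[OF f good_power] pw
      by (simp add: moments_fs[OF f] sum_distrib_right mult.assoc)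
    have "\<bar>(\<integral>t. \<phi> t \<partial>\<nu> f) - (\<integral>t. ?P t \<partial>\<nu> f)\<bar> = \<bar>\<integral>t. \<phi> t - ?P t \<partial>\<nu> f\<bar>"
      using int Pint by simp
    also have "\<dots> \<le> (\<integral>t. d \<partial>\<nu> f)"
    proof (rule order_trans[OF integral_abs_bound], rule integral_mono_AE)
      show "AE t in \<nu> f. \<bar>\<phi> t - ?P t\<bar> \<le> d"
        using AE_\<nu>_support[OF f2] by eventually_elim (use P in \<open>auto intro: less_imp_le\<close>)
      show "integrable (\<nu> f) (\<lambda>t. d)"
        by (rule finite_measure.integrable_const[OF finite_\<nu>[OF f2]])
    qed (use int Pint in auto)
    also have "\<dots> = d * nrm2 f" using measure_\<nu>_UNIV[OF f2] by simp
    finally have 1: "\<bar>(\<integral>t. \<phi> t \<partial>\<nu> f) - (\<integral>t. ?P t \<partial>\<nu> f)\<bar> \<le> d * nrm2 f" .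
    note int\<rho> = \<rho>_integral(1)[OF f good] \<rho>_integral(1)[OF f good_P]
    have "\<bar>(\<integral>t. \<phi> (1 - cos t) * \<rho> f t \<partial>T) - (\<integral>t. ?P (1 - cos t) * \<rho> f t \<partial>T)\<bar>
        = \<bar>\<integral>t. \<phi> (1 - cos t) * \<rho> f t - ?P (1 - cos t) * \<rho> f t \<partial>T\<bar>"
      using int\<rho> by simp
    also have "\<dots> \<le> (\<integral>t. d * \<rho> f t \<partial>T)"
    proof (rule order_trans[OF integral_abs_bound], rule integral_mono)
      show "integrable T (\<lambda>t. \<bar>\<phi> (1 - cos t) * \<rho> f t - ?P (1 - cos t) * \<rho> f t\<bar>)"
        by (intro integrable_abs Bochner_Integration.integrable_diff int\<rho>)
      show "integrable T (\<lambda>t. d * \<rho> f t)" using nrm2_eq_integral_\<rho>(2)[OF f] by simp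
      fix t assume "t \<in> space T"
      then have "\<rho> f t \<ge> 0" using \<rho>_nonneg[OF f] by simp
      then show "\<bar>\<phi> (1 - cos t) * \<rho> f t - ?P (1 - cos t) * \<rho> f t\<bar> \<le> d * \<rho> f t"
        using P[OF one_minus_cos_bounds[of t]]
        by (simp add: abs_mult mult_right_mono flip: left_diff_distrib)
    qed
    also have "\<dots> = d * nrm2 f" using nrm2_eq_integral_\<rho>[OF f] by simp
    finally show "\<bar>(\<integral>t. \<phi> t \<partial>\<nu> f) - (\<integral>t. \<phi> (1 - cos t) * \<rho> f t \<partial>T)\<bar> \<le> 0 + e"
      using 1 eq d2 by linarith
  qed
  then show "(\<integral>t. \<phi> t \<partial>\<nu> f) = (\<integral>t. \<phi> (1 - cos t) * \<rho> f t \<partial>T)" by simp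
qed

abbreviation \<phi>0 :: "real \<Rightarrow> real" where
  "\<phi>0 \<equiv> \<lambda>t. t powr (- 1 / 2)"

text \<open>The regularizations \<open>?g n\<close> of \<open>1 / t\<close> are continuous, so their
  integrals are known from the explicit density and bounded by \<open>?K\<close> uniformly in
  \<open>n\<close>. This excludes an atom at 0, gives membership in the domain by Fatou, and leaves
  the value of the form to dominated convergence of the square roots of \<open>?g n\<close>.\<close>

lemma fs_singular:
  assumes f: "fs f"
  shows "AE t in \<nu> f. t \<in> {0<..2}" "f \<in> dom \<phi>0"
    "(\<integral>t. \<phi>0 t \<partial>\<nu> f) = Re (ip (Op Fb f) f)"
proof -
  note f2 = fs_L2[OF f]
  let ?g = "\<lambda>n t. 1 / (\<bar>t\<bar> + 1 / Suc n)"
  let ?K = "\<integral>t. (\<phi>0 (1 - cos t))\<^sup>2 * \<rho> f t \<partial>T"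
  have den: "\<bar>t\<bar> + 1 / Suc n > 0" for t :: real and n by (simp add: add_nonneg_pos)
  have cont: "continuous_on S (?g n)" for S n
    using den by (intro continuous_intros) (auto simp: less_imp_neq[symmetric])
  have meas: "?g n \<in> borel_measurable borel" for n
    using cont[of UNIV n] by (rule borel_measurable_continuous_onI)
  have inv: "(\<phi>0 t)\<^sup>2 = 1 / t" if "t > 0" for t :: real
    using that by (simp add: powr_minus powr_half_sqrt inverse_eq_divide power_divide)
  have le: "(\<integral>t. ?g n t \<partial>\<nu> f) \<le> ?K" for n
    unfolding integral_\<nu>_continuous(1)[OF f cont meas]
  proof (rule integral_mono)
    show "integrable T (\<lambda>t. ?g n (1 - cos t) * \<rho> f t)"
    proof (rule \<rho>_integral(1)[OF f], rule good_boundedI[OF meas])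
      show "\<bar>?g n t\<bar> \<le> Suc n" for t using den[of t n] by (simp add: field_simps)
    qed
    show "integrable T (\<lambda>t. (\<phi>0 (1 - cos t))\<^sup>2 * \<rho> f t)"
      by (rule \<rho>_integral(1)[OF f good_powr_half(2)])
    fix t assume t: "t \<in> space T"
    show "?g n (1 - cos t) * \<rho> f t \<le> (\<phi>0 (1 - cos t))\<^sup>2 * \<rho> f t"
    \<comment> \<open>\<open>\<phi>0 0 = 0\<close> by the convention for \<open>powr\<close>, so the
      inequality would fail at the spectral value 0 if the density did not vanish there.\<close>
    proof (cases "cos t = 1")
      case True
      then have "Fd t d = 0" for d using Fd_bound[of t d] by (simp add: sin_sq_eq)
      then have "\<rho> f t = 0" by (simp add: \<rho>_def Op_def[abs_def] ker_def L2_inner_def)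
      then show ?thesis by simp
    next
      case False
      then have pos: "1 - cos t > 0" using cos_le_one[of t] by linarith
      have "?g n (1 - cos t) \<le> (\<phi>0 (1 - cos t))\<^sup>2"
        unfolding inv[OF pos] using pos by (intro divide_left_mono) (auto simp: add_pos_pos)
      then show ?thesis using \<rho>_nonneg[OF f] t by (intro mult_right_mono) auto
    qed
  qed
  \<comment> \<open>\<open>?g n 0 = Suc n\<close>, so an atom at 0 would make the bounded integrals
    grow without bound.\<close>
  have "measure (\<nu> f) {0} * Suc n \<le> ?K" for n
  proof -
    have "measure (\<nu> f) {0} * Suc n = (\<integral>t. indicator {0} t * real (Suc n) \<partial>\<nu> f)" by simp
    also have "\<dots> \<le> (\<integral>t. ?g n t \<partial>\<nu> f)"
    proof (rule integral_mono)
      show "integrable (\<nu> f) (\<lambda>t. indicator {0} t * real (Suc n))"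
        by (rule integrable_\<nu>_bounded[OF f2, where s = "Suc n"]) (auto simp: indicator_def)
      show "integrable (\<nu> f) (?g n)" by (rule integral_\<nu>_continuous(2)[OF f cont meas])
      show "indicator {0} t * real (Suc n) \<le> ?g n t" for t
        using den[of t n] by (cases "t = 0") auto
    qed
    finally show ?thesis using le[of n] by linarith
  qed
  moreover have "\<exists>n. measure (\<nu> f) {0} * real (Suc n) > ?K" if m: "measure (\<nu> f) {0} > 0"
  proof -
    obtain n where "real n > ?K / measure (\<nu> f) {0}" using reals_Archimedean2 by blast
    then have "real (Suc n) * measure (\<nu> f) {0} > ?K" using m by (simp add: field_simps)
    then show ?thesis by (metis mult.commute)
  qed
  ultimately have "\<not> measure (\<nu> f) {0} > 0" by (meson not_le)
  then have "measure (\<nu> f) {0} = 0" using measure_nonneg[of "\<nu> f" "{0}"] by linarith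
  then have "emeasure (\<nu> f) {0} = 0"
    using finite_measure.emeasure_eq_measure[OF finite_\<nu>[OF f2]] by simp
  then have "AE t in \<nu> f. t \<noteq> 0" by (intro AE_I[where N = "{0}"]) auto
  with AE_\<nu>_support[OF f2] show AE: "AE t in \<nu> f. t \<in> {0<..2}"
    by eventually_elim auto
  have g_lim: "(\<lambda>n. 1 / Suc n) \<longlonglongrightarrow> (0::real)" by (rule LIMSEQ_Suc[OF lim_1_over_n])
  have gt: "(\<lambda>n. ?g n t) \<longlonglongrightarrow> (\<phi>0 t)\<^sup>2" if "t > 0" for t
  proof -
    have "(\<lambda>n. ?g n t) \<longlonglongrightarrow> 1 / (\<bar>t\<bar> + 0)"
      using that by (intro tendsto_divide tendsto_add tendsto_const g_lim) auto
    then show ?thesis using that inv by simp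
  qed
  have "(\<integral>\<^sup>+t. ennreal ((\<phi>0 t)\<^sup>2) \<partial>\<nu> f) = (\<integral>\<^sup>+t. liminf (\<lambda>n. ennreal (?g n t)) \<partial>\<nu> f)"
  proof (rule nn_integral_cong_AE)
    show "AE t in \<nu> f. ennreal ((\<phi>0 t)\<^sup>2) = liminf (\<lambda>n. ennreal (?g n t))"
      using AE
    proof eventually_elim
      case (elim t)
      then show ?case
        using lim_imp_Liminf[OF _ tendsto_ennrealI[OF gt[of t]]] by simp
    qed
  qed
  also have "\<dots> \<le> liminf (\<lambda>n. \<integral>\<^sup>+t. ennreal (?g n t) \<partial>\<nu> f)"
    using meas by (intro nn_integral_liminf) (auto cong: measurable_cong_sets)
  also have "\<dots> \<le> ennreal ?K"
  proof (rule Liminf_le)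
    have "(\<integral>\<^sup>+t. ennreal (?g n t) \<partial>\<nu> f) = ennreal (\<integral>t. ?g n t \<partial>\<nu> f)" for n
      using den by (intro nn_integral_eq_integral integral_\<nu>_continuous(2)[OF f cont meas])
        (auto intro!: AE_I2 simp: less_imp_le)
    then show "\<forall>\<^sub>F n in sequentially. (\<integral>\<^sup>+t. ennreal (?g n t) \<partial>\<nu> f) \<le> ennreal ?K"
      using le by (simp add: ennreal_leI)
  qed simp
  finally have fin: "(\<integral>\<^sup>+t. ennreal ((\<phi>0 t)\<^sup>2) \<partial>\<nu> f) < \<infinity>"
    by (rule le_less_trans) simp
  have "integrable (\<nu> f) (\<lambda>t. (\<phi>0 t)\<^sup>2)"
  proof (rule integrableI_nonneg[OF _ _ fin])
    show "(\<lambda>t. (\<phi>0 t)\<^sup>2) \<in> borel_measurable (\<nu> f)" by (rule borel_\<nu>) measurable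
  qed simp
  then show dom: "f \<in> dom \<phi>0" by (rule domI[OF f2])
  have int0: "integrable (\<nu> f) \<phi>0" by (rule dom_integrable[OF dom]) simp
  let ?h = "\<lambda>n t. sqrt (?g n t)"
  have h_cont: "continuous_on S (?h n)" for S n by (intro continuous_on_real_sqrt cont)
  have h_meas: "?h n \<in> borel_measurable borel" for n using h_cont by (rule borel_measurable_continuous_onI)
  have \<phi>0_eq: "\<phi>0 t = sqrt ((\<phi>0 t)\<^sup>2)" for t :: real by simp
  have h_lim: "(\<lambda>n. ?h n t) \<longlonglongrightarrow> \<phi>0 t" if "t > 0" for t
    by (subst \<phi>0_eq) (intro tendsto_real_sqrt gt that)
  have h_le: "\<bar>?h n t\<bar> \<le> \<phi>0 t" if "t > 0" for n t
  proof -
    have "?g n t \<le> (\<phi>0 t)\<^sup>2" unfolding inv[OF that] using that by (intro divide_left_mono) (auto simp: add_pos_pos)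
    then have "?h n t \<le> sqrt ((\<phi>0 t)\<^sup>2)" by (rule real_sqrt_le_mono)
    then show ?thesis using den[of t n] by (simp add: less_imp_le)
  qed
  have lim1: "(\<lambda>n. \<integral>t. ?h n t \<partial>\<nu> f) \<longlonglongrightarrow> (\<integral>t. \<phi>0 t \<partial>\<nu> f)"
  proof (rule integral_dominated_convergence[where w = \<phi>0])
    show "AE t in \<nu> f. (\<lambda>n. ?h n t) \<longlonglongrightarrow> \<phi>0 t" using AE by eventually_elim (use h_lim in auto)
    show "AE t in \<nu> f. norm (?h n t) \<le> \<phi>0 t" for n using AE by eventually_elim (use h_le in auto)
    show "integrable (\<nu> f) \<phi>0" by (rule int0)
    show "\<phi>0 \<in> borel_measurable (\<nu> f)" by (rule borel_\<nu>) measurable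
    show "?h n \<in> borel_measurable (\<nu> f)" for n by (rule borel_\<nu>[OF h_meas])
  qed
  have lim2: "(\<lambda>n. Re (ip (Op (Kf (?h n)) f) f)) \<longlonglongrightarrow> Re (ip (Op (Kf \<phi>0) f) f)"
  proof -
    define S where "S = {x. f x \<noteq> 0}"
    have S: "finite S" "{x. f x \<noteq> 0} \<subseteq> S" using f by (auto simp: S_def fs_def)
    have K: "(\<lambda>n. Kf (?h n) d) \<longlonglongrightarrow> Kf \<phi>0 d" for d
    proof (rule Kf_tendsto[where B = 2])
      show "\<bar>t * ?h n t\<bar> \<le> 2" if t: "t \<in> {0..2}" for n t
      proof (cases "t = 0")
        case False
        then have pos: "t > 0" using t by simp
        have "\<bar>t * ?h n t\<bar> \<le> t * \<phi>0 t"
          using mult_left_mono[OF h_le[OF pos], of t n] pos by (simp add: abs_mult)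
        also have "\<dots> \<le> 2" using powr_half_bounds(1)[OF t] by linarith
        finally show ?thesis .
      qed simp
      show "?h n \<in> borel_measurable borel" for n by (rule h_meas)
      show "(\<lambda>n. ?h n t) \<longlonglongrightarrow> \<phi>0 t" if "t \<in> {0<..2}" for t by (rule h_lim) (use that in simp)
    qed measurable
    show ?thesis
      unfolding ip_Op(1)[OF S S(2)]
      by (intro tendsto_Re tendsto_sum tendsto_mult tendsto_const tendsto_of_real ker_tendsto K)
  qed
  have eq: "(\<integral>t. ?h n t \<partial>\<nu> f) = Re (ip (Op (Kf (?h n)) f) f)" for n
  proof -
    have "good (?h n)"
    proof (rule good_boundedI[OF h_meas])
      show "\<bar>?h n t\<bar> \<le> sqrt (Suc n)" for t
        using den[of t n] by (simp add: field_simps)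
    qed
    then show ?thesis
      using integral_\<nu>_continuous(1)[OF f h_cont h_meas] \<rho>_integral(2)[OF f] by simp
  qed
  from LIMSEQ_unique[OF lim1[unfolded eq] lim2]
  show "(\<integral>t. \<phi>0 t \<partial>\<nu> f) = Re (ip (Op Fb f) f)"
    unfolding Kf_powr_half .
qed


lemma ip_fs_lin_right:
  assumes "fs f" "fs h"
  shows "ip u (\<lambda>x. f x + c * h x) = ip u f + cnj c * ip u h"
proof -
  have "integrable M (\<lambda>x. u x * cnj (g x))" if "fs g" for g
    by (rule integrable_finite_support[of "{x. g x \<noteq> 0}"]) (use that in \<open>auto simp: fs_def\<close>)
  from this[OF assms(1)] this[OF assms(2)]
  have "(\<integral>x. u x * cnj (f x) + cnj c * (u x * cnj (h x)) \<partial>M) = ip u f + cnj c * ip u h"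
    unfolding L2_inner_def by simp
  then show ?thesis unfolding L2_inner_def by (simp add: distrib_left mult_ac)
qed

lemma ip_fs_lin_left:
  assumes "fs h"
  shows "ip (\<lambda>x. u x + c * v x) h = ip u h + c * ip v h"
proof -
  have "integrable M (\<lambda>x. g x * cnj (h x))" for g
    by (rule integrable_finite_support[of "{x. h x \<noteq> 0}"]) (use assms in \<open>auto simp: fs_def\<close>)
  then have "(\<integral>x. u x * cnj (h x) + c * (v x * cnj (h x)) \<partial>M) = ip u h + c * ip v h"
    unfolding L2_inner_def by simp
  then show ?thesis unfolding L2_inner_def by (simp only: distrib_right mult.assoc)
qed

lemma Op_lin_fs: "fs f \<Longrightarrow> fs g \<Longrightarrow> Op F (\<lambda>x. f x + c * g x) = (\<lambda>x. Op F f x + c * Op F g x)"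
  using Op_diff_fs[of f "\<lambda>x. (- c) * g x" F] fs_scale[of g "- c"] Op_scale[of F "- c" g] by simp

end

context flow_tree_spectral
begin

lemma pairing_fs:
  assumes f: "fs f" and h: "fs h"
  shows "pair \<phi>0 f h = ip (Op Fb f) h"
proof -
  have "complex_of_real (\<integral>t. \<phi>0 t \<partial>\<nu> (\<lambda>x. f x + \<i> ^ k * h x))
      = ip (Op Fb f) f + cnj (\<i> ^ k) * ip (Op Fb f) h + \<i> ^ k * ip (Op Fb h) f + ip (Op Fb h) h" for k
  proof -
    let ?u = "\<lambda>x. f x + \<i> ^ k * h x"
    have u: "fs ?u" using f h by (intro fs_add fs_scale)
    have "complex_of_real (\<integral>t. \<phi>0 t \<partial>\<nu> ?u) = ip (Op Fb ?u) ?u"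
      using fs_singular(3)[OF u] Op_real[OF u] by simp
    also have "\<dots> = ip (Op Fb f) f + cnj (\<i> ^ k) * ip (Op Fb f) h + \<i> ^ k * (ip (Op Fb h) f + cnj (\<i> ^ k) * ip (Op Fb h) h)"
      unfolding Op_lin_fs[OF f h] ip_fs_lin_left[OF u] ip_fs_lin_right[OF f h] ..
    also have "\<i> ^ k * (ip (Op Fb h) f + cnj (\<i> ^ k) * ip (Op Fb h) h) = \<i> ^ k * ip (Op Fb h) f + ip (Op Fb h) h"
      by (simp add: distrib_left flip: mult.assoc power_mult_distrib)
    finally show ?thesis by (simp add: add_ac)
  qed
  then show ?thesis unfolding spectral_pairing_def by (simp only: polarization_algebra)
qed

lemma \<phi>0_measurable: "\<phi>0 \<in> borel_measurable borel"
  by measurable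

text \<open>A point mass lies in the domain, so its image under the inverse square root has finite
  norm; the rows of this kernel are therefore in L2 although the symbol is unbounded.\<close>

lemma kx_Fb_L2: "kx Fb x \<in> Lp M 2"
proof -
  let ?d = "\<delta> x"
  have d: "fs ?d" by simp
  have C: "sqrt (\<integral>t. (\<phi>0 t)\<^sup>2 \<partial>\<nu> ?d) \<ge> 0"
    by (intro real_sqrt_ge_zero Bochner_Integration.integral_nonneg) simp
  have "cmod (ip (Op Fb ?d) h) \<le> sqrt (\<integral>t. (\<phi>0 t)\<^sup>2 \<partial>\<nu> ?d) * nrm h" if "fs h" for h
    unfolding pairing_fs[OF d that, symmetric]
    by (rule pairing_bound(1)[OF fs_singular(2)[OF d] fs_singular(2)[OF that] \<phi>0_measurable])
  then have "Op Fb ?d \<in> Lp M 2" by (rule L2_dual(1)[OF C])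
  then show ?thesis unfolding kx_eq by (rule L2_scale)
qed

text \<open>For fixed finitely supported \<open>h\<close> both sides are continuous in
  \<open>f\<close> along truncations: the left by the second bound in \<open>pairing_bound\<close>,
  the right because the rows of the kernel are in L2.\<close>

lemma pairing_dom_fs:
  assumes f: "f \<in> dom \<phi>0" and h: "fs h"
  shows "pair \<phi>0 f h = ip (Op Fb f) h"
proof (rule LIMSEQ_unique)
  note f2 = dom_L2[OF f] and hd = fs_singular(2)[OF h]
  show "(\<lambda>n. pair \<phi>0 (trunc n f) h) \<longlonglongrightarrow> pair \<phi>0 f h"
  proof (rule LIM_zero_cancel, rule Lim_null_comparison)
    show "(\<lambda>n. nrm (\<lambda>x. trunc n f x - f x) * sqrt (\<integral>t. (\<phi>0 t)\<^sup>2 \<partial>\<nu> h)) \<longlonglongrightarrow> 0"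
      by (rule tendsto_mult_left_zero[OF trunc_tendsto[OF f2]])
    have "cmod (pair \<phi>0 (trunc n f) h - pair \<phi>0 f h) \<le> nrm (\<lambda>x. trunc n f x - f x) * sqrt (\<integral>t. (\<phi>0 t)\<^sup>2 \<partial>\<nu> h)" for n
    proof -
      note t = fs_singular(2)[OF fs_trunc[of n f]]
      have "(\<lambda>x. trunc n f x - f x) \<in> dom \<phi>0"
        using dom_lin[OF t f \<phi>0_measurable, of "-1"] by simp
      then show ?thesis
        unfolding pairing_diff_left[OF t f hd \<phi>0_measurable, symmetric]
        by (rule pairing_bound(2)[OF _ hd \<phi>0_measurable])
    qed
    then show "\<forall>\<^sub>F n in sequentially. norm (pair \<phi>0 (trunc n f) h - pair \<phi>0 f h) \<le> nrm (\<lambda>x. trunc n f x - f x) * sqrt (\<integral>t. (\<phi>0 t)\<^sup>2 \<partial>\<nu> h)"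
      by simp
  qed
  show "(\<lambda>n. pair \<phi>0 (trunc n f) h) \<longlonglongrightarrow> ip (Op Fb f) h"
    unfolding pairing_fs[OF fs_trunc h]
    by (rule ip_fs_tendsto[OF h Op_trunc_tendsto[OF f2 kx_Fb_L2]])
qed

text \<open>The pairing with \<open>f\<close> is bounded by a multiple of the norm of the test
  function, so \<open>Op Fb f\<close> is in L2 and the identity extends to all test vectors.
  Uniqueness in the definite description holds since point masses are test vectors.\<close>

lemma spectral_integral_eq:
  assumes f: "f \<in> dom \<phi>0"
  shows "Op Fb f \<in> Lp M 2" "spectral_integral M E \<phi>0 f = Op Fb f"
proof -
  let ?C = "sqrt (\<integral>t. (\<phi>0 t)\<^sup>2 \<partial>\<nu> f)"
  have C: "?C \<ge> 0" by (intro real_sqrt_ge_zero Bochner_Integration.integral_nonneg) simp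
  have "cmod (ip (Op Fb f) h) \<le> ?C * nrm h" if "fs h" for h
    unfolding pairing_dom_fs[OF f that, symmetric]
    by (rule pairing_bound(1)[OF f fs_singular(2)[OF that] \<phi>0_measurable])
  then show g: "Op Fb f \<in> Lp M 2" by (rule L2_dual(1)[OF C])
  have eq: "ip (Op Fb f) h = pair \<phi>0 f h" if h: "h \<in> dom \<phi>0" for h
  proof (rule LIMSEQ_unique)
    note h2 = dom_L2[OF h]
    have "(\<lambda>n. ip (trunc n h) (Op Fb f)) \<longlonglongrightarrow> ip h (Op Fb f)"
      by (rule ip_tendsto_left[OF fs_L2[OF fs_trunc] h2 trunc_tendsto[OF h2] g])
    then have "(\<lambda>n. cnj (ip (trunc n h) (Op Fb f))) \<longlonglongrightarrow> cnj (ip h (Op Fb f))" by (rule tendsto_cnj)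
    then show "(\<lambda>n. ip (Op Fb f) (trunc n h)) \<longlonglongrightarrow> ip (Op Fb f) h" by (simp only: ip_cnj[symmetric])
    show "(\<lambda>n. ip (Op Fb f) (trunc n h)) \<longlonglongrightarrow> pair \<phi>0 f h"
      unfolding pairing_dom_fs[OF f fs_trunc, symmetric]
    proof (rule LIM_zero_cancel, rule Lim_null_comparison)
      show "(\<lambda>n. ?C * nrm (\<lambda>x. trunc n h x - h x)) \<longlonglongrightarrow> 0"
        by (rule tendsto_mult_right_zero[OF trunc_tendsto[OF h2]])
      have "cmod (pair \<phi>0 f (trunc n h) - pair \<phi>0 f h) \<le> ?C * nrm (\<lambda>x. trunc n h x - h x)" for n
      proof -
        note t = fs_singular(2)[OF fs_trunc[of n h]]
        have "(\<lambda>x. trunc n h x - h x) \<in> dom \<phi>0"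
          using dom_lin[OF t h \<phi>0_measurable, of "-1"] by simp
        then show ?thesis
          unfolding pairing_diff_right[OF t h f \<phi>0_measurable, symmetric]
          by (rule pairing_bound(1)[OF f _ \<phi>0_measurable])
      qed
      then show "\<forall>\<^sub>F n in sequentially. norm (pair \<phi>0 f (trunc n h) - pair \<phi>0 f h) \<le> ?C * nrm (\<lambda>x. trunc n h x - h x)"
        by simp
    qed
  qed
  show "spectral_integral M E \<phi>0 f = Op Fb f"
    unfolding spectral_integral_def
  proof (rule the_equality)
    show "Op Fb f \<in> Lp M 2 \<and> (\<forall>h\<in>dom \<phi>0. ip (Op Fb f) h = pair \<phi>0 f h)" using g eq by blast
    fix g' assume g': "g' \<in> Lp M 2 \<and> (\<forall>h\<in>dom \<phi>0. ip g' h = pair \<phi>0 f h)"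
    show "g' = Op Fb f"
    proof
      fix x
      have "\<delta> x \<in> dom \<phi>0" by (rule fs_singular(2)) simp
      then have "ip g' (\<delta> x) = ip (Op Fb f) (\<delta> x)" using g' eq by simp
      then show "g' x = Op Fb f x" by (simp add: ip_\<delta>)
    qed
  qed
qed

end


subsection \<open>Existence of the spectral resolution\<close>

context flow_tree
begin

text \<open>\<open>spectral_resolution\<close> is a choice, and without a witness nothing would be
  known about the chosen resolution. The projections are the functional calculus at
  indicators.\<close>

definition E0 :: "real set \<Rightarrow> ('v \<Rightarrow> complex) \<Rightarrow> 'v \<Rightarrow> complex" where
  "E0 B = Op (Kf (indicator B))"

lemma E0_L2: "B \<in> sets borel \<Longrightarrow> f \<in> Lp M 2 \<Longrightarrow> E0 B f \<in> Lp M 2"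
  unfolding E0_def by (rule Op_Kf_L2(1)[OF bdd_indicator])

text \<open>Multiplicativity is known on finitely supported functions, and both sides converge at
  each point along truncations.\<close>

lemma E0_Int:
  assumes B: "B \<in> sets borel" and C: "C \<in> sets borel" and f: "f \<in> Lp M 2"
  shows "E0 (B \<inter> C) f = E0 B (E0 C f)"
proof
  fix x
  have BC: "B \<inter> C \<in> sets borel" using B C by simp
  have fs_case: "E0 B (E0 C g) = E0 (B \<inter> C) g" if "fs g" for g
    using Op_mult_indicator_fs[OF B bdd_indicator[OF C] that]
    by (simp add: E0_def indicator_inter_arith[abs_def])
  have "(\<lambda>n. E0 (B \<inter> C) (trunc n f) x) \<longlonglongrightarrow> E0 (B \<inter> C) f x"
    unfolding E0_def by (rule Op_trunc_tendsto[OF f kx_L2(1)[OF bdd_indicator[OF BC]]])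
  moreover have "(\<lambda>n. E0 B (E0 C (trunc n f)) x) \<longlonglongrightarrow> E0 B (E0 C f) x"
    unfolding E0_def Op_eq_ip[of "Kf (indicator B)"]
    by (rule ip_tendsto_left[OF Op_Kf_L2(1)[OF bdd_indicator[OF C] fs_L2[OF fs_trunc]] Op_Kf_L2(1)[OF bdd_indicator[OF C] f]
          Op_trunc_nrm_tendsto[OF bdd_indicator[OF C] f] kx_L2(1)[OF bdd_indicator[OF B]]])
  ultimately show "E0 (B \<inter> C) f x = E0 B (E0 C f) x"
    unfolding fs_case[OF fs_trunc] by (rule LIMSEQ_unique)
qed

lemma Op_Kf_add:
  assumes "bdd s \<phi>" "bdd r \<psi>" "f \<in> Lp M 2"
  shows "Op (Kf (\<lambda>t. \<phi> t + \<psi> t)) f x = Op (Kf \<phi>) f x + Op (Kf \<psi>) f x"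
proof -
  have "kx (Kf (\<lambda>t. \<phi> t + \<psi> t)) x = (\<lambda>y. kx (Kf \<phi>) x y + kx (Kf \<psi>) x y)"
    using bdd_good[OF assms(1)] bdd_good[OF assms(2)]
    by (auto simp: kx_def ker_def Kf_add add_divide_distrib)
  then show ?thesis
    using ip_add_right[OF kx_L2(1)[OF assms(1)] kx_L2(1)[OF assms(2)] assms(3)] by (simp add: Op_eq_ip)
qed

lemma E0_sum:
  assumes "finite I" "\<And>i. i \<in> I \<Longrightarrow> D i \<in> sets borel" "f \<in> Lp M 2"
  shows "Op (Kf (\<lambda>t. \<Sum>i\<in>I. c i * indicator (D i) t)) f x = (\<Sum>i\<in>I. complex_of_real (c i) * E0 (D i) f x)"
    "\<exists>s. bdd s (\<lambda>t. \<Sum>i\<in>I. c i * indicator (D i) t)"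
proof -
  have bdd: "\<exists>s. bdd s (\<lambda>t. \<Sum>i\<in>J. c i * indicator (D i) t)" if "J \<subseteq> I" for J
  proof -
    have "\<bar>\<Sum>i\<in>J. c i * indicator (D i) t\<bar> \<le> (\<Sum>i\<in>J. \<bar>c i\<bar>)" for t
      by (rule order_trans[OF sum_abs]) (auto intro!: sum_mono simp: indicator_def abs_mult)
    moreover have "(\<lambda>t. \<Sum>i\<in>J. c i * indicator (D i) t) \<in> borel_measurable borel"
      using assms(2) that by (intro borel_measurable_sum borel_measurable_times borel_measurable_indicator) auto
    ultimately have "bdd (\<Sum>i\<in>J. \<bar>c i\<bar>) (\<lambda>t. \<Sum>i\<in>J. c i * indicator (D i) t)"
      unfolding bdd_def by blast
    then show ?thesis ..
  qed
  show "\<exists>s. bdd s (\<lambda>t. \<Sum>i\<in>I. c i * indicator (D i) t)" by (rule bdd[OF subset_refl])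
  have scale: "Op (Kf (\<lambda>t. c * \<phi> t)) f x = complex_of_real c * Op (Kf \<phi>) f x" for c \<phi>
  proof -
    have "ker (Kf (\<lambda>t. c * \<phi> t)) x y = c * ker (Kf \<phi>) x y" for y by (simp add: ker_def Kf_scale)
    then show ?thesis by (simp add: Op_def mult.assoc)
  qed
  show "Op (Kf (\<lambda>t. \<Sum>i\<in>I. c i * indicator (D i) t)) f x = (\<Sum>i\<in>I. complex_of_real (c i) * E0 (D i) f x)"
    using assms(1) subset_refl[of I]
  proof (induction rule: finite_subset_induct')
    case empty
    then show ?case by (simp add: Op_def ker_def Kf_def)
  next
    case (insert i J)
    obtain s where s: "bdd s (\<lambda>t. \<Sum>i\<in>J. c i * indicator (D i) t)" using bdd[OF insert(3)] ..
    have ci: "bdd \<bar>c i\<bar> (\<lambda>t. c i * indicator (D i) t)"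
      using assms(2)[OF insert(2)] by (auto simp: bdd_def indicator_def abs_mult)
    have "(\<lambda>t. \<Sum>k\<in>insert i J. c k * indicator (D k) t) = (\<lambda>t. c i * indicator (D i) t + (\<Sum>k\<in>J. c k * indicator (D k) t))"
      by (rule ext, rule sum.insert[OF insert(1,4)])
    then have "Op (Kf (\<lambda>t. \<Sum>i\<in>insert i J. c i * indicator (D i) t)) f x
        = Op (Kf (\<lambda>t. c i * indicator (D i) t + (\<Sum>i\<in>J. c i * indicator (D i) t))) f x"
      by (simp only:)
    also have "\<dots> = Op (Kf (\<lambda>t. c i * indicator (D i) t)) f x + Op (Kf (\<lambda>t. \<Sum>i\<in>J. c i * indicator (D i) t)) f x"
      by (rule Op_Kf_add[OF ci s assms(3)])
    also have "\<dots> = complex_of_real (c i) * E0 (D i) f x + (\<Sum>i\<in>J. complex_of_real (c i) * E0 (D i) f x)"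
      unfolding scale insert(5) E0_def ..
    finally show ?case unfolding sum.insert[OF insert(1,4)] .
  qed
qed

lemma E0_resolution: "resolution_of_identity M E0"
  unfolding resolution_of_identity_def
proof (intro conjI ballI allI impI)
  fix B :: "real set" assume B: "B \<in> sets borel"
  fix f assume f: "f \<in> Lp M 2"
  show "E0 B f \<in> Lp M 2" by (rule E0_L2[OF B f])
  fix g assume g: "g \<in> Lp M 2"
  show "E0 B (\<lambda>x. f x + c * g x) = (\<lambda>x. E0 B f x + c * E0 B g x)" for c
    unfolding E0_def Op_add_L2[OF bdd_indicator[OF B] f L2_scale[OF g]] Op_scale ..
  show "ip (E0 B f) g = ip f (E0 B g)"
    unfolding E0_def by (rule Op_symmetric_L2[OF bdd_indicator[OF B] f g])
next
  fix f
  have "indicator UNIV = (\<lambda>t. 1 :: real)" by auto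
  then show "E0 UNIV f = f" by (simp add: E0_def Op_one)
  show "E0 {} f = (\<lambda>x. 0)" by (auto simp: E0_def Op_def ker_def Kf_def)
next
  fix B C :: "real set" and f
  assume "B \<in> sets borel" "C \<in> sets borel" "f \<in> Lp M 2"
  then show "E0 (B \<inter> C) f = E0 B (E0 C f)" by (rule E0_Int)
next
  fix D :: "nat \<Rightarrow> real set" and f g
  assume D: "range D \<subseteq> sets borel \<and> disjoint_family D" and f: "f \<in> Lp M 2" and g: "g \<in> Lp M 2"
  have Db: "D i \<in> sets borel" for i using D by auto
  have ind: "(\<lambda>t. \<Sum>i<n. 1 * indicator (D i) t) = (indicator (\<Union>i<n. D i) :: real \<Rightarrow> real)" for n
    using D by (auto intro!: indicator_UN_disjoint[symmetric] simp: disjoint_family_on_def)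
  have part: "E0 (\<Union>i<n. D i) f = (\<lambda>x. \<Sum>i<n. E0 (D i) f x)" for n
    using E0_sum(1)[of "{..<n}" D f "\<lambda>i. 1"] Db f unfolding ind by (auto simp: E0_def)
  have "(\<lambda>n. ip (E0 (\<Union>i<n. D i) f) g) \<longlonglongrightarrow> ip (E0 (\<Union>i. D i) f) g"
    unfolding E0_def
  proof (rule Op_Kf_tendsto(2)[OF _ _ _ f g])
    show "bdd 1 (indicator (\<Union>i<n. D i))" for n using Db by (intro bdd_indicator) auto
    show "bdd 1 (indicator (\<Union>i. D i))" using Db by (intro bdd_indicator) auto
    show "(\<lambda>n. indicator (\<Union>i<n. D i) t) \<longlonglongrightarrow> (indicator (\<Union>i. D i) t :: real)" for t
      by (rule LIMSEQ_indicator_UN)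
  qed
  moreover have "ip (E0 (\<Union>i<n. D i) f) g = (\<Sum>i<n. ip (E0 (D i) f) g)" for n
    unfolding part by (rule ip_sum_left) (auto intro: E0_L2 Db f g)
  ultimately show "(\<lambda>n. ip (E0 (D n) f) g) sums ip (E0 (\<Union>n. D n) f) g"
    by (simp add: sums_def)
qed

lemma Kf_cong: "(\<And>t. t \<in> {0..2} \<Longrightarrow> \<phi> t = \<psi> t) \<Longrightarrow> Kf \<phi> d = Kf \<psi> d"
  unfolding Kf_def using one_minus_cos_bounds by (intro Bochner_Integration.integral_cong) auto

interpretation R0: flow_tree_resolution q p lev E0
  by unfold_locales (rule E0_resolution)

lemma AE_E0_support:
  assumes f: "f \<in> Lp M 2"
  shows "AE t in spectral_dist M E0 f. t \<in> {0..2}"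
proof (rule AE_I[where N = "- {0..2}"])
  have "Kf (indicator (- {0..2})) d = Kf (\<lambda>t. 0) d" for d
    by (rule Kf_cong) (auto simp: indicator_def)
  then have "E0 (- {0..2}) f = (\<lambda>x. 0)"
    by (auto simp: E0_def Op_def ker_def Kf_def[of "\<lambda>t. 0"])
  then show "emeasure (spectral_dist M E0 f) (- {0..2}) = 0"
    by (subst R0.emeasure_\<nu>[OF f]) (auto simp: nrm2_def)
qed auto

text \<open>For simple functions the integral against the spectral measure is the form of the
  functional calculus, by additivity of \<open>E0\<close>. Both sides pass to the limit towards the
  symbol \<open>t\<close>.\<close>

lemma integral_E0_id:
  assumes f: "f \<in> Lp M 2"
  shows "complex_of_real (\<integral>t. t \<partial>spectral_dist M E0 f) = ip (A f) f"
    "integrable (spectral_dist M E0 f) (\<lambda>t. t\<^sup>2)"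
proof -
  interpret fin: finite_measure "spectral_dist M E0 f" by (rule R0.finite_\<nu>[OF f])
  \<comment> \<open>The identity clamped to \<open>{0..2}\<close>: bounded everywhere, and unchanged
    on the support of the spectral measure and on the range of \<open>1 - cos t\<close>.\<close>
  let ?\<phi> = "\<lambda>t. max 0 (min 2 t) :: real"
  have \<phi>: "?\<phi> \<in> borel_measurable borel" by measurable
  show "integrable (spectral_dist M E0 f) (\<lambda>t. t\<^sup>2)"
  proof (rule fin.integrable_const_bound[where B = "2\<^sup>2"])
    show "AE t in spectral_dist M E0 f. norm (t\<^sup>2) \<le> 2\<^sup>2"
      using AE_E0_support[OF f]
    proof eventually_elim
      case (elim t)
      then show ?case using power_mono[of t 2 2] by simp
    qed
  qed (rule R0.borel_\<nu>, measurable)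
  have int: "integrable (spectral_dist M E0 f) ?\<phi>"
    by (rule fin.integrable_const_bound[where B = 2]) (auto intro!: AE_I2 R0.borel_\<nu>)
  obtain F where F: "\<And>j. simple_function borel (F j)" "\<And>x. (\<lambda>j. F j x) \<longlonglongrightarrow> ?\<phi> x"
    "\<And>j x. \<bar>F j x\<bar> \<le> 2 * \<bar>?\<phi> x\<bar>"
    using simple_approx[OF \<phi>] by blast
  have F4: "bdd 4 (F j)" for j
    unfolding bdd_def
  proof (intro conjI ballI)
    show "F j \<in> borel_measurable borel" by (rule borel_measurable_simple_function[OF F(1)])
    show "\<bar>F j t\<bar> \<le> 4" if "t \<in> {0..2}" for t using F(3)[of j t] that by auto
  qed
  have simple: "complex_of_real (\<integral>t. F j t \<partial>spectral_dist M E0 f) = ip (Op (Kf (F j)) f) f" for j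
  proof -
    have fin: "finite (range (F j))" and meas: "\<And>y. F j -` {y} \<in> sets borel"
      using simple_functionD(1)[OF F(1)[of j]] simple_function_vimage[OF F(1)[of j]] by auto
    have eq: "F j = (\<lambda>t. \<Sum>y\<in>range (F j). y * indicator (F j -` {y}) t)"
    proof
      fix t
      have "(\<Sum>y\<in>range (F j). y * indicator (F j -` {y}) t) = (\<Sum>y\<in>range (F j). if F j t = y then y else 0)"
        by (intro sum.cong) (auto simp: indicator_def)
      then show "F j t = (\<Sum>y\<in>range (F j). y * indicator (F j -` {y}) t)" using fin by simp
    qed
    have "Op (Kf (F j)) f = (\<lambda>x. \<Sum>y\<in>range (F j). complex_of_real y * E0 (F j -` {y}) f x)"
      by (subst eq, rule ext, rule E0_sum(1)[OF fin meas f])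
    then have "ip (Op (Kf (F j)) f) f = (\<Sum>y\<in>range (F j). ip (\<lambda>x. complex_of_real y * E0 (F j -` {y}) f x) f)"
      using ip_sum_left[of "range (F j)" "\<lambda>y x. complex_of_real y * E0 (F j -` {y}) f x" f] E0_L2[OF meas f] f
      by (simp add: L2_scale)
    also have "\<dots> = (\<Sum>y\<in>range (F j). complex_of_real (y * nrm2 (E0 (F j -` {y}) f)))"
      by (simp add: ip_scale_left R0.roi_ip_self[OF meas f])
    also have "\<dots> = complex_of_real (\<integral>t. F j t \<partial>spectral_dist M E0 f)"
      using simple_function_integral(2)[OF R0.finite_\<nu>[OF f] R0.sets_\<nu> F(1)[of j], where \<psi> = "\<lambda>y. y"]
      by (simp add: R0.measure_\<nu>[OF f meas])
    finally show ?thesis ..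
  qed
  have "(\<lambda>j. complex_of_real (\<integral>t. F j t \<partial>spectral_dist M E0 f)) \<longlonglongrightarrow> complex_of_real (\<integral>t. ?\<phi> t \<partial>spectral_dist M E0 f)"
    by (intro tendsto_of_real simple_approx_integral[OF \<phi> R0.sets_\<nu> int F])
  moreover have "(\<lambda>j. ip (Op (Kf (F j)) f) f) \<longlonglongrightarrow> ip (Op (Kf ?\<phi>) f) f"
    by (rule Op_Kf_tendsto(2)[OF F4 _ F(2) f f]) (use \<phi> in \<open>auto simp: bdd_def\<close>)
  ultimately have "complex_of_real (\<integral>t. ?\<phi> t \<partial>spectral_dist M E0 f) = ip (Op (Kf ?\<phi>) f) f"
    unfolding simple by (rule LIMSEQ_unique)
  moreover have "(\<integral>t. ?\<phi> t \<partial>spectral_dist M E0 f) = (\<integral>t. t \<partial>spectral_dist M E0 f)"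
  proof (rule integral_cong_AE)
    show "AE t in spectral_dist M E0 f. ?\<phi> t = t"
      using AE_E0_support[OF f] by eventually_elim auto
  qed (rule R0.borel_\<nu>, measurable)+
  moreover have "Kf ?\<phi> = Kf (\<lambda>t. t)" by (rule ext, rule Kf_cong) auto
  ultimately show "complex_of_real (\<integral>t. t \<partial>spectral_dist M E0 f) = ip (A f) f"
    using Op_id[OF f] by simp
qed

lemma A_lin: "A (\<lambda>x. f x + c * g x) = (\<lambda>x. A f x + c * A g x)"
  by (auto simp: A_def J_add J_scale algebra_simps)

lemma E0_spectral: "is_spectral_resolution M A E0"
  unfolding is_spectral_resolution_def
proof (intro conjI ballI)
  show "resolution_of_identity M E0" by (rule E0_resolution)
  show "spectral_domain M E0 (\<lambda>t. t) = Lp M 2"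
    unfolding spectral_domain_def using integral_E0_id(2) by auto
  fix f h assume f: "f \<in> Lp M 2" and h: "h \<in> Lp M 2"
  have "complex_of_real (\<integral>t. t \<partial>spectral_dist M E0 (\<lambda>x. f x + \<i> ^ k * h x))
      = ip (A f) f + cnj (\<i> ^ k) * ip (A f) h + \<i> ^ k * ip (A h) f + ip (A h) h" for k
  proof -
    have u: "(\<lambda>x. f x + \<i> ^ k * h x) \<in> Lp M 2" using f h by (intro L2_add L2_scale)
    have "ip (A (\<lambda>x. f x + \<i> ^ k * h x)) (\<lambda>x. f x + \<i> ^ k * h x)
        = ip (A f) f + cnj (\<i> ^ k) * ip (A f) h + (\<i> ^ k * ip (A h) f + \<i> ^ k * (cnj (\<i> ^ k) * ip (A h) h))"
      unfolding A_lin using f h A_L2[OF f] A_L2[OF h]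
      by (simp add: ip_add_left ip_add_right ip_scale_left ip_scale_right L2_add L2_scale distrib_left)
    also have "\<i> ^ k * (cnj (\<i> ^ k) * ip (A h) h) = ip (A h) h"
      by (simp flip: mult.assoc power_mult_distrib)
    finally show ?thesis using integral_E0_id(1)[OF u] by (simp add: add_ac)
  qed
  then show "ip (A f) h = spectral_pairing M E0 (\<lambda>t. t) f h"
    unfolding spectral_pairing_def by (simp only: polarization_algebra)
qed

lemma flow_tree_spectral_some: "flow_tree_spectral q p lev (spectral_resolution M A)"
proof -
  have "is_spectral_resolution M A (spectral_resolution M A)"
    unfolding spectral_resolution_def by (rule someI[where P = "is_spectral_resolution M A", OF E0_spectral])
  then show ?thesis
    by unfold_locales (auto simp: is_spectral_resolution_def)
qed

lemma fs_power_domain: "fs f \<Longrightarrow> f \<in> power_domain M A (- 1 / 2)"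
  and op_power_eq: "f \<in> power_domain M A (- 1 / 2) \<Longrightarrow> op_power M A (- 1 / 2) f = Op Fb f"
  and power_domain_L2: "f \<in> power_domain M A (- 1 / 2) \<Longrightarrow> f \<in> Lp M 2"
  and kx_Fb_L2: "kx Fb x \<in> Lp M 2"
proof -
  interpret S: flow_tree_spectral q p lev "spectral_resolution M A" by (rule flow_tree_spectral_some)
  show "fs f \<Longrightarrow> f \<in> power_domain M A (- 1 / 2)"
    unfolding power_domain_def by (rule S.fs_singular(2))
  show "f \<in> power_domain M A (- 1 / 2) \<Longrightarrow> op_power M A (- 1 / 2) f = Op Fb f"
    unfolding power_domain_def op_power_def by (rule S.spectral_integral_eq(2))
  show "f \<in> power_domain M A (- 1 / 2) \<Longrightarrow> f \<in> Lp M 2"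
    unfolding power_domain_def by (rule S.dom_L2)
  show "kx Fb x \<in> Lp M 2" by (rule S.kx_Fb_L2)
qed

end

section \<open>The kernel of the Riesz transform\<close>

text \<open>Telescoping of \<open>1 / (n + s)\<close>. The term \<open>n = 0\<close> is left out
  because it would add \<open>c / s\<^sup>2\<close>; in the kernel estimates this case is treated
  separately.\<close>

lemma suminf_inverse_squares_le:
  fixes s c :: real
  assumes "s > 0" "c \<ge> 0"
  shows "(\<Sum>n. ennreal (if n = 0 then 0 else c / (real n + s)\<^sup>2)) \<le> ennreal (c / s)"
proof (rule suminf_le_const[OF summableI])
  fix N :: nat
  have partial: "(\<Sum>n<Suc N. if n = 0 then 0 else c / (real n + s)\<^sup>2) \<le> c * (1 / s - 1 / (real N + s))" for N
  proof (induction N)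
    case (Suc N)
    have "1 / (real (Suc N) + s)\<^sup>2 \<le> 1 / (real N + s) - 1 / (real (Suc N) + s)"
    proof -
      have "1 / (real N + s) - 1 / (real (Suc N) + s) = 1 / ((real N + s) * (real (Suc N) + s))"
        using assms(1) by (simp add: divide_simps)
      moreover have "(real N + s) * (real (Suc N) + s) \<le> (real (Suc N) + s)\<^sup>2"
        unfolding power2_eq_square using assms(1) by (intro mult_right_mono) auto
      then have "1 / (real (Suc N) + s)\<^sup>2 \<le> 1 / ((real N + s) * (real (Suc N) + s))"
        using assms(1) by (intro divide_left_mono mult_pos_pos zero_less_power) auto
      ultimately show ?thesis by linarith
    qed
    from mult_left_mono[OF this assms(2)] Suc show ?case by (simp add: algebra_simps)
  qed simp
  have "(\<Sum>n<N. if n = 0 then 0 else c / (real n + s)\<^sup>2) \<le> (\<Sum>n<Suc N. if n = 0 then 0 else c / (real n + s)\<^sup>2)"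
    using assms by simp
  also have "\<dots> \<le> c * (1 / s - 1 / (real N + s))" by (rule partial)
  also have "\<dots> \<le> c * (1 / s)" using assms by (intro mult_left_mono) auto
  finally have "ennreal (\<Sum>n<N. if n = 0 then 0 else c / (real n + s)\<^sup>2) \<le> ennreal (c / s)"
    by (simp add: ennreal_leI)
  then show "(\<Sum>n<N. ennreal (if n = 0 then 0 else c / (real n + s)\<^sup>2)) \<le> ennreal (c / s)"
    using assms by (subst sum_ennreal) auto
qed

context flow_tree
begin

definition \<gamma> :: "nat \<Rightarrow> real" where
  "\<gamma> k = (sqrt 2 / pi) * 2 / ((real k + 1/2) * (real k + 5/2))"

lemma sqrt2_pi: "0 < sqrt 2 / pi" "sqrt 2 / pi \<le> 1 / 2"
proof -
  have "sqrt 2 \<le> 3 / 2" by (rule real_le_lsqrt) (auto simp: power2_eq_square)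
  then have "sqrt 2 * 2 \<le> pi" using pi_gt3 by linarith
  then show "sqrt 2 / pi \<le> 1 / 2" by (simp add: field_simps)
qed simp

lemma b_diff: "b k - b (Suc k) = \<gamma> k"
proof -
  have "1 / (real k + 1/2) - 1 / (real k + 5/2) = 2 / ((real k + 1/2) * (real k + 5/2))"
    by (simp add: divide_simps)
  moreover have "b k - b (Suc k) = (sqrt 2 / pi) * (1 / (real k + 1/2) - 1 / (real k + 5/2))"
    by (simp add: b_def algebra_simps)
  ultimately show ?thesis by (simp add: \<gamma>_def)
qed

lemma \<gamma>_bounds: "0 \<le> \<gamma> k" "\<gamma> k \<le> 1 / (real k + 1)\<^sup>2"
proof -
  show "0 \<le> \<gamma> k" by (simp add: \<gamma>_def)
  have "\<gamma> k = (sqrt 2 / pi) * (2 / ((real k + 1/2) * (real k + 5/2)))" by (simp add: \<gamma>_def)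
  also have "\<dots> \<le> (1 / 2) * (2 / ((real k + 1/2) * (real k + 5/2)))"
    by (rule mult_right_mono[OF sqrt2_pi(2)]) simp
  also have "\<dots> \<le> 1 / (real k + 1)\<^sup>2"
  proof -
    have "(real k + 1)\<^sup>2 \<le> (real k + 1/2) * (real k + 5/2)"
      by (simp add: power2_eq_square field_simps)
    then show ?thesis by (simp add: frac_le)
  qed
  finally show "\<gamma> k \<le> 1 / (real k + 1)\<^sup>2" .
qed

lemma \<gamma>_diff: "0 \<le> \<gamma> k - \<gamma> (Suc k)" "\<gamma> k - \<gamma> (Suc k) \<le> 2 / (real k + 1) ^ 3"
proof -
  let ?k = "real k"
  have fr: "1 / ((?k + 1/2) * (?k + 5/2)) - 1 / ((?k + 3/2) * (?k + 7/2))
      = (2 * ?k + 4) / ((?k + 1/2) * (?k + 5/2) * ((?k + 3/2) * (?k + 7/2)))"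
    by (simp add: divide_simps) (simp add: algebra_simps)
  have "\<gamma> k - \<gamma> (Suc k) = (sqrt 2 / pi) * 2 * (1 / ((?k + 1/2) * (?k + 5/2)) - 1 / ((?k + 3/2) * (?k + 7/2)))"
    by (simp add: \<gamma>_def algebra_simps)
  then have eq: "\<gamma> k - \<gamma> (Suc k) = (sqrt 2 / pi) * (2 * ((2 * ?k + 4) / ((?k + 1/2) * (?k + 5/2) * ((?k + 3/2) * (?k + 7/2)))))"
    unfolding fr by simp
  show "0 \<le> \<gamma> k - \<gamma> (Suc k)" unfolding eq by (intro mult_nonneg_nonneg divide_nonneg_nonneg) auto
  have "\<gamma> k - \<gamma> (Suc k) \<le> (1 / 2) * (2 * ((2 * ?k + 4) / ((?k + 1/2) * (?k + 5/2) * ((?k + 3/2) * (?k + 7/2)))))"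
    unfolding eq by (rule mult_right_mono[OF sqrt2_pi(2)]) (intro mult_nonneg_nonneg divide_nonneg_nonneg; simp)
  also have "\<dots> \<le> 2 / (?k + 1) ^ 3"
  proof -
    have "(?k + 1) ^ 3 * (?k + 2) \<le> (?k + 1/2) * (?k + 5/2) * ((?k + 3/2) * (?k + 7/2))"
    proof -
      \<comment> \<open>The outer two of the four factors are paired with each other, and so are the
        inner two; each pair can then be compared coefficient by coefficient.\<close>
      have "(?k + 1) * (?k + 1) * ((?k + 1) * (?k + 2)) \<le> ((?k + 1/2) * (?k + 7/2)) * ((?k + 3/2) * (?k + 5/2))"
        by (rule mult_mono) (simp_all add: field_simps)
      then show ?thesis by (simp add: power3_eq_cube mult_ac)
    qed
    then have "(2 * ?k + 4) / ((?k + 1/2) * (?k + 5/2) * ((?k + 3/2) * (?k + 7/2))) \<le> (2 * ?k + 4) / ((?k + 1) ^ 3 * (?k + 2))"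
      by (intro divide_left_mono mult_pos_pos zero_less_power) auto
    also have "\<dots> = (2 * (?k + 2)) / ((?k + 1) ^ 3 * (?k + 2))" by simp
    also have "\<dots> = 2 / (?k + 1) ^ 3" by (subst mult_divide_mult_cancel_right) auto
    finally show ?thesis by linarith
  qed
  finally show "\<gamma> k - \<gamma> (Suc k) \<le> 2 / (?k + 1) ^ 3" .
qed

lemma b_bounds: "0 \<le> b k" "b k \<le> 2 / (real k + 1)"
proof -
  show "0 \<le> b k" by (simp add: b_def)
  have "b k \<le> (1 / 2) * (1 / (real k + 1/2) + 1 / (real k + 3/2))"
    unfolding b_def by (rule mult_right_mono[OF sqrt2_pi(2)]) simp
  also have "\<dots> \<le> (1 / 2) * (1 / (real k + 1/2) + 1 / (real k + 1/2))"
    by (intro mult_left_mono add_mono frac_le) auto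
  also have "\<dots> = 1 / (real k + 1/2)" by simp
  also have "\<dots> = 2 / (2 * real k + 1)" by (simp add: field_simps)
  also have "\<dots> \<le> 2 / (real k + 1)" by (intro divide_left_mono) auto
  finally show "b k \<le> 2 / (real k + 1)" .
qed

lemma decrement_sum:
  fixes s :: "nat \<Rightarrow> real"
  assumes "\<And>k. 0 \<le> s k - s (Suc k)" "\<And>k. s k - s (Suc k) \<le> c / (real k + 1) ^ e" "c \<ge> 0"
  shows "\<bar>s k - s (k + n)\<bar> \<le> real n * c / (real k + 1) ^ e"
proof -
  have "0 \<le> s k - s (k + n) \<and> s k - s (k + n) \<le> real n * (c / (real k + 1) ^ e)"
  proof (induction n)
    case (Suc n)
    have "c / (real (k + n) + 1) ^ e \<le> c / (real k + 1) ^ e"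
      using assms(3) by (intro divide_left_mono power_mono mult_pos_pos zero_less_power) auto
    moreover have "real (Suc n) * (c / (real k + 1) ^ e) = c / (real k + 1) ^ e + real n * (c / (real k + 1) ^ e)"
      by (simp only: of_nat_Suc distrib_right mult_1_left)
    moreover have "s (k + Suc n) = s (Suc (k + n))" by simp
    ultimately show ?case using Suc assms(1,2)[of "k + n"] by linarith
  qed simp
  then show ?thesis by simp
qed

text \<open>The weights \<open>1 / q ^ j\<close> sum to at most 2, so the series for
  \<open>Fb\<close> and \<open>\<Gamma>\<close> inherit the decay of the sequences \<open>b\<close>
  and \<open>\<gamma>\<close>.\<close>

lemma suminf_geometric_le:
  fixes s :: "nat \<Rightarrow> real"
  assumes "\<And>j. \<bar>s j\<bar> \<le> B"
  shows "\<bar>\<Sum>j. s j / real q ^ j\<bar> \<le> 2 * B"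
proof -
  have B: "B \<ge> 0" using assms[of 0] by linarith
  have geo: "(\<lambda>j. B * (1 / 2) ^ j) sums (B * (1 / (1 - 1 / 2)))"
    by (intro sums_mult geometric_sums) auto
  have "\<bar>\<Sum>j. s j / real q ^ j\<bar> \<le> (\<Sum>j. \<bar>s j / real q ^ j\<bar>)"
    by (rule summable_rabs[OF summable_geometric_bounded[OF assms]])
  also have "\<dots> \<le> (\<Sum>j. B * (1 / 2) ^ j)"
  proof (rule suminf_le[OF _ summable_geometric_bounded[OF assms] sums_summable[OF geo]])
    fix j
    have "\<bar>s j\<bar> / real q ^ j \<le> B / 2 ^ j"
      using assms[of j] B q_ge_2 by (intro frac_le power_mono) auto
    then show "\<bar>s j / real q ^ j\<bar> \<le> B * (1 / 2) ^ j" by (simp add: power_one_over)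
  qed
  also have "\<dots> = 2 * B" using geo by (simp add: sums_iff)
  finally show ?thesis .
qed

lemma summable_b: "summable (\<lambda>j. b (d + 2 * j) / real q ^ j)"
proof (rule summable_rabs_cancel, rule summable_geometric_bounded)
  fix j
  have "2 / (real (d + 2 * j) + 1) \<le> 2" by (simp add: divide_simps)
  then show "\<bar>b (d + 2 * j)\<bar> \<le> 2" using b_bounds[of "d + 2 * j"] by simp
qed

lemma Fb_bound: "\<bar>Fb d\<bar> \<le> 4 / (real d + 1)"
proof -
  have "\<bar>Fb d\<bar> \<le> 2 * (2 / (real d + 1))"
    unfolding Fb_def
  proof (rule suminf_geometric_le)
    fix j
    have "2 / (real (d + 2 * j) + 1) \<le> 2 / (real d + 1)" by (intro divide_left_mono) auto
    then show "\<bar>b (d + 2 * j)\<bar> \<le> 2 / (real d + 1)" using b_bounds[of "d + 2 * j"] by simp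
  qed
  then show ?thesis by simp
qed

lemma Fb_diff: "\<bar>Fb d - Fb (d + n)\<bar> \<le> 2 * real n / (real d + 1)\<^sup>2"
proof -
  have "Fb d - Fb (d + n) = (\<Sum>j. (b (d + 2 * j) - b (d + n + 2 * j)) / real q ^ j)"
    unfolding Fb_def by (subst suminf_diff[OF summable_b summable_b]) (simp add: diff_divide_distrib)
  also have "\<bar>\<dots>\<bar> \<le> 2 * (real n * 1 / (real d + 1)\<^sup>2)"
  proof (rule suminf_geometric_le)
    fix j
    have "\<bar>b (d + 2 * j) - b (d + 2 * j + n)\<bar> \<le> real n * 1 / (real (d + 2 * j) + 1)\<^sup>2"
      by (rule decrement_sum) (use b_diff \<gamma>_bounds in auto)
    also have "\<dots> \<le> real n * 1 / (real d + 1)\<^sup>2"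
      by (intro divide_left_mono power_mono mult_pos_pos zero_less_power) auto
    finally show "\<bar>b (d + 2 * j) - b (d + n + 2 * j)\<bar> \<le> real n * 1 / (real d + 1)\<^sup>2"
      by (simp add: add_ac)
  qed
  finally show ?thesis by simp
qed

definition \<Gamma> :: "nat \<Rightarrow> real" where
  "\<Gamma> d = Fb d - Fb (Suc d)"

lemma \<Gamma>_eq: "\<Gamma> d = (\<Sum>j. \<gamma> (d + 2 * j) / real q ^ j)"
  unfolding \<Gamma>_def Fb_def
  by (subst suminf_diff[OF summable_b summable_b]) (simp add: b_diff flip: diff_divide_distrib)

lemma \<gamma>_le_1: "\<bar>\<gamma> k\<bar> \<le> 1"
proof -
  have "1 / (real k + 1)\<^sup>2 \<le> 1" by (simp add: divide_simps)
  then show ?thesis using \<gamma>_bounds[of k] by linarith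
qed

lemma \<Gamma>_bound: "\<bar>\<Gamma> d\<bar> \<le> 2 / (real d + 1)\<^sup>2"
  using Fb_diff[of d 1] by (simp add: \<Gamma>_def)

lemma \<Gamma>_diff: "\<bar>\<Gamma> d - \<Gamma> (d + n)\<bar> \<le> 4 * real n / (real d + 1) ^ 3"
proof -
  have sm: "summable (\<lambda>j. \<gamma> (d + 2 * j) / real q ^ j)" for d
    by (rule summable_rabs_cancel, rule summable_geometric_bounded[OF \<gamma>_le_1])
  have "\<Gamma> d - \<Gamma> (d + n) = (\<Sum>j. (\<gamma> (d + 2 * j) - \<gamma> (d + n + 2 * j)) / real q ^ j)"
    unfolding \<Gamma>_eq by (subst suminf_diff[OF sm sm]) (simp add: diff_divide_distrib)
  also have "\<bar>\<dots>\<bar> \<le> 2 * (real n * 2 / (real d + 1) ^ 3)"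
  proof (rule suminf_geometric_le)
    fix j
    have "\<bar>\<gamma> (d + 2 * j) - \<gamma> (d + 2 * j + n)\<bar> \<le> real n * 2 / (real (d + 2 * j) + 1) ^ 3"
      by (rule decrement_sum) (use \<gamma>_diff in auto)
    also have "\<dots> \<le> real n * 2 / (real d + 1) ^ 3"
      by (intro divide_left_mono power_mono mult_pos_pos zero_less_power) auto
    finally show "\<bar>\<gamma> (d + 2 * j) - \<gamma> (d + n + 2 * j)\<bar> \<le> real n * 2 / (real d + 1) ^ 3"
      by (simp add: add_ac)
  qed
  finally show ?thesis by simp
qed

definition kR :: "'v \<Rightarrow> 'v \<Rightarrow> real" where
  "kR x y = ker Fb x y - ker Fb (p x) y"

text \<open>If \<open>x\<close> is not an ancestor of \<open>y\<close>, the step to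
  \<open>p x\<close> keeps the join and shortens the distance by one, so the gradient is a plain
  difference of \<open>Fb\<close> and gains one order of decay.\<close>

lemma kR_off:
  assumes "jn x y \<noteq> 0"
  shows "kR x y = - \<Gamma> (dd x y - 1) / w (apx x y)"
proof -
  have "dd (p x) y = dd x y - 1" "Suc (dd x y - 1) = dd x y"
    using assms by (simp_all add: dd_def jn_predecessor)
  then show ?thesis
    using assms by (simp add: kR_def ker_def apx_predecessor \<Gamma>_def diff_divide_distrib)
qed

text \<open>Profile of the kernel where \<open>x\<close> is \<open>y\<close> or an ancestor of it.
  The step up multiplies the weight of the join by \<open>q\<close>, so no cancellation occurs and
  only the decay of \<open>Fb\<close> is left; it is harmless because it concerns a single
  \<open>x\<close> on each level.\<close>

definition Hb :: "nat \<Rightarrow> real" where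
  "Hb d = Fb d - Fb (Suc d) / real q"

lemma kR_on:
  assumes "jn x y = 0"
  shows "kR x y = Hb (jn y x) / w (apx x y)"
  using assms
  by (simp add: kR_def ker_def apx_predecessor dd_def jn_predecessor Hb_def apx_def w_p diff_divide_distrib)

lemma Hb_diff: "\<bar>Hb d - Hb (d + n)\<bar> \<le> 4 * real n / (real d + 1)\<^sup>2"
proof -
  have q: "real q \<ge> 1" using q_ge_2 by simp
  have "\<bar>Hb d - Hb (d + n)\<bar> = \<bar>(Fb d - Fb (d + n)) - (Fb (Suc d) - Fb (Suc d + n)) / real q\<bar>"
    by (simp add: Hb_def diff_divide_distrib)
  also have "\<dots> \<le> \<bar>Fb d - Fb (d + n)\<bar> + \<bar>(Fb (Suc d) - Fb (Suc d + n)) / real q\<bar>"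
    by (rule abs_triangle_ineq4)
  also have "\<bar>(Fb (Suc d) - Fb (Suc d + n)) / real q\<bar> \<le> \<bar>Fb (Suc d) - Fb (Suc d + n)\<bar> / 1"
    unfolding abs_divide using q by (intro divide_left_mono) auto
  also have "\<bar>Fb (Suc d) - Fb (Suc d + n)\<bar> \<le> 2 * real n / (real (Suc d) + 1)\<^sup>2" by (rule Fb_diff)
  also have "\<dots> \<le> 2 * real n / (real d + 1)\<^sup>2"
    by (intro divide_left_mono power_mono mult_pos_pos zero_less_power) auto
  finally show ?thesis using Fb_diff[of d n] by simp
qed

lemma ker_Fb_bound: "\<bar>ker Fb x y\<bar> \<le> 4 / w x"
proof -
  have "\<bar>ker Fb x y\<bar> = \<bar>Fb (dd x y)\<bar> / w (apx x y)" by (simp add: ker_def)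
  also have "\<dots> \<le> 4 / w x"
  proof (rule frac_le)
    have "4 / (real (dd x y) + 1) \<le> 4" by (simp add: divide_simps)
    then show "\<bar>Fb (dd x y)\<bar> \<le> 4" using Fb_bound[of "dd x y"] by linarith
  qed (auto intro: w_le_apx)
  finally show ?thesis .
qed

lemma kR_bound: "\<bar>kR x y\<bar> \<le> 8 / w x"
proof -
  have "w x \<le> w (p x)" using w_le_anc[of x 1] by simp
  then have "4 / w (p x) \<le> 4 / w x" by (intro divide_left_mono) auto
  then show ?thesis
    using ker_Fb_bound[of x y] ker_Fb_bound[of "p x" y] unfolding kR_def by linarith
qed

text \<open>One formula for all extensions: the integral converges absolutely for every
  \<open>f\<close> in \<open>Lp M s\<close> with \<open>1 \<le> s\<close> and
  \<open>s \<le> 2\<close> (\<open>kR_integrable\<close>).\<close>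

definition Rz :: "('v \<Rightarrow> complex) \<Rightarrow> 'v \<Rightarrow> complex" where
  "Rz f x = (\<integral>y. complex_of_real (kR x y) * f y \<partial>M)"

lemma kR_L2: "(\<lambda>y. complex_of_real (kR x y)) \<in> Lp M 2"
  using L2_diff[OF kx_Fb_L2[of x] kx_Fb_L2[of "p x"]] by (simp add: kR_def kx_def)

lemma Rz_eq: "f \<in> Lp M 2 \<Longrightarrow> Rz f x = Op Fb f x - Op Fb f (p x)"
proof -
  assume f: "f \<in> Lp M 2"
  have "ip f (\<lambda>y. kx Fb x y - kx Fb (p x) y) = Op Fb f x - Op Fb f (p x)"
    unfolding Op_eq_ip by (rule ip_diff_right[OF kx_Fb_L2 kx_Fb_L2 f])
  then show ?thesis by (simp add: Rz_def L2_inner_def kx_def kR_def mult.commute)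
qed

lemma Rz_fs: 
  assumes "finite S" "{x. f x \<noteq> 0} \<subseteq> S"
  shows "Rz f x = (\<Sum>y\<in>S. complex_of_real (w y * kR x y) * f y)"
  unfolding Rz_def using assms
  by (subst integral_finite_support[of S]) (auto simp: scaleR_conv_of_real mult.assoc)


subsection \<open>The bound on \<open>L\<^sup>2\<close>\<close>

text \<open>By the energy identity the squared norm is twice the integral of
  \<open>t * (P t)\<^sup>2\<close> against the density, thus at most \<open>12 * nrm2 f\<close>; the
  constant 4 rounds this up to \<open>16 * nrm2 f\<close>.\<close>

lemma nrm_gradient_PA:
  assumes f: "fs f" and P: "\<And>t. t \<in> {0..2} \<Longrightarrow> t * (\<Sum>i\<le>n. a i * t ^ i)\<^sup>2 \<le> 6"
  shows "nrm (\<lambda>x. PA a n f x - PA a n f (p x)) \<le> 4 * nrm f"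
proof (rule power2_le_imp_le)
  let ?P = "\<lambda>t. \<Sum>i\<le>n. a i * t ^ i"
  have g: "PA a n f \<in> Lp M 2" by (rule fs_L2[OF PA_fs[OF f]])
  have "(nrm (\<lambda>x. PA a n f x - PA a n f (p x)))\<^sup>2 = 2 * Re (ip (A (PA a n f)) (PA a n f))"
    using nrm2_gradient(2)[OF g] by (simp add: nrm_sq A_def[abs_def])
  also have "Re (ip (A (PA a n f)) (PA a n f)) = (\<integral>t. (1 - cos t) * (?P (1 - cos t))\<^sup>2 * \<rho> f t \<partial>T)"
    by (rule ip_PA_A_PA(2)[OF f])
  also have "\<dots> \<le> (\<integral>t. 6 * \<rho> f t \<partial>T)"
  proof (rule integral_mono)
    have "good (\<lambda>t. t * ?P t ^ 2)"
    proof (rule good_boundedI[where s = 6])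
      show "\<bar>t * ?P t ^ 2\<bar> \<le> 6" if "t \<in> {0..2}" for t using P[OF that] that by simp
    qed measurable
    from \<rho>_integral(1)[OF f this]
    show "integrable T (\<lambda>t. (1 - cos t) * (?P (1 - cos t))\<^sup>2 * \<rho> f t)" .
    show "integrable T (\<lambda>t. 6 * \<rho> f t)" using nrm2_eq_integral_\<rho>(2)[OF f] by simp
    fix t assume "t \<in> space T"
    then have "\<rho> f t \<ge> 0" using \<rho>_nonneg[OF f] by simp
    then show "(1 - cos t) * (?P (1 - cos t))\<^sup>2 * \<rho> f t \<le> 6 * \<rho> f t"
      by (intro mult_right_mono P one_minus_cos_bounds)
  qed
  also have "\<dots> = 6 * nrm2 f" using nrm2_eq_integral_\<rho>[OF f] by simp
  finally have "(nrm (\<lambda>x. PA a n f x - PA a n f (p x)))\<^sup>2 \<le> 12 * nrm2 f" by simp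
  also have "\<dots> \<le> (4 * nrm f)\<^sup>2" by (simp add: power_mult_distrib nrm_sq)
  finally show "(nrm (\<lambda>x. PA a n f x - PA a n f (p x)))\<^sup>2 \<le> (4 * nrm f)\<^sup>2" .
qed simp

text \<open>\<open>t powr (- 1 / 2)\<close> is a limit of polynomials \<open>P\<close> with \<open>t * (P t)\<^sup>2\<close> bounded, which makes
  the gradient of \<open>P\<close> applied to the Laplacian bounded.\<close>

lemma Rz_fs_L2:
  assumes f: "fs f"
  shows "Rz f \<in> Lp M 2" "nrm (Rz f) \<le> 4 * nrm f"
proof -
  \<comment> \<open>Regularized inverse square root, chosen so that
    \<open>t * (?h n t)\<^sup>2 \<le> 1\<close>.\<close>
  let ?h = "\<lambda>n t. sqrt (1 / (\<bar>t\<bar> + 1 / Suc n)) :: real"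
  have den: "\<bar>t\<bar> + 1 / Suc n > 0" for t :: real and n by (simp add: add_nonneg_pos)
  have cont: "continuous_on {0..2} (?h n)" for n
  proof -
    have "\<bar>t\<bar> + 1 / Suc n \<noteq> 0" for t :: real using den[of t n] by linarith
    then show ?thesis by (intro continuous_intros ballI)
  qed
  have "\<exists>a m. \<forall>t\<in>{0..2}. \<bar>?h n t - (\<Sum>i\<le>m. a i * t ^ i)\<bar> < 1 / Suc n" for n
    using poly_approx[OF cont[of n], of "1 / Suc n"] by (metis of_nat_0_less_iff zero_less_Suc zero_less_divide_1_iff)
  then obtain a m where am: "\<And>n t. t \<in> {0..2} \<Longrightarrow> \<bar>?h n t - (\<Sum>i\<le>m n. a n i * t ^ i)\<bar> < 1 / Suc n"
    by metis
  let ?P = "\<lambda>n t. \<Sum>i\<le>m n. a n i * t ^ i"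
  have th: "t * (?h n t)\<^sup>2 \<le> 1" if "t \<in> {0..2}" for n t
    using den[of t n] that by (simp add: field_simps)
  \<comment> \<open>The bound 6 is \<open>2 * 1 + 2 * 2\<close>, from
    \<open>P\<^sup>2 \<le> 2 * h\<^sup>2 + 2 * (P - h)\<^sup>2\<close>,
    \<open>\<bar>P - h\<bar> \<le> 1\<close> and \<open>t \<le> 2\<close>.\<close>
  have P6: "t * (?P n t)\<^sup>2 \<le> 6" if t: "t \<in> {0..2}" for n t
  proof -
    have "\<bar>?P n t - ?h n t\<bar> \<le> 1" using am[OF t, of n] by (simp add: abs_minus_commute) (smt (verit) divide_le_eq_1 of_nat_0_le_iff)
    then have d: "(?P n t - ?h n t)\<^sup>2 \<le> 1" by (simp add: abs_square_le_1)
    have "(?P n t)\<^sup>2 \<le> 2 * (?h n t)\<^sup>2 + 2 * (?P n t - ?h n t)\<^sup>2"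
      using zero_le_power2[of "?P n t - 2 * ?h n t"] by (simp add: power2_eq_square algebra_simps)
    also have "\<dots> \<le> 2 * (?h n t)\<^sup>2 + 2" using d by simp
    finally have "t * (?P n t)\<^sup>2 \<le> t * (2 * (?h n t)\<^sup>2 + 2)" using t by (intro mult_left_mono) auto
    also have "\<dots> = 2 * (t * (?h n t)\<^sup>2) + 2 * t" by (simp only: distrib_left mult.left_commute mult.commute)
    also have "\<dots> \<le> 2 * 1 + 2 * 2" using t by (intro add_mono mult_left_mono th[OF t]) auto
    also have "\<dots> = 6" by simp
    finally show ?thesis .
  qed
  have g_lim: "(\<lambda>n. 1 / Suc n) \<longlonglongrightarrow> (0::real)" by (rule LIMSEQ_Suc[OF lim_1_over_n])
  have P_lim: "(\<lambda>n. ?P n t) \<longlonglongrightarrow> t powr (- 1 / 2)" if t: "t \<in> {0<..2}" for t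
  proof -
    have "(\<lambda>n. ?h n t) \<longlonglongrightarrow> sqrt (1 / (\<bar>t\<bar> + 0))"
      using t by (intro tendsto_real_sqrt tendsto_divide tendsto_add tendsto_const g_lim) auto
    also have "sqrt (1 / (\<bar>t\<bar> + 0)) = t powr (- 1 / 2)"
      using t by (simp add: powr_minus powr_half_sqrt real_sqrt_divide inverse_eq_divide)
    finally have h: "(\<lambda>n. ?h n t) \<longlonglongrightarrow> t powr (- 1 / 2)" .
    have "(\<lambda>n. ?P n t - ?h n t) \<longlonglongrightarrow> 0"
    proof (rule Lim_null_comparison[OF _ g_lim])
      show "\<forall>\<^sub>F n in sequentially. norm (?P n t - ?h n t) \<le> 1 / Suc n"
        using am[of t] t by (intro always_eventually) (auto simp: abs_minus_commute less_imp_le)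
    qed
    from tendsto_add[OF this h] show ?thesis by simp
  qed
  have K: "(\<lambda>n. Kf (?P n) d) \<longlonglongrightarrow> Fb d" for d
    unfolding Kf_powr_half[symmetric]
  proof (rule Kf_tendsto[where B = 4])
    show "\<bar>t * ?P n t\<bar> \<le> 4" if t: "t \<in> {0..2}" for n t
    proof (rule power2_le_imp_le)
      have "\<bar>t * ?P n t\<bar>\<^sup>2 = t * (t * (?P n t)\<^sup>2)" by (simp add: power2_eq_square)
      also have "\<dots> \<le> 2 * 6" using P6[OF t, of n] t by (intro mult_mono) auto
      finally show "\<bar>t * ?P n t\<bar>\<^sup>2 \<le> 4\<^sup>2" by simp
    qed simp
    show "(\<lambda>t::real. t powr (- 1 / 2)) \<in> borel_measurable borel" by measurable
    show "?P n \<in> borel_measurable borel" for n by measurable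
    show "(\<lambda>n. ?P n t) \<longlonglongrightarrow> t powr (- 1 / 2)" if "t \<in> {0<..2}" for t by (rule P_lim[OF that])
  qed
  have lim: "(\<lambda>n. PA (a n) (m n) f x) \<longlonglongrightarrow> Op Fb f x" for x
    unfolding PA_eq_Op(1)[OF f] Op_fs[OF f]
    by (intro tendsto_sum tendsto_mult tendsto_const tendsto_of_real ker_tendsto K)
  let ?u = "\<lambda>n x. PA (a n) (m n) f x - PA (a n) (m n) f (p x)"
  have u: "?u n \<in> Lp M 2" for n
    using fs_L2[OF PA_fs[OF f]] by (intro L2_diff L2_p)
  have "(\<lambda>n. ?u n x) \<longlonglongrightarrow> Rz f x" for x
    unfolding Rz_eq[OF fs_L2[OF f]] by (intro tendsto_diff lim)
  note L2_pointwise_limit[OF u nrm_gradient_PA[OF f P6] this]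
  then show "Rz f \<in> Lp M 2" "nrm (Rz f) \<le> 4 * nrm f" by auto
qed


subsection \<open>Cancellation away from a trapezoid\<close>

text \<open>The admissible trapezoids that are not given as points are
  \<open>trap z h (2 * h)\<close>; independent bounds on the depth are kept because trapezoids will
  be split and enlarged.\<close>

definition trap :: "'v \<Rightarrow> nat \<Rightarrow> nat \<Rightarrow> 'v set" where
  "trap z a c = {y. \<exists>m. a \<le> m \<and> m < c \<and> anc m y = z}"

definition below_of :: "'v \<Rightarrow> 'v set" where
  "below_of z = {x. \<exists>k. anc k x = z}"

text \<open>Seen from an \<open>x\<close> outside the cone below \<open>z\<close>, all
  \<open>y\<close> at depth \<open>m\<close> below \<open>z\<close> look alike: the join with
  \<open>x\<close> is that of \<open>z\<close>. Differences of the kernel in \<open>y\<close> are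
  therefore differences in the integer \<open>m\<close>.\<close>

lemma jn_above:
  assumes "x \<notin> below_of z" "anc m y = z"
  shows "jn x y = jn x z" "jn y x = jn z x + m" "apx x y = apx z x" "jn z x \<noteq> 0"
proof -
  have eq: "anc (jn x z) x = anc (jn z x) z" by (rule anc_jn)
  show nz: "jn z x \<noteq> 0"
  proof
    assume "jn z x = 0"
    then have "anc (jn x z) x = z" using eq by simp
    then show False using assms(1) by (auto simp: below_of_def)
  qed
  have "anc (jn x z) x = anc (jn z x + m) y" using eq assms(2) by (simp add: anc_add)
  moreover have "jn x z = 0 \<or> jn z x + m = 0 \<or> anc (jn x z - 1) x \<noteq> anc (jn z x + m - 1) y"
  proof (cases "jn x z = 0")
    case False
    have "anc (jn z x + m - 1) y = anc (jn z x - 1) z"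
      using nz assms(2) anc_add[of "jn z x - 1" m y] by simp
    moreover have "anc (jn x z - 1) x \<noteq> anc (jn z x - 1) z"
      using anc_eq_iff[of "jn x z - 1" x "jn z x - 1" z] False nz by auto
    ultimately show ?thesis by simp
  qed simp
  ultimately show "jn x y = jn x z" "jn y x = jn z x + m" using jnI by blast+
  then show "apx x y = apx z x" using apx_sym[of z x] by (simp add: apx_def)
qed

text \<open>The depths of \<open>y\<close> and \<open>y0\<close> differ by less than
  \<open>c\<close>, so the difference estimates for \<open>Hb\<close> and \<open>\<Gamma>\<close>
  apply. Of the three powers of \<open>n + j + a\<close> in the second case one is weakened to
  \<open>j + a\<close>, which leaves a bound that telescopes first in \<open>n\<close> and then in
  \<open>j\<close>.\<close>

lemma kR_difference_above:
  assumes x: "x \<notin> below_of z" and y: "anc m y = z" and y0: "anc m0 y0 = z"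
    and bounds: "1 \<le> a" "a \<le> m" "m < c" "a \<le> m0" "m0 < c"
  defines "j \<equiv> jn z x" and "n \<equiv> jn x z"
  shows "\<bar>kR x y - kR x y0\<bar> \<le> (if n = 0 then 4 * real c / (real j + real a)\<^sup>2
      else (4 * real c / (real j + real a)) / (real n + (real j + real a))\<^sup>2) / w (apx z x)"
proof -
  note J = jn_above[OF x y] and J0 = jn_above[OF x y0]
  have Fdiff: "\<bar>G u - G v\<bar> \<le> 4 * real c / (real d + 1) ^ e"
    if G: "\<And>d n. \<bar>G d - G (d + n)\<bar> \<le> 4 * real n / (real d + 1) ^ e"
      and uv: "d \<le> u" "d \<le> v" "u \<le> v + c" "v \<le> u + c" for G :: "nat \<Rightarrow> real" and d u v e :: nat
  proof -
    have main: "\<bar>G u - G v\<bar> \<le> 4 * real c / (real d + 1) ^ e"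
      if "d \<le> u" "u \<le> v" "v \<le> u + c" for u v
    proof -
      have "\<bar>G u - G v\<bar> \<le> 4 * real (v - u) / (real u + 1) ^ e" using G[of u "v - u"] that by simp
      also have "\<dots> \<le> 4 * real c / (real d + 1) ^ e"
        using that by (intro frac_le power_mono zero_less_power) auto
      finally show ?thesis .
    qed
    show ?thesis
      using main[of u v] main[of v u] uv by (cases "u \<le> v") (auto simp: abs_minus_commute)
  qed
  show ?thesis
  proof (cases "n = 0")
    case True
    have "kR x y = Hb (j + m) / w (apx z x)" "kR x y0 = Hb (j + m0) / w (apx z x)"
      using kR_on[of x y] kR_on[of x y0] J J0 True by (simp_all add: j_def n_def)
    then have eq: "\<bar>kR x y - kR x y0\<bar> = \<bar>Hb (j + m) - Hb (j + m0)\<bar> / w (apx z x)"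
      by (simp flip: diff_divide_distrib)
    have "\<bar>Hb (j + m) - Hb (j + m0)\<bar> \<le> 4 * real c / (real (j + a) + 1)\<^sup>2"
      by (rule Fdiff[OF Hb_diff]) (use bounds in auto)
    moreover have "4 * real c / (real (j + a) + 1)\<^sup>2 \<le> 4 * real c / (real j + real a)\<^sup>2"
      using bounds(1) by (intro divide_left_mono power_mono mult_pos_pos zero_less_power) auto
    ultimately have "\<bar>Hb (j + m) - Hb (j + m0)\<bar> \<le> 4 * real c / (real j + real a)\<^sup>2" by linarith
    from divide_right_mono[OF this w_nonneg] show ?thesis
      unfolding eq using True by simp
  next
    case False
    have "kR x y = - \<Gamma> (n + (j + m) - 1) / w (apx z x)" "kR x y0 = - \<Gamma> (n + (j + m0) - 1) / w (apx z x)"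
      using kR_off[of x y] kR_off[of x y0] J J0 False by (simp_all add: j_def n_def dd_def)
    then have eq: "\<bar>kR x y - kR x y0\<bar> = \<bar>\<Gamma> (n + (j + m) - 1) - \<Gamma> (n + (j + m0) - 1)\<bar> / w (apx z x)"
      by (simp add: abs_minus_commute flip: diff_divide_distrib)
    have "\<bar>\<Gamma> (n + (j + m) - 1) - \<Gamma> (n + (j + m0) - 1)\<bar> \<le> 4 * real c / (real (n + (j + a) - 1) + 1) ^ 3"
      by (rule Fdiff[OF \<Gamma>_diff]) (use bounds in auto)
    moreover have "real (n + (j + a) - 1) + 1 = real n + (real j + real a)"
      using False by (simp add: of_nat_diff)
    moreover have "4 * real c / (real n + (real j + real a)) ^ 3
        \<le> (4 * real c / (real j + real a)) / (real n + (real j + real a))\<^sup>2"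
    proof -
      have "(real j + real a) * (real n + (real j + real a))\<^sup>2 \<le> (real n + (real j + real a)) ^ 3"
        unfolding power3_eq_cube power2_eq_square mult.assoc by (intro mult_right_mono) auto
      then show ?thesis
        unfolding divide_divide_eq_left using bounds(1)
        by (intro divide_left_mono mult_pos_pos zero_less_power) auto
    qed
    ultimately have "\<bar>\<Gamma> (n + (j + m) - 1) - \<Gamma> (n + (j + m0) - 1)\<bar>
        \<le> (4 * real c / (real j + real a)) / (real n + (real j + real a))\<^sup>2" by simp
    from divide_right_mono[OF this w_nonneg] show ?thesis
      unfolding eq using False by simp
  qed
qed

text \<open>The path from \<open>y\<close> to such an \<open>x\<close> turns after fewer than
  \<open>c\<close> steps and then descends at least \<open>c\<close> steps. The descent
  \<open>n\<close> thus dominates \<open>c\<close>, so \<open>n\<^sup>2\<close> may be replaced by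
  \<open>(n + c)\<^sup>2 / 4\<close>, whose reciprocals telescope to a multiple of
  \<open>1 / c\<close>.\<close>

lemma kR_below:
  assumes x: "anc k x = z" and y: "anc m y = z" and "m < c" "2 * c \<le> k"
  shows "jn y x < c" "\<bar>kR x y\<bar> \<le> (if jn x y = 0 then 0 else 8 / (real (jn x y) + real c)\<^sup>2) / w (apx y x)"
proof -
  have "anc k x = anc m y" using x y by simp
  then obtain i where i: "k = i + jn x y" "m = i + jn y x" using anc_eq_iff by blast
  show "jn y x < c" using i assms(3) by simp
  have n: "jn x y \<ge> c" "jn x y \<noteq> 0" using i assms(3,4) by linarith+
  let ?n = "jn x y"
  have "\<bar>\<Gamma> (dd x y - 1)\<bar> \<le> 2 / (real (dd x y - 1) + 1)\<^sup>2" by (rule \<Gamma>_bound)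
  also have "\<dots> \<le> 2 / (real ?n)\<^sup>2"
    using n(2) by (intro divide_left_mono power_mono mult_pos_pos zero_less_power) (auto simp: dd_def of_nat_diff)
  also have "\<dots> = 8 / (real ?n + real ?n)\<^sup>2" by (simp add: power2_eq_square)
  also have "\<dots> \<le> 8 / (real ?n + real c)\<^sup>2"
    using n by (intro divide_left_mono power_mono mult_pos_pos zero_less_power) auto
  finally have G: "\<bar>\<Gamma> (dd x y - 1)\<bar> \<le> 8 / (real ?n + real c)\<^sup>2" .
  have "\<bar>kR x y\<bar> = \<bar>\<Gamma> (dd x y - 1)\<bar> / w (apx y x)"
    using kR_off[OF n(2)] apx_sym[of x y] by simp
  also have "\<dots> \<le> 8 / (real ?n + real c)\<^sup>2 / w (apx y x)"
    by (rule divide_right_mono[OF G]) simp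
  finally show "\<bar>kR x y\<bar> \<le> (if jn x y = 0 then 0 else 8 / (real (jn x y) + real c)\<^sup>2) / w (apx y x)"
    using n(2) by simp
qed

text \<open>Outside the cone below \<open>z\<close> the cases \<open>n = 0\<close> and
  \<open>n > 0\<close> contribute at most \<open>4 * c / a \<le> 32\<close> each. Inside it no
  cancellation is used: each of the \<open>c\<close> possible heights of the join above
  \<open>y\<close> contributes at most \<open>8 / c\<close>. Together this is 72.\<close>

lemma kernel_cancellation:
  assumes ac: "1 \<le> a" "c \<le> 8 * a" and y: "anc m y = z" "a \<le> m" "m < c"
    and y0: "anc m0 y0 = z" "a \<le> m0" "m0 < c"
  shows "(\<integral>\<^sup>+x. ennreal (if x \<in> trap z 0 (2 * c) then 0 else
      if x \<in> below_of z then \<bar>kR x y\<bar> else \<bar>kR x y - kR x y0\<bar>) \<partial>M) \<le> ennreal 72"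
proof -
  have c: "c \<ge> 1" using y by simp
  let ?s = "\<lambda>j. real j + real a"
  let ?B1 = "\<lambda>(j::nat) (n::nat). if j = 0 then 0 else if n = 0 then 4 * real c / (?s j)\<^sup>2 else 0"
  let ?B2 = "\<lambda>(j::nat) (n::nat). if j = 0 then 0 else if n = 0 then 0 else (4 * real c / ?s j) / (real n + ?s j)\<^sup>2"
  let ?B3 = "\<lambda>(i::nat) (n::nat). if i < c then (if n = 0 then 0 else 8 / (real n + real c)\<^sup>2) else 0"
  let ?g1 = "\<lambda>x. ennreal (if x \<in> below_of z then 0 else \<bar>kR x y - kR x y0\<bar>)"
  let ?g2 = "\<lambda>x. ennreal (if x \<in> below_of z \<and> x \<notin> trap z 0 (2 * c) then \<bar>kR x y\<bar> else 0)"
  have "(\<integral>\<^sup>+x. ?g1 x \<partial>M) \<le> (\<Sum>j. \<Sum>n. ennreal (?B1 j n + ?B2 j n))"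
  proof (rule nn_integral_join_le)
    show "?B1 j n + ?B2 j n \<ge> 0" for j n by auto
    show "?g1 x \<le> ennreal ((?B1 (jn z x) (jn x z) + ?B2 (jn z x) (jn x z)) / w (apx z x))" for x
    proof (cases "x \<in> below_of z")
      case False
      show ?thesis
        using kR_difference_above[OF False y(1) y0(1) ac(1) y(2,3) y0(2,3)] jn_above(4)[OF False y(1)] False
        by (intro ennreal_leI) (simp split: if_splits)
    qed simp
  qed
  also have "\<dots> = (\<Sum>j. (\<Sum>n. ennreal (?B1 j n)) + (\<Sum>n. ennreal (?B2 j n)))"
    by (subst suminf_add[OF summableI summableI]) (simp add: ennreal_plus[symmetric] del: ennreal_plus)
  also have "\<dots> \<le> (\<Sum>j. ennreal (if j = 0 then 0 else 4 * real c / (?s j)\<^sup>2) + ennreal (if j = 0 then 0 else 4 * real c / (?s j)\<^sup>2))"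
  proof (rule suminf_le[OF _ summableI summableI], rule add_mono)
    fix j :: nat
    have "(\<Sum>n. ennreal (?B1 j n)) = (\<Sum>n\<in>{0}. ennreal (?B1 j n))"
      by (rule suminf_finite) auto
    then show "(\<Sum>n. ennreal (?B1 j n)) \<le> ennreal (if j = 0 then 0 else 4 * real c / (?s j)\<^sup>2)" by simp
    show "(\<Sum>n. ennreal (?B2 j n)) \<le> ennreal (if j = 0 then 0 else 4 * real c / (?s j)\<^sup>2)"
    proof (cases "j = 0")
      case False
      have "(\<Sum>n. ennreal (if n = 0 then 0 else (4 * real c / ?s j) / (real n + ?s j)\<^sup>2)) \<le> ennreal ((4 * real c / ?s j) / ?s j)"
        by (rule suminf_inverse_squares_le) (use ac in auto)
      then show ?thesis using False by (simp add: power2_eq_square)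
    qed simp
  qed
  also have "\<dots> = (\<Sum>j. ennreal (if j = 0 then 0 else 4 * real c / (?s j)\<^sup>2)) + (\<Sum>j. ennreal (if j = 0 then 0 else 4 * real c / (?s j)\<^sup>2))"
    by (rule suminf_add[symmetric]) (rule summableI)+
  also have "\<dots> \<le> ennreal (4 * real c / real a) + ennreal (4 * real c / real a)"
    by (intro add_mono suminf_inverse_squares_le) (use ac in auto)
  also have "\<dots> \<le> ennreal 32 + ennreal 32"
    using ac by (intro add_mono ennreal_leI) (auto simp: field_simps)
  finally have 1: "(\<integral>\<^sup>+x. ?g1 x \<partial>M) \<le> ennreal 64" by (simp flip: ennreal_plus)
  have "(\<integral>\<^sup>+x. ?g2 x \<partial>M) \<le> (\<Sum>i. \<Sum>n. ennreal (?B3 i n))"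
  proof (rule nn_integral_join_le)
    show "?B3 i n \<ge> 0" for i n by auto
    show "?g2 x \<le> ennreal (?B3 (jn y x) (jn x y) / w (apx y x))" for x
    proof (cases "x \<in> below_of z \<and> x \<notin> trap z 0 (2 * c)")
      case True
      then obtain k where k: "anc k x = z" "2 * c \<le> k" by (auto simp: below_of_def trap_def not_less)
      show ?thesis using kR_below[OF k(1) y(1,3) k(2)] True by (intro ennreal_leI) simp
    next
      case False
      then have "?g2 x = 0" by auto
      then show ?thesis by simp
    qed
  qed
  also have "\<dots> = (\<Sum>i<c. \<Sum>n. ennreal (?B3 i n))"
  proof (rule suminf_finite)
    fix i assume "i \<notin> {..<c}"
    then have "ennreal (?B3 i n) = 0" for n by simp
    then show "(\<Sum>n. ennreal (?B3 i n)) = 0" by (simp only: suminf_zero)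
  qed simp
  also have "\<dots> \<le> (\<Sum>i<c. ennreal (8 / real c))"
  proof (rule sum_mono)
    fix i assume "i \<in> {..<c}"
    then have "?B3 i n = (if n = 0 then 0 else 8 / (real n + real c)\<^sup>2)" for n by simp
    then show "(\<Sum>n. ennreal (?B3 i n)) \<le> ennreal (8 / real c)"
      using suminf_inverse_squares_le[of "real c" 8] c by (simp only:)
  qed
  also have "\<dots> = ennreal 8" using c by (simp add: ennreal_of_nat_eq_real_of_nat flip: ennreal_mult)
  finally have 2: "(\<integral>\<^sup>+x. ?g2 x \<partial>M) \<le> ennreal 8" .
  have "(\<integral>\<^sup>+x. ennreal (if x \<in> trap z 0 (2 * c) then 0 else
      if x \<in> below_of z then \<bar>kR x y\<bar> else \<bar>kR x y - kR x y0\<bar>) \<partial>M) \<le> (\<integral>\<^sup>+x. ?g1 x + ?g2 x \<partial>M)"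
    by (intro nn_integral_mono) (simp split: if_split)
  also have "\<dots> = (\<integral>\<^sup>+x. ?g1 x \<partial>M) + (\<integral>\<^sup>+x. ?g2 x \<partial>M)" by (rule nn_integral_add) simp_all
  also have "\<dots> \<le> ennreal 64 + ennreal 8" by (intro add_mono 1 2)
  finally show ?thesis by (simp flip: ennreal_plus)
qed

lemma finite_trap: "finite (trap z a c)"
proof -
  have "trap z a c = (\<Union>m\<in>{a..<c}. {y. anc m y = z})" by (auto simp: trap_def)
  then show ?thesis by (simp add: finite_desc)
qed

lemma sum_w_trap: "a \<le> c \<Longrightarrow> (\<Sum>y\<in>trap z a c. w y) = (real c - real a) * w z"
proof -
  assume ac: "a \<le> c"
  have eq: "trap z a c = (\<Union>m\<in>{a..<c}. {y. anc m y = z})" by (auto simp: trap_def)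
  have disj: "m = m'" if "anc m y = z" "anc m' y = z" for m m' y
    using that lev_anc[of m y] lev_anc[of m' y] by simp
  have "(\<Sum>y\<in>trap z a c. w y) = (\<Sum>m\<in>{a..<c}. \<Sum>y | anc m y = z. w y)"
    unfolding eq by (rule sum.UNION_disjoint) (use disj in \<open>auto simp: finite_desc\<close>)
  then show ?thesis using ac by (simp add: sum_w_desc of_nat_diff)
qed

text \<open>The estimate \<open>kernel_cancellation\<close> is uniform in \<open>y\<close>, so it
  can be integrated against \<open>cmod (f y)\<close>; the reference point \<open>y0\<close> is any
  point of the trapezoid.\<close>

lemma Rz_cancellation:
  assumes ac: "1 \<le> a" "c \<le> 8 * a" and supp: "{x. f x \<noteq> 0} \<subseteq> trap z a c"
    and mean: "(\<Sum>y\<in>trap z a c. complex_of_real (w y) * f y) = 0"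
  shows "(\<integral>\<^sup>+x. ennreal (if x \<in> trap z 0 (2 * c) then 0 else cmod (Rz f x)) \<partial>M)
      \<le> ennreal (72 * (\<Sum>y\<in>trap z a c. w y * cmod (f y)))"
proof (cases "trap z a c = {}")
  case True
  then have "f = (\<lambda>x. 0)" using supp by auto
  then have z: "(if P then 0 else cmod (Rz f x)) = 0" for x P by (simp add: Rz_def)
  show ?thesis unfolding z by simp
next
  case False
  let ?S = "trap z a c"
  obtain y0 m0 where y0: "anc m0 y0 = z" "a \<le> m0" "m0 < c" using False by (auto simp: trap_def)
  let ?D = "\<lambda>x y. if x \<in> trap z 0 (2 * c) then 0 else if x \<in> below_of z then \<bar>kR x y\<bar> else \<bar>kR x y - kR x y0\<bar>"
  have bound: "cmod (Rz f x) \<le> (\<Sum>y\<in>?S. (w y * cmod (f y)) * ?D x y)" if x: "x \<notin> trap z 0 (2 * c)" for x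
  proof -
    \<comment> \<open>below the apex the kernel itself is integrable, so nothing has to be subtracted there\<close>
    define e where "e = (if x \<in> below_of z then 0 else kR x y0)"
    have "Rz f x = (\<Sum>y\<in>?S. complex_of_real (w y * kR x y) * f y)" by (rule Rz_fs[OF finite_trap supp])
    also have "\<dots> = (\<Sum>y\<in>?S. complex_of_real (w y * kR x y) * f y) - complex_of_real e * (\<Sum>y\<in>?S. complex_of_real (w y) * f y)"
      using mean by simp
    also have "\<dots> = (\<Sum>y\<in>?S. complex_of_real (w y * (kR x y - e)) * f y)"
      by (simp add: sum_distrib_left sum_subtractf[symmetric] algebra_simps)
    finally have "cmod (Rz f x) = cmod (\<Sum>y\<in>?S. complex_of_real (w y * (kR x y - e)) * f y)" by (rule arg_cong)
    also have "\<dots> \<le> (\<Sum>y\<in>?S. (w y * cmod (f y)) * ?D x y)"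
    proof (rule sum_norm_le)
      fix y
      show "cmod (complex_of_real (w y * (kR x y - e)) * f y) \<le> (w y * cmod (f y)) * ?D x y"
      proof -
        have "?D x y = \<bar>kR x y - e\<bar>" using x by (cases "x \<in> below_of z") (simp_all only: e_def if_False if_True diff_zero)
        then show ?thesis by (simp only: norm_mult norm_of_real abs_mult abs_of_nonneg[OF w_nonneg] mult_ac)
      qed
    qed
    finally show ?thesis .
  qed
  have "(\<integral>\<^sup>+x. ennreal (if x \<in> trap z 0 (2 * c) then 0 else cmod (Rz f x)) \<partial>M)
      \<le> (\<integral>\<^sup>+x. (\<Sum>y\<in>?S. ennreal (w y * cmod (f y)) * ennreal (?D x y)) \<partial>M)"
  proof (rule nn_integral_mono)
    fix x
    show "ennreal (if x \<in> trap z 0 (2 * c) then 0 else cmod (Rz f x)) \<le> (\<Sum>y\<in>?S. ennreal (w y * cmod (f y)) * ennreal (?D x y))"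
    proof (cases "x \<in> trap z 0 (2 * c)")
      case x: False
      have "ennreal (cmod (Rz f x)) \<le> ennreal (\<Sum>y\<in>?S. (w y * cmod (f y)) * ?D x y)"
        by (rule ennreal_leI[OF bound[OF x]])
      also have "\<dots> = (\<Sum>y\<in>?S. ennreal ((w y * cmod (f y)) * ?D x y))"
        by (rule sum_ennreal[symmetric]) auto
      also have "\<dots> = (\<Sum>y\<in>?S. ennreal (w y * cmod (f y)) * ennreal (?D x y))"
        by (intro sum.cong refl ennreal_mult) auto
      finally show ?thesis using x by simp
    qed simp
  qed
  also have "\<dots> = (\<Sum>y\<in>?S. ennreal (w y * cmod (f y)) * (\<integral>\<^sup>+x. ennreal (?D x y) \<partial>M))"
    by (subst nn_integral_sum) (auto simp: nn_integral_cmult)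
  also have "\<dots> \<le> (\<Sum>y\<in>?S. ennreal (w y * cmod (f y)) * ennreal 72)"
  proof (intro sum_mono mult_left_mono)
    fix y assume "y \<in> ?S"
    then obtain m where "anc m y = z" "a \<le> m" "m < c" by (auto simp: trap_def)
    then show "(\<integral>\<^sup>+x. ennreal (?D x y) \<partial>M) \<le> ennreal 72"
      by (rule kernel_cancellation[OF ac _ _ _ y0])
  qed simp
  also have "\<dots> = ennreal (72 * (\<Sum>y\<in>?S. w y * cmod (f y)))"
  proof -
    have "(\<Sum>y\<in>?S. ennreal (w y * cmod (f y)) * ennreal 72) = (\<Sum>y\<in>?S. ennreal (72 * (w y * cmod (f y))))"
      by (intro sum.cong refl) (subst mult.commute, rule ennreal_mult[symmetric], simp_all)
    also have "\<dots> = ennreal (\<Sum>y\<in>?S. 72 * (w y * cmod (f y)))" by (rule sum_ennreal) simp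
    finally show ?thesis by (simp only: sum_distrib_left)
  qed
  finally show ?thesis .
qed


subsection \<open>The weak type estimate\<close>

definition nrm1 :: "('v \<Rightarrow> complex) \<Rightarrow> real" where
  "nrm1 f = (\<integral>x. cmod (f x) \<partial>M)"

lemma nrm1_nonneg [simp]: "nrm1 f \<ge> 0"
  by (simp add: nrm1_def)

lemma nrm1_fs: "finite S \<Longrightarrow> {x. f x \<noteq> 0} \<subseteq> S \<Longrightarrow> nrm1 f = (\<Sum>y\<in>S. w y * cmod (f y))"
  unfolding nrm1_def by (subst integral_finite_support[of S]) auto

lemma nrm2_fs: "finite S \<Longrightarrow> {x. f x \<noteq> 0} \<subseteq> S \<Longrightarrow> nrm2 f = (\<Sum>y\<in>S. w y * (cmod (f y))\<^sup>2)"
  unfolding nrm2_def by (subst integral_finite_support[of S]) auto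

lemma chebyshev:
  fixes h :: "'v \<Rightarrow> real"
  assumes "t > 0"
  shows "emeasure M {x. t < h x} \<le> ennreal (1 / t) * (\<integral>\<^sup>+x. ennreal (h x) \<partial>M)"
proof -
  have "emeasure M {x. t < h x} \<le> emeasure M {x \<in> UNIV. 1 \<le> ennreal (1 / t) * ennreal (h x)}"
  proof (rule emeasure_mono)
    show "{x. t < h x} \<subseteq> {x \<in> UNIV. 1 \<le> ennreal (1 / t) * ennreal (h x)}"
    proof
      fix x assume "x \<in> {x. t < h x}"
      then have "ennreal 1 \<le> ennreal (1 / t * h x)" using assms by (intro ennreal_leI) (simp add: field_simps)
      also have "\<dots> = ennreal (1 / t) * ennreal (h x)" using assms by (intro ennreal_mult') simp
      finally show "x \<in> {x \<in> UNIV. 1 \<le> ennreal (1 / t) * ennreal (h x)}" by simp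
    qed
  qed simp
  also have "\<dots> \<le> ennreal (1 / t) * (\<integral>\<^sup>+x. ennreal (h x) * indicator UNIV x \<partial>M)"
    by (rule nn_integral_Markov_inequality) simp_all
  finally show ?thesis by simp
qed

lemma chebyshev_L2:
  assumes "t > 0" "h \<in> Lp M 2"
  shows "emeasure M {x. t < cmod (h x)} \<le> ennreal (nrm2 h / t\<^sup>2)"
proof -
  have "{x. t < cmod (h x)} = {x. t\<^sup>2 < (cmod (h x))\<^sup>2}"
    using assms(1) by (auto intro: power_strict_mono dest: power_less_imp_less_base)
  then have "emeasure M {x. t < cmod (h x)} \<le> ennreal (1 / t\<^sup>2) * (\<integral>\<^sup>+x. ennreal ((cmod (h x))\<^sup>2) \<partial>M)"
    using chebyshev[of "t\<^sup>2" "\<lambda>x. (cmod (h x))\<^sup>2"] assms(1) by simp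
  also have "(\<integral>\<^sup>+x. ennreal ((cmod (h x))\<^sup>2) \<partial>M) = ennreal (nrm2 h)"
    unfolding nrm2_def using assms(2) by (intro nn_integral_eq_integral) (simp_all add: in_L2_iff)
  also have "ennreal (1 / t\<^sup>2) * ennreal (nrm2 h) = ennreal (nrm2 h / t\<^sup>2)"
    by (subst ennreal_mult[symmetric]) auto
  finally show ?thesis .
qed

lemma anc_exponent_unique: "anc m y = z \<Longrightarrow> anc m' y = z \<Longrightarrow> m = m'"
  using lev_anc[of m y] lev_anc[of m' y] by simp

lemma common_anc_finite:
  "finite S \<Longrightarrow> \<exists>z N. \<forall>y\<in>S. \<exists>m\<le>N. anc m y = z"
proof (induction S rule: finite_induct)
  case (insert y S)
  then obtain z N where zN: "\<And>x. x \<in> S \<Longrightarrow> \<exists>m\<le>N. anc m x = z" by blast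
  obtain m n where mn: "anc m z = anc n y" using common by blast
  have "\<exists>k\<le>N + m + n. anc k x = anc m z" if x: "x \<in> insert y S" for x
  proof (cases "x = y")
    case True
    then show ?thesis using mn by (intro exI[of _ n]) simp
  next
    case False
    then obtain k where "k \<le> N" "anc k x = z" using zN x by auto
    then show ?thesis by (intro exI[of _ "m + k"]) (simp add: anc_add)
  qed
  then show ?case by blast
qed simp

text \<open>The bounds \<open>2a \<le> c \<le> 8a\<close> are stable under splitting: for \<open>c \<ge> 4a\<close> cut at depth \<open>2a\<close>, otherwise pass to
  the children of the apex, which lowers \<open>a\<close> and \<open>c\<close> by one.\<close>

definition dyad :: "'v set \<Rightarrow> bool" where
  "dyad Q \<longleftrightarrow> (\<exists>y. Q = {y}) \<or> (\<exists>z a c. 1 \<le> a \<and> 2 * a \<le> c \<and> c \<le> 8 * a \<and> Q = trap z a c)"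

lemma dyad_finite: "dyad Q \<Longrightarrow> finite Q"
  by (auto simp: dyad_def finite_trap)

lemma dyad_pos: "dyad Q \<Longrightarrow> sum w Q > 0"
  by (auto simp: dyad_def sum_w_trap)

text \<open>Apex and depths are raised together: a point at depth \<open>m\<close> under
  \<open>z\<close> has depth \<open>j + m\<close> under \<open>anc j z\<close>, which stays below
  \<open>2 * j\<close> when \<open>m < j\<close>. The weight \<open>2 * j * w (anc j z)\<close>
  grows with \<open>j\<close>, so \<open>j\<close> exceeds \<open>N\<close> for the inclusion and
  \<open>n\<close> for the weight.\<close>

lemma dyad_large:
  assumes "finite S"
  shows "\<exists>Q. dyad Q \<and> S \<subseteq> Q \<and> K \<le> sum w Q"
proof -
  obtain z N where zN: "\<And>y. y \<in> S \<Longrightarrow> \<exists>m\<le>N. anc m y = z" using common_anc_finite[OF assms] by blast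
  obtain n where n: "K / w z \<le> real n" using real_arch_simple by blast
  define j where "j = Suc (N + n)"
  have "S \<subseteq> trap (anc j z) j (3 * j)"
  proof
    fix y assume "y \<in> S"
    then obtain m where "m \<le> N" "anc m y = z" using zN by blast
    then show "y \<in> trap (anc j z) j (3 * j)"
      unfolding trap_def mem_Collect_eq by (intro exI[of _ "j + m"]) (simp add: anc_add j_def)
  qed
  moreover have "K \<le> sum w (trap (anc j z) j (3 * j))"
  proof -
    have "K \<le> real n * w z" using n by (simp add: pos_divide_le_eq)
    also have "\<dots> \<le> (real (3 * j) - real j) * w (anc j z)"
      by (rule mult_mono[OF _ w_le_anc]) (simp_all add: j_def)
    also have "\<dots> = sum w (trap (anc j z) j (3 * j))" by (rule sum_w_trap[symmetric]) simp
    finally show ?thesis .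
  qed
  moreover have "dyad (trap (anc j z) j (3 * j))"
    unfolding dyad_def by (rule disjI2) (intro exI[of _ "anc j z"] exI[of _ j] exI[of _ "3 * j"], simp add: j_def)
  ultimately show ?thesis by blast
qed

definition parts :: "'v set \<Rightarrow> 'v set set \<Rightarrow> bool" where
  "parts Q P \<longleftrightarrow> finite P \<and> (\<forall>R\<in>P. \<forall>R'\<in>P. R \<noteq> R' \<longrightarrow> R \<inter> R' = {}) \<and> \<Union>P = Q"

text \<open>Cutting at \<open>2 * a\<close> gives depth ratios 2 and \<open>c / (2 * a)\<close>, the
  latter between 2 and 4. Each piece has at least \<open>a\<close> of at most \<open>7 * a\<close>
  generations, whence the factor 8.\<close>

lemma dyad_split_vertical:
  assumes "1 \<le> a" "4 * a \<le> c" "c \<le> 8 * a"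
  shows "\<exists>P. parts (trap z a c) P \<and>
    (\<forall>R\<in>P. dyad R \<and> sum w R < sum w (trap z a c) \<and> sum w (trap z a c) \<le> 8 * (real q)\<^sup>2 * sum w R)"
proof (intro exI conjI ballI)
  let ?P = "{trap z a (2 * a), trap z (2 * a) c}"
  show "parts (trap z a c) ?P"
    unfolding parts_def
  proof (intro conjI)
    have "trap z a (2 * a) \<inter> trap z (2 * a) c = {}"
      unfolding trap_def by (auto dest: anc_exponent_unique)
    then show "\<forall>R\<in>?P. \<forall>R'\<in>?P. R \<noteq> R' \<longrightarrow> R \<inter> R' = {}" by (auto simp: Int_commute)
    have "y \<in> trap z a c \<longleftrightarrow> y \<in> trap z a (2 * a) \<or> y \<in> trap z (2 * a) c" for y
    proof
      assume "y \<in> trap z a c"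
      then obtain m where "anc m y = z" "a \<le> m" "m < c" by (auto simp: trap_def)
      then show "y \<in> trap z a (2 * a) \<or> y \<in> trap z (2 * a) c"
        by (cases "m < 2 * a") (auto simp: trap_def not_less)
    next
      assume "y \<in> trap z a (2 * a) \<or> y \<in> trap z (2 * a) c"
      then obtain m where "anc m y = z" "a \<le> m" "m < c" using assms by (auto simp: trap_def)
      then show "y \<in> trap z a c" by (auto simp: trap_def)
    qed
    then show "\<Union>?P = trap z a c" by auto
  qed simp
  fix R assume R: "R \<in> ?P"
  show "dyad R" unfolding dyad_def
  proof (rule disjI2, cases "R = trap z a (2 * a)")
    case True
    then show "\<exists>z a c. 1 \<le> a \<and> 2 * a \<le> c \<and> c \<le> 8 * a \<and> R = trap z a c"
      using assms by (intro exI[of _ z] exI[of _ a] exI[of _ "2 * a"]) simp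
  next
    case False
    then show "\<exists>z a c. 1 \<le> a \<and> 2 * a \<le> c \<and> c \<le> 8 * a \<and> R = trap z a c"
      using assms R by (intro exI[of _ z] exI[of _ "2 * a"] exI[of _ c]) simp
  qed
  have r: "1 \<le> real a" "4 * real a \<le> real c" "real c \<le> 8 * real a" using assms by auto
  obtain k where k: "sum w R = k * w z" "real a \<le> k" "k < real c - real a"
    using R assms by (auto simp: sum_w_trap)
  have Q: "sum w (trap z a c) = (real c - real a) * w z" using assms by (simp add: sum_w_trap)
  show "sum w R < sum w (trap z a c)" unfolding k Q using k by simp
  have "1 \<le> (real q)\<^sup>2" using q_gt_1 by simp
  then have "8 * 1 * k \<le> 8 * (real q)\<^sup>2 * k" by (intro mult_right_mono mult_left_mono) (use k r in auto)
  then have "real c - real a \<le> 8 * (real q)\<^sup>2 * k" using k r by linarith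
  from mult_right_mono[OF this w_nonneg[of z]] show "sum w (trap z a c) \<le> 8 * (real q)\<^sup>2 * sum w R"
    unfolding k Q by (simp add: mult.assoc)
qed

text \<open>Passing to children lowers both depths by one and increases their ratio; with
  \<open>c < 4 * a\<close> and \<open>a \<ge> 2\<close> it stays at most 8, the reason for this
  upper bound in \<open>dyad\<close>. Each piece has exactly the fraction \<open>1 / q\<close> of
  the weight.\<close>

lemma dyad_split_horizontal:
  assumes "2 \<le> a" "2 * a \<le> c" "c < 4 * a"
  shows "\<exists>P. parts (trap z a c) P \<and>
    (\<forall>R\<in>P. dyad R \<and> sum w R < sum w (trap z a c) \<and> sum w (trap z a c) \<le> 8 * (real q)\<^sup>2 * sum w R)"
proof (intro exI conjI ballI)
  let ?P = "(\<lambda>u. trap u (a - 1) (c - 1)) ` {u. p u = z}"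
  show "parts (trap z a c) ?P"
    unfolding parts_def
  proof (intro conjI ballI impI)
    show "finite ?P" by (simp add: finite_children)
    show "R \<inter> R' = {}" if R: "R \<in> ?P" "R' \<in> ?P" "R \<noteq> R'" for R R'
    proof (rule ccontr)
      assume "R \<inter> R' \<noteq> {}"
      then obtain y where y: "y \<in> R" "y \<in> R'" by blast
      obtain u u' where u: "p u = z" "p u' = z" "R = trap u (a - 1) (c - 1)" "R' = trap u' (a - 1) (c - 1)"
        using R by blast
      obtain m m' where m: "anc m y = u" "anc m' y = u'" using y u by (auto simp: trap_def)
      have "anc (Suc m) y = z" "anc (Suc m') y = z" using m u by auto
      then have "m = m'" using anc_exponent_unique by blast
      then show False using m u R(3) by simp
    qed
    show "\<Union>?P = trap z a c"
    proof (intro equalityI subsetI)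
      fix y assume "y \<in> \<Union>?P"
      then obtain u m where "p u = z" "anc m y = u" "a - 1 \<le> m" "m < c - 1" by (auto simp: trap_def)
      then show "y \<in> trap z a c" unfolding trap_def mem_Collect_eq by (intro exI[of _ "Suc m"]) auto
    next
      fix y assume "y \<in> trap z a c"
      then obtain m where m: "anc m y = z" "a \<le> m" "m < c" by (auto simp: trap_def)
      then obtain n where n: "m = Suc n" using assms by (cases m) auto
      have "y \<in> trap (anc n y) (a - 1) (c - 1)"
        unfolding trap_def mem_Collect_eq by (intro exI[of _ n]) (use m n assms in auto)
      then show "y \<in> \<Union>?P" using m n by auto
    qed
  qed
  fix R assume "R \<in> ?P"
  then obtain u where u: "p u = z" "R = trap u (a - 1) (c - 1)" by blast
  show "dyad R" unfolding dyad_def u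
    by (rule disjI2, intro exI[of _ u] exI[of _ "a - 1"] exI[of _ "c - 1"]) (use assms in auto)
  have z: "w z = real q * w u" using u w_p by blast
  have R: "sum w R = (real c - real a) * w u" unfolding u using assms by (subst sum_w_trap) auto
  have Q: "sum w (trap z a c) = real q * sum w R" unfolding R using assms by (simp add: sum_w_trap z)
  have pos: "sum w R > 0" unfolding R using assms by simp
  then show "sum w R < sum w (trap z a c)" unfolding Q using q_gt_1 by simp
  have "real q \<le> 8 * (real q)\<^sup>2" using q_gt_1 by (simp add: power2_eq_square)
  then show "sum w (trap z a c) \<le> 8 * (real q)\<^sup>2 * sum w R"
    unfolding Q using pos by (intro mult_right_mono) auto
qed

text \<open>With \<open>a = 1\<close> the children would start at depth 0, so the trapezoid is split
  into points instead. It has at most two generations, at depths 1 and 2, and a point has at least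
  the fraction \<open>1 / (2 * q\<^sup>2)\<close> of its weight.\<close>

lemma dyad_split_points:
  assumes "2 \<le> c" "c \<le> 3"
  shows "\<exists>P. parts (trap z 1 c) P \<and>
    (\<forall>R\<in>P. dyad R \<and> sum w R < sum w (trap z 1 c) \<and> sum w (trap z 1 c) \<le> 8 * (real q)\<^sup>2 * sum w R)"
proof (intro exI conjI ballI)
  let ?P = "(\<lambda>y. {y}) ` trap z 1 c"
  show "parts (trap z 1 c) ?P"
    unfolding parts_def by (auto simp: finite_trap)
  fix R assume "R \<in> ?P"
  then obtain y m where y: "R = {y}" "anc m y = z" "1 \<le> m" "m < c" by (auto simp: trap_def)
  show "dyad R" unfolding dyad_def using y by blast
  have m: "m = 1 \<or> m = 2" using y assms by auto
  have z: "w z = real q ^ m * w y" using y(2) w_anc by metis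
  have Q: "sum w (trap z 1 c) = (real c - 1) * w z" using assms by (simp add: sum_w_trap)
  have q: "real q \<ge> 2" using q_ge_2 by simp
  have "1 * w y < real q ^ m * w y"
    by (rule mult_strict_right_mono) (use m q in \<open>auto intro: one_less_power\<close>)
  also have "\<dots> = 1 * w z" by (simp add: z)
  also have "\<dots> \<le> (real c - 1) * w z" using assms by (intro mult_right_mono) auto
  finally show "sum w R < sum w (trap z 1 c)" unfolding Q y by simp
  have "(real c - 1) * real q ^ m \<le> 2 * (real q)\<^sup>2"
    using m q assms by (intro mult_mono) (auto simp: power2_eq_square)
  also have "\<dots> \<le> 8 * (real q)\<^sup>2" by simp
  finally have "(real c - 1) * real q ^ m * w y \<le> 8 * (real q)\<^sup>2 * w y" by (intro mult_right_mono) auto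
  then show "sum w (trap z 1 c) \<le> 8 * (real q)\<^sup>2 * sum w R" unfolding Q z y by (simp add: mult.assoc)
qed

lemma dyad_split:
  assumes "dyad Q" "\<nexists>y. Q = {y}"
  obtains P where "parts Q P"
    "\<And>R. R \<in> P \<Longrightarrow> dyad R \<and> sum w R < sum w Q \<and> sum w Q \<le> 8 * (real q)\<^sup>2 * sum w R"
proof -
  obtain z a c where Q: "1 \<le> a" "2 * a \<le> c" "c \<le> 8 * a" "Q = trap z a c"
    using assms by (auto simp: dyad_def)
  have "\<exists>P. parts Q P \<and> (\<forall>R\<in>P. dyad R \<and> sum w R < sum w Q \<and> sum w Q \<le> 8 * (real q)\<^sup>2 * sum w R)"
  proof (cases "4 * a \<le> c")
    case True
    then show ?thesis unfolding Q using Q by (intro dyad_split_vertical) auto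
  next
    case False
    show ?thesis
    proof (cases "a = 1")
      case True
      show ?thesis unfolding Q(4) True by (rule dyad_split_points) (use Q False True in auto)
    next
      case a: False
      show ?thesis unfolding Q(4) by (rule dyad_split_horizontal) (use Q False a in auto)
    qed
  qed
  then show ?thesis using that by blast
qed

text \<open>The factor \<open>8 * q\<^sup>2\<close> is the largest loss of weight in a single
  splitting step, by \<open>dyad_split\<close>.\<close>

definition cz :: "('v \<Rightarrow> real) \<Rightarrow> real \<Rightarrow> 'v set \<Rightarrow> 'v set set \<Rightarrow> bool" where
  "cz h l Q P \<longleftrightarrow> parts (\<Union>P) P \<and> \<Union>P \<subseteq> Q \<and> (\<forall>y\<in>Q - \<Union>P. h y \<le> l) \<and>
     (\<forall>R\<in>P. dyad R \<and> l * sum w R < (\<Sum>y\<in>R. w y * h y) \<and> (\<Sum>y\<in>R. w y * h y) \<le> 8 * (real q)\<^sup>2 * l * sum w R)"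

text \<open>A piece is selected as soon as its mean exceeds \<open>l\<close>; the upper bound comes
  from the parent, whose mean was still at most \<open>l\<close>. The recursion ends at points,
  where mean and value coincide, so no differentiation theorem is involved.\<close>

lemma calderon_zygmund:
  assumes "dyad Q" "\<And>y. h y \<ge> 0" "l > 0" "(\<Sum>y\<in>Q. w y * h y) \<le> l * sum w Q"
  shows "\<exists>P. cz h l Q P"
  using assms(1,4)
proof (induction "card Q" arbitrary: Q rule: less_induct)
  case less
  show ?case
  proof (cases "\<exists>y. Q = {y}")
    case True
    then obtain y where Q: "Q = {y}" by blast
    then have "w y * h y \<le> w y * l" using less.prems by (simp add: mult.commute)
    then have "h y \<le> l" by simp
    then have "cz h l Q {}" using Q by (simp add: cz_def parts_def)
    then show ?thesis by blast
  next
    case False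
    with less.prems(1) obtain S where S: "parts Q S"
      and R: "\<And>R. R \<in> S \<Longrightarrow> dyad R \<and> sum w R < sum w Q \<and> sum w Q \<le> 8 * (real q)\<^sup>2 * sum w R"
      using dyad_split by metis
    note finQ = dyad_finite[OF less.prems(1)]
    have "\<exists>P. cz h l R P" if RS: "R \<in> S" for R
    proof (cases "l * sum w R < (\<Sum>y\<in>R. w y * h y)")
      case True
      have "R \<subseteq> Q" using S RS by (auto simp: parts_def)
      then have "(\<Sum>y\<in>R. w y * h y) \<le> (\<Sum>y\<in>Q. w y * h y)"
        by (intro sum_mono2[OF finQ]) (auto simp: assms(2))
      also have "\<dots> \<le> l * sum w Q" by (rule less.prems(2))
      also have "\<dots> \<le> l * (8 * (real q)\<^sup>2 * sum w R)" using R[OF RS] assms(3) by (intro mult_left_mono) auto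
      also have "\<dots> = 8 * (real q)\<^sup>2 * l * sum w R" by (simp only: mult_ac)
      finally have "cz h l R {R}" using True R[OF RS] by (simp add: cz_def parts_def)
      then show ?thesis by blast
    next
      case small: False
      have "R \<subseteq> Q" using S RS by (auto simp: parts_def)
      moreover have "R \<noteq> Q" using R[OF RS] by auto
      ultimately have "card R < card Q" using finQ by (intro psubset_card_mono) auto
      then show ?thesis using less.hyps R[OF RS] small by (simp add: not_less)
    qed
    then obtain F where F: "\<And>R. R \<in> S \<Longrightarrow> cz h l R (F R)" by metis
    have sub: "\<Union>(F R) \<subseteq> R" if "R \<in> S" for R using F[OF that] by (simp add: cz_def)
    have "cz h l Q (\<Union>(F ` S))"
      unfolding cz_def
    proof (intro conjI ballI)
      show "parts (\<Union>(\<Union>(F ` S))) (\<Union>(F ` S))"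
        unfolding parts_def
      proof (intro conjI ballI impI)
        show "finite (\<Union>(F ` S))" using S F by (auto simp: parts_def cz_def)
        fix A B assume AB: "A \<in> \<Union>(F ` S)" "B \<in> \<Union>(F ` S)" "A \<noteq> B"
        then obtain U V where UV: "U \<in> S" "V \<in> S" "A \<in> F U" "B \<in> F V" by blast
        show "A \<inter> B = {}"
        proof (cases "U = V")
          case True
          then show ?thesis using F[OF UV(1)] UV AB(3) unfolding cz_def parts_def by blast
        next
          case False
          then have "U \<inter> V = {}" using S UV unfolding parts_def by blast
          moreover have "A \<subseteq> U" "B \<subseteq> V" using sub UV by blast+
          ultimately show ?thesis by blast
        qed
      qed simp
      show "\<Union>(\<Union>(F ` S)) \<subseteq> Q" using sub S by (force simp: parts_def)
      show "h y \<le> l" if "y \<in> Q - \<Union>(\<Union>(F ` S))" for y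
      proof -
        have "y \<in> \<Union>S" using that S by (simp add: parts_def)
        then obtain U where U: "U \<in> S" "y \<in> U" by blast
        then have "y \<in> U - \<Union>(F U)" using that by blast
        moreover have "\<forall>y\<in>U - \<Union>(F U). h y \<le> l" using F[OF U(1)] unfolding cz_def by (elim conjE)
        ultimately show ?thesis by (rule bspec[rotated])
      qed
      fix A assume "A \<in> \<Union>(F ` S)"
      then obtain U where U: "U \<in> S" "A \<in> F U" by blast
      then show "dyad A" "l * sum w A < (\<Sum>y\<in>A. w y * h y)" "(\<Sum>y\<in>A. w y * h y) \<le> 8 * (real q)\<^sup>2 * l * sum w A"
        using F[OF U(1)] U(2) by (simp_all add: cz_def)
    qed
    then show ?thesis by blast
  qed
qed

text \<open>The exceptional set is the enlarged trapezoid with depths below \<open>2 * c\<close>;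
  \<open>c \<ge> 2 * a\<close> makes its weight at most four times that of \<open>R\<close>. For a
  point the mean value zero forces \<open>f = 0\<close>.\<close>

lemma dyad_cancellation:
  assumes "dyad R" "{x. f x \<noteq> 0} \<subseteq> R" "(\<Sum>y\<in>R. complex_of_real (w y) * f y) = 0"
  shows "\<exists>R'. emeasure M R' \<le> ennreal (4 * sum w R) \<and>
    (\<integral>\<^sup>+x. ennreal (if x \<in> R' then 0 else cmod (Rz f x)) \<partial>M) \<le> ennreal (72 * (\<Sum>y\<in>R. w y * cmod (f y)))"
proof (cases "\<exists>y. R = {y}")
  case True
  then obtain y where y: "R = {y}" by blast
  then have "f y = 0" using assms(3) by simp
  then have "f = (\<lambda>x. 0)" using assms(2) y by auto
  then have z: "(if x \<in> {} then 0 else cmod (Rz f x)) = 0" for x by (simp add: Rz_def)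
  show ?thesis by (rule exI[of _ "{}"]) (simp only: z, simp)
next
  case False
  then obtain z a c where R: "1 \<le> a" "2 * a \<le> c" "c \<le> 8 * a" "R = trap z a c"
    using assms(1) by (auto simp: dyad_def)
  have "emeasure M (trap z 0 (2 * c)) = ennreal (2 * real c * w z)"
    by (simp add: emeasure_M_finite finite_trap sum_w_trap)
  also have "\<dots> \<le> ennreal (4 * sum w R)"
  proof (rule ennreal_leI)
    have "2 * real c \<le> 4 * (real c - real a)" using R by simp
    then have "2 * real c * w z \<le> 4 * (real c - real a) * w z" by (rule mult_right_mono) simp
    then show "2 * real c * w z \<le> 4 * sum w R" using R by (simp add: sum_w_trap)
  qed
  finally show ?thesis
    using Rz_cancellation[OF R(1,3), of f z] assms R(4) by (intro exI[of _ "trap z 0 (2 * c)"]) simp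
qed


definition avg :: "('v \<Rightarrow> complex) \<Rightarrow> 'v set \<Rightarrow> complex" where
  "avg f R = (\<Sum>y\<in>R. complex_of_real (w y) * f y) / complex_of_real (sum w R)"

definition bad :: "('v \<Rightarrow> complex) \<Rightarrow> 'v set \<Rightarrow> 'v \<Rightarrow> complex" where
  "bad f R y = (if y \<in> R then f y - avg f R else 0)"

lemma avg_bound:
  assumes "dyad R"
  shows "sum w R * cmod (avg f R) \<le> (\<Sum>y\<in>R. w y * cmod (f y))"
proof -
  note pos = dyad_pos[OF assms]
  have "sum w R * cmod (avg f R) = cmod (\<Sum>y\<in>R. complex_of_real (w y) * f y)"
    unfolding avg_def norm_divide norm_of_real using pos by simp
  also have "\<dots> \<le> (\<Sum>y\<in>R. w y * cmod (f y))"
    by (rule sum_norm_le) (simp add: norm_mult)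
  finally show ?thesis .
qed

lemma bad_support: "{x. bad f R x \<noteq> 0} \<subseteq> R"
  by (auto simp: bad_def)

lemma bad_mean:
  assumes "dyad R"
  shows "(\<Sum>y\<in>R. complex_of_real (w y) * bad f R y) = 0"
proof -
  have "complex_of_real (sum w R) \<noteq> 0" using dyad_pos[OF assms] unfolding of_real_eq_0_iff by simp
  then have *: "avg f R * complex_of_real (sum w R) = (\<Sum>y\<in>R. complex_of_real (w y) * f y)"
    unfolding avg_def by (rule nonzero_eq_divide_eq[THEN iffD1]) simp
  have "(\<Sum>y\<in>R. complex_of_real (w y) * bad f R y)
      = (\<Sum>y\<in>R. complex_of_real (w y) * f y - avg f R * complex_of_real (w y))"
    by (intro sum.cong refl) (simp add: bad_def algebra_simps)
  also have "\<dots> = (\<Sum>y\<in>R. complex_of_real (w y) * f y) - avg f R * complex_of_real (sum w R)"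
    by (simp only: sum_subtractf sum_distrib_left of_real_sum)
  also have "\<dots> = 0" unfolding * by (rule diff_self)
  finally show ?thesis .
qed

lemma bad_nrm1:
  assumes "dyad R"
  shows "(\<Sum>y\<in>R. w y * cmod (bad f R y)) \<le> 2 * (\<Sum>y\<in>R. w y * cmod (f y))"
proof -
  have "(\<Sum>y\<in>R. w y * cmod (bad f R y)) \<le> (\<Sum>y\<in>R. w y * cmod (f y) + w y * cmod (avg f R))"
  proof (rule sum_mono)
    fix y assume "y \<in> R"
    then have "cmod (bad f R y) \<le> cmod (f y) + cmod (avg f R)" by (simp add: bad_def norm_triangle_ineq4)
    from mult_left_mono[OF this w_nonneg[of y]]
    show "w y * cmod (bad f R y) \<le> w y * cmod (f y) + w y * cmod (avg f R)" by (simp only: distrib_left)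
  qed
  also have "\<dots> = (\<Sum>y\<in>R. w y * cmod (f y)) + sum w R * cmod (avg f R)"
    by (simp only: sum.distrib sum_distrib_right)
  also have "\<dots> \<le> (\<Sum>y\<in>R. w y * cmod (f y)) + (\<Sum>y\<in>R. w y * cmod (f y))"
    by (intro add_left_mono avg_bound assms)
  finally show ?thesis by simp
qed

lemma sum_bad:
  assumes "parts (\<Union>P) P" "R \<in> P" "y \<in> R"
  shows "(\<Sum>R\<in>P. bad f R y) = f y - avg f R"
proof -
  have "(\<Sum>R'\<in>P. bad f R' y) = bad f R y + (\<Sum>R'\<in>P - {R}. bad f R' y)"
    using assms by (intro sum.remove) (auto simp: parts_def)
  also have "(\<Sum>R'\<in>P - {R}. bad f R' y) = 0"
  proof (rule sum.neutral, rule ballI)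
    fix R' assume R': "R' \<in> P - {R}"
    then have "R \<inter> R' = {}" using assms by (auto simp: parts_def)
    then show "bad f R' y = 0" using assms(3) by (auto simp: bad_def)
  qed
  finally show ?thesis using assms(3) by (simp add: bad_def)
qed

lemma sum_parts_le:
  assumes "parts (\<Union>P) P" "\<Union>P \<subseteq> Q" "finite Q" "\<And>R. R \<in> P \<Longrightarrow> finite R" "\<And>y. h y \<ge> (0::real)"
  shows "(\<Sum>R\<in>P. sum h R) \<le> sum h Q"
proof -
  have "(\<Sum>R\<in>P. sum h R) = sum h (\<Union>P)"
    by (rule sum.Union_disjoint[symmetric, unfolded comp_def]) (use assms in \<open>auto simp: parts_def\<close>)
  also have "\<dots> \<le> sum h Q" by (rule sum_mono2) (use assms in auto)
  finally show ?thesis .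
qed

text \<open>Twice \<open>48 * D + 4 + 144\<close> with \<open>D = 8 * q\<^sup>2\<close>, the
  constants in the proof of \<open>Rz_fs_weak\<close>; the factor two comes from working at height
  \<open>t / 2\<close>.\<close>

definition Cw :: real where "Cw = 768 * (real q)\<^sup>2 + 296"

lemma Rz_fs_weak:
  assumes f: "fs f" and t: "t > 0"
  shows "emeasure M {x. t < cmod (Rz f x)} \<le> ennreal (Cw * nrm1 f / t)"
proof -
  define l where "l = t / 2"
  have l: "l > 0" using t by (simp add: l_def)
  define D where "D = 8 * (real q)\<^sup>2"
  have D1: "D \<ge> 1" using one_le_power[of "real q" 2] q_gt_1 unfolding D_def by linarith
  obtain Q where Q: "dyad Q" "{x. f x \<noteq> 0} \<subseteq> Q" "nrm1 f / l \<le> sum w Q"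
    using dyad_large f unfolding fs_def by blast
  note finQ = dyad_finite[OF Q(1)]
  have N: "nrm1 f = (\<Sum>y\<in>Q. w y * cmod (f y))" by (rule nrm1_fs[OF finQ Q(2)])
  have "\<exists>P. cz (\<lambda>y. cmod (f y)) l Q P"
  proof (rule calderon_zygmund[OF Q(1) _ l])
    show "(\<Sum>y\<in>Q. w y * cmod (f y)) \<le> l * sum w Q"
      unfolding N[symmetric] using Q(3) l by (simp add: pos_divide_le_eq mult.commute)
  qed simp
  then obtain P where P: "cz (\<lambda>y. cmod (f y)) l Q P" by blast
  have pP: "parts (\<Union>P) P" "\<Union>P \<subseteq> Q" using P by (simp_all add: cz_def)
  have finP: "finite P" using pP by (simp add: parts_def)
  have dP: "dyad R" and lo: "l * sum w R \<le> (\<Sum>y\<in>R. w y * cmod (f y))"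
    and hi: "(\<Sum>y\<in>R. w y * cmod (f y)) \<le> D * l * sum w R" if "R \<in> P" for R
    using P that by (auto simp: cz_def D_def less_imp_le)
  define g where "g = (\<lambda>y. f y - (\<Sum>R\<in>P. bad f R y))"
  have badQ: "{x. bad f R x \<noteq> 0} \<subseteq> Q" if "R \<in> P" for R
    using bad_support[of f R] that pP(2) by blast
  have bad0: "(\<Sum>R\<in>P. bad f R y) = 0" if "y \<notin> \<Union>P" for y
    by (rule sum.neutral) (use that in \<open>auto simp: bad_def\<close>)
  have gQ: "{x. g x \<noteq> 0} \<subseteq> Q"
  proof
    fix x assume x: "x \<in> {x. g x \<noteq> 0}"
    show "x \<in> Q"
    proof (rule ccontr)
      assume "x \<notin> Q"
      then have "f x = 0" "x \<notin> \<Union>P" using Q(2) pP(2) by auto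
      then show False using x bad0[of x] by (simp add: g_def)
    qed
  qed
  have g_bd: "cmod (g y) \<le> D * l" if y: "y \<in> Q" for y
  proof (cases "y \<in> \<Union>P")
    case True
    then obtain R where R: "R \<in> P" "y \<in> R" by blast
    have "g y = avg f R" unfolding g_def sum_bad[OF pP(1) R] by simp
    moreover have "sum w R * cmod (avg f R) \<le> sum w R * (D * l)"
      using avg_bound[OF dP[OF R(1)], of f] hi[OF R(1)] by (simp add: mult_ac)
    ultimately show ?thesis using dyad_pos[OF dP[OF R(1)]] by (simp add: mult_le_cancel_left_pos)
  next
    case False
    then have "cmod (f y) \<le> l" using P y by (simp add: cz_def)
    also have "l \<le> D * l" using D1 l by simp
    finally show ?thesis using bad0[OF False] by (simp add: g_def)
  qed
  have bad_total: "(\<Sum>R\<in>P. \<Sum>y\<in>R. w y * cmod (bad f R y)) \<le> 2 * nrm1 f"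
  proof -
    have "(\<Sum>R\<in>P. \<Sum>y\<in>R. w y * cmod (bad f R y)) \<le> (\<Sum>R\<in>P. 2 * (\<Sum>y\<in>R. w y * cmod (f y)))"
      by (intro sum_mono bad_nrm1 dP)
    also have "\<dots> = 2 * (\<Sum>R\<in>P. \<Sum>y\<in>R. w y * cmod (f y))" by (simp only: sum_distrib_left)
    also have "\<dots> \<le> 2 * nrm1 f" unfolding N
      by (intro mult_left_mono sum_parts_le pP finQ dyad_finite dP) simp_all
    finally show ?thesis .
  qed
  have measP: "(\<Sum>R\<in>P. sum w R) \<le> nrm1 f / l"
  proof -
    have "l * (\<Sum>R\<in>P. sum w R) \<le> (\<Sum>R\<in>P. \<Sum>y\<in>R. w y * cmod (f y))"
      unfolding sum_distrib_left[of l] by (rule sum_mono) (use lo in \<open>simp add: sum_distrib_left[symmetric]\<close>)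
    also have "\<dots> \<le> nrm1 f" unfolding N
      by (intro sum_parts_le pP finQ dyad_finite dP) simp_all
    finally show ?thesis using l by (simp add: field_simps)
  qed
  \<comment> \<open>The triangle inequality through the bad parts costs the factor
    \<open>1 + 2\<close>.\<close>
  have g1: "(\<Sum>y\<in>Q. w y * cmod (g y)) \<le> 3 * nrm1 f"
  proof -
    have "(\<Sum>y\<in>Q. w y * cmod (g y)) \<le> (\<Sum>y\<in>Q. w y * cmod (f y) + (\<Sum>R\<in>P. w y * cmod (bad f R y)))"
    proof (rule sum_mono)
      fix y
      have "cmod (g y) \<le> cmod (f y) + cmod (\<Sum>R\<in>P. bad f R y)" unfolding g_def by (rule norm_triangle_ineq4)
      also have "\<dots> \<le> cmod (f y) + (\<Sum>R\<in>P. cmod (bad f R y))" by (intro add_left_mono norm_sum)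
      finally have "w y * cmod (g y) \<le> w y * (cmod (f y) + (\<Sum>R\<in>P. cmod (bad f R y)))" by (rule mult_left_mono) simp
      then show "w y * cmod (g y) \<le> w y * cmod (f y) + (\<Sum>R\<in>P. w y * cmod (bad f R y))"
        by (simp only: distrib_left sum_distrib_left)
    qed
    also have "\<dots> = nrm1 f + (\<Sum>R\<in>P. \<Sum>y\<in>Q. w y * cmod (bad f R y))"
      unfolding N sum.distrib by (subst sum.swap) (rule refl)
    also have "(\<Sum>R\<in>P. \<Sum>y\<in>Q. w y * cmod (bad f R y)) = (\<Sum>R\<in>P. \<Sum>y\<in>R. w y * cmod (bad f R y))"
    proof (rule sum.cong[OF refl], rule sum.mono_neutral_right[OF finQ])
      fix R assume R: "R \<in> P"
      then show "R \<subseteq> Q" using pP(2) by blast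
      show "\<forall>y\<in>Q - R. w y * cmod (bad f R y) = 0" by (simp add: bad_def)
    qed
    finally show ?thesis using bad_total by linarith
  qed
  have g2: "nrm2 g \<le> D * l * (3 * nrm1 f)"
  proof -
    have "nrm2 g = (\<Sum>y\<in>Q. w y * (cmod (g y))\<^sup>2)" by (rule nrm2_fs[OF finQ gQ])
    also have "\<dots> \<le> (\<Sum>y\<in>Q. (D * l) * (w y * cmod (g y)))"
    proof (rule sum_mono)
      fix y assume "y \<in> Q"
      from mult_right_mono[OF g_bd[OF this], of "w y * cmod (g y)"]
      show "w y * (cmod (g y))\<^sup>2 \<le> (D * l) * (w y * cmod (g y))" by (simp add: power2_eq_square mult_ac)
    qed
    also have "\<dots> = D * l * (\<Sum>y\<in>Q. w y * cmod (g y))" by (simp only: sum_distrib_left)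
    also have "\<dots> \<le> D * l * (3 * nrm1 f)" using g1 D1 l by (intro mult_left_mono) auto
    finally show ?thesis .
  qed
  have fsg: "fs g" unfolding fs_def using gQ finQ by (rule finite_subset)
  have "\<forall>R\<in>P. \<exists>R'. emeasure M R' \<le> ennreal (4 * sum w R) \<and>
    (\<integral>\<^sup>+x. ennreal (if x \<in> R' then 0 else cmod (Rz (bad f R) x)) \<partial>M) \<le> ennreal (72 * (\<Sum>y\<in>R. w y * cmod (bad f R y)))"
    by (intro ballI dyad_cancellation dP bad_support bad_mean)
  from bchoice[OF this] obtain E where E: "\<forall>R\<in>P. emeasure M (E R) \<le> ennreal (4 * sum w R) \<and>
    (\<integral>\<^sup>+x. ennreal (if x \<in> E R then 0 else cmod (Rz (bad f R) x)) \<partial>M) \<le> ennreal (72 * (\<Sum>y\<in>R. w y * cmod (bad f R y)))"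
    by (rule exE)
  have E1: "\<And>R. R \<in> P \<Longrightarrow> emeasure M (E R) \<le> ennreal (4 * sum w R)"
    and E2: "\<And>R. R \<in> P \<Longrightarrow> (\<integral>\<^sup>+x. ennreal (if x \<in> E R then 0 else cmod (Rz (bad f R) x)) \<partial>M)
      \<le> ennreal (72 * (\<Sum>y\<in>R. w y * cmod (bad f R y)))"
    using E by (simp_all only: Ball_def)
  \<comment> \<open>The exceptional set differs from piece to piece, so each bad part is cut off by
    its own set before summing.\<close>
  define u where "u x = (\<Sum>R\<in>P. if x \<in> E R then 0 else cmod (Rz (bad f R) x))" for x
  have Rsplit: "Rz f x = Rz g x + (\<Sum>R\<in>P. Rz (bad f R) x)" for x
  proof -
    have "Rz f x = (\<Sum>y\<in>Q. complex_of_real (w y * kR x y) * (g y + (\<Sum>R\<in>P. bad f R y)))"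
      unfolding Rz_fs[OF finQ Q(2)] by (simp add: g_def)
    also have "\<dots> = (\<Sum>y\<in>Q. complex_of_real (w y * kR x y) * g y)
        + (\<Sum>y\<in>Q. \<Sum>R\<in>P. complex_of_real (w y * kR x y) * bad f R y)"
      by (simp only: distrib_left sum.distrib sum_distrib_left)
    also have "(\<Sum>y\<in>Q. \<Sum>R\<in>P. complex_of_real (w y * kR x y) * bad f R y) = (\<Sum>R\<in>P. Rz (bad f R) x)"
      by (subst sum.swap) (intro sum.cong refl Rz_fs[symmetric] finQ badQ)
    finally show ?thesis unfolding Rz_fs[OF finQ gQ] .
  qed
  have "{x. t < cmod (Rz f x)} \<subseteq> {x. l < cmod (Rz g x)} \<union> ((\<Union>R\<in>P. E R) \<union> {x. l < u x})"
  proof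
    fix x assume x: "x \<in> {x. t < cmod (Rz f x)}"
    show "x \<in> {x. l < cmod (Rz g x)} \<union> ((\<Union>R\<in>P. E R) \<union> {x. l < u x})"
    proof (cases "x \<in> (\<Union>R\<in>P. E R)")
      case False
      then have "u x = (\<Sum>R\<in>P. cmod (Rz (bad f R) x))" unfolding u_def by (intro sum.cong refl) auto
      moreover have "cmod (Rz f x) \<le> cmod (Rz g x) + (\<Sum>R\<in>P. cmod (Rz (bad f R) x))"
        unfolding Rsplit by (rule order_trans[OF norm_triangle_ineq add_left_mono[OF norm_sum]])
      ultimately show ?thesis using x by (auto simp: l_def)
    qed simp
  qed
  then have "emeasure M {x. t < cmod (Rz f x)}
      \<le> emeasure M ({x. l < cmod (Rz g x)} \<union> ((\<Union>R\<in>P. E R) \<union> {x. l < u x}))"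
    by (rule emeasure_mono) simp
  also have "\<dots> \<le> emeasure M {x. l < cmod (Rz g x)} + (emeasure M (\<Union>R\<in>P. E R) + emeasure M {x. l < u x})"
    by (rule order_trans[OF emeasure_subadditive add_left_mono[OF emeasure_subadditive]]) simp_all
  \<comment> \<open>\<open>48 = 16 * 3\<close> is the squared L2 constant times the factor for the
    good part; \<open>144 = 72 * 2\<close> is the cancellation constant times the factor for the bad
    parts.\<close>
  also have "\<dots> \<le> ennreal (48 * D * nrm1 f / l) + (ennreal (4 * nrm1 f / l) + ennreal (144 * nrm1 f / l))"
  proof (intro add_mono)
    have "nrm2 (Rz g) \<le> 16 * nrm2 g"
      using power_mono[OF Rz_fs_L2(2)[OF fsg] nrm_nonneg, of 2] by (simp add: power_mult_distrib nrm_sq)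
    then have "nrm2 (Rz g) \<le> 48 * D * nrm1 f * l" using g2 by (simp add: mult_ac)
    then have "nrm2 (Rz g) / l\<^sup>2 \<le> 48 * D * nrm1 f / l" using l by (simp add: field_simps power2_eq_square)
    then show "emeasure M {x. l < cmod (Rz g x)} \<le> ennreal (48 * D * nrm1 f / l)"
      using chebyshev_L2[OF l Rz_fs_L2(1)[OF fsg]] by (meson ennreal_leI order_trans)
    have "emeasure M (\<Union>R\<in>P. E R) \<le> (\<Sum>R\<in>P. emeasure M (E R))"
      by (rule emeasure_subadditive_finite[OF finP]) simp
    also have "\<dots> \<le> (\<Sum>R\<in>P. ennreal (4 * sum w R))" by (intro sum_mono E1)
    also have "\<dots> = ennreal (\<Sum>R\<in>P. 4 * sum w R)" by (rule sum_ennreal) (simp add: sum_nonneg)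
    also have "\<dots> \<le> ennreal (4 * nrm1 f / l)"
      using measP by (intro ennreal_leI) (simp add: sum_distrib_left[symmetric])
    finally show "emeasure M (\<Union>R\<in>P. E R) \<le> ennreal (4 * nrm1 f / l)" .
    have "(\<integral>\<^sup>+x. ennreal (u x) \<partial>M) = (\<integral>\<^sup>+x. (\<Sum>R\<in>P. ennreal (if x \<in> E R then 0 else cmod (Rz (bad f R) x))) \<partial>M)"
      unfolding u_def by (intro nn_integral_cong sum_ennreal[symmetric]) simp
    also have "\<dots> = (\<Sum>R\<in>P. \<integral>\<^sup>+x. ennreal (if x \<in> E R then 0 else cmod (Rz (bad f R) x)) \<partial>M)"
      by (rule nn_integral_sum) simp
    also have "\<dots> \<le> (\<Sum>R\<in>P. ennreal (72 * (\<Sum>y\<in>R. w y * cmod (bad f R y))))" by (intro sum_mono E2)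
    also have "\<dots> = ennreal (\<Sum>R\<in>P. 72 * (\<Sum>y\<in>R. w y * cmod (bad f R y)))"
      by (rule sum_ennreal) (simp add: sum_nonneg)
    also have "\<dots> \<le> ennreal (144 * nrm1 f)"
      using bad_total by (intro ennreal_leI) (simp add: sum_distrib_left[symmetric])
    finally have "ennreal (1 / l) * (\<integral>\<^sup>+x. ennreal (u x) \<partial>M) \<le> ennreal (1 / l) * ennreal (144 * nrm1 f)"
      by (rule mult_left_mono) simp
    also have "\<dots> = ennreal (144 * nrm1 f / l)" using l by (subst ennreal_mult[symmetric]) auto
    finally show "emeasure M {x. l < u x} \<le> ennreal (144 * nrm1 f / l)"
      by (rule order_trans[OF chebyshev[OF l]])
  qed
  also have "\<dots> = ennreal (48 * D * nrm1 f / l + (4 * nrm1 f / l + 144 * nrm1 f / l))"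
    using D1 l by (subst ennreal_plus[symmetric] | simp)+
  also have "48 * D * nrm1 f / l + (4 * nrm1 f / l + 144 * nrm1 f / l) = Cw * nrm1 f / t"
    unfolding D_def l_def Cw_def by (simp add: algebra_simps add_divide_distrib)
  finally show ?thesis .
qed

end

lemma nn_integral_powr_from_0:
  assumes "a > -1" "c \<ge> (0::real)"
  shows "(\<integral>\<^sup>+t. ennreal (indicator {0..c} t * t powr a) \<partial>lborel) = ennreal (c powr (a + 1) / (a + 1))"
  by (rule nn_integral_has_integral_lebesgue[OF _ has_integral_powr_from_0[OF assms]]) simp

lemma nn_integral_powr_to_inf:
  assumes "e < -1" "c > (0::real)"
  shows "(\<integral>\<^sup>+t. ennreal (indicator {c..} t * t powr e) \<partial>lborel) = ennreal (- (c powr (e + 1)) / (e + 1))"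
  by (rule nn_integral_has_integral_lebesgue[OF _ has_integral_powr_to_inf[OF assms]]) simp

context flow_tree
begin

lemma sum_le_integral:
  fixes h :: "'v \<Rightarrow> real"
  assumes "finite S" "\<And>x. h x \<ge> 0" "integrable M h"
  shows "(\<Sum>x\<in>S. w x * h x) \<le> (\<integral>x. h x \<partial>M)"
proof -
  have "(\<Sum>x\<in>S. w x * h x) = (\<integral>x. (if x \<in> S then h x else 0) \<partial>M)"
    using assms(1) by (subst integral_finite_support[of S]) auto
  also have "\<dots> \<le> (\<integral>x. h x \<partial>M)"
    by (rule integral_mono[OF integrable_finite_support[OF assms(1)] assms(3)]) (auto simp: assms(2))
  finally show ?thesis .
qed

lemma sum_le_nn_integral:
  fixes h :: "'v \<Rightarrow> real"
  assumes "finite S" "\<And>x. h x \<ge> 0"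
  shows "ennreal (\<Sum>x\<in>S. w x * h x) \<le> (\<integral>\<^sup>+x. ennreal (h x) \<partial>M)"
proof -
  have int: "integrable M (\<lambda>x. if x \<in> S then h x else 0)"
    using assms(1) by (rule integrable_finite_support) simp
  have "(\<Sum>x\<in>S. w x * h x) = (\<integral>x. (if x \<in> S then h x else 0) \<partial>M)"
    using assms(1) by (subst integral_finite_support[of S]) auto
  then have "ennreal (\<Sum>x\<in>S. w x * h x) = (\<integral>\<^sup>+x. ennreal (if x \<in> S then h x else 0) \<partial>M)"
    using nn_integral_eq_integral[OF int] assms(2) by simp
  also have "\<dots> \<le> (\<integral>\<^sup>+x. ennreal (h x) \<partial>M)" by (intro nn_integral_mono ennreal_leI) (simp add: assms(2))
  finally show ?thesis .
qed

subsection \<open>Interpolation\<close>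

lemma Rz_add_fs:
  assumes "finite F" "{x. f x \<noteq> 0} \<subseteq> F" "{x. g x \<noteq> 0} \<subseteq> F"
  shows "Rz (\<lambda>y. f y + g y) x = Rz f x + Rz g x"
proof -
  have *: "{x. f x + g x \<noteq> 0} \<subseteq> F"
  proof
    fix x assume "x \<in> {x. f x + g x \<noteq> 0}"
    then have "f x \<noteq> 0 \<or> g x \<noteq> 0" by auto
    then show "x \<in> F" using assms(2,3) by blast
  qed
  show ?thesis
    unfolding Rz_fs[OF assms(1,2)] Rz_fs[OF assms(1,3)] Rz_fs[OF assms(1) *]
    by (simp only: distrib_left sum.distrib)
qed

text \<open>\<open>f\<close> is split at height \<open>t\<close> itself: the large part is measured
  by the weak type bound, the small part by the L2 bound. The closed indicators overlap only where
  \<open>cmod (f y) = t\<close>.\<close>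

lemma distribution_bound:
  assumes f: "finite F" "{x. f x \<noteq> 0} \<subseteq> F" and S: "finite S" and t: "t > 0"
  shows "sum w {x\<in>S. t \<le> cmod (Rz f x)} \<le>
    4 * Cw / t * (\<Sum>y\<in>F. w y * (cmod (f y) * indicator {0..cmod (f y)} t))
    + 256 / t\<^sup>2 * (\<Sum>y\<in>F. w y * ((cmod (f y))\<^sup>2 * indicator {cmod (f y)..} t))"
proof -
  let ?f1 = "\<lambda>y. if t \<le> cmod (f y) then f y else 0"
  let ?f2 = "\<lambda>y. if t \<le> cmod (f y) then 0 else f y"
  have s: "{x. ?f1 x \<noteq> 0} \<subseteq> F" "{x. ?f2 x \<noteq> 0} \<subseteq> F" using f(2) by auto
  then have fs12: "fs ?f1" "fs ?f2" using f(1) unfolding fs_def by (blast intro: finite_subset)+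
  have eq: "f = (\<lambda>y. ?f1 y + ?f2 y)" by auto
  \<comment> \<open>A quarter instead of a half, because the level set here is closed while the
    available estimates concern strict inequalities. It produces
    \<open>256 = 16 * 4\<^sup>2\<close>.\<close>
  have t4: "t / 4 > 0" using t by simp
  have Cw0: "Cw \<ge> 0" by (simp add: Cw_def)
  have "{x\<in>S. t \<le> cmod (Rz f x)} \<subseteq> {x. t / 4 < cmod (Rz ?f1 x)} \<union> {x. t / 4 < cmod (Rz ?f2 x)}"
  proof
    fix x assume "x \<in> {x\<in>S. t \<le> cmod (Rz f x)}"
    then have "t \<le> cmod (Rz ?f1 x + Rz ?f2 x)" using Rz_add_fs[OF f(1) s] eq by simp
    also have "\<dots> \<le> cmod (Rz ?f1 x) + cmod (Rz ?f2 x)" by (rule norm_triangle_ineq)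
    finally have "t \<le> cmod (Rz ?f1 x) + cmod (Rz ?f2 x)" .
    then have "t / 4 < cmod (Rz ?f1 x) \<or> t / 4 < cmod (Rz ?f2 x)" using t by linarith
    then show "x \<in> {x. t / 4 < cmod (Rz ?f1 x)} \<union> {x. t / 4 < cmod (Rz ?f2 x)}" by blast
  qed
  then have "emeasure M {x\<in>S. t \<le> cmod (Rz f x)} \<le> emeasure M ({x. t / 4 < cmod (Rz ?f1 x)} \<union> {x. t / 4 < cmod (Rz ?f2 x)})"
    by (rule emeasure_mono) simp
  also have "\<dots> \<le> emeasure M {x. t / 4 < cmod (Rz ?f1 x)} + emeasure M {x. t / 4 < cmod (Rz ?f2 x)}"
    by (rule emeasure_subadditive) simp_all
  also have "\<dots> \<le> ennreal (Cw * nrm1 ?f1 / (t / 4)) + ennreal (16 * nrm2 ?f2 / (t / 4)\<^sup>2)"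
  proof (rule add_mono[OF Rz_fs_weak[OF fs12(1) t4]])
    have "nrm2 (Rz ?f2) \<le> 16 * nrm2 ?f2"
      using power_mono[OF Rz_fs_L2(2)[OF fs12(2)] nrm_nonneg, of 2] by (simp only: power_mult_distrib nrm_sq) simp
    then have "nrm2 (Rz ?f2) / (t / 4)\<^sup>2 \<le> 16 * nrm2 ?f2 / (t / 4)\<^sup>2" by (rule divide_right_mono) simp
    then show "emeasure M {x. t / 4 < cmod (Rz ?f2 x)} \<le> ennreal (16 * nrm2 ?f2 / (t / 4)\<^sup>2)"
      by (rule order_trans[OF chebyshev_L2[OF t4 Rz_fs_L2(1)[OF fs12(2)]] ennreal_leI])
  qed
  also have "\<dots> = ennreal (4 * Cw / t * nrm1 ?f1 + 256 / t\<^sup>2 * nrm2 ?f2)"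
    using t Cw0 by (subst ennreal_plus[symmetric]) (auto simp: power2_eq_square)
  finally have e: "emeasure M {x\<in>S. t \<le> cmod (Rz f x)} \<le> ennreal (4 * Cw / t * nrm1 ?f1 + 256 / t\<^sup>2 * nrm2 ?f2)" .
  have "finite {x\<in>S. t \<le> cmod (Rz f x)}" using S by simp
  moreover have "0 \<le> 4 * Cw / t * nrm1 ?f1 + 256 / t\<^sup>2 * nrm2 ?f2" using t Cw0 by simp
  ultimately have "sum w {x\<in>S. t \<le> cmod (Rz f x)} \<le> 4 * Cw / t * nrm1 ?f1 + 256 / t\<^sup>2 * nrm2 ?f2"
    using e by (simp only: emeasure_M_finite ennreal_le_iff)
  also have "\<dots> \<le> 4 * Cw / t * (\<Sum>y\<in>F. w y * (cmod (f y) * indicator {0..cmod (f y)} t))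
    + 256 / t\<^sup>2 * (\<Sum>y\<in>F. w y * ((cmod (f y))\<^sup>2 * indicator {cmod (f y)..} t))"
    unfolding nrm1_fs[OF f(1) s(1)] nrm2_fs[OF f(1) s(2)]
  proof (intro add_mono mult_left_mono sum_mono)
    fix y
    show "cmod (?f1 y) \<le> cmod (f y) * indicator {0..cmod (f y)} t" using t by simp
    show "(cmod (?f2 y))\<^sup>2 \<le> (cmod (f y))\<^sup>2 * indicator {cmod (f y)..} t" using t by simp
  qed (use t Cw0 in simp_all)
  finally show ?thesis .
qed

text \<open>Marcinkiewicz interpolation by the layer-cake formula. The large parts lead to the
  integral of \<open>t powr (s - 2)\<close> from 0 to \<open>cmod (f y)\<close>, finite for
  \<open>s > 1\<close>, the small parts to that of \<open>t powr (s - 3)\<close> from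
  \<open>cmod (f y)\<close> to infinity, finite for \<open>s < 2\<close>.\<close>

lemma Rz_fs_Lp:
  assumes s: "1 < s" "s < 2" and f: "fs f" and S: "finite S"
  shows "(\<Sum>x\<in>S. w x * cmod (Rz f x) powr s)
    \<le> (4 * Cw * s / (s - 1) + 256 * s / (2 - s)) * (\<integral>x. cmod (f x) powr s \<partial>M)"
proof -
  define F where "F = {x. f x \<noteq> 0}"
  have F: "finite F" "{x. f x \<noteq> 0} \<subseteq> F" using f by (auto simp: fs_def F_def)
  have c: "cmod (f y) > 0" if "y \<in> F" for y using that by (simp add: F_def)
  have Cw0: "Cw \<ge> 0" by (simp add: Cw_def)
  let ?I = "\<lambda>x t. indicator {0..cmod (Rz f x)} t * t powr (s - 1) :: real"
  let ?A = "\<lambda>y t. indicator {0..cmod (f y)} t * t powr (s - 2) :: real"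
  let ?B = "\<lambda>y t. indicator {cmod (f y)..} t * t powr (s - 3) :: real"
  let ?a = "\<lambda>y. 4 * Cw * s * (w y * cmod (f y))"
  let ?b = "\<lambda>y. 256 * s * (w y * (cmod (f y))\<^sup>2)"
  have layer: "ennreal (cmod (Rz f x) powr s) = ennreal s * (\<integral>\<^sup>+t. ennreal (?I x t) \<partial>lborel)" for x
  proof -
    have "(\<integral>\<^sup>+t. ennreal (?I x t) \<partial>lborel) = ennreal (cmod (Rz f x) powr s / s)"
      using nn_integral_powr_from_0[of "s - 1" "cmod (Rz f x)"] s by simp
    then show ?thesis using s by (simp add: ennreal_mult[symmetric])
  qed
  have pointwise: "(\<Sum>x\<in>S. w x * s * ?I x t) \<le> (\<Sum>y\<in>F. ?a y * ?A y t + ?b y * ?B y t)" for t :: real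
  proof (cases "t > 0")
    case False
    then have z: "?I x t = 0" for x by (cases "t = 0") simp_all
    have "(\<Sum>x\<in>S. w x * s * ?I x t) = 0" unfolding z by simp
    also have "0 \<le> (\<Sum>y\<in>F. ?a y * ?A y t + ?b y * ?B y t)"
      using s Cw0 by (intro sum_nonneg add_nonneg_nonneg mult_nonneg_nonneg) auto
    finally show ?thesis .
  next
    case t: True
    have "(\<Sum>x\<in>S. w x * s * ?I x t) = (\<Sum>x\<in>S. (s * t powr (s - 1)) * (if t \<le> cmod (Rz f x) then w x else 0))"
      using t by (intro sum.cong refl) simp
    also have "\<dots> = (s * t powr (s - 1)) * sum w {x\<in>S. t \<le> cmod (Rz f x)}"
      unfolding sum_distrib_left[symmetric] using S by (simp add: sum.inter_filter[symmetric])
    also have "\<dots> \<le> (s * t powr (s - 1)) * (4 * Cw / t * (\<Sum>y\<in>F. w y * (cmod (f y) * indicator {0..cmod (f y)} t))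
        + 256 / t\<^sup>2 * (\<Sum>y\<in>F. w y * ((cmod (f y))\<^sup>2 * indicator {cmod (f y)..} t)))"
      using s by (intro mult_left_mono distribution_bound F S t) simp
    also have "\<dots> = (4 * Cw * s) * (t powr (s - 1) / t) * (\<Sum>y\<in>F. w y * (cmod (f y) * indicator {0..cmod (f y)} t))
        + (256 * s) * (t powr (s - 1) / t\<^sup>2) * (\<Sum>y\<in>F. w y * ((cmod (f y))\<^sup>2 * indicator {cmod (f y)..} t))"
      by (simp add: algebra_simps)
    also have "t powr (s - 1) / t = t powr (s - 2)" using t powr_diff[of t "s - 1" 1] by simp
    also have "t powr (s - 1) / t\<^sup>2 = t powr (s - 3)" using t powr_diff[of t "s - 1" 2] by simp
    also have "(4 * Cw * s) * t powr (s - 2) * (\<Sum>y\<in>F. w y * (cmod (f y) * indicator {0..cmod (f y)} t))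
        + (256 * s) * t powr (s - 3) * (\<Sum>y\<in>F. w y * ((cmod (f y))\<^sup>2 * indicator {cmod (f y)..} t))
        = (\<Sum>y\<in>F. ?a y * ?A y t + ?b y * ?B y t)"
      unfolding sum_distrib_left sum.distrib[symmetric] by (intro sum.cong refl) (simp only: mult_ac)
    finally show ?thesis .
  qed
  have "ennreal (\<Sum>x\<in>S. w x * cmod (Rz f x) powr s) = (\<Sum>x\<in>S. ennreal (w x * s) * (\<integral>\<^sup>+t. ennreal (?I x t) \<partial>lborel))"
  proof (subst sum_ennreal[symmetric])
    show "0 \<le> w x * cmod (Rz f x) powr s" for x by simp
    show "(\<Sum>x\<in>S. ennreal (w x * cmod (Rz f x) powr s)) = (\<Sum>x\<in>S. ennreal (w x * s) * (\<integral>\<^sup>+t. ennreal (?I x t) \<partial>lborel))"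
    proof (intro sum.cong refl)
      fix x
      show "ennreal (w x * cmod (Rz f x) powr s) = ennreal (w x * s) * (\<integral>\<^sup>+t. ennreal (?I x t) \<partial>lborel)"
        using s by (simp add: ennreal_mult layer mult.assoc)
    qed
  qed
  also have "\<dots> = (\<integral>\<^sup>+t. (\<Sum>x\<in>S. ennreal (w x * s) * ennreal (?I x t)) \<partial>lborel)"
    by (subst nn_integral_sum) (simp_all add: nn_integral_cmult)
  also have "\<dots> = (\<integral>\<^sup>+t. ennreal (\<Sum>x\<in>S. w x * s * ?I x t) \<partial>lborel)"
    using s by (intro nn_integral_cong) (simp add: ennreal_mult[symmetric] sum_ennreal)
  also have "\<dots> \<le> (\<integral>\<^sup>+t. ennreal (\<Sum>y\<in>F. ?a y * ?A y t + ?b y * ?B y t) \<partial>lborel)"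
    by (intro nn_integral_mono ennreal_leI pointwise)
  also have "\<dots> = (\<integral>\<^sup>+t. (\<Sum>y\<in>F. ennreal (?a y) * ennreal (?A y t) + ennreal (?b y) * ennreal (?B y t)) \<partial>lborel)"
  proof (rule nn_integral_cong, subst sum_ennreal[symmetric])
    fix t :: real
    show "0 \<le> ?a y * ?A y t + ?b y * ?B y t" for y
      using s Cw0 by (intro add_nonneg_nonneg mult_nonneg_nonneg) auto
    show "(\<Sum>y\<in>F. ennreal (?a y * ?A y t + ?b y * ?B y t)) = (\<Sum>y\<in>F. ennreal (?a y) * ennreal (?A y t) + ennreal (?b y) * ennreal (?B y t))"
    proof (intro sum.cong refl)
      fix y
      have "ennreal (?a y * ?A y t + ?b y * ?B y t) = ennreal (?a y * ?A y t) + ennreal (?b y * ?B y t)"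
        using s Cw0 by (intro ennreal_plus mult_nonneg_nonneg) auto
      also have "ennreal (?a y * ?A y t) = ennreal (?a y) * ennreal (?A y t)"
        using s Cw0 by (intro ennreal_mult mult_nonneg_nonneg) auto
      also have "ennreal (?b y * ?B y t) = ennreal (?b y) * ennreal (?B y t)"
        using s by (intro ennreal_mult mult_nonneg_nonneg) auto
      finally show "ennreal (?a y * ?A y t + ?b y * ?B y t) = ennreal (?a y) * ennreal (?A y t) + ennreal (?b y) * ennreal (?B y t)" .
    qed
  qed
  also have "\<dots> = (\<Sum>y\<in>F. ennreal (?a y) * (\<integral>\<^sup>+t. ennreal (?A y t) \<partial>lborel) + ennreal (?b y) * (\<integral>\<^sup>+t. ennreal (?B y t) \<partial>lborel))"
    by (subst nn_integral_sum) (simp_all add: nn_integral_cmult nn_integral_add)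
  also have "\<dots> = (\<Sum>y\<in>F. ennreal ((4 * Cw * s / (s - 1) + 256 * s / (2 - s)) * (w y * cmod (f y) powr s)))"
  proof (intro sum.cong refl)
    fix y assume "y \<in> F"
    note cy = c[OF this]
    have A: "(\<integral>\<^sup>+t. ennreal (?A y t) \<partial>lborel) = ennreal (cmod (f y) powr (s - 1) / (s - 1))"
      using nn_integral_powr_from_0[of "s - 2" "cmod (f y)"] s by simp
    have "- (cmod (f y) powr (s - 3 + 1)) / (s - 3 + 1) = cmod (f y) powr (s - 2) / (2 - s)"
      using s by (simp add: field_simps)
    then have B: "(\<integral>\<^sup>+t. ennreal (?B y t) \<partial>lborel) = ennreal (cmod (f y) powr (s - 2) / (2 - s))"
      using nn_integral_powr_to_inf[of "s - 3" "cmod (f y)"] s cy by simp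
    have c1: "cmod (f y) * cmod (f y) powr (s - 1) = cmod (f y) powr s"
      using powr_add[of "cmod (f y)" 1 "s - 1"] cy by simp
    have c2: "(cmod (f y))\<^sup>2 * cmod (f y) powr (s - 2) = cmod (f y) powr s"
      using powr_add[of "cmod (f y)" 2 "s - 2"] cy by simp
    have "ennreal (?a y) * (\<integral>\<^sup>+t. ennreal (?A y t) \<partial>lborel) + ennreal (?b y) * (\<integral>\<^sup>+t. ennreal (?B y t) \<partial>lborel)
        = ennreal (?a y * (cmod (f y) powr (s - 1) / (s - 1)) + ?b y * (cmod (f y) powr (s - 2) / (2 - s)))"
      unfolding A B using s Cw0 by (simp add: ennreal_mult[symmetric] ennreal_plus[symmetric] del: ennreal_plus)
    also have "?a y * (cmod (f y) powr (s - 1) / (s - 1)) + ?b y * (cmod (f y) powr (s - 2) / (2 - s))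
        = 4 * Cw * s / (s - 1) * (w y * (cmod (f y) * cmod (f y) powr (s - 1)))
          + 256 * s / (2 - s) * (w y * ((cmod (f y))\<^sup>2 * cmod (f y) powr (s - 2)))"
      by (simp add: mult_ac)
    also have "\<dots> = (4 * Cw * s / (s - 1) + 256 * s / (2 - s)) * (w y * cmod (f y) powr s)"
      unfolding c1 c2 by (simp only: distrib_right)
    finally show "ennreal (?a y) * (\<integral>\<^sup>+t. ennreal (?A y t) \<partial>lborel) + ennreal (?b y) * (\<integral>\<^sup>+t. ennreal (?B y t) \<partial>lborel)
        = ennreal ((4 * Cw * s / (s - 1) + 256 * s / (2 - s)) * (w y * cmod (f y) powr s))" .
  qed
  also have "\<dots> = ennreal (\<Sum>y\<in>F. (4 * Cw * s / (s - 1) + 256 * s / (2 - s)) * (w y * cmod (f y) powr s))"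
    using s Cw0 by (intro sum_ennreal mult_nonneg_nonneg add_nonneg_nonneg divide_nonneg_nonneg) auto
  also have "(\<Sum>y\<in>F. (4 * Cw * s / (s - 1) + 256 * s / (2 - s)) * (w y * cmod (f y) powr s))
      = (4 * Cw * s / (s - 1) + 256 * s / (2 - s)) * (\<Sum>y\<in>F. w y * cmod (f y) powr s)"
    by (rule sum_distrib_left[symmetric])
  also have "(\<Sum>y\<in>F. w y * cmod (f y) powr s) = (\<integral>x. cmod (f x) powr s \<partial>M)"
    using F by (subst integral_finite_support[of F]) auto
  finally show ?thesis
    using s Cw0 by (subst (asm) ennreal_le_iff) (auto intro!: mult_nonneg_nonneg add_nonneg_nonneg divide_nonneg_nonneg)
qed

text \<open>The endpoint \<open>s = 2\<close> is the L2 bound itself; the interpolation constant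
  blows up there.\<close>

lemma Rz_fs_strong:
  assumes s: "1 < s" "s \<le> 2"
  shows "\<exists>C\<ge>0. \<forall>f S. fs f \<longrightarrow> finite S \<longrightarrow> (\<Sum>x\<in>S. w x * cmod (Rz f x) powr s) \<le> C * (\<integral>x. cmod (f x) powr s \<partial>M)"
proof (cases "s = 2")
  case True
  have "(\<Sum>x\<in>S. w x * cmod (Rz f x) powr 2) \<le> 16 * (\<integral>x. cmod (f x) powr 2 \<partial>M)" if f: "fs f" and S: "finite S" for f S
  proof -
    have "(\<Sum>x\<in>S. w x * (cmod (Rz f x))\<^sup>2) \<le> nrm2 (Rz f)"
      unfolding nrm2_def using Rz_fs_L2(1)[OF f] by (intro sum_le_integral S) (simp_all add: in_L2_iff)
    also have "\<dots> \<le> 16 * nrm2 f"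
      using power_mono[OF Rz_fs_L2(2)[OF f] nrm_nonneg, of 2] by (simp add: power_mult_distrib nrm_sq)
    finally show ?thesis by (simp add: nrm2_def)
  qed
  then show ?thesis unfolding True by (intro exI[of _ 16]) auto
next
  case False
  let ?C = "4 * Cw * s / (s - 1) + 256 * s / (2 - s)"
  have "?C \<ge> 0" using s by (intro add_nonneg_nonneg divide_nonneg_nonneg) (auto simp: Cw_def)
  moreover have "(\<Sum>x\<in>S. w x * cmod (Rz f x) powr s) \<le> ?C * (\<integral>x. cmod (f x) powr s \<partial>M)" if "fs f" "finite S" for f S
    using Rz_fs_Lp[OF s(1) _ that] s False by simp
  ultimately show ?thesis by blast
qed

subsection \<open>Atoms\<close>

text \<open>On the enlarged trapezoid, of weight \<open>4 * W\<close>, Cauchy-Schwarz in the form of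
  an inequality of means gives \<open>4 * W / (2 * W) + (W / 2) * (16 / W) = 10\<close>; off it the
  cancellation estimate gives 72.\<close>

lemma Rz_atom:
  assumes h: "1 \<le> h" and supp: "{x. f x \<noteq> 0} \<subseteq> trap z h (2 * h)"
    and size: "\<And>x. cmod (f x) \<le> 1 / sum w (trap z h (2 * h))"
    and mean: "(\<Sum>y\<in>trap z h (2 * h). complex_of_real (w y) * f y) = 0" and S: "finite S"
  shows "(\<Sum>x\<in>S. w x * cmod (Rz f x)) \<le> 82"
proof -
  let ?Q = "trap z h (2 * h)" and ?B = "trap z 0 (2 * (2 * h))"
  define W where "W = sum w ?Q"
  have W: "W = real h * w z" using h by (simp add: W_def sum_w_trap)
  then have W0: "W > 0" using h by simp
  have fsf: "fs f" unfolding fs_def using supp finite_trap by (rule finite_subset)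
  have "nrm2 f = (\<Sum>y\<in>?Q. w y * (cmod (f y))\<^sup>2)" by (rule nrm2_fs[OF finite_trap supp])
  also have "\<dots> \<le> (\<Sum>y\<in>?Q. w y * (1 / W)\<^sup>2)"
    using size unfolding W_def[symmetric] by (intro sum_mono mult_left_mono power_mono) auto
  also have "\<dots> = W * (1 / W)\<^sup>2" by (simp only: sum_distrib_right W_def)
  also have "\<dots> = 1 / W" using W0 by (simp add: power2_eq_square)
  finally have f2: "nrm2 f \<le> 1 / W" .
  have R2: "nrm2 (Rz f) \<le> 16 / W"
    using power_mono[OF Rz_fs_L2(2)[OF fsf] nrm_nonneg, of 2] f2 by (simp add: power_mult_distrib nrm_sq)
  have near: "(\<Sum>x\<in>?B. w x * cmod (Rz f x)) \<le> 10"
  proof -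
    have "(\<Sum>x\<in>?B. w x * cmod (Rz f x)) \<le> (\<Sum>x\<in>?B. w x * (1 / (2 * W)) + (W / 2) * (w x * (cmod (Rz f x))\<^sup>2))"
    proof (rule sum_mono)
      fix x
      have "0 \<le> (1 - W * cmod (Rz f x))\<^sup>2 / (2 * W)" using W0 by simp
      also have "\<dots> = 1 / (2 * W) + (W / 2) * (cmod (Rz f x))\<^sup>2 - cmod (Rz f x)"
        using W0 by (simp add: power2_eq_square field_simps)
      finally have "w x * cmod (Rz f x) \<le> w x * (1 / (2 * W) + (W / 2) * (cmod (Rz f x))\<^sup>2)"
        by (intro mult_left_mono) auto
      then show "w x * cmod (Rz f x) \<le> w x * (1 / (2 * W)) + (W / 2) * (w x * (cmod (Rz f x))\<^sup>2)"
        by (simp only: distrib_left mult_ac)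
    qed
    also have "\<dots> = sum w ?B * (1 / (2 * W)) + (W / 2) * (\<Sum>x\<in>?B. w x * (cmod (Rz f x))\<^sup>2)"
      by (simp only: sum.distrib sum_distrib_left sum_distrib_right)
    also have "(\<Sum>x\<in>?B. w x * (cmod (Rz f x))\<^sup>2) \<le> nrm2 (Rz f)"
      unfolding nrm2_def using Rz_fs_L2(1)[OF fsf] by (intro sum_le_integral finite_trap) (simp_all add: in_L2_iff)
    also note R2
    also have "sum w ?B = 4 * W" unfolding W by (simp add: sum_w_trap)
    finally show ?thesis using W0 by simp
  qed
  have far: "(\<Sum>x\<in>S. w x * (if x \<in> ?B then 0 else cmod (Rz f x))) \<le> 72"
  proof -
    have "ennreal (\<Sum>x\<in>S. w x * (if x \<in> ?B then 0 else cmod (Rz f x)))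
        \<le> (\<integral>\<^sup>+x. ennreal (if x \<in> ?B then 0 else cmod (Rz f x)) \<partial>M)"
      by (rule sum_le_nn_integral[OF S]) simp
    also have "\<dots> \<le> ennreal (72 * (\<Sum>y\<in>?Q. w y * cmod (f y)))"
      by (rule Rz_cancellation[OF h _ supp mean]) simp
    finally have "(\<Sum>x\<in>S. w x * (if x \<in> ?B then 0 else cmod (Rz f x))) \<le> 72 * (\<Sum>y\<in>?Q. w y * cmod (f y))"
      by (simp add: ennreal_le_iff sum_nonneg)
    also have "(\<Sum>y\<in>?Q. w y * cmod (f y)) \<le> (\<Sum>y\<in>?Q. w y * (1 / W))"
      using size unfolding W_def[symmetric] by (intro sum_mono mult_left_mono) auto
    also have "\<dots> = W * (1 / W)" by (simp only: sum_distrib_right W_def)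
    finally show ?thesis using W0 by simp
  qed
  have split: "(\<Sum>x\<in>S. w x * cmod (Rz f x)) = (\<Sum>x\<in>S. w x * (if x \<in> ?B then 0 else cmod (Rz f x)))
      + (\<Sum>x\<in>S. w x * (if x \<in> ?B then cmod (Rz f x) else 0))"
    unfolding sum.distrib[symmetric] by (intro sum.cong refl) simp
  have "(\<Sum>x\<in>S. w x * (if x \<in> ?B then cmod (Rz f x) else 0)) = (\<Sum>x\<in>S \<inter> ?B. w x * cmod (Rz f x))"
    using S by (intro sum.mono_neutral_cong_right) auto
  also have "\<dots> \<le> (\<Sum>x\<in>?B. w x * cmod (Rz f x))"
    by (rule sum_mono2) (simp_all add: finite_trap)
  finally show ?thesis using near far unfolding split by linarith
qed

end

lemma norm_diff_powr_le:
  assumes "s \<ge> 0"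
  shows "cmod (u - v) powr s \<le> 2 powr s * (cmod u powr s + cmod v powr s)"
proof -
  let ?m = "max (cmod u) (cmod v)"
  have "cmod (u - v) \<le> 2 * ?m" using norm_triangle_ineq4[of u v] by simp
  then have "cmod (u - v) powr s \<le> (2 * ?m) powr s" using assms by (intro powr_mono2) auto
  also have "\<dots> = 2 powr s * ?m powr s" by (simp add: powr_mult)
  also have "\<dots> \<le> 2 powr s * (cmod u powr s + cmod v powr s)"
    by (intro mult_left_mono) (auto simp: max_def)
  finally show ?thesis .
qed

context flow_tree
begin

subsection \<open>Extension to Lebesgue spaces\<close>

lemma in_Lp_iff: "f \<in> Lp M s \<longleftrightarrow> integrable M (\<lambda>x. cmod (f x) powr s)"
  by (simp add: Lp_def)

definition ipow :: "real \<Rightarrow> ('v \<Rightarrow> complex) \<Rightarrow> real" where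
  "ipow s f = (\<integral>x. cmod (f x) powr s \<partial>M)"

lemma ipow_nonneg [simp]: "ipow s f \<ge> 0"
  by (simp add: ipow_def)

lemma Lp_norm_ipow: "Lp_norm M s f = ipow s f powr (1 / s)"
  by (simp add: Lp_norm_def ipow_def)

lemma Lp_norm_1: "Lp_norm M 1 f = nrm1 f"
  by (simp add: Lp_norm_def nrm1_def)

lemma fs_Lp: "fs f \<Longrightarrow> s > 0 \<Longrightarrow> f \<in> Lp M s"
  unfolding in_Lp_iff by (rule integrable_finite_support[of "{x. f x \<noteq> 0}"]) (auto simp: fs_def)

lemma Lp_diff:
  assumes "s \<ge> 0" "f \<in> Lp M s" "g \<in> Lp M s"
  shows "(\<lambda>x. f x - g x) \<in> Lp M s"
  unfolding in_Lp_iff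
proof (rule Bochner_Integration.integrable_bound)
  show "integrable M (\<lambda>x. 2 powr s * (cmod (f x) powr s + cmod (g x) powr s))"
    using assms by (intro integrable_mult_right Bochner_Integration.integrable_add) (simp_all add: in_Lp_iff)
  show "AE x in M. norm (cmod (f x - g x) powr s) \<le> norm (2 powr s * (cmod (f x) powr s + cmod (g x) powr s))"
    using norm_diff_powr_le[OF assms(1)] by simp
qed simp

text \<open>Where \<open>cmod (f y) \<le> 1\<close>, the square of \<open>cmod (f y)\<close> is
  dominated by its power \<open>s\<close>, and the rows of the kernel are in L2; elsewhere
  \<open>cmod (f y)\<close> itself is dominated by this power, and the rows are bounded by
  \<open>8 / w x\<close>.\<close>

lemma kR_integrable:
  assumes s: "1 \<le> s" "s \<le> 2" and f: "f \<in> Lp M s"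
  shows "integrable M (\<lambda>y. complex_of_real (kR x y) * f y)"
proof (rule Bochner_Integration.integrable_bound)
  show "integrable M (\<lambda>y. (kR x y)\<^sup>2 + (1 + 8 / w x) * cmod (f y) powr s)"
    using kR_L2[of x] f
    by (intro Bochner_Integration.integrable_add integrable_mult_right) (simp_all add: in_L2_iff in_Lp_iff)
  have bound: "\<bar>kR x y\<bar> * cmod (f y) \<le> (kR x y)\<^sup>2 + (1 + 8 / w x) * cmod (f y) powr s" for y
  proof (cases "cmod (f y) \<le> 1")
    case True
    have "\<bar>kR x y\<bar> * cmod (f y) \<le> (kR x y)\<^sup>2 + (cmod (f y))\<^sup>2"
    proof -
      have "0 \<le> \<bar>kR x y\<bar> * cmod (f y)" by simp
      then show ?thesis
        using sum_squares_bound[of "\<bar>kR x y\<bar>" "cmod (f y)"] unfolding power2_abs mult.assoc by linarith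
    qed
    also have "(cmod (f y))\<^sup>2 \<le> cmod (f y) powr s"
      using powr_mono'[of s 2 "cmod (f y)"] s True by simp
    also have "\<dots> \<le> (1 + 8 / w x) * cmod (f y) powr s" by (simp add: distrib_right)
    finally show ?thesis by simp
  next
    case False
    then have "cmod (f y) \<le> cmod (f y) powr s" using powr_mono[of 1 s "cmod (f y)"] s by simp
    then have "\<bar>kR x y\<bar> * cmod (f y) \<le> (8 / w x) * cmod (f y) powr s"
      by (intro mult_mono kR_bound) auto
    also have "\<dots> \<le> (kR x y)\<^sup>2 + (1 + 8 / w x) * cmod (f y) powr s" by (simp add: distrib_right)
    finally show ?thesis .
  qed
  have "norm (complex_of_real (kR x y) * f y) \<le> norm ((kR x y)\<^sup>2 + (1 + 8 / w x) * cmod (f y) powr s)" for y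
    using bound[of y] unfolding norm_mult norm_of_real real_norm_def by linarith
  then show "AE y in M. norm (complex_of_real (kR x y) * f y) \<le> norm ((kR x y)\<^sup>2 + (1 + 8 / w x) * cmod (f y) powr s)"
    by simp
qed simp

lemma Rz_diff:
  assumes "1 \<le> s" "s \<le> 2" "f \<in> Lp M s" "g \<in> Lp M s"
  shows "Rz (\<lambda>y. f y - g y) x = Rz f x - Rz g x"
  unfolding Rz_def right_diff_distrib
  by (rule Bochner_Integration.integral_diff[OF kR_integrable[OF assms(1,2,3)] kR_integrable[OF assms(1,2,4)]])

lemma Rz_trunc_tendsto:
  assumes "1 \<le> s" "s \<le> 2" "f \<in> Lp M s"
  shows "(\<lambda>n. Rz (trunc n f) x) \<longlonglongrightarrow> Rz f x"
  unfolding Rz_def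
proof (rule integral_dominated_convergence[where w = "\<lambda>y. norm (complex_of_real (kR x y) * f y)"])
  show "integrable M (\<lambda>y. norm (complex_of_real (kR x y) * f y))"
    by (rule integrable_norm[OF kR_integrable[OF assms]])
  show "AE y in M. (\<lambda>n. complex_of_real (kR x y) * trunc n f y) \<longlonglongrightarrow> complex_of_real (kR x y) * f y"
    unfolding AE_M by (intro allI tendsto_mult tendsto_const tendsto_eventually trunc_eventually)
  show "AE y in M. norm (complex_of_real (kR x y) * trunc n f y) \<le> norm (complex_of_real (kR x y) * f y)" for n
    by (simp add: trunc_def norm_mult)
qed simp_all

lemma ipow_trunc_le: "f \<in> Lp M s \<Longrightarrow> s > 0 \<Longrightarrow> ipow s (trunc n f) \<le> ipow s f"
  unfolding ipow_def
  by (rule integral_mono) (use fs_Lp[OF fs_trunc] in \<open>simp_all add: in_Lp_iff trunc_def\<close>)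

lemma converges_trunc:
  assumes f: "f \<in> Lp M s" and s: "s \<ge> 1"
  shows "converges_Lp M s (\<lambda>n. trunc n f) f"
  unfolding converges_Lp_def
proof (intro conjI allI)
  have s0: "s > 0" using s by simp
  show "(\<lambda>x. trunc n f x - f x) \<in> Lp M s" for n
    using s by (intro Lp_diff f fs_Lp) simp_all
  have "(\<lambda>n. ipow s (\<lambda>x. trunc n f x - f x)) \<longlonglongrightarrow> (\<integral>x. 0 \<partial>M)"
    unfolding ipow_def
  proof (rule integral_dominated_convergence[where w = "\<lambda>x. cmod (f x) powr s"])
    show "AE x in M. (\<lambda>n. cmod (trunc n f x - f x) powr s) \<longlonglongrightarrow> 0"
    proof (unfold AE_M, intro allI tendsto_eventually)
      fix x
      show "\<forall>\<^sub>F n in sequentially. cmod (trunc n f x - f x) powr s = 0"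
        using trunc_eventually[of f x] by (rule eventually_mono) simp
    qed
    show "AE x in M. norm (cmod (trunc n f x - f x) powr s) \<le> cmod (f x) powr s" for n
      by (simp add: trunc_def)
  qed (use f in \<open>simp_all add: in_Lp_iff\<close>)
  then have "(\<lambda>n. ipow s (\<lambda>x. trunc n f x - f x) powr (1 / s)) \<longlonglongrightarrow> 0 powr (1 / s)"
    using s0 by (intro tendsto_powr2) simp_all
  then show "(\<lambda>n. Lp_norm M s (\<lambda>x. trunc n f x - f x)) \<longlonglongrightarrow> 0"
    by (simp add: Lp_norm_ipow)
qed

lemma norm_le_Lp_norm:
  assumes "f \<in> Lp M s" "s > 0"
  shows "cmod (f x) \<le> Lp_norm M s f * (1 / w x) powr (1 / s)"
proof -
  have "w x * cmod (f x) powr s \<le> ipow s f"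
    using sum_le_integral[of "{x}" "\<lambda>x. cmod (f x) powr s"] assms by (simp add: in_Lp_iff ipow_def)
  then have "cmod (f x) powr s \<le> ipow s f * (1 / w x)" by (simp add: field_simps)
  then have "(cmod (f x) powr s) powr (1 / s) \<le> (ipow s f * (1 / w x)) powr (1 / s)"
    using assms(2) by (intro powr_mono2) auto
  also have "(cmod (f x) powr s) powr (1 / s) = cmod (f x)" using assms(2) by (simp add: powr_powr)
  also have "(ipow s f * (1 / w x)) powr (1 / s) = Lp_norm M s f * (1 / w x) powr (1 / s)"
    unfolding Lp_norm_ipow by (rule powr_mult)
  finally show ?thesis .
qed

text \<open>Points have positive mass, so evaluation at a point is continuous on every
  \<open>Lp\<close> space; this is how limits are identified.\<close>

lemma converges_Lp_pointwise:
  assumes "converges_Lp M s u f" "s > 0"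
  shows "(\<lambda>n. u n x) \<longlonglongrightarrow> f x"
proof (rule LIM_zero_cancel, rule Lim_null_comparison)
  show "\<forall>\<^sub>F n in sequentially. norm (u n x - f x) \<le> Lp_norm M s (\<lambda>x. u n x - f x) * (1 / w x) powr (1 / s)"
    using norm_le_Lp_norm[of "\<lambda>x. u n x - f x" s x for n] assms
    by (intro always_eventually allI) (simp add: converges_Lp_def)
  show "(\<lambda>n. Lp_norm M s (\<lambda>x. u n x - f x) * (1 / w x) powr (1 / s)) \<longlonglongrightarrow> 0"
    by (rule tendsto_mult_left_zero) (use assms in \<open>simp add: converges_Lp_def\<close>)
qed

lemma converges_Lp_limit:
  assumes "converges_Lp M s u f" "u n \<in> Lp M s" "s > 0"
  shows "f \<in> Lp M s"
proof -
  have "(\<lambda>x. u n x - (u n x - f x)) \<in> Lp M s"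
    by (rule Lp_diff) (use assms in \<open>simp_all add: converges_Lp_def\<close>)
  then show ?thesis by simp
qed

lemma integrable_if_sums_le:
  fixes h :: "'v \<Rightarrow> real"
  assumes h: "\<And>x. h x \<ge> 0" and le: "\<And>S. finite S \<Longrightarrow> (\<Sum>x\<in>S. w x * h x) \<le> C"
  shows "integrable M h" "(\<integral>x. h x \<partial>M) \<le> C"
proof -
  have int: "integrable M (trunc n h)" for n
    by (rule integrable_finite_support[OF finite_exh[of n]]) (simp add: trunc_def)
  have I: "(\<integral>x. trunc n h x \<partial>M) = (\<Sum>x\<in>exh n. w x * h x)" for n
    by (subst integral_finite_support[OF finite_exh[of n]]) (simp_all add: trunc_def)
  have "incseq (\<lambda>n. \<integral>x. trunc n h x \<partial>M)"
    unfolding I incseq_def by (intro allI impI sum_mono2 mono_exh) (simp_all add: h)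
  moreover have "\<forall>n. (\<integral>x. trunc n h x \<partial>M) \<le> C" unfolding I by (simp add: le)
  ultimately obtain L where L: "(\<lambda>n. \<integral>x. trunc n h x \<partial>M) \<longlonglongrightarrow> L"
    by (rule incseq_convergent)
  have "L \<le> C" by (rule LIMSEQ_le_const2[OF L]) (simp add: I le)
  have mono: "AE x in M. mono (\<lambda>n. trunc n h x)"
    unfolding AE_M by (intro allI monoI) (use mono_exh in \<open>auto simp: trunc_def h\<close>)
  have lim: "AE x in M. (\<lambda>n. trunc n h x) \<longlonglongrightarrow> h x"
    unfolding AE_M by (intro allI tendsto_eventually trunc_eventually)
  show "integrable M h" by (rule integrable_monotone_convergence[OF int mono lim L measurable_M])
  show "(\<integral>x. h x \<partial>M) \<le> C"
    using integral_monotone_convergence[OF int mono lim L measurable_M] \<open>L \<le> C\<close> by simp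
qed

lemma emeasure_le_if_finite_le:
  assumes "\<And>S. finite S \<Longrightarrow> S \<subseteq> X \<Longrightarrow> ennreal (sum w S) \<le> C"
  shows "emeasure M X \<le> C"
proof -
  have "(\<Union>n. X \<inter> exh n) = X"
  proof -
    have "\<exists>n. x \<in> exh n" for x using eventually_happens[OF exh_eventually[of x]] by simp
    then show ?thesis by auto
  qed
  then have "emeasure M X = (SUP n. emeasure M (X \<inter> exh n))"
  proof (subst SUP_emeasure_incseq)
    show "incseq (\<lambda>n. X \<inter> exh n)" unfolding incseq_def by (intro allI impI Int_mono order_refl mono_exh)
  qed simp_all
  also have "\<dots> \<le> C"
  proof (rule SUP_least)
    fix n
    have "finite (X \<inter> exh n)" by simp
    then show "emeasure M (X \<inter> exh n) \<le> C" using assms[of "X \<inter> exh n"] by (simp add: emeasure_M_finite)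
  qed
  finally show ?thesis .
qed

text \<open>A Fatou argument: at finitely many points the images of the truncations converge, so the
  uniform bound on finite sums survives.\<close>

lemma Rz_strong:
  assumes s: "1 < s" "s \<le> 2"
  shows "\<exists>C\<ge>0. \<forall>f\<in>Lp M s. Rz f \<in> Lp M s \<and> Lp_norm M s (Rz f) \<le> C * Lp_norm M s f"
proof -
  obtain C where C: "C \<ge> 0"
    and bd: "\<And>f S. fs f \<Longrightarrow> finite S \<Longrightarrow> (\<Sum>x\<in>S. w x * cmod (Rz f x) powr s) \<le> C * ipow s f"
    using Rz_fs_strong[OF s] unfolding ipow_def by blast
  have "Rz f \<in> Lp M s \<and> Lp_norm M s (Rz f) \<le> C powr (1 / s) * Lp_norm M s f" if f: "f \<in> Lp M s" for f
  proof -
    have le: "(\<Sum>x\<in>S. w x * cmod (Rz f x) powr s) \<le> C * ipow s f" if S: "finite S" for S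
    proof (rule LIMSEQ_le_const2)
      show "(\<lambda>n. \<Sum>x\<in>S. w x * cmod (Rz (trunc n f) x) powr s) \<longlonglongrightarrow> (\<Sum>x\<in>S. w x * cmod (Rz f x) powr s)"
        using s by (intro tendsto_sum tendsto_mult tendsto_const tendsto_powr2 tendsto_norm Rz_trunc_tendsto[OF _ _ f]) simp_all
      have "(\<Sum>x\<in>S. w x * cmod (Rz (trunc n f) x) powr s) \<le> C * ipow s f" for n
        by (rule order_trans[OF bd[OF fs_trunc S] mult_left_mono[OF ipow_trunc_le[OF f] C]]) (use s in simp)
      then show "\<exists>N. \<forall>n\<ge>N. (\<Sum>x\<in>S. w x * cmod (Rz (trunc n f) x) powr s) \<le> C * ipow s f" by blast
    qed
    have "Rz f \<in> Lp M s" unfolding in_Lp_iff by (rule integrable_if_sums_le(1)[OF _ le]) simp_all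
    moreover have "ipow s (Rz f) \<le> C * ipow s f" unfolding ipow_def[of s "Rz f"]
      by (rule integrable_if_sums_le(2)[OF _ le]) simp_all
    then have "ipow s (Rz f) powr (1 / s) \<le> (C * ipow s f) powr (1 / s)" using s by (intro powr_mono2) simp_all
    ultimately show ?thesis by (simp add: Lp_norm_ipow powr_mult)
  qed
  then show ?thesis by (intro exI[of _ "C powr (1 / s)"]) simp
qed

text \<open>A strict inequality at finitely many points already holds for the image of some
  truncation, and finite subsets exhaust the measure of the level set.\<close>

lemma Rz_weak:
  assumes f: "f \<in> Lp M 1" and t: "t > 0"
  shows "emeasure M {x. t < cmod (Rz f x)} \<le> ennreal (Cw * nrm1 f / t)"
proof (rule emeasure_le_if_finite_le)
  fix S assume S: "finite S" "S \<subseteq> {x. t < cmod (Rz f x)}"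
  have "\<forall>x\<in>S. \<forall>\<^sub>F n in sequentially. t < cmod (Rz (trunc n f) x)"
  proof
    fix x assume "x \<in> S"
    then have "t < cmod (Rz f x)" using S(2) by blast
    moreover have "(\<lambda>n. cmod (Rz (trunc n f) x)) \<longlonglongrightarrow> cmod (Rz f x)"
      by (intro tendsto_norm Rz_trunc_tendsto[OF _ _ f]) simp_all
    ultimately show "\<forall>\<^sub>F n in sequentially. t < cmod (Rz (trunc n f) x)" by (rule order_tendstoD(1)[rotated])
  qed
  then have "\<forall>\<^sub>F n in sequentially. \<forall>x\<in>S. t < cmod (Rz (trunc n f) x)" using S(1) by (simp add: eventually_ball_finite)
  then obtain n where n: "\<forall>x\<in>S. t < cmod (Rz (trunc n f) x)" using eventually_happens'[OF sequentially_bot] by blast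
  have "ennreal (sum w S) = emeasure M S" by (simp add: emeasure_M_finite S)
  also have "\<dots> \<le> emeasure M {x. t < cmod (Rz (trunc n f) x)}" using n by (intro emeasure_mono) auto
  also have "\<dots> \<le> ennreal (Cw * nrm1 (trunc n f) / t)" by (rule Rz_fs_weak[OF fs_trunc t])
  also have "\<dots> \<le> ennreal (Cw * nrm1 f / t)"
    using ipow_trunc_le[OF f, of n] t
    by (intro ennreal_leI divide_right_mono mult_left_mono) (simp_all add: ipow_def nrm1_def Cw_def)
  finally show "ennreal (sum w S) \<le> ennreal (Cw * nrm1 f / t)" .
qed

lemma Rz_weak_norm:
  assumes "f \<in> Lp M 1"
  shows "weak_L1_norm M (Rz f) \<le> ennreal (Cw * nrm1 f)"
  unfolding weak_L1_norm_def
proof (rule SUP_least)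
  fix t :: real assume "t \<in> {0<..}"
  then have t: "t > 0" by simp
  have "ennreal t * emeasure M {x \<in> space M. t < cmod (Rz f x)} \<le> ennreal t * ennreal (Cw * nrm1 f / t)"
    using Rz_weak[OF assms t] by (intro mult_left_mono) simp_all
  also have "\<dots> = ennreal (Cw * nrm1 f)" using t by (subst ennreal_mult'[symmetric]) simp_all
  finally show "ennreal t * emeasure M {x \<in> space M. t < cmod (Rz f x)} \<le> ennreal (Cw * nrm1 f)" .
qed

lemma converges_Rz:
  assumes s: "1 < s" "s \<le> 2" and u: "\<And>n. u n \<in> Lp M s" "converges_Lp M s u f"
  shows "converges_Lp M s (\<lambda>n. Rz (u n)) (Rz f)"
proof -
  have s': "1 \<le> s" "s > 0" using s by auto
  have f: "f \<in> Lp M s" by (rule converges_Lp_limit[OF u(2) u(1) s'(2)])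
  obtain C where C: "\<And>f. f \<in> Lp M s \<Longrightarrow> Rz f \<in> Lp M s" "\<And>f. f \<in> Lp M s \<Longrightarrow> Lp_norm M s (Rz f) \<le> C * Lp_norm M s f"
    using Rz_strong[OF s] by blast
  have eq: "(\<lambda>x. Rz (u n) x - Rz f x) = Rz (\<lambda>x. u n x - f x)" for n
    by (rule ext) (rule Rz_diff[OF s'(1) s(2) u(1) f, symmetric])
  have d: "(\<lambda>x. u n x - f x) \<in> Lp M s" for n using u(2) by (simp add: converges_Lp_def)
  show ?thesis
    unfolding converges_Lp_def eq
  proof (intro conjI allI)
    show "Rz (\<lambda>x. u n x - f x) \<in> Lp M s" for n by (rule C(1)[OF d])
    show "(\<lambda>n. Lp_norm M s (Rz (\<lambda>x. u n x - f x))) \<longlonglongrightarrow> 0"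
    proof (rule Lim_null_comparison)
      show "\<forall>\<^sub>F n in sequentially. norm (Lp_norm M s (Rz (\<lambda>x. u n x - f x))) \<le> C * Lp_norm M s (\<lambda>x. u n x - f x)"
        using C(2)[OF d] by (intro always_eventually allI) (simp add: Lp_norm_ipow)
      show "(\<lambda>n. C * Lp_norm M s (\<lambda>x. u n x - f x)) \<longlonglongrightarrow> 0"
        using u(2) by (intro tendsto_mult_right_zero) (simp add: converges_Lp_def)
    qed
  qed
qed

text \<open>Any graph between that of \<open>Rz\<close> on finitely supported functions and that of
  \<open>Rz\<close> on \<open>Lp M s\<close> has the same extension. Both extension steps are
  instances: from the domain of the power for \<open>s = 2\<close>, then from the intersection of
  the spaces.\<close>

lemma extension_iff:
  assumes s: "1 < s" "s \<le> 2" and G: "\<And>f g. G f g \<Longrightarrow> f \<in> Lp M s \<and> g = Rz f" "\<And>f. fs f \<Longrightarrow> G f (Rz f)"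
  shows "continuous_extension G (converges_Lp M s) (converges_Lp M s) f g \<longleftrightarrow> f \<in> Lp M s \<and> g = Rz f"
proof
  have s0: "s > 0" using s by simp
  have lim: "converges_Lp M s v (Rz f)" if "\<And>n. G (u n) (v n)" "converges_Lp M s u f" for u v f
  proof -
    have "v = (\<lambda>n. Rz (u n))" using G(1)[OF that(1)] by auto
    then show ?thesis using converges_Rz[OF s _ that(2)] G(1)[OF that(1)] by simp
  qed
  show "f \<in> Lp M s \<and> g = Rz f" if ext: "continuous_extension G (converges_Lp M s) (converges_Lp M s) f g"
  proof -
    obtain u v where uv: "\<And>n. G (u n) (v n)" "converges_Lp M s u f"
      using ext unfolding continuous_extension_def by blast
    have "converges_Lp M s v g" using ext uv unfolding continuous_extension_def by blast
    then have "g x = Rz f x" for x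
      using converges_Lp_pointwise[OF _ s0] lim[OF uv] LIMSEQ_unique by blast
    then show ?thesis using converges_Lp_limit[OF uv(2) _ s0] G(1)[OF uv(1)] by blast
  qed
  show "continuous_extension G (converges_Lp M s) (converges_Lp M s) f g" if "f \<in> Lp M s \<and> g = Rz f"
    unfolding continuous_extension_def
  proof (intro conjI exI allI impI)
    show "G (trunc n f) (Rz (trunc n f))" for n by (rule G(2)[OF fs_trunc])
    show "converges_Lp M s (\<lambda>n. trunc n f) f" using that s by (intro converges_trunc) simp_all
    show "converges_Lp M s v g" if "(\<forall>n. G (u n) (v n)) \<and> converges_Lp M s u f" for u v
      using lim[of u v f] that \<open>f \<in> Lp M s \<and> g = Rz f\<close> by blast
  qed
qed

text \<open>Only the value \<open>Rz f\<close> is asserted; the weak type bound applied to the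
  differences makes the images of every approximation converge in the weak norm.\<close>

lemma extension_weak:
  assumes f: "f \<in> Lp M 1" and G: "\<And>f g. G f g \<Longrightarrow> f \<in> Lp M 1 \<and> g = Rz f" "\<And>f. fs f \<Longrightarrow> G f (Rz f)"
  shows "continuous_extension G (converges_Lp M 1) (converges_weak_L1 M) f (Rz f)"
  unfolding continuous_extension_def
proof (intro conjI exI allI impI)
  show "G (trunc n f) (Rz (trunc n f))" for n by (rule G(2)[OF fs_trunc])
  show "converges_Lp M 1 (\<lambda>n. trunc n f) f" using f by (intro converges_trunc) simp_all
  fix u v assume uv: "(\<forall>n. G (u n) (v n)) \<and> converges_Lp M 1 u f"
  have "u n \<in> Lp M 1" "v n = Rz (u n)" for n using G(1) uv by blast+
  then have eq: "(\<lambda>x. v n x - Rz f x) = Rz (\<lambda>x. u n x - f x)" for n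
    using Rz_diff[OF _ _ _ f] by auto
  have d: "(\<lambda>x. u n x - f x) \<in> Lp M 1" for n using uv by (simp add: converges_Lp_def)
  have "(\<lambda>n. ennreal (Cw * nrm1 (\<lambda>x. u n x - f x))) \<longlonglongrightarrow> ennreal (Cw * 0)"
    using uv by (intro tendsto_ennrealI tendsto_mult tendsto_const) (simp add: converges_Lp_def Lp_norm_1)
  then have lim: "(\<lambda>n. ennreal (Cw * nrm1 (\<lambda>x. u n x - f x))) \<longlonglongrightarrow> 0" by simp
  show "converges_weak_L1 M v (Rz f)"
    unfolding converges_weak_L1_def eq
  proof (rule tendsto_sandwich[OF _ _ tendsto_const lim])
    show "\<forall>\<^sub>F n in sequentially. weak_L1_norm M (Rz (\<lambda>x. u n x - f x)) \<le> ennreal (Cw * nrm1 (\<lambda>x. u n x - f x))"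
      by (intro always_eventually allI Rz_weak_norm d)
  qed simp
qed

lemma Rz_norm_le: 
  assumes "f \<in> Lp M 1"
  shows "cmod (Rz f x) \<le> 8 / w x * nrm1 f"
proof -
  have int: "integrable M (\<lambda>y. cmod (f y))" using assms by (simp add: in_Lp_iff)
  have "cmod (Rz f x) \<le> (\<integral>y. 8 / w x * cmod (f y) \<partial>M)"
    unfolding Rz_def
  proof (rule order_trans[OF integral_norm_bound], rule integral_mono)
    show "integrable M (\<lambda>y. norm (complex_of_real (kR x y) * f y))"
      using assms by (intro integrable_norm kR_integrable[of 1]) simp_all
    show "integrable M (\<lambda>y. 8 / w x * cmod (f y))" using int by (rule integrable_mult_right)
    show "norm (complex_of_real (kR x y) * f y) \<le> 8 / w x * cmod (f y)" for y
      unfolding norm_mult norm_of_real by (intro mult_right_mono kR_bound) simp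
  qed
  then show ?thesis by (simp add: nrm1_def)
qed

lemma Rz_sum:
  assumes "\<And>j. fs (a j)"
  shows "Rz (\<lambda>y. \<Sum>j<n. c j * a j y) x = (\<Sum>j<(n::nat). c j * Rz (a j) x)"
proof -
  let ?F = "\<Union>j<n. {x. a j x \<noteq> 0}"
  have F: "finite ?F" using assms by (simp add: fs_def)
  have s: "{y. (\<Sum>j<n. c j * a j y) \<noteq> 0} \<subseteq> ?F"
  proof (rule subsetI, rule ccontr)
    fix y assume y: "y \<in> {y. (\<Sum>j<n. c j * a j y) \<noteq> 0}" "y \<notin> ?F"
    then have "(\<Sum>j<n. c j * a j y) = 0" by (intro sum.neutral) auto
    then show False using y by simp
  qed
  have "Rz (\<lambda>y. \<Sum>j<n. c j * a j y) x = (\<Sum>y\<in>?F. \<Sum>j<n. complex_of_real (w y * kR x y) * (c j * a j y))"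
    unfolding Rz_fs[OF F s] by (simp only: sum_distrib_left)
  also have "\<dots> = (\<Sum>j<n. c j * (\<Sum>y\<in>?F. complex_of_real (w y * kR x y) * a j y))"
    by (subst sum.swap) (simp only: sum_distrib_left mult.left_commute)
  also have "\<dots> = (\<Sum>j<n. c j * Rz (a j) x)"
  proof (intro sum.cong refl)
    fix j assume "j \<in> {..<n}"
    then have "{x. a j x \<noteq> 0} \<subseteq> ?F" by auto
    from Rz_fs[OF F this, of x]
    show "c j * (\<Sum>y\<in>?F. complex_of_real (w y * kR x y) * a j y) = c j * Rz (a j) x" by simp
  qed
  finally show ?thesis .
qed

text \<open>Uniform bounds on atoms do not by themselves pass to infinite sums. Here the kernel is
  bounded by \<open>8 / w x\<close> for fixed \<open>x\<close>, so convergence of the partial sums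
  in L1 gives pointwise convergence of their images, and finite sums over \<open>x\<close> keep the
  bound.\<close>

lemma Rz_atomic:
  assumes f: "f \<in> Lp M 1" and a: "\<And>j. fs (a j)" "\<And>j S. finite S \<Longrightarrow> (\<Sum>x\<in>S. w x * cmod (Rz (a j) x)) \<le> K"
    and c: "summable (\<lambda>j. cmod (c j))" and lim: "converges_Lp M 1 (\<lambda>n x. \<Sum>j<n. c j * a j x) f"
  shows "Rz f \<in> Lp M 1" "Lp_norm M 1 (Rz f) \<le> K * (\<Sum>j. cmod (c j))"
proof -
  let ?F = "\<lambda>n x. \<Sum>j<n. c j * a j x"
  have K: "K \<ge> 0" using a(2)[of "{}" 0] by simp
  have FL: "?F n \<in> Lp M 1" for n by (intro fs_Lp fs_sum fs_scale a) simp
  have ptw: "(\<lambda>n. Rz (?F n) x) \<longlonglongrightarrow> Rz f x" for x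
  proof (rule LIM_zero_cancel, rule Lim_null_comparison)
    have d: "(\<lambda>x. ?F n x - f x) \<in> Lp M 1" for n using lim by (simp add: converges_Lp_def)
    show "\<forall>\<^sub>F n in sequentially. norm (Rz (?F n) x - Rz f x) \<le> 8 / w x * nrm1 (\<lambda>x. ?F n x - f x)"
    proof (intro always_eventually allI)
      fix n
      have "Rz (?F n) x - Rz f x = Rz (\<lambda>x. ?F n x - f x) x" by (rule Rz_diff[OF _ _ FL f, symmetric]) simp_all
      then show "norm (Rz (?F n) x - Rz f x) \<le> 8 / w x * nrm1 (\<lambda>x. ?F n x - f x)" using Rz_norm_le[OF d] by simp
    qed
    show "(\<lambda>n. 8 / w x * nrm1 (\<lambda>x. ?F n x - f x)) \<longlonglongrightarrow> 0"
      using lim by (intro tendsto_mult_right_zero) (simp add: converges_Lp_def Lp_norm_1)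
  qed
  have le: "(\<Sum>x\<in>S. w x * cmod (Rz f x)) \<le> K * (\<Sum>j. cmod (c j))" if S: "finite S" for S
  proof (rule LIMSEQ_le_const2)
    show "(\<lambda>n. \<Sum>x\<in>S. w x * cmod (Rz (?F n) x)) \<longlonglongrightarrow> (\<Sum>x\<in>S. w x * cmod (Rz f x))"
      by (intro tendsto_sum tendsto_mult tendsto_const tendsto_norm ptw)
    have "(\<Sum>x\<in>S. w x * cmod (Rz (?F n) x)) \<le> K * (\<Sum>j. cmod (c j))" for n
    proof -
      have "(\<Sum>x\<in>S. w x * cmod (Rz (?F n) x)) \<le> (\<Sum>x\<in>S. w x * (\<Sum>j<n. cmod (c j) * cmod (Rz (a j) x)))"
        unfolding Rz_sum[OF a(1)] by (intro sum_mono mult_left_mono sum_norm_le) (simp_all add: norm_mult)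
      also have "\<dots> = (\<Sum>j<n. cmod (c j) * (\<Sum>x\<in>S. w x * cmod (Rz (a j) x)))"
        unfolding sum_distrib_left by (subst sum.swap) (simp only: mult.left_commute)
      also have "\<dots> \<le> (\<Sum>j<n. cmod (c j) * K)" by (intro sum_mono mult_left_mono a(2) S) simp
      also have "\<dots> = K * (\<Sum>j<n. cmod (c j))" by (simp only: sum_distrib_left mult.commute)
      also have "\<dots> \<le> K * (\<Sum>j. cmod (c j))" using K c by (intro mult_left_mono sum_le_suminf) auto
      finally show ?thesis .
    qed
    then show "\<exists>N. \<forall>n\<ge>N. (\<Sum>x\<in>S. w x * cmod (Rz (?F n) x)) \<le> K * (\<Sum>j. cmod (c j))" by blast
  qed
  have "integrable M (\<lambda>x. cmod (Rz f x))" by (rule integrable_if_sums_le(1)[OF _ le]) simp_all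
  then show "Rz f \<in> Lp M 1" by (simp add: in_Lp_iff)
  show "Lp_norm M 1 (Rz f) \<le> K * (\<Sum>j. cmod (c j))"
    unfolding Lp_norm_1 nrm1_def by (rule integrable_if_sums_le(2)[OF _ le]) simp_all
qed


section \<open>Translation to the homogeneous tree of the statement\<close>

lemma riesz_pairs:
  assumes "f \<in> power_domain M A (- 1 / 2)"
    and g: "g = (\<lambda>x. op_power M A (- 1 / 2) f x - op_power M A (- 1 / 2) f (p x))"
  shows "f \<in> Lp M 2" "g = Rz f"
proof -
  show f: "f \<in> Lp M 2" by (rule power_domain_L2[OF assms(1)])
  show "g = Rz f" unfolding g op_power_eq[OF assms(1)] Rz_eq[OF f] by (rule refl)
qed

lemma level_of_anc: "anc n y = z \<Longrightarrow> int n = lev z - lev y"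
  using lev_anc[of n y] by simp

lemma trap_by_level:
  assumes "h > 0"
  shows "{y. (\<exists>n. anc n y = z) \<and> h \<le> lev z - lev y \<and> lev z - lev y < 2 * h} = trap z (nat h) (2 * nat h)"
proof (intro set_eqI iffI)
  fix y assume "y \<in> {y. (\<exists>n. anc n y = z) \<and> h \<le> lev z - lev y \<and> lev z - lev y < 2 * h}"
  then obtain n where n: "anc n y = z" "h \<le> lev z - lev y" "lev z - lev y < 2 * h" by blast
  then have "nat h \<le> n" "n < 2 * nat h" using assms level_of_anc[OF n(1)] by linarith+
  then show "y \<in> trap z (nat h) (2 * nat h)" using n(1) by (auto simp: trap_def)
next
  fix y assume "y \<in> trap z (nat h) (2 * nat h)"
  then obtain n where n: "anc n y = z" "nat h \<le> n" "n < 2 * nat h" by (auto simp: trap_def)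
  then have "h \<le> lev z - lev y" "lev z - lev y < 2 * h" using assms level_of_anc[OF n(1)] by linarith+
  then show "y \<in> {y. (\<exists>n. anc n y = z) \<and> h \<le> lev z - lev y \<and> lev z - lev y < 2 * h}" using n(1) by blast
qed

text \<open>The square roots of the weights have ratio \<open>sqrt q\<close> upwards and
  \<open>1 / sqrt q\<close> downwards, which together with \<open>1 / (2 * sqrt q)\<close> gives the
  coefficients \<open>1 / 2\<close> and \<open>1 / (2 * q)\<close> of \<open>J\<close>.\<close>

lemma A_neighbours:
  "A f x = f x - complex_of_real (1 / (2 * sqrt (real q))) *
     (\<Sum>y\<in>insert (p x) {y. p y = x}. complex_of_real (sqrt (w y) / sqrt (w x)) * f y)"
proof -
  have pq: "sqrt (real q) > 0" using q_gt_0 by simp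
  have "p x \<noteq> y" if "p y = x" for y using lev_p[of x] lev_p[of y] that by auto
  then have notin: "p x \<notin> {y. p y = x}" by auto
  have up: "sqrt (w (p x)) / sqrt (w x) = sqrt (real q)" by (simp add: w_p real_sqrt_mult)
  have down: "sqrt (w y) / sqrt (w x) = 1 / sqrt (real q)" if "p y = x" for y
    using w_p[of y] pq that by (simp add: real_sqrt_mult)
  have "(\<Sum>y | p y = x. complex_of_real (sqrt (w y) / sqrt (w x)) * f y)
      = complex_of_real (1 / sqrt (real q)) * (\<Sum>y | p y = x. f y)"
    unfolding sum_distrib_left by (intro sum.cong refl) (simp only: mem_Collect_eq down)
  then have "complex_of_real (1 / (2 * sqrt (real q))) *
      (\<Sum>y\<in>insert (p x) {y. p y = x}. complex_of_real (sqrt (w y) / sqrt (w x)) * f y)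
      = complex_of_real (1 / (2 * sqrt (real q))) * (complex_of_real (sqrt (real q)) * f (p x)
          + complex_of_real (1 / sqrt (real q)) * (\<Sum>y | p y = x. f y))"
    unfolding sum.insert[OF finite_children notin] up by (simp only:)
  also have "\<dots> = complex_of_real (1 / (2 * sqrt (real q)) * sqrt (real q)) * f (p x)
      + complex_of_real (1 / (2 * sqrt (real q)) * (1 / sqrt (real q))) * (\<Sum>y | p y = x. f y)"
    by (simp only: distrib_left of_real_mult mult.assoc)
  also have "1 / (2 * sqrt (real q)) * sqrt (real q) = 1 / 2" using pq by simp
  also have "1 / (2 * sqrt (real q)) * (1 / sqrt (real q)) = 1 / (2 * real q)" by simp
  finally show ?thesis by (simp only: A_def J_def scaleR_conv_of_real)
qed

end

lemma homogeneous_tree_acyclic: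
  assumes "homogeneous_tree d adj"
  shows "acyclic_graph adj"
proof (rule acyclic_graph.intro)
  note tree = assms[unfolded homogeneous_tree_def]
  show "\<not> adj x x" for x by (rule spec[OF tree[THEN conjunct1]])
  show "adj y x" if "adj x y" for x y
    by (rule tree[THEN conjunct2, THEN conjunct1, rule_format, OF that])
  show "adj\<^sup>*\<^sup>* x y" for x y
    by (rule tree[THEN conjunct2, THEN conjunct2, THEN conjunct1, rule_format])
  show False if "length xs \<ge> 3" "distinct xs" "successively adj xs" "adj (last xs) (hd xs)" for xs
    by (rule notE[OF tree[THEN conjunct2, THEN conjunct2, THEN conjunct2, THEN conjunct1]])
      (intro exI[of _ xs] conjI that)
qed

theorem theorem1p2:
  fixes q :: nat and adj :: "'v \<Rightarrow> 'v \<Rightarrow> bool" and r :: 'v and \<omega> :: "nat \<Rightarrow> 'v"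
  assumes "q \<ge> 2"
    and "homogeneous_tree (q + 1) adj"
    and "ray_from adj r \<omega>"
  shows
    "(\<exists>C::real. \<forall>f\<in>Lp (flow_measure q adj r \<omega>) 1. \<exists>g. riesz_L1 q adj r \<omega> f g \<and>
        (\<forall>t>0. emeasure (flow_measure q adj r \<omega>) {x. norm (g x) > t}
                 \<le> ennreal (C * Lp_norm (flow_measure q adj r \<omega>) 1 f / t))) \<and>
     (\<exists>C::real. \<forall>f\<in>H1 q adj r \<omega>. \<exists>g\<in>Lp (flow_measure q adj r \<omega>) 1. riesz_L1 q adj r \<omega> f g \<and>
        Lp_norm (flow_measure q adj r \<omega>) 1 g \<le> C * H1_norm q adj r \<omega> f) \<and>
     (\<forall>p::real. 1 < p \<and> p \<le> 2 \<longrightarrow>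
        (\<exists>C::real. \<forall>f\<in>Lp (flow_measure q adj r \<omega>) p. \<exists>g\<in>Lp (flow_measure q adj r \<omega>) p.
           riesz_Lp p q adj r \<omega> f g \<and>
           Lp_norm (flow_measure q adj r \<omega>) p g \<le> C * Lp_norm (flow_measure q adj r \<omega>) p f))"
proof -
  interpret G: acyclic_graph_ray adj r \<omega>
    by (rule acyclic_graph_ray.intro[OF homogeneous_tree_acyclic[OF assms(2)] acyclic_graph_ray_axioms.intro[OF assms(3)]])
  let ?p = "predecessor adj r \<omega>" and ?l = "level adj r \<omega>"
  have nb: "{y. adj x y} = insert (?p x) {y. ?p y = x}" for x
    by (rule set_eqI, unfold mem_Collect_eq insert_iff, subst eq_commute[of _ x]) (rule G.adj_iff_predecessor)
  have deg: "finite {y. adj x y}" "card {y. adj x y} = q + 1" for x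
    using assms(2) by (simp_all add: homogeneous_tree_def)
  have "?p x \<notin> {y. ?p y = x}" for x
  proof
    assume "?p x \<in> {y. ?p y = x}"
    then have "?l x = ?l (?p x) + 1" using G.level_predecessor[of "?p x"] by simp
    then show False using G.level_predecessor[of x] by simp
  qed
  moreover have "finite {y. ?p y = x}" for x using deg(1)[of x] unfolding nb by simp
  \<comment> \<open>One of the \<open>q + 1\<close> neighbours is the predecessor, the others are
    the children.\<close>
  ultimately have "card {y. ?p y = x} = q" for x using deg(2)[of x] unfolding nb by simp
  then interpret T: flow_tree q ?p ?l
    using assms(1) G.level_predecessor G.common_ancestor by unfold_locales
  have w: "flow_weight q adj r \<omega> = T.w" by (rule ext) (simp add: flow_weight_def T.w_def)
  have M: "flow_measure q adj r \<omega> = T.M" by (simp add: flow_measure_def T.M_def w)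
  have A: "flow_laplacian q adj r \<omega> = T.A"
    by (intro ext) (simp only: flow_laplacian_def w nb T.A_neighbours)
  have ini: "riesz_initial q adj r \<omega> f g \<longleftrightarrow> f \<in> power_domain T.M T.A (- 1 / 2) \<and>
      g = (\<lambda>x. op_power T.M T.A (- 1 / 2) f x - op_power T.M T.A (- 1 / 2) f (?p x))" for f g
    unfolding riesz_initial_def M A flow_gradient_def by (rule refl)
  have L2: "riesz_L2 q adj r \<omega> f g \<longleftrightarrow> f \<in> Lp T.M 2 \<and> g = T.Rz f" for f g
    unfolding riesz_L2_def M
  proof (rule T.extension_iff)
    show "f \<in> Lp T.M 2 \<and> g = T.Rz f" if "riesz_initial q adj r \<omega> f g" for f g
      using T.riesz_pairs[of f g] that unfolding ini by blast
    show "riesz_initial q adj r \<omega> f (T.Rz f)" if "T.fs f" for f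
      unfolding ini using T.fs_power_domain[OF that] T.riesz_pairs(2)[OF T.fs_power_domain[OF that] refl] by simp
  qed simp_all
  have Lp: "riesz_Lp s q adj r \<omega> f g \<longleftrightarrow> f \<in> Lp T.M s \<and> g = T.Rz f" if s: "1 < s" "s \<le> 2" for s f g
    unfolding riesz_Lp_def M
    by (rule T.extension_iff[OF s]) (use s in \<open>simp_all add: L2 T.fs_Lp\<close>)
  have L1: "riesz_L1 q adj r \<omega> f (T.Rz f)" if "f \<in> Lp T.M 1" for f
    unfolding riesz_L1_def M
    by (rule T.extension_weak[OF that]) (simp_all add: L2 T.fs_Lp)
  have atom: "T.fs a \<and> (\<forall>S. finite S \<longrightarrow> (\<Sum>x\<in>S. T.w x * cmod (T.Rz a x)) \<le> 82)" if "atom q adj r \<omega> a" for a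
  proof -
    obtain S where S: "admissible_trapezoid adj r \<omega> S" "\<And>x. x \<notin> S \<Longrightarrow> a x = 0"
      "\<And>x. cmod (a x) \<le> 1 / measure T.M S" "(\<Sum>x\<in>S. a x * complex_of_real (T.w x)) = 0"
      using \<open>atom q adj r \<omega> a\<close> unfolding atom_def M w by blast
    have supp: "{x. a x \<noteq> 0} \<subseteq> S" using S(2) by blast
    have mean: "(\<Sum>x\<in>S. complex_of_real (T.w x) * a x) = 0" using S(4) by (simp only: mult.commute)
    show ?thesis
    \<comment> \<open>An atom on a single vertex vanishes because its mean does; the remaining
      admissible sets are trapezoids \<open>T.trap z (nat h) (2 * nat h)\<close>.\<close>
    proof (cases "\<exists>x. S = {x}")
      case True
      then obtain x where x: "S = {x}" by blast
      then have "a x = 0" using mean by simp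
      then have "a y = 0" for y using S(2)[of y] x by (cases "y = x") simp_all
      then have "a = (\<lambda>x. 0)" by (rule ext)
      then have "T.Rz a x = 0" "T.fs a" for x by (simp_all add: T.Rz_def)
      then show ?thesis by simp
    next
      case False
      then obtain z h where h: "(h::int) > 0" "S = {x. below adj r \<omega> x z \<and> h \<le> ?l z - ?l x \<and> ?l z - ?l x < 2 * h}"
        using S(1) unfolding admissible_trapezoid_def by blast
      then have tr: "S = T.trap z (nat h) (2 * nat h)"
        unfolding G.below_iff by (simp only: T.trap_by_level)
      have "measure T.M S = sum T.w S" unfolding tr by (rule T.measure_M_finite[OF T.finite_trap])
      then have size: "cmod (a x) \<le> 1 / sum T.w S" for x using S(3) by simp
      have "1 \<le> nat h" using h(1) by simp
      from T.Rz_atom[OF this supp[unfolded tr] size[unfolded tr] mean[unfolded tr]]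
      have "\<forall>S. finite S \<longrightarrow> (\<Sum>x\<in>S. T.w x * cmod (T.Rz a x)) \<le> 82" by blast
      moreover have "T.fs a" unfolding T.fs_def using supp unfolding tr by (rule finite_subset[OF _ T.finite_trap])
      ultimately show ?thesis by blast
    qed
  qed
  have H1: "\<exists>g\<in>Lp T.M 1. riesz_L1 q adj r \<omega> f g \<and> Lp_norm T.M 1 g \<le> 82 * H1_norm q adj r \<omega> f"
    if "f \<in> H1 q adj r \<omega>" for f
  proof -
    have f: "f \<in> Lp T.M 1" and ex: "\<exists>c a. atomic_decomposition q adj r \<omega> f c a"
      using that unfolding H1_def M by blast+
    have le: "T.Rz f \<in> Lp T.M 1 \<and> Lp_norm T.M 1 (T.Rz f) \<le> 82 * (\<Sum>j. cmod (c j))"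
      if d: "atomic_decomposition q adj r \<omega> f c a" for c a
    proof -
      have a: "T.fs (a j)" "\<And>S. finite S \<Longrightarrow> (\<Sum>x\<in>S. T.w x * cmod (T.Rz (a j) x)) \<le> 82" for j
        using d atom[of "a j"] unfolding atomic_decomposition_def by blast+
      have s: "summable (\<lambda>j. cmod (c j))" "converges_Lp T.M 1 (\<lambda>n x. \<Sum>j<n. c j * a j x) f"
        using d unfolding atomic_decomposition_def M by blast+
      show ?thesis
        by (rule conjI; rule T.Rz_atomic[where a = a and c = c and K = 82, OF f]) (simp_all add: a s)
    qed
    \<comment> \<open>The bound holds for every decomposition of the same function, so it passes to
      the infimum.\<close>
    have "Lp_norm T.M 1 (T.Rz f) / 82 \<le> H1_norm q adj r \<omega> f"
      unfolding H1_norm_def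
    proof (rule cInf_greatest)
      show "{(\<Sum>j. cmod (c j)) | c. \<exists>a. atomic_decomposition q adj r \<omega> f c a} \<noteq> {}" using ex by blast
      fix y assume "y \<in> {(\<Sum>j. cmod (c j)) | c. \<exists>a. atomic_decomposition q adj r \<omega> f c a}"
      then obtain c a where "y = (\<Sum>j. cmod (c j))" "atomic_decomposition q adj r \<omega> f c a" by blast
      then show "Lp_norm T.M 1 (T.Rz f) / 82 \<le> y" using le[of c a] by simp
    qed
    then have "Lp_norm T.M 1 (T.Rz f) \<le> 82 * H1_norm q adj r \<omega> f" by simp
    moreover have "T.Rz f \<in> Lp T.M 1" using ex le by blast
    ultimately show ?thesis using L1[OF f] by blast
  qed
  have weak: "\<exists>g. riesz_L1 q adj r \<omega> f g \<and>
      (\<forall>t>0. emeasure T.M {x. norm (g x) > t} \<le> ennreal (T.Cw * Lp_norm T.M 1 f / t))"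
    if "f \<in> Lp T.M 1" for f
    using L1[OF that] T.Rz_weak[OF that] unfolding T.Lp_norm_1 by blast
  have strong: "\<exists>C. \<forall>f\<in>Lp T.M s. \<exists>g\<in>Lp T.M s. riesz_Lp s q adj r \<omega> f g \<and> Lp_norm T.M s g \<le> C * Lp_norm T.M s f"
    if s: "1 < s" "s \<le> 2" for s
  proof -
    obtain C where "\<forall>f\<in>Lp T.M s. T.Rz f \<in> Lp T.M s \<and> Lp_norm T.M s (T.Rz f) \<le> C * Lp_norm T.M s f"
      using T.Rz_strong[OF s] by blast
    then show ?thesis unfolding Lp[OF s] by (intro exI[of _ C]) blast
  qed
  show ?thesis
    unfolding M using weak H1 strong by blast
qed

end
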